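(* Let $S=\{(x,y,z)\in\mathbb{R}^3 : xyz=1\}$, with the Riemannian metric induced from the Euclidean metric of $\mathbb{R}^3$. Then the geodesic flow on $S$ is not integrable in the sense of Liouville with meromorphic first integrals.
   Context: Let $S\subset\mathbb{R}^3$ be a smooth real surface with the metric induced from the Euclidean metric. For a connected component $S_0$ of $S$, let $\overline{S_0}\subset\mathbb{C}^3$ be its complex Zariski closure (a complex algebraic surface in the cases considered), and let $X\subset\overline{S_0}$ be the open set of smooth points of $\overline{S_0}$ at which the complex bilinear form $dx^2+dy^2+dz^2$ restricted to the tangent plane is nondegenerate. This form is then a nondegenerate holomorphic metric $g$ on $X$, extending the induced metric on $S_0$. The complexified phase space is the holomorphic tangent bundle $TX$, of complex dimension $4$, with the holomorphic symplectic form obtained by pulling back the canonical symplectic form of $T^*X$ via the isomorphism $TX\cong T^*X$ given by $g$; write $\{\cdot,\cdot\}$ for the corresponding Poisson bracket. The (complexified) geodesic flow is the Hamiltonian flow of $H(r,v)=\tfrac12 g_r(v,v)$. The geodesic flow on $S_0$ is integrable in the sense of Liouville with meromorphic first integrals if there exist two meromorphic functions $F_1,F_2$ on $TX$ which are first integrals ($\{F_1,H\}=\{F_2,H\}=0$), are in involution ($\{F_1,F_2\}=0$), and are functionally independent ($dF_1\wedge dF_2$ is not identically zero). The geodesic flow on $S$ is integrable in this sense if it is so on every connected component $S_0$ of $S$. *)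

theory Defs
  imports "HOL-Analysis.Analysis"
begin

subsection \<open>Complex algebraic surfaces in complex three-space\<close>

inductive complex_polynomial_function :: "(complex^'n \<Rightarrow> complex) \<Rightarrow> bool" where
  coord: "complex_polynomial_function (\<lambda>r. r $ i)"
| const: "complex_polynomial_function (\<lambda>r. c)"
| add: "complex_polynomial_function f \<Longrightarrow> complex_polynomial_function g \<Longrightarrow>
        complex_polynomial_function (\<lambda>r. f r + g r)"
| mult: "complex_polynomial_function f \<Longrightarrow> complex_polynomial_function g \<Longrightarrow>
        complex_polynomial_function (\<lambda>r. f r * g r)"

definition vanishing_ideal :: "(complex^'n) set \<Rightarrow> (complex^'n \<Rightarrow> complex) set" where
  "vanishing_ideal A = {f. complex_polynomial_function f \<and> (\<forall>r\<in>A. f r = 0)}"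

definition zariski_closure :: "(complex^'n) set \<Rightarrow> (complex^'n) set" where
  "zariski_closure A = {r. \<forall>f\<in>vanishing_ideal A. f r = 0}"

definition complexify :: "real^'n \<Rightarrow> complex^'n" where
  "complexify x = (\<chi> i. complex_of_real (x $ i))"

definition zariski_tangent :: "(complex^'n) set \<Rightarrow> complex^'n \<Rightarrow> (complex^'n) set" where
  "zariski_tangent V r = {v. \<forall>f\<in>vanishing_ideal V. frechet_derivative f (at r) v = 0}"

text \<open>The complex bilinear form \<open>dx\<^sup>2 + dy\<^sup>2 + dz\<^sup>2\<close> (not the Hermitian product).\<close>

definition cform :: "complex^'n \<Rightarrow> complex^'n \<Rightarrow> complex" where
  "cform v w = (\<Sum>i\<in>UNIV. v $ i * w $ i)"

text \<open>For an algebraic surface \<open>V\<close>: the points at which \<open>V\<close> is smooth (the Zariski tangent space has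
  dimension \<open>2 = dim V\<close>) and the form is nondegenerate on the tangent plane.\<close>

definition nondegenerate_part :: "(complex^3) set \<Rightarrow> (complex^3) set" where
  "nondegenerate_part V = {r\<in>V. vec.dim (zariski_tangent V r) = 2 \<and>
     (\<forall>v\<in>zariski_tangent V r. (\<forall>w\<in>zariski_tangent V r. cform v w = 0) \<longrightarrow> v = 0)}"

type_synonym phase = "(complex^3) \<times> (complex^3)"

definition phase_space :: "(complex^3) set \<Rightarrow> phase set" where
  "phase_space V = {(r, v). r \<in> nondegenerate_part V \<and> v \<in> zariski_tangent V r}"


subsection \<open>Holomorphic and meromorphic functions on a complex submanifold\<close>

definition cscale :: "complex \<Rightarrow> phase \<Rightarrow> phase" where
  "cscale c \<xi> = (c *s fst \<xi>, c *s snd \<xi>)"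

definition holomorphic_fun_on :: "(phase \<Rightarrow> complex) \<Rightarrow> phase set \<Rightarrow> bool" where
  "holomorphic_fun_on f W \<longleftrightarrow>
     (\<forall>q\<in>W. \<exists>D. (f has_derivative D) (at q) \<and> (\<forall>c \<xi>. D (cscale c \<xi>) = c * D \<xi>))"

text \<open>In the following \<open>M\<close> is a complex submanifold (not necessarily closed) of the ambient space.
  A function on \<open>M\<close> is holomorphic near a point iff it is there the restriction of a
  holomorphic function on an open subset of the ambient space.\<close>

definition holomorphic_near :: "phase set \<Rightarrow> (phase \<Rightarrow> complex) \<Rightarrow> phase \<Rightarrow> bool" where
  "holomorphic_near M F q \<longleftrightarrow>
     (\<exists>W f. open W \<and> q \<in> W \<and> holomorphic_fun_on f W \<and> (\<forall>p\<in>W \<inter> M. F p = f p))"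

text \<open>A meromorphic function is represented by a total function which is locally a quotient
  \<open>f / g\<close> of holomorphic functions on \<open>M\<close>, where \<open>g\<close> does not vanish identically on any nonempty
  open part of \<open>M\<close>. Its values on the zero set of \<open>g\<close> are irrelevant: all identities between
  meromorphic functions below are stated on the dense open set where they are holomorphic.\<close>

definition meromorphic_fun_on :: "(phase \<Rightarrow> complex) \<Rightarrow> phase set \<Rightarrow> bool" where
  "meromorphic_fun_on F M \<longleftrightarrow>
     (\<forall>p\<in>M. \<exists>W f g. open W \<and> p \<in> W \<and> holomorphic_fun_on f W \<and> holomorphic_fun_on g W \<and>
        W \<inter> M \<subseteq> closure {q \<in> W \<inter> M. g q \<noteq> 0} \<and>
        (\<forall>q \<in> W \<inter> M. g q \<noteq> 0 \<longrightarrow> F q = f q / g q))"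

text \<open>The holomorphic tangent space: velocities of holomorphic curves in \<open>M\<close>.\<close>

definition tangent :: "phase set \<Rightarrow> phase \<Rightarrow> phase set" where
  "tangent M q = {\<xi>. \<exists>\<gamma> e. e > 0 \<and> \<gamma> 0 = q \<and>
     (\<forall>t\<in>ball 0 e. \<gamma> t \<in> M \<and> (\<exists>\<eta>. (\<gamma> has_derivative (\<lambda>h. cscale h \<eta>)) (at t))) \<and>
     (\<gamma> has_derivative (\<lambda>h. cscale h \<xi>)) (at 0)}"

text \<open>The differential at \<open>q\<close> of a function that is holomorphic near \<open>q\<close> on \<open>M\<close>. The derivative
  within \<open>M\<close> is not unique as a linear map on the ambient space, but its restriction to
  \<open>tangent M q\<close> is, and it is only ever applied to such vectors.\<close>

definition differential :: "phase set \<Rightarrow> (phase \<Rightarrow> complex) \<Rightarrow> phase \<Rightarrow> phase \<Rightarrow> complex" where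
  "differential M F q \<xi> = frechet_derivative F (at q within M) \<xi>"


subsection \<open>Symplectic structure and integrability\<close>

text \<open>The tautological one-form \<open>\<theta>\<^sub>(\<^sub>r\<^sub>,\<^sub>p\<^sub>)(\<xi>) = p (d\<pi> \<xi>)\<close> of the cotangent bundle, pulled back along
  \<open>v \<mapsto> p = g\<^sub>r(v, -)\<close>. The formula makes sense on the whole ambient space; since restriction to a
  submanifold commutes with the exterior derivative, the symplectic form \<open>-d\<theta> = dr \<and> dv\<close> may be computed
  in the ambient space and restricted to the tangent spaces of \<open>M\<close>.\<close>

definition tautological_form :: "phase \<Rightarrow> phase \<Rightarrow> complex" where
  "tautological_form q \<xi> = cform (snd q) (fst \<xi>)"

definition exterior_derivative :: "(phase \<Rightarrow> phase \<Rightarrow> complex) \<Rightarrow> phase \<Rightarrow> phase \<Rightarrow> phase \<Rightarrow> complex" where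
  "exterior_derivative \<theta> q \<xi> \<eta> =
     frechet_derivative (\<lambda>p. \<theta> p \<eta>) (at q) \<xi> - frechet_derivative (\<lambda>p. \<theta> p \<xi>) (at q) \<eta>"

definition symplectic_form :: "phase \<Rightarrow> phase \<Rightarrow> phase \<Rightarrow> complex" where
  "symplectic_form q \<xi> \<eta> = - exterior_derivative tautological_form q \<xi> \<eta>"

definition hamiltonian_vector :: "phase set \<Rightarrow> (phase \<Rightarrow> complex) \<Rightarrow> phase \<Rightarrow> phase" where
  "hamiltonian_vector M F q =
     (THE \<xi>. \<xi> \<in> tangent M q \<and> (\<forall>\<eta>\<in>tangent M q. symplectic_form q \<xi> \<eta> = differential M F q \<eta>))"

definition poisson_bracket :: "phase set \<Rightarrow> (phase \<Rightarrow> complex) \<Rightarrow> (phase \<Rightarrow> complex) \<Rightarrow> phase \<Rightarrow> complex" where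
  "poisson_bracket M F G q =
     symplectic_form q (hamiltonian_vector M F q) (hamiltonian_vector M G q)"

definition kinetic_energy :: "phase \<Rightarrow> complex" where
  "kinetic_energy q = cform (snd q) (snd q) / 2"

definition in_involution :: "phase set \<Rightarrow> (phase \<Rightarrow> complex) \<Rightarrow> (phase \<Rightarrow> complex) \<Rightarrow> bool" where
  "in_involution M F G \<longleftrightarrow>
     (\<forall>q\<in>M. holomorphic_near M F q \<and> holomorphic_near M G q \<longrightarrow> poisson_bracket M F G q = 0)"

text \<open>\<open>dF \<and> dG\<close> is not identically zero.\<close>

definition functionally_independent :: "phase set \<Rightarrow> (phase \<Rightarrow> complex) \<Rightarrow> (phase \<Rightarrow> complex) \<Rightarrow> bool" where
  "functionally_independent M F G \<longleftrightarrow>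
     (\<exists>q\<in>M. holomorphic_near M F q \<and> holomorphic_near M G q \<and>
        (\<exists>\<xi>\<in>tangent M q. \<exists>\<eta>\<in>tangent M q.
           differential M F q \<xi> * differential M G q \<eta> - differential M F q \<eta> * differential M G q \<xi> \<noteq> 0))"

definition meromorphically_integrable_on :: "phase set \<Rightarrow> bool" where
  "meromorphically_integrable_on M \<longleftrightarrow>
     (\<exists>F\<^sub>1 F\<^sub>2. meromorphic_fun_on F\<^sub>1 M \<and> meromorphic_fun_on F\<^sub>2 M \<and>
        in_involution M F\<^sub>1 kinetic_energy \<and> in_involution M F\<^sub>2 kinetic_energy \<and>
        in_involution M F\<^sub>1 F\<^sub>2 \<and> functionally_independent M F\<^sub>1 F\<^sub>2)"

definition geodesic_flow_integrable :: "(real^3) set \<Rightarrow> bool" where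
  "geodesic_flow_integrable S \<longleftrightarrow>
     (\<forall>S\<^sub>0\<in>components S.
        meromorphically_integrable_on (phase_space (zariski_closure (complexify ` S\<^sub>0))))"

end

theory Submission imports Defs "HOL-Complex_Analysis.Complex_Analysis"
begin

text \<open>
 The geodesic flow is studied near the geodesic in the symmetry plane $x = y$. In logarithmic
 coordinates the points of the surface are $(e^{s+\xi}, e^{s-\xi}, e^{-2s})$, and this geodesic is
 $\xi = 0$. The argument is in the spirit of Ziglin, Morales and Ramis: a meromorphic first
 integral induces a function on the solutions of the variational equation that is invariant under
 monodromy, and here the monodromy is too large for this.

 The variational equation. On a level of fixed energy, geodesics are curves $\xi(s)$
 with slope $\eta$. Linearised at $\xi = 0$, their equation is hypergeometric in $U = - e^{6s}/2$. The
 exponents at $U = 0$ are not real, so going around that point (six times, to obtain a period of the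
 phase space) multiplies two solutions by real numbers $\lambda < 1$ and $1/\lambda$. At $U = 1$ the
 geodesic turns around: the exponents are $0$ and $3/2$, and with $z^2 = 1 - U$ the loop is the map
 $z \mapsto -z$, which exchanges the two directions of travel. Its matrix follows from the connection
 formula (lemma hg_connection). The coefficients are quotients of Gamma values, and the
 reflection formula shows that this loop does not map the eigenvector for $\lambda$ of the first loop
 to an eigenvector (lemma flip_nonzero).

 Initial forms. Along a small multiple $\epsilon (t Y_1 + Y_2)$ of a solution, a first integral
 grows like $c(t) \epsilon^d$, and $c$ does not depend on the base point, since to leading order the curve is
 a trajectory (theorem initial_form_global). The first loop makes $c$ invariant under
 $t \mapsto \lambda^2 t$ up to a factor, hence $c(t) = C t^n$ and $d = 2n$. The second loop transports this
 monomial to the other sheet, where it has to be a monomial again, so that $n = 0$. Subtracting the constant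
 and repeating the argument, one sees that the first integral is constant on
 the level near the geodesic (theorem constant_on_level).

 Conclusion. This holds on all but countably many levels, so every first integral is a function of the
 energy near the geodesic: its differential is proportional to that of the energy, first on
 an open set (lemma open_dependence) and by the identity theorem everywhere, because the
 phase space is connected. Two first integrals are then never independent (theorem
 first_integrals_dependent). The last part identifies the phase space of the Zariski closure
 of a component with the image of the logarithmic chart and the Poisson bracket with the
 energy with the derivative along the flow.
\<close>

section \<open>Hypergeometric functions inside the unit disc\<close>

lemma eventually_eq_imp_limits_eq:
 fixes a b :: complex
 assumes "(f \<longlongrightarrow> a) F" "(g \<longlongrightarrow> b) F" "\<forall>\<^sub>F x in F. f x = g x" "F ~= bot"
 shows "a = b"
proof -
 have "(f \<longlongrightarrow> b) F"
  by (rule Lim_transform_eventually[OF assms(2)]) (use assms(3) in eventually_elim, simp)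
 then show ?thesis using tendsto_unique[OF assms(4,1)] by blast
qed

definition hg_coeff :: "complex => complex => complex => nat => complex" where
 "hg_coeff a b c n = pochhammer a n * pochhammer b n / (pochhammer c n * fact n)"

text \<open>The Gauss series, as a function on the unit disc; outside of it the value is meaningless.\<close>
definition hg :: "complex => complex => complex => complex => complex" where
 "hg a b c x = (\<Sum>n. hg_coeff a b c n * x ^ n)"

lemma hg_coeff_Suc:
 assumes "c \<notin> \<int>\<^sub>\<le>\<^sub>0"
 shows "(of_nat n + 1) * (of_nat n + c) * hg_coeff a b c (Suc n)
      = (of_nat n + a) * (of_nat n + b) * hg_coeff a b c n"
proof -
 have 1: "of_nat n + c ~= 0"
  using assms by (metis add.commute plus_of_nat_eq_0_imp)
 have 2: "pochhammer c n ~= 0"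
  using assms pochhammer_eq_0_imp_nonpos_Int by blast
 have 3: "(of_nat n + 1 :: complex) ~= 0"
  by (metis of_nat_Suc of_nat_eq_0_iff add.commute nat.simps(3))
 show ?thesis
  unfolding hg_coeff_def pochhammer_Suc fact_Suc of_nat_Suc
  using 1 2 3 by (simp add: divide_simps add_ac)
qed

lemma summable_hg:
 assumes c: "c \<notin> \<int>\<^sub>\<le>\<^sub>0" and x: "norm x < 1"
 shows "summable (\<lambda>n. hg_coeff a b c n * x ^ n)"
proof -
 define q where "q n = norm ((of_nat n + a) * (of_nat n + b) / ((of_nat n + 1) * (of_nat n + c)) * x)" for n
 have "((\<lambda>n. (of_nat n + a) * (of_nat n + b) / ((of_nat n + 1) * (of_nat n + c)) * x) \<longlongrightarrow> 1 * 1 / (1*1) * x) sequentially"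
 proof -
  have L: "(\<lambda>n. 1 + d / of_nat n :: complex) \<longlonglongrightarrow> 1" for d
   using tendsto_add[OF tendsto_const[of 1] tendsto_divide_0[OF tendsto_const[of d] tendsto_of_nat]] by simp
  have "(\<lambda>n. (1 + a / of_nat n) * (1 + b / of_nat n) / ((1 + 1 / of_nat n) * (1 + c / of_nat n)) * x)
    \<longlonglongrightarrow> 1 * 1 / (1*1) * x"
   by (intro tendsto_intros L) auto
  moreover have "\<forall>\<^sub>F n in sequentially. (1 + a / of_nat n) * (1 + b / of_nat n) / ((1 + 1 / of_nat n) * (1 + c / of_nat n)) * x
    = (of_nat n + a) * (of_nat n + b) / ((of_nat n + 1) * (of_nat n + c)) * x"
   using eventually_gt_at_top[of 0]
  proof eventually_elim
   case (elim n)
   have e: "1 + d / of_nat n = (of_nat n + d) / of_nat n" for d :: complex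
    using elim by (simp add: field_simps)
   show ?case unfolding e using elim by simp
  qed
  ultimately show ?thesis by (rule Lim_transform_eventually)
 qed
 then have "q \<longlonglongrightarrow> norm x" unfolding q_def by (auto dest: tendsto_norm)
 moreover obtain y where y: "norm x < y" "y < 1" using x dense by blast
 ultimately have "\<forall>\<^sub>F n in sequentially. q n < y" by (metis order_tendstoD(2))
 then obtain N where N: "!!n. n \<ge> N ==> q n < y" by (auto simp: eventually_sequentially)
 show ?thesis
 proof (rule summable_ratio_test[OF y(2)])
  fix n assume "n \<ge> N"
  then have qn: "q n < y" using N by simp
  have 1: "of_nat n + c ~= 0"
   using c by (metis add.commute plus_of_nat_eq_0_imp)
  have 3: "(of_nat n + 1 :: complex) ~= 0"
   by (metis of_nat_Suc of_nat_eq_0_iff add.commute nat.simps(3))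
  have "hg_coeff a b c (Suc n) = (of_nat n + a) * (of_nat n + b) / ((of_nat n + 1) * (of_nat n + c)) * hg_coeff a b c n"
   using hg_coeff_Suc[OF c, of n a b] 1 3
   by (simp add: divide_simps mult_ac)
  then have "norm (hg_coeff a b c (Suc n) * x ^ Suc n) = q n * norm (hg_coeff a b c n * x ^ n)"
   unfolding q_def by (simp add: norm_mult norm_divide mult_ac)
  also have "\<dots> \<le> y * norm (hg_coeff a b c n * x ^ n)"
   using qn by (intro mult_right_mono) auto
  finally show "norm (hg_coeff a b c (Suc n) * x ^ Suc n) \<le> y * norm (hg_coeff a b c n * x ^ n)" .
 qed
qed

lemma hg_0 [simp]: "hg a b c 0 = 1"
 unfolding hg_def using powser_zero[of "hg_coeff a b c"] by (simp add: hg_coeff_def)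

lemma Suc_not_nonpos: "(c::complex) \<notin> \<int>\<^sub>\<le>\<^sub>0 ==> c + 1 \<notin> \<int>\<^sub>\<le>\<^sub>0"
 using plus_one_in_nonpos_Ints_imp by blast

lemma diffs_hg_coeff:
 assumes c: "c \<notin> \<int>\<^sub>\<le>\<^sub>0"
 shows "diffs (hg_coeff a b c) n = a * b / c * hg_coeff (a+1) (b+1) (c+1) n"
proof -
 have "c ~= 0" using c by auto
 have 3: "(of_nat n + 1 :: complex) ~= 0"
  by (metis of_nat_Suc of_nat_eq_0_iff add.commute nat.simps(3))
 have "pochhammer z (Suc n) = z * pochhammer (z + 1) n" for z :: complex
  by (rule pochhammer_rec)
 then show ?thesis
  unfolding diffs_def hg_coeff_def fact_Suc of_nat_Suc
  using 3 \<open>c ~= 0\<close> by (simp add: divide_simps add_ac)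
qed

lemma has_field_derivative_hg:
 assumes c: "c \<notin> \<int>\<^sub>\<le>\<^sub>0" and x: "norm x < 1"
 shows "(hg a b c has_field_derivative a * b / c * hg (a+1) (b+1) (c+1) x) (at x)"
proof -
 have "((\<lambda>z. \<Sum>n. hg_coeff a b c n * z ^ n) has_field_derivative (\<Sum>n. diffs (hg_coeff a b c) n * x ^ n)) (at x)"
  by (rule termdiffs_strong'[where K = 1]) (use summable_hg[OF c] x in auto)
 also have "(\<Sum>n. diffs (hg_coeff a b c) n * x ^ n) = (\<Sum>n. a * b / c * (hg_coeff (a+1) (b+1) (c+1) n * x ^ n))"
  unfolding diffs_hg_coeff[OF c] by (simp add: mult_ac)
 also have "\<dots> = a * b / c * hg (a+1) (b+1) (c+1) x"
  unfolding hg_def by (rule suminf_mult[OF summable_hg[OF Suc_not_nonpos[OF c] x]])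
 finally show ?thesis unfolding hg_def[abs_def] .
qed

lemma holomorphic_hg: "c \<notin> \<int>\<^sub>\<le>\<^sub>0 ==> hg a b c holomorphic_on ball 0 1"
 by (auto simp: holomorphic_on_open dest!: has_field_derivative_hg)

text \<open>Comparing coefficients reduces the equation to the two-term recursion of the coefficients.\<close>
lemma hg_ode:
 assumes c: "c \<notin> \<int>\<^sub>\<le>\<^sub>0" and x: "norm x < 1"
 shows "x * (1 - x) * (a * b / c * ((a+1) * (b+1) / (c+1) * hg (a+2) (b+2) (c+2) x))
   + (c - (a + b + 1) * x) * (a * b / c * hg (a+1) (b+1) (c+1) x) = a * b * hg a b c x"
proof -
 define D where "D = hg_coeff a b c"
 define F1 where "F1 = a * b / c * hg (a+1) (b+1) (c+1) x"
 define F2 where "F2 = a * b / c * ((a+1) * (b+1) / (c+1) * hg (a+2) (b+2) (c+2) x)"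
 note c1 = Suc_not_nonpos[OF c]
 have c2: "c + 2 \<notin> \<int>\<^sub>\<le>\<^sub>0" using Suc_not_nonpos[OF c1] by (simp add: add.assoc)
 have d1: "diffs D n = a * b / c * hg_coeff (a+1) (b+1) (c+1) n" for n
  unfolding D_def by (rule diffs_hg_coeff[OF c])
 have d1': "diffs D = (\<lambda>n. a * b / c * hg_coeff (a+1) (b+1) (c+1) n)" by (rule ext) (rule d1)
 have d2: "diffs (diffs D) n = a * b / c * ((a+1) * (b+1) / (c+1) * hg_coeff (a+2) (b+2) (c+2) n)" for n
  using diffs_hg_coeff[OF c1, of "a+1" "b+1" n] unfolding d1'
  by (simp add: diffs_def mult_ac add.assoc)
 have S0: "(\<lambda>n. D n * x ^ n) sums hg a b c x"
  unfolding hg_def D_def by (rule summable_sums[OF summable_hg[OF c x]])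
 have S1: "(\<lambda>n. diffs D n * x ^ n) sums F1"
  unfolding F1_def d1 using sums_mult[OF summable_sums[OF summable_hg[OF c1 x]], of "a*b/c" "a+1" "b+1"]
  by (simp add: hg_def mult_ac)
 have S2: "(\<lambda>n. diffs (diffs D) n * x ^ n) sums F2"
  unfolding F2_def d2 using sums_mult[OF summable_sums[OF summable_hg[OF c2 x]], of "a*b/c * ((a+1) * (b+1) / (c+1))" "a+2" "b+2"]
  by (simp add: hg_def mult_ac)
 have shift: "f sums s" if "(\<lambda>n. f (Suc n)) sums s" "f 0 = 0" for f :: "nat => complex" and s
  using that by (simp add: sums_Suc_iff)
 have T1: "(\<lambda>n. of_nat n * D n * x ^ n) sums (x * F1)"
  by (rule shift) (use sums_mult[OF S1, of x] in \<open>simp_all add: diffs_def mult_ac\<close>)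
 have T2: "(\<lambda>n. of_nat n * diffs D n * x ^ n) sums (x * F2)"
  by (rule shift) (use sums_mult[OF S2, of x] in \<open>simp_all add: diffs_def mult_ac\<close>)
 have T3: "(\<lambda>n. of_nat n * (of_nat n - 1) * D n * x ^ n) sums (x * (x * F2))"
  by (rule shift) (use sums_mult[OF T2, of x] in \<open>simp_all add: diffs_def mult_ac\<close>)
 have "(\<lambda>n. of_nat n * diffs D n * x ^ n + c * (diffs D n * x ^ n) - of_nat n * (of_nat n - 1) * D n * x ^ n
   - (a + b + 1) * (of_nat n * D n * x ^ n) - a * b * (D n * x ^ n)) sums
   (x * F2 + c * F1 - x * (x * F2) - (a + b + 1) * (x * F1) - a * b * hg a b c x)"
  by (intro sums_add sums_diff sums_mult T1 T2 T3 S0 S1)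
 moreover have "of_nat n * diffs D n * x ^ n + c * (diffs D n * x ^ n) - of_nat n * (of_nat n - 1) * D n * x ^ n
   - (a + b + 1) * (of_nat n * D n * x ^ n) - a * b * (D n * x ^ n) = 0" for n
 proof -
  have "(of_nat n + c) * diffs D n = (of_nat n + a) * (of_nat n + b) * D n"
   using hg_coeff_Suc[OF c, of n a b] unfolding D_def diffs_def by (simp add: mult_ac add_ac)
  then have "((of_nat n + c) * diffs D n - (of_nat n + a) * (of_nat n + b) * D n) * x ^ n = 0" by simp
  then show ?thesis by (simp add: algebra_simps)
 qed
 ultimately have "(\<lambda>n. 0) sums (x * F2 + c * F1 - x * (x * F2) - (a + b + 1) * (x * F1) - a * b * hg a b c x)"
  by simp
 then have "x * F2 + c * F1 - x * (x * F2) - (a + b + 1) * (x * F1) - a * b * hg a b c x = 0"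
  using sums_unique2 sums_zero by blast
 then show ?thesis unfolding F1_def[symmetric] F2_def[symmetric] by (simp add: algebra_simps)
qed

subsection \<open>Behaviour at 1\<close>

text \<open>Abel's theorem for quotients: when the coefficients of a power series are asymptotic to a multiple of those of a series that diverges at 1, so are the sums as the argument tends to 1.\<close>
lemma abel_quotient:
 fixes a :: "nat => complex" and b :: "nat => real"
 assumes b: "!!n. b n > 0" and lim: "(\<lambda>n. a n / of_real (b n)) \<longlonglongrightarrow> L"
  and sb: "!!x. 0 \<le> x ==> x < 1 ==> summable (\<lambda>n. b n * x ^ n)"
  and sa: "!!x. 0 \<le> x ==> x < 1 ==> summable (\<lambda>n. a n * of_real x ^ n)"
  and inf: "filterlim (\<lambda>x. \<Sum>n. b n * x ^ n) at_top (at_left 1)"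
 shows "((\<lambda>x::real. (\<Sum>n. a n * of_real x ^ n) / of_real (\<Sum>n. b n * x ^ n)) \<longlongrightarrow> L) (at_left 1)"
proof (rule tendstoI)
 fix e :: real assume e: "e > 0"
 define B where "B x = (\<Sum>n. b n * x ^ n)" for x
 obtain N where N: "!!n. n \<ge> N ==> dist (a n / of_real (b n)) L < e/2"
  using e metric_LIMSEQ_D[OF lim, of "e/2"] by (auto simp: half_gt_zero)
 have N': "norm (a n - L * of_real (b n)) \<le> e/2 * b n" if "n \<ge> N" for n
 proof -
  have "norm (a n - L * of_real (b n)) = norm (a n / of_real (b n) - L) * b n"
  proof -
   have "a n - L * of_real (b n) = (a n / of_real (b n) - L) * of_real (b n)"
    using b[of n] by (simp add: field_simps)
   then show ?thesis using b[of n] by (simp add: norm_mult)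
  qed
  also have "\<dots> \<le> e/2 * b n" using N[OF that] b[of n] by (intro mult_right_mono) (auto simp: dist_norm)
  finally show ?thesis .
 qed
 define C where "C = (\<Sum>n<N. norm (a n - L * of_real (b n)))"
 have "\<forall>\<^sub>F x in at_left 1. B x > 2 * C / e + 1"
  using inf unfolding B_def filterlim_at_top_dense by blast
 moreover have "\<forall>\<^sub>F x::real in at_left 1. 0 < x" by (rule eventually_at_leftI[of 0]) auto
 moreover have "\<forall>\<^sub>F x::real in at_left 1. x < 1" by (simp add: eventually_at_filter)
 ultimately show "\<forall>\<^sub>F x in at_left 1. dist ((\<Sum>n. a n * of_real x ^ n) / of_real (\<Sum>n. b n * x ^ n)) L < e"
 proof eventually_elim
  case (elim x)
  then have x: "0 \<le> x" "x < 1" by auto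
  have C0: "C \<ge> 0" unfolding C_def by (simp add: sum_nonneg)
  have B1: "B x > 0" using elim(1) C0 e by (smt (verit, best) divide_nonneg_pos mult_nonneg_nonneg)
  have bx: "b n * x ^ n \<ge> 0" for n using b[of n] x by simp
  define d where "d n = (a n - L * of_real (b n)) * of_real x ^ n" for n
  have dle: "norm (d n) \<le> (if n < N then norm (a n - L * of_real (b n)) else 0) + e/2 * (b n * x^n)" for n
  proof (cases "n < N")
   case True
   have "norm (d n) \<le> norm (a n - L * of_real (b n)) * 1"
    unfolding d_def norm_mult norm_power using x by (intro mult_left_mono) (auto intro: power_le_one)
   then show ?thesis using True bx[of n] e by (smt (verit) divide_pos_pos mult_nonneg_nonneg)
  next
   case False
   then show ?thesis using mult_right_mono[OF N', of n "x^n"] x unfolding d_def norm_mult norm_power by simp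
  qed
  have s1: "summable (\<lambda>n. (if n < N then norm (a n - L * of_real (b n)) else 0))"
   by (rule summable_finite[of "{..<N}"]) auto
  have s1': "(\<Sum>n. (if n < N then norm (a n - L * of_real (b n)) else 0)) = C"
   unfolding C_def by (subst suminf_finite[of "{..<N}"]) auto
  have s2: "summable (\<lambda>n. e/2 * (b n * x^n))" using sb[OF x] by (rule summable_mult)
  have sd: "summable (\<lambda>n. norm (d n))"
   by (rule summable_comparison_test'[OF summable_add[OF s1 s2], of 0]) (use dle in auto)
  have "norm (\<Sum>n. d n) \<le> (\<Sum>n. norm (d n))" by (rule summable_norm[OF sd])
  also have "\<dots> \<le> (\<Sum>n. (if n < N then norm (a n - L * of_real (b n)) else 0) + e/2 * (b n * x^n))"
   by (rule suminf_le[OF dle sd summable_add[OF s1 s2]])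
  also have "\<dots> = C + e/2 * B x"
   unfolding B_def by (subst suminf_add[OF s1 s2, symmetric]) (simp only: s1' suminf_mult[OF sb[OF x], of "e/2"])
  also have "\<dots> < e * B x"
  proof -
   have "e * (2 * C / e + 1) < e * B x" using elim(1) e by (intro mult_strict_left_mono)
   moreover have "e * (2 * C / e + 1) = 2 * C + e" using e by (simp add: distrib_left)
   ultimately have "e * B x > 2 * C" using e by linarith
   then show ?thesis by simp
  qed
  finally have *: "norm (\<Sum>n. d n) < e * B x" .
  have sb': "summable (\<lambda>n. of_real (b n) * of_real x ^ n :: complex)"
   using summable_of_real[OF sb[OF x], where 'a=complex] by simp
  have Bc: "of_real (B x) = (\<Sum>n. of_real (b n) * of_real x ^ n :: complex)"
   unfolding B_def using suminf_of_real[OF sb[OF x], where 'a=complex] by simp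
  have "(\<Sum>n. d n) = (\<Sum>n. a n * of_real x ^ n) - L * of_real (B x)"
   unfolding Bc d_def
   by (subst suminf_mult[OF sb', symmetric], subst suminf_diff[OF sa[OF x] summable_mult[OF sb']])
     (simp add: algebra_simps)
  then have "(\<Sum>n. a n * of_real x ^ n) / of_real (B x) - L = (\<Sum>n. d n) / of_real (B x)"
   using B1 by (simp add: field_simps)
  then have "norm ((\<Sum>n. a n * of_real x ^ n) / of_real (B x) - L) = norm (\<Sum>n. d n) / B x"
   using B1 by (simp add: norm_divide)
  also have "\<dots> < e" using * B1 by (simp add: field_simps)
  finally show ?case by (simp add: dist_norm B_def)
 qed
qed

lemma binomial_series_at_1:
 fixes \<alpha> :: real
 assumes "0 \<le> x" "x < 1"
 shows "(\<lambda>n. pochhammer \<alpha> n / fact n * x ^ n) sums ((1 - x) powr (- \<alpha>))"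
proof -
 have "(\<lambda>n. (- \<alpha> gchoose n) * (- x) ^ n) sums (1 + (- x)) powr (- \<alpha>)"
  by (rule gen_binomial_real) (use assms in auto)
 moreover have "(- \<alpha> gchoose n) * (- x) ^ n = pochhammer \<alpha> n / fact n * x ^ n" for n
  by (simp add: gbinomial_pochhammer power_minus[of x] mult_ac)
 ultimately show ?thesis by simp
qed

text \<open>The coefficients of the series behave like a Gamma quotient times those of a binomial series, by Stirling in the form of the limit formula for Gamma. This is how the connection coefficients get their values.\<close>
lemma hg_asymp_at_1:
 fixes \<alpha> :: real
 assumes c: "c \<notin> \<int>\<^sub>\<le>\<^sub>0" and \<alpha>: "\<alpha> > 0" and s: "a + b = c + of_real \<alpha>"
 shows "((\<lambda>x::real. of_real ((1 - x) powr \<alpha>) * hg a b c (of_real x)) \<longlongrightarrow> Gamma c * Gamma (of_real \<alpha>) * rGamma a * rGamma b) (at_left 1)"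
proof -
 define b' where "b' n = pochhammer \<alpha> n / fact n" for n
 have b': "b' n > 0" for n unfolding b'_def using \<alpha> by (simp add: pochhammer_pos)
 have pow: "(\<Sum>n. b' n * x ^ n) = (1 - x) powr (- \<alpha>)" "summable (\<lambda>n. b' n * x ^ n)" if "0 \<le> x" "x < 1" for x
  using binomial_series_at_1[OF that, of \<alpha>] unfolding b'_def by (auto simp: sums_iff)
 have ca: "complex_of_real \<alpha> \<notin> \<int>\<^sub>\<le>\<^sub>0" "complex_of_real \<alpha> ~= 0" using \<alpha>
  by (auto elim!: nonpos_Ints_cases simp: complex_eq_iff)
 have nz: "rGamma c ~= 0" "rGamma (of_real \<alpha> :: complex) ~= 0"
  using c ca by (auto simp: rGamma_eq_zero_iff)
 have "(\<lambda>n. (rGamma_series a n * rGamma_series b n) / (rGamma_series c n * rGamma_series (of_real \<alpha>) n))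
   \<longlonglongrightarrow> (rGamma a * rGamma b) / (rGamma c * rGamma (of_real \<alpha>))"
  by (intro tendsto_intros rGamma_series_LIMSEQ) (use nz in auto)
 moreover have "\<forall>\<^sub>F n in sequentially. (rGamma_series a n * rGamma_series b n) / (rGamma_series c n * rGamma_series (of_real \<alpha>) n)
   = hg_coeff a b c (Suc n) / of_real (b' (Suc n))"
 proof (rule always_eventually, rule allI)
  fix n
  have E: "exp (a * of_real (ln (of_nat n))) * exp (b * of_real (ln (of_nat n)))
    = exp (c * of_real (ln (of_nat n))) * exp (of_real \<alpha> * complex_of_real (ln (of_nat n)))"
   unfolding exp_add[symmetric] distrib_right[symmetric] s ..
  have quot: "(pa / (f * ea) * (pb / (f * eb))) / (pc / (f * ec) * (pd / (f * ed))) = pa * pb / (pc * f') / (pd / f')"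
   if "ea * eb = ec * ed" "f ~= 0" "f' ~= 0" "ea ~= 0" "eb ~= 0" for ea eb ec ed f f' pa pb pc pd :: complex
  proof -
   define K where "K = f * ea * (f * eb)"
   have K: "f * ec * (f * ed) = K" "K ~= 0" unfolding K_def using that by (simp_all add: mult_ac)
   have "(pa / (f * ea) * (pb / (f * eb))) / (pc / (f * ec) * (pd / (f * ed))) = (pa * pb / K) / (pc * pd / K)"
    by (simp only: times_divide_times_eq K(1) K_def[symmetric])
   also have "\<dots> = pa * pb / (pc * pd)" using K(2) by simp
   also have "\<dots> = pa * pb / (pc * f') / (pd / f')" using that(3) by simp
   finally show ?thesis .
  qed
  have pa: "pochhammer (complex_of_real \<alpha>) m = of_real (pochhammer \<alpha> m)" for m
   by (simp add: pochhammer_of_real)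
  show "(rGamma_series a n * rGamma_series b n) / (rGamma_series c n * rGamma_series (of_real \<alpha>) n)
   = hg_coeff a b c (Suc n) / of_real (b' (Suc n))"
   unfolding rGamma_series_def hg_coeff_def b'_def Suc_eq_plus1[symmetric] pa of_real_divide of_real_fact
   by (rule quot) (use E in \<open>simp_all del: fact_Suc\<close>)
 qed
 ultimately have "(\<lambda>n. hg_coeff a b c (Suc n) / of_real (b' (Suc n))) \<longlonglongrightarrow> (rGamma a * rGamma b) / (rGamma c * rGamma (of_real \<alpha>))"
  by (rule Lim_transform_eventually)
 then have lim: "(\<lambda>n. hg_coeff a b c n / of_real (b' n)) \<longlonglongrightarrow> (rGamma a * rGamma b) / (rGamma c * rGamma (of_real \<alpha>))"
  by (rule LIMSEQ_imp_Suc)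
 have top: "filterlim (\<lambda>x::real. (1 - x) powr (- \<alpha>)) at_top (at_left 1)"
  using \<alpha> by real_asymp
 have ev: "\<forall>\<^sub>F x in at_left (1::real). 0 < x \<and> x < 1" by (rule eventually_at_leftI[of 0]) auto
 have "((\<lambda>x::real. (\<Sum>n. hg_coeff a b c n * of_real x ^ n) / of_real (\<Sum>n. b' n * x ^ n)) \<longlongrightarrow> (rGamma a * rGamma b) / (rGamma c * rGamma (of_real \<alpha>))) (at_left 1)"
 proof (rule abel_quotient[OF b' lim pow(2)])
  show "summable (\<lambda>n. hg_coeff a b c n * complex_of_real x ^ n)" if "0 \<le> x" "x < 1" for x
   using summable_hg[OF c, of "of_real x"] that by simp
  show "filterlim (\<lambda>x. \<Sum>n. b' n * x ^ n) at_top (at_left 1)"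
   by (rule filterlim_cong[THEN iffD1, OF refl refl _ top]) (use ev in eventually_elim, simp add: pow)
 qed
 then have "((\<lambda>x::real. of_real ((1 - x) powr \<alpha>) * hg a b c (of_real x)) \<longlongrightarrow> (rGamma a * rGamma b) / (rGamma c * rGamma (of_real \<alpha>))) (at_left 1)"
 proof (rule Lim_transform_eventually)
  show "\<forall>\<^sub>F x in at_left 1. (\<Sum>n. hg_coeff a b c n * of_real x ^ n) / of_real (\<Sum>n. b' n * x ^ n) = of_real ((1 - x) powr \<alpha>) * hg a b c (of_real x)"
   using ev
  proof eventually_elim
   case (elim x)
   then have "(\<Sum>n. b' n * x ^ n) = inverse ((1 - x) powr \<alpha>)" by (simp add: pow powr_minus)
   then show ?case unfolding hg_def by (simp add: divide_inverse mult.commute)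
  qed
 qed
 then show ?thesis by (simp add: rGamma_inverse_Gamma field_simps)
qed

section \<open>Second-order linear systems in the complex domain\<close>

text \<open>Linear equations are written as systems with an arbitrary rate p of the independent variable, so that the same equation can be transported along a change of variable by changing p, q and r only.\<close>
definition solves :: "complex set => (complex => complex) => (complex => complex) => (complex => complex) => (complex => complex) => (complex => complex) => bool" where
 "solves D p q r Y Z \<longleftrightarrow> (\<forall>x\<in>D. (Y has_field_derivative p x * Z x) (at x) \<and>
   (Z has_field_derivative q x * Y x + r x * Z x) (at x))"

lemma solves_wronskian:
 assumes "solves D p q r Y1 Z1" "solves D p q r Y2 Z2" "x \<in> D"
 shows "((\<lambda>x. Y1 x * Z2 x - Y2 x * Z1 x) has_field_derivative r x * (Y1 x * Z2 x - Y2 x * Z1 x)) (at x)"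
proof -
 have d: "(Y1 has_field_derivative p x * Z1 x) (at x)" "(Z1 has_field_derivative q x * Y1 x + r x * Z1 x) (at x)"
  "(Y2 has_field_derivative p x * Z2 x) (at x)" "(Z2 has_field_derivative q x * Y2 x + r x * Z2 x) (at x)"
  using assms unfolding solves_def by auto
 show ?thesis by (rule derivative_eq_intros d refl)+ (simp add: algebra_simps)
qed

text \<open>The coefficients are Wronskian quotients, and all Wronskians satisfy the same first-order equation.\<close>
lemma solves_span:
 assumes "open D" "connected D" "solves D p q r Y1 Z1" "solves D p q r Y2 Z2" "solves D p q r Y3 Z3"
  and W: "!!x. x \<in> D ==> Y1 x * Z2 x - Y2 x * Z1 x ~= 0"
 shows "\<exists>\<alpha> \<beta>. \<forall>x\<in>D. Y3 x = \<alpha> * Y1 x + \<beta> * Y2 x \<and> Z3 x = \<alpha> * Z1 x + \<beta> * Z2 x"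
proof -
 define W where "W x = Y1 x * Z2 x - Y2 x * Z1 x" for x
 have const: "\<exists>\<gamma>. \<forall>x\<in>D. (U x * Z x - Y x * V x) / W x = \<gamma>" if s: "solves D p q r U V" "solves D p q r Y Z" for U V Y Z
 proof -
  have "((\<lambda>x. (U x * Z x - Y x * V x) / W x) has_field_derivative 0) (at x)" if x: "x \<in> D" for x
  proof -
   note d = solves_wronskian[OF s x] solves_wronskian[OF assms(3,4) x, folded W_def]
   show ?thesis
    by (rule derivative_eq_intros d refl)+ (use W[OF x] in \<open>simp_all add: W_def\<close>)
  qed
  then have "\<forall>x\<in>D - {}. ((\<lambda>x. (U x * Z x - Y x * V x) / W x) has_field_derivative 0) (at x)" by simp
  moreover from this have "continuous_on D (\<lambda>x. (U x * Z x - Y x * V x) / W x)"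
   by (intro continuous_at_imp_continuous_on) (auto intro: DERIV_isCont)
  ultimately obtain \<gamma> where "!!x. x \<in> D ==> (U x * Z x - Y x * V x) / W x = \<gamma>"
   using DERIV_zero_connected_constant[OF assms(2,1) finite.emptyI] by blast
  then show ?thesis by blast
 qed
 obtain \<alpha> where \<alpha>: "!!x. x \<in> D ==> (Y3 x * Z2 x - Y2 x * Z3 x) / W x = \<alpha>" using const[OF assms(5,4)] by blast
 obtain \<beta> where \<beta>: "!!x. x \<in> D ==> (Y1 x * Z3 x - Y3 x * Z1 x) / W x = \<beta>" using const[OF assms(3,5)] by blast
 have "Y3 x = \<alpha> * Y1 x + \<beta> * Y2 x \<and> Z3 x = \<alpha> * Z1 x + \<beta> * Z2 x" if x: "x \<in> D" for x
 proof -
  have W0: "W x ~= 0" using W[OF x] by (simp add: W_def)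
  have a: "\<alpha> * W x = Y3 x * Z2 x - Y2 x * Z3 x" and b: "\<beta> * W x = Y1 x * Z3 x - Y3 x * Z1 x"
   using \<alpha>[OF x] \<beta>[OF x] W0 by (simp_all add: field_simps)
  have "Y3 x * W x = (\<alpha> * W x) * Y1 x + (\<beta> * W x) * Y2 x" "Z3 x * W x = (\<alpha> * W x) * Z1 x + (\<beta> * W x) * Z2 x"
   unfolding a b by (simp_all add: W_def algebra_simps)
  then have "Y3 x * W x = (\<alpha> * Y1 x + \<beta> * Y2 x) * W x" "Z3 x * W x = (\<alpha> * Z1 x + \<beta> * Z2 x) * W x"
   by (simp_all add: distrib_left distrib_right mult_ac)
  then show ?thesis using W0 by simp
 qed
 then show ?thesis by blast
qed

text \<open>At a zero of order n of W the equation would give q the value n there.\<close>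
lemma ode_zero_identically:
 assumes D: "open D" "connected D" and W: "W holomorphic_on D" and zz: "zz \<in> D" "W zz = 0"
  and q: "q holomorphic_on D" and qn: "!!n. n > 0 ==> q zz ~= of_nat n"
  and ode: "!!w. w \<in> D ==> (w - zz) * deriv W w = q w * W w"
  and w: "w \<in> D"
 shows "W w = 0"
proof (rule ccontr)
 assume "W w ~= 0"
 then have "\<not> W constant_on D" using zz w unfolding constant_on_def by metis
 then obtain g r n where g: "0 < n" "0 < r" "ball zz r \<subseteq> D" "g holomorphic_on ball zz r"
   "!!w. w \<in> ball zz r ==> W w = (w - zz) ^ n * g w" "!!w. w \<in> ball zz r ==> g w ~= 0"
  using holomorphic_factor_zero_nonconstant[OF W D zz] by metis
 have eq: "of_nat n * g w + (w - zz) * deriv g w = q w * g w" if w: "w \<in> ball zz r - {zz}" for w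
 proof -
  have dg: "(g has_field_derivative deriv g w) (at w)"
   using holomorphic_derivI[OF g(4) open_ball] w by blast
  have "((\<lambda>w. (w - zz) ^ n * g w) has_field_derivative (of_nat n * (w - zz) ^ (n - 1)) * g w + (w - zz) ^ n * deriv g w) (at w)"
   by (rule derivative_eq_intros dg refl)+ (use g(1) in \<open>simp add: mult_ac\<close>)
  then have "(W has_field_derivative (of_nat n * (w - zz) ^ (n - 1)) * g w + (w - zz) ^ n * deriv g w) (at w)"
   by (rule has_field_derivative_transform_within_open[where S = "ball zz r"]) (use w g(5) in auto)
  then have "deriv W w = (of_nat n * (w - zz) ^ (n - 1)) * g w + (w - zz) ^ n * deriv g w"
   by (rule DERIV_imp_deriv)
  moreover have "(w - zz) * deriv W w = q w * W w" using ode w g(3) by blast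
  moreover have "W w = (w - zz) ^ n * g w" using g(5) w by blast
  moreover obtain m where m: "n = Suc m" using g(1) gr0_implies_Suc by blast
  ultimately have "(w - zz) * (of_nat n * (w - zz) ^ m * g w + (w - zz) ^ n * deriv g w) = q w * ((w - zz) ^ n * g w)"
   by simp
  then have "(w - zz) ^ n * (of_nat n * g w + (w - zz) * deriv g w) = (w - zz) ^ n * (q w * g w)"
   unfolding m power_Suc by (simp add: distrib_left distrib_right mult_ac)
  then show ?thesis using w by simp
 qed
 have zzr: "zz \<in> ball zz r" using g(2) by simp
 have cg: "isCont g zz" "isCont (deriv g) zz" "isCont q zz"
  using g(4) q zz zzr D holomorphic_deriv[OF g(4) open_ball]
  by (meson holomorphic_on_imp_continuous_on continuous_on_eq_continuous_at open_ball)+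
 have "((\<lambda>w. of_nat n * g w + (w - zz) * deriv g w) \<longlongrightarrow> of_nat n * g zz + (zz - zz) * deriv g zz) (at zz)"
  using cg unfolding isCont_def by (intro tendsto_intros)
 moreover have "((\<lambda>w. q w * g w) \<longlongrightarrow> q zz * g zz) (at zz)"
  using cg unfolding isCont_def by (intro tendsto_intros)
 moreover have "\<forall>\<^sub>F w in at zz. of_nat n * g w + (w - zz) * deriv g w = q w * g w"
  unfolding eventually_at by (rule exI[of _ r]) (use eq g(2) in \<open>auto simp: dist_commute\<close>)
 ultimately have "of_nat n * g zz + (zz - zz) * deriv g zz = q zz * g zz"
  by (rule eventually_eq_imp_limits_eq) simp
 then show False using g(6)[OF zzr] qn[OF g(1)] by simp
qed

text \<open>The Wronskian satisfies W' = r W, so a zero would make it vanish identically.\<close>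
lemma wronskian_nonzero:
 assumes D: "open D" "connected D" "solves D p q r Y1 Z1" "solves D p q r Y2 Z2" and r: "r holomorphic_on D"
  and x0: "x0 \<in> D" "Y1 x0 * Z2 x0 - Y2 x0 * Z1 x0 ~= 0" and x: "x \<in> D"
 shows "Y1 x * Z2 x - Y2 x * Z1 x ~= 0"
proof
 assume 0: "Y1 x * Z2 x - Y2 x * Z1 x = 0"
 note d = solves_wronskian[OF D(3,4)]
 have "Y1 x0 * Z2 x0 - Y2 x0 * Z1 x0 = 0"
 proof (rule ode_zero_identically[where D = D and zz = x and q = "\<lambda>w. (w - x) * r w" and W = "\<lambda>x. Y1 x * Z2 x - Y2 x * Z1 x"])
  show "(\<lambda>x. Y1 x * Z2 x - Y2 x * Z1 x) holomorphic_on D"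
   using d unfolding holomorphic_on_open[OF D(1)] by blast
  show "(\<lambda>w. (w - x) * r w) holomorphic_on D" by (intro holomorphic_intros r)
  show "(w - x) * deriv (\<lambda>x. Y1 x * Z2 x - Y2 x * Z1 x) w = (w - x) * r w * (Y1 w * Z2 w - Y2 w * Z1 w)" if "w \<in> D" for w
   using DERIV_imp_deriv[OF d[OF that]] by simp
 qed (use x 0 D x0 in auto)
 then show False using x0 by simp
qed

definition hgq :: "complex => complex => complex => complex" where "hgq a b U = a * b / (U * (1 - U))"
definition hgr :: "complex => complex => complex => complex => complex" where "hgr a b c U = ((a + b + 1) * U - c) / (U * (1 - U))"

definition hg' :: "complex => complex => complex => complex => complex" where
 "hg' a b c x = a * b / c * hg (a+1) (b+1) (c+1) x"
definition hg'' :: "complex => complex => complex => complex => complex" where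
 "hg'' a b c x = a * b / c * ((a+1) * (b+1) / (c+1) * hg (a+2) (b+2) (c+2) x)"

lemma hg_derivs:
 assumes c: "c \<notin> \<int>\<^sub>\<le>\<^sub>0" and x: "norm x < 1"
 shows "(hg a b c has_field_derivative hg' a b c x) (at x)" "(hg' a b c has_field_derivative hg'' a b c x) (at x)"
proof -
 show "(hg a b c has_field_derivative hg' a b c x) (at x)"
  unfolding hg'_def by (rule has_field_derivative_hg[OF c x])
 show "(hg' a b c has_field_derivative hg'' a b c x) (at x)"
  unfolding hg''_def hg'_def[abs_def]
  by (rule DERIV_cmult) (use has_field_derivative_hg[OF Suc_not_nonpos[OF c] x, of "a+1" "b+1"] in \<open>simp add: add.assoc\<close>)
qed

lemma hg''_eq:
 assumes c: "c \<notin> \<int>\<^sub>\<le>\<^sub>0" and x: "norm x < 1" "x ~= 0"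
 shows "hg'' a b c x = hgq a b x * hg a b c x + hgr a b c x * hg' a b c x"
proof -
 have "x ~= 1" using x by auto
 then have nz: "x * (1 - x) ~= 0" using x by simp
 have ode: "x * (1 - x) * hg'' a b c x + (c - (a + b + 1) * x) * hg' a b c x = a * b * hg a b c x"
  unfolding hg'_def hg''_def by (rule hg_ode[OF c x(1)])
 have "hg'' a b c x = (x * (1 - x) * hg'' a b c x) / (x * (1 - x))" using nz by simp
 also have "x * (1 - x) * hg'' a b c x = a * b * hg a b c x - (c - (a + b + 1) * x) * hg' a b c x"
  using ode by (simp add: algebra_simps)
 also have "\<dots> / (x * (1 - x)) = a * b / (x * (1 - x)) * hg a b c x + ((a + b + 1) * x - c) / (x * (1 - x)) * hg' a b c x"
  unfolding times_divide_eq_left add_divide_distrib[symmetric] by (simp add: algebra_simps)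
 finally show ?thesis unfolding hgq_def hgr_def .
qed

lemma solves_hg:
 assumes c: "c \<notin> \<int>\<^sub>\<le>\<^sub>0" and D: "D \<subseteq> ball 0 1 - {0}"
 shows "solves D (\<lambda>_. 1) (hgq a b) (hgr a b c) (hg a b c) (hg' a b c)"
 unfolding solves_def using hg_derivs[OF c, of _ a b] D
 by (auto simp: subset_iff hg''_eq[OF c, symmetric])

lemma solves_hg_reflect:
 assumes c: "c' \<notin> \<int>\<^sub>\<le>\<^sub>0" and cc: "c = a + b + 1 - c'" and D: "D \<subseteq> ball 1 1 - {1}"
 shows "solves D (\<lambda>_. 1) (hgq a b) (hgr a b c) (\<lambda>x. hg a b c' (1 - x)) (\<lambda>x. - hg' a b c' (1 - x))"
 unfolding solves_def
proof (intro ballI conjI)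
 fix x assume "x \<in> D"
 then have x: "norm (1 - x) < 1" "1 - x ~= 0" using D by (auto simp: dist_norm)
 have d1: "((\<lambda>x. 1 - x) has_field_derivative - 1) (at x)" by (auto intro!: derivative_eq_intros)
 show "((\<lambda>x. hg a b c' (1 - x)) has_field_derivative 1 * - hg' a b c' (1 - x)) (at x)"
  using DERIV_chain2[OF hg_derivs(1)[OF c x(1)] d1] by simp
 have "((\<lambda>x. - hg' a b c' (1 - x)) has_field_derivative hg'' a b c' (1 - x)) (at x)"
  using DERIV_minus[OF DERIV_chain2[OF hg_derivs(2)[OF c x(1)] d1]] by simp
 also have "hg'' a b c' (1 - x) = hgq a b x * hg a b c' (1 - x) + hgr a b c x * - hg' a b c' (1 - x)"
 proof -
  have q: "hgq a b (1 - x) = hgq a b x" unfolding hgq_def by (simp add: mult.commute)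
  have "(a + b + 1) * (1 - x) - c' = - ((a + b + 1) * x - c)" unfolding cc by (simp add: algebra_simps)
  moreover have "(1 - x) * (1 - (1 - x)) = x * (1 - x)" by (simp add: mult.commute)
  ultimately have r: "hgr a b c' (1 - x) = - hgr a b c x" unfolding hgr_def by (simp only: minus_divide_left)
  show ?thesis unfolding hg''_eq[OF c x] q r by simp
 qed
 finally show "((\<lambda>x. - hg' a b c' (1 - x)) has_field_derivative hgq a b x * hg a b c' (1 - x) + hgr a b c x * - hg' a b c' (1 - x)) (at x)" .
qed

text \<open>Multiplication by a power of 1 - x moves the exponents at 1; this is the substitution behind Euler's transformation.\<close>
lemma solves_twist:
 assumes s: "solves D (\<lambda>_. 1) (hgq (c - a) (c - b)) (hgr (c - a) (c - b) c) g h"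
  and D: "!!x. x \<in> D ==> x ~= 0 \<and> 1 - x \<notin> \<real>\<^sub>\<le>\<^sub>0"
 shows "solves D (\<lambda>_. 1) (hgq a b) (hgr a b c) (\<lambda>x. exp ((c - a - b) * Ln (1 - x)) * g x)
   (\<lambda>x. exp ((c - a - b) * Ln (1 - x)) * (h x - (c - a - b) * g x / (1 - x)))"
 unfolding solves_def
proof (intro ballI conjI)
 fix x assume x: "x \<in> D"
 define e where "e = c - a - b"
 have nz: "x ~= 0" "1 - x ~= 0" "1 - x \<notin> \<real>\<^sub>\<le>\<^sub>0" using D[OF x] by auto
 have d: "(g has_field_derivative h x) (at x)"
  "(h has_field_derivative hgq (c - a) (c - b) x * g x + hgr (c - a) (c - b) c x * h x) (at x)"
  using s x unfolding solves_def by auto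
 have d3: "((\<lambda>x. 1 - x) has_field_derivative - 1) (at x)" by (auto intro!: derivative_eq_intros)
 have dE: "((\<lambda>x. exp (e * Ln (1 - x))) has_field_derivative exp (e * Ln (1 - x)) * (- e / (1 - x))) (at x)"
 proof -
  have "((\<lambda>x. exp (e * Ln (1 - x))) has_field_derivative exp (e * Ln (1 - x)) * (e * (inverse (1 - x) * - 1))) (at x)"
   by (rule DERIV_chain2[OF DERIV_exp DERIV_cmult[OF DERIV_chain2[OF has_field_derivative_Ln[OF nz(3)] d3]]])
  then show ?thesis by (simp add: divide_inverse)
 qed
 show "((\<lambda>x. exp ((c - a - b) * Ln (1 - x)) * g x) has_field_derivative
   1 * (exp ((c - a - b) * Ln (1 - x)) * (h x - (c - a - b) * g x / (1 - x)))) (at x)"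
  unfolding e_def[symmetric]
  by (rule DERIV_cong[OF DERIV_mult[OF dE d(1)]]) (simp add: algebra_simps)
 define i where "i = 1 / (1 - x)"
 have "((\<lambda>x. exp (e * Ln (1 - x)) * (h x - e * g x / (1 - x))) has_field_derivative
   exp (e * Ln (1 - x)) * (- e / (1 - x)) * (h x - e * g x / (1 - x)) +
   exp (e * Ln (1 - x)) * ((hgq (c - a) (c - b) x * g x + hgr (c - a) (c - b) c x * h x)
    - (e * h x * (1 - x) + e * g x) / ((1 - x) * (1 - x)))) (at x)"
  by (rule DERIV_cong[OF DERIV_mult[OF dE DERIV_diff[OF d(2) DERIV_divide[OF DERIV_cmult[OF d(1), of e] d3 nz(2)]]]])
    (simp add: algebra_simps)
 also have "exp (e * Ln (1 - x)) * (- e / (1 - x)) * (h x - e * g x / (1 - x)) +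
   exp (e * Ln (1 - x)) * ((hgq (c - a) (c - b) x * g x + hgr (c - a) (c - b) c x * h x)
    - (e * h x * (1 - x) + e * g x) / ((1 - x) * (1 - x)))
  = exp (e * Ln (1 - x)) * ((- e * i) * (h x - e * g x * i) + (hgq (c - a) (c - b) x * g x + hgr (c - a) (c - b) c x * h x)
    - (e * h x * i + e * g x * i * i))"
 proof -
  have f1: "(e * h x * (1 - x) + e * g x) / ((1 - x) * (1 - x)) = e * h x * i + e * g x * i * i"
   unfolding i_def using nz by (simp add: add_divide_distrib)
  have f2: "y / (1 - x) = y * i" for y unfolding i_def by simp
  show ?thesis unfolding f1 f2 by (simp add: algebra_simps)
 qed
 also have "(- e * i) * (h x - e * g x * i) + (hgq (c - a) (c - b) x * g x + hgr (c - a) (c - b) c x * h x)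
    - (e * h x * i + e * g x * i * i) = hgq a b x * g x + hgr a b c x * (h x - e * g x * i)"
 proof -
  have R: "hgr (c - a) (c - b) c x = hgr a b c x + 2 * e * i"
  proof -
   have "2 * e * i = (2 * e * x) / (x * (1 - x))" unfolding i_def using nz by simp
   then show ?thesis unfolding hgr_def add_divide_distrib[symmetric]
    by (simp only: add_divide_distrib[symmetric]) (simp add: e_def algebra_simps)
  qed
  have Q: "hgq (c - a) (c - b) x = hgq a b x - hgr a b c x * e * i - e * e * i * i + e * i * i"
  proof -
   define K where "K = x * (1 - x) * (1 - x)"
   have "hgq a b x - hgr a b c x * e * i - e * e * i * i + e * i * i
    = (a * b * (1 - x)) / K - (((a + b + 1) * x - c) * e) / K - (e * e * x) / K + (e * x) / K"
    unfolding hgq_def hgr_def i_def K_def using nz by simp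
   also have "\<dots> = (a * b * (1 - x) - ((a + b + 1) * x - c) * e - e * e * x + e * x) / K"
    by (simp only: add_divide_distrib diff_divide_distrib)
   also have "a * b * (1 - x) - ((a + b + 1) * x - c) * e - e * e * x + e * x = (c - a) * (c - b) * (1 - x)"
    unfolding e_def by (simp add: algebra_simps)
   also have "(c - a) * (c - b) * (1 - x) / K = hgq (c - a) (c - b) x"
    unfolding hgq_def K_def using nz by simp
   finally show ?thesis by simp
  qed
  show ?thesis unfolding R Q by (simp add: algebra_simps)
 qed
 also have "exp (e * Ln (1 - x)) * (hgq a b x * g x + hgr a b c x * (h x - e * g x * i))
   = hgq a b x * (exp (e * Ln (1 - x)) * g x) + hgr a b c x * (exp (e * Ln (1 - x)) * (h x - e * g x / (1 - x)))"
  unfolding i_def by (simp add: algebra_simps)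
 finally show "((\<lambda>x. exp ((c - a - b) * Ln (1 - x)) * (h x - (c - a - b) * g x / (1 - x))) has_field_derivative
  hgq a b x * (exp ((c - a - b) * Ln (1 - x)) * g x) + hgr a b c x * (exp ((c - a - b) * Ln (1 - x)) * (h x - (c - a - b) * g x / (1 - x)))) (at x)"
  unfolding e_def .
qed

section \<open>The connection formula at 1 for exponents 0 and 3/2\<close>

text \<open>Both sides solve the hypergeometric equation and are regular at 0 with value 1. Their Wronskian with each other satisfies a first-order equation with a singularity at 0 that forces it to vanish.\<close>
lemma hg_euler:
 assumes c: "c \<notin> \<int>\<^sub>\<le>\<^sub>0" and x: "norm x < 1"
 shows "hg a b c x = exp ((c - a - b) * Ln (1 - x)) * hg (c - a) (c - b) c x"
proof -
 define e where "e = c - a - b"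
 define g where "g x = exp (e * Ln (1 - x)) * hg (c - a) (c - b) c x" for x
 define g' where "g' x = exp (e * Ln (1 - x)) * (hg' (c - a) (c - b) c x - e * hg (c - a) (c - b) c x / (1 - x))" for x
 define W where "W x = hg a b c x * g' x - g x * hg' a b c x" for x
 have cut: "1 - w \<notin> \<real>\<^sub>\<le>\<^sub>0" if "norm w < 1" for w :: complex
 proof
  assume "1 - w \<in> \<real>\<^sub>\<le>\<^sub>0"
  then have "Re w \<ge> 1" by (auto simp: complex_nonpos_Reals_iff)
  then show False using that abs_Re_le_cmod[of w] by linarith
 qed
 have ne1: "1 - w ~= 0" if "norm w < 1" for w :: complex using that by auto
 have dg: "(g has_field_derivative g' w) (at w)" if w: "norm w < 1" for w
 proof -
  have d3: "((\<lambda>x. 1 - x) has_field_derivative - 1) (at w)" by (auto intro!: derivative_eq_intros)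
  show ?thesis unfolding g_def g'_def
   by (rule DERIV_cong[OF DERIV_mult[OF DERIV_chain2[OF DERIV_exp DERIV_cmult[OF DERIV_chain2[OF has_field_derivative_Ln[OF cut[OF w]] d3]]]
      hg_derivs(1)[OF c w]]]) (simp add: divide_inverse algebra_simps)
 qed
 have s1: "solves (ball 0 1 - {0}) (\<lambda>_. 1) (hgq a b) (hgr a b c) (hg a b c) (hg' a b c)"
  by (rule solves_hg[OF c]) simp
 have s2: "solves (ball 0 1 - {0}) (\<lambda>_. 1) (hgq a b) (hgr a b c) g g'"
  unfolding g_def g'_def e_def by (rule solves_twist[OF solves_hg[OF c]]) (use cut in auto)
 have hol: "hg a b c holomorphic_on ball 0 1" "hg' a b c holomorphic_on ball 0 1" for a b
  by (auto simp: holomorphic_on_open intro!: exI hg_derivs[OF c])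
 have Wh: "W holomorphic_on ball 0 1" unfolding W_def g_def g'_def
  by (intro holomorphic_intros hol) (use cut ne1 in auto)
 have W0: "W w = 0" if w: "w \<in> ball 0 1" for w
 proof (rule ccontr)
  assume Wn: "W w ~= 0"
  have der: "w * deriv W w = ((a + b + 1) * w - c) / (1 - w) * W w" if w: "w \<in> ball 0 1 - {0}" for w
   using DERIV_imp_deriv[OF solves_wronskian[OF s1 s2 w]] w ne1[of w]
   unfolding W_def hgr_def by (simp add: field_simps)
  have rh: "(\<lambda>w. ((a + b + 1) * w - c) / (1 - w)) holomorphic_on ball 0 1"
   by (intro holomorphic_intros) (use ne1 in auto)
  have cont: "isCont (\<lambda>w. w * deriv W w) 0" "isCont (\<lambda>w. ((a + b + 1) * w - c) / (1 - w) * W w) 0"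
   using holomorphic_on_imp_continuous_on[OF holomorphic_on_mult[OF rh Wh]]
    holomorphic_on_imp_continuous_on[OF holomorphic_on_mult[OF holomorphic_on_ident holomorphic_deriv[OF Wh open_ball]]]
   by (auto simp: continuous_on_eq_continuous_at)
  have "\<forall>\<^sub>F w in at 0. w * deriv W w = ((a + b + 1) * w - c) / (1 - w) * W w"
   unfolding eventually_at by (rule exI[of _ 1]) (use der in auto)
  then have "0 * deriv W 0 = ((a + b + 1) * 0 - c) / (1 - 0) * W 0"
   using cont[unfolded isCont_def] by (intro eventually_eq_imp_limits_eq[OF _ _ _ at_neq_bot]) simp_all
  then have W00: "W 0 = 0" using c by auto
  have "W w = 0"
  proof (rule ode_zero_identically[OF open_ball _ Wh _ W00 rh _ _ w])
   show "(w - 0) * deriv W w = ((a + b + 1) * w - c) / (1 - w) * W w" if "w \<in> ball 0 1" for w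
    using der[of w] that W00 by (cases "w = 0") auto
   show "((a + b + 1) * 0 - c) / (1 - 0) ~= of_nat n" if "n > 0" for n
    using plus_of_nat_eq_0_imp[of c n] c by (auto simp: add_eq_0_iff)
  qed auto
  then show False using Wn by simp
 qed
 obtain r where r: "r > 0" "r \<le> 1" and nz: "!!w. w \<in> ball 0 r ==> hg a b c w ~= 0"
 proof -
  have "isCont (hg a b c) 0" by (rule DERIV_isCont[OF hg_derivs(1)[OF c]]) simp
  then have "\<forall>\<^sub>F w in at 0. hg a b c w ~= 0"
   unfolding isCont_def by (rule tendsto_imp_eventually_ne) simp
  then obtain d where d: "d > 0" "!!w. w ~= 0 ==> dist w 0 < d ==> hg a b c w ~= 0"
   unfolding eventually_at by auto
  show ?thesis by (rule that[of "min d 1"]) (use d in \<open>auto, metis hg_0 zero_neq_one dist_0_norm dist_commute\<close>)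
 qed
 have "((\<lambda>w. g w / hg a b c w) has_field_derivative 0) (at w within ball 0 r)" if w: "w \<in> ball 0 r" for w
 proof -
  have w1: "norm w < 1" using w r by auto
  have "W w = 0" using W0 w1 by simp
  then show ?thesis
   by (intro DERIV_cong[OF DERIV_divide[OF has_field_derivative_at_within[OF dg[OF w1]] has_field_derivative_at_within[OF hg_derivs(1)[OF c w1]] nz[OF w]]])
     (simp add: W_def mult.commute)
 qed
 then obtain k where k: "!!w. w \<in> ball 0 r ==> g w / hg a b c w = k"
  using has_field_derivative_zero_constant[of "ball 0 r" "\<lambda>w. g w / hg a b c w"] by auto
 have "k = 1" using k[of 0] r(1) by (simp add: g_def)
 then have eq: "g w = hg a b c w" if "w \<in> ball 0 r" for w using k[OF that] nz[OF that] by simp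
 have gh: "g holomorphic_on ball 0 1" by (auto simp: holomorphic_on_open intro!: exI dg)
 have "hg a b c x = g x"
 proof (rule analytic_continuation_open[where s = "ball 0 r" and s' = "ball 0 1" and f = "hg a b c" and g = g])
  show "ball (0::complex) r \<subseteq> ball 0 1" by (rule subset_ball[OF r(2)])
 qed (use r hol gh eq x in auto)
 then show ?thesis unfolding g_def e_def .
qed

definition hgA :: "complex => complex => complex => complex" where
 "hgA a b c = Gamma c * Gamma (of_real (3/2)) * rGamma (c - a) * rGamma (c - b)"
definition hgB :: "complex => complex => complex => complex" where
 "hgB a b c = 4/3 * (Gamma c * Gamma (of_real (1/2)) * rGamma a * rGamma b)"

text \<open>By Euler's transformation the left side is a power of 1 - x times a series that diverges like the inverse power.\<close>
lemma hg_limit_A: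
 assumes c: "c \<notin> \<int>\<^sub>\<le>\<^sub>0" and s: "c = a + b + 3/2"
 shows "((\<lambda>x::real. hg a b c (of_real x)) \<longlongrightarrow> hgA a b c) (at_left 1)"
proof -
 have "((\<lambda>x::real. of_real ((1 - x) powr (3/2)) * hg (c - a) (c - b) c (of_real x)) \<longlongrightarrow> hgA a b c) (at_left 1)"
  unfolding hgA_def by (rule hg_asymp_at_1[OF c]) (auto simp: s)
 then show ?thesis
 proof (rule Lim_transform_eventually)
  have "\<forall>\<^sub>F x in at_left (1::real). 0 < x \<and> x < 1" by (rule eventually_at_leftI[of 0]) auto
  then show "\<forall>\<^sub>F x in at_left 1. of_real ((1 - x) powr (3/2)) * hg (c - a) (c - b) c (of_real x) = hg a b c (of_real x)"
  proof eventually_elim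
   case (elim x)
   have "of_real ((1 - x) powr (3/2)) = exp ((c - a - b) * Ln (1 - complex_of_real x))"
    using elim s by (simp add: powr_def exp_of_real[symmetric] Ln_of_real[symmetric] mult.commute)
   then show ?case using hg_euler[OF c, of "of_real x" a b] elim by simp
  qed
 qed
qed

text \<open>The second derivative is the first one to diverge at 1, like (1 - x) to the power -1/2; its size detects the coefficient of the second solution.\<close>
lemma hg_limit_B:
 assumes c: "c \<notin> \<int>\<^sub>\<le>\<^sub>0" and s: "c = a + b + 3/2"
 shows "((\<lambda>x::real. of_real (sqrt (1 - x)) * hg'' a b c (of_real x)) \<longlongrightarrow> 3/4 * hgB a b c) (at_left 1)"
proof -
 note c1 = Suc_not_nonpos[OF c]
 have c2: "c + 2 \<notin> \<int>\<^sub>\<le>\<^sub>0" using Suc_not_nonpos[OF c1] by (simp add: add.assoc)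
 have "((\<lambda>x::real. of_real ((1 - x) powr (1/2)) * hg (a+2) (b+2) (c+2) (of_real x)) \<longlongrightarrow>
   Gamma (c+2) * Gamma (of_real (1/2)) * rGamma (a+2) * rGamma (b+2)) (at_left 1)"
  by (rule hg_asymp_at_1[OF c2]) (auto simp: s)
 then have "((\<lambda>x::real. a * b / c * ((a+1) * (b+1) / (c+1)) * (of_real ((1 - x) powr (1/2)) * hg (a+2) (b+2) (c+2) (of_real x))) \<longlongrightarrow>
   a * b / c * ((a+1) * (b+1) / (c+1)) * (Gamma (c+2) * Gamma (of_real (1/2)) * rGamma (a+2) * rGamma (b+2))) (at_left 1)"
  by (rule tendsto_mult_left)
 also have "a * b / c * ((a+1) * (b+1) / (c+1)) * (Gamma (c+2) * Gamma (of_real (1/2)) * rGamma (a+2) * rGamma (b+2)) = 3/4 * hgB a b c"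
 proof -
  have rG: "z * ((z + 1) * rGamma (z + 2)) = rGamma z" for z :: complex
   using rGamma_plus1[of z] rGamma_plus1[of "z+1"] by (simp add: add.assoc)
  have nz: "c ~= 0" "c + 1 ~= 0" using c c1 by auto
  have G: "Gamma (c + 2) = (c + 1) * (c * Gamma c)"
   using Gamma_plus1[OF c] Gamma_plus1[OF c1] by (simp add: add.assoc)
  show ?thesis unfolding hgB_def G rG[of a, symmetric] rG[of b, symmetric] using nz
   by simp
 qed
 finally show ?thesis
 proof (rule Lim_transform_eventually)
  have "\<forall>\<^sub>F x in at_left (1::real). 0 < x \<and> x < 1" by (rule eventually_at_leftI[of 0]) auto
  then show "\<forall>\<^sub>F x in at_left 1. a * b / c * ((a+1) * (b+1) / (c+1)) * (of_real ((1 - x) powr (1/2)) * hg (a+2) (b+2) (c+2) (of_real x))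
    = of_real (sqrt (1 - x)) * hg'' a b c (of_real x)"
   by eventually_elim (simp add: hg''_def powr_half_sqrt)
 qed
qed

text \<open>The two functions on the right span the solutions near 1. The coefficients follow from the limit of the function itself (the second solution vanishes at 1) and from the growth of the second derivative (the first solution contributes nothing to it).\<close>
lemma hg_connection:
 assumes c: "c \<notin> \<int>\<^sub>\<le>\<^sub>0" and s: "c = a + b + 3/2" and U: "norm U < 1" "norm (1 - U) < 1"
 shows "hg a b c U = hgA a b c * hg a b (-1/2) (1 - U) + hgB a b c * (exp (3/2 * Ln (1 - U)) * hg (b + 3/2) (a + 3/2) (5/2) (1 - U))"
proof -
 define D :: "complex set" where "D = ball 0 1 \<inter> ball 1 1"
 have D: "open D" "connected D" unfolding D_def by (auto intro: convex_connected convex_Int)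
 have cut: "x ~= 0 \<and> 1 - x \<notin> \<real>\<^sub>\<le>\<^sub>0" "1 - x ~= 0" "norm x < 1" "norm (1 - x) < 1" if "x \<in> D" for x :: complex
 proof -
  show n: "norm x < 1" "norm (1 - x) < 1" using that by (auto simp: D_def dist_norm)
  then show "1 - x ~= 0" by auto
  have "1 - x \<notin> \<real>\<^sub>\<le>\<^sub>0"
  proof
   assume "1 - x \<in> \<real>\<^sub>\<le>\<^sub>0"
   then have "Re x \<ge> 1" by (auto simp: complex_nonpos_Reals_iff)
   then show False using n abs_Re_le_cmod[of x] by linarith
  qed
  then show "x ~= 0 \<and> 1 - x \<notin> \<real>\<^sub>\<le>\<^sub>0" using n by auto
 qed
 have h1: "(- 1 / 2 :: complex) \<notin> \<int>\<^sub>\<le>\<^sub>0" "(5 / 2 :: complex) \<notin> \<int>\<^sub>\<le>\<^sub>0"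
 proof -
  have False if k: "2 * z = (of_int k :: complex)" "odd k" "z \<in> \<int>\<^sub>\<le>\<^sub>0" for z k
  proof -
   obtain n where "z = of_int n" using k(3) by (auto elim: nonpos_Ints_cases)
   then have "(of_int (2 * n) :: complex) = of_int k" using k(1) by simp
   then have "2 * n = k" using of_int_eq_iff by blast
   then show False using k(2) by auto
  qed
  from this[of "-1/2" "-1"] this[of "5/2" 5] show "(- 1 / 2 :: complex) \<notin> \<int>\<^sub>\<le>\<^sub>0" "(5 / 2 :: complex) \<notin> \<int>\<^sub>\<le>\<^sub>0" by auto
 qed
 define y1 y1' where "y1 x = hg a b (-1/2) (1 - x)" and "y1' x = - hg' a b (-1/2) (1 - x)" for x
 define k where "k = hg (b + 3/2) (a + 3/2) (5/2)"
 define k' where "k' = hg' (b + 3/2) (a + 3/2) (5/2)"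
 define y2 y2' where "y2 x = exp (3/2 * Ln (1 - x)) * k (1 - x)"
  and "y2' x = exp (3/2 * Ln (1 - x)) * (- k' (1 - x) - 3/2 * k (1 - x) / (1 - x))" for x
 have s0: "solves D (\<lambda>_. 1) (hgq a b) (hgr a b c) (hg a b c) (hg' a b c)"
  by (rule solves_hg[OF c]) (use cut in auto)
 have s1: "solves D (\<lambda>_. 1) (hgq a b) (hgr a b c) y1 y1'"
  unfolding y1_def y1'_def by (rule solves_hg_reflect[OF h1(1)]) (use cut s in \<open>auto simp: D_def\<close>)
 have e: "c - a - b = 3/2" "c - a = b + 3/2" "c - b = a + 3/2" unfolding s by simp_all
 have "solves D (\<lambda>_. 1) (hgq (c - a) (c - b)) (hgr (c - a) (c - b) c) (\<lambda>x. k (1 - x)) (\<lambda>x. - k' (1 - x))"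
  unfolding k_def k'_def e(2,3) by (rule solves_hg_reflect[OF h1(2)]) (use cut s in \<open>auto simp: D_def\<close>)
 from solves_twist[OF this cut(1)] have s2: "solves D (\<lambda>_. 1) (hgq a b) (hgr a b c) y2 y2'"
  unfolding y2_def[abs_def] y2'_def[abs_def] e(1) .
 have cont: "isCont (hg a b (-1/2)) 0" "isCont (hg' a b (-1/2)) 0" "isCont (hg'' a b (-1/2)) 0" "isCont k 0" "isCont k' 0"
 proof -
  note * = DERIV_isCont[OF hg_derivs(1)] DERIV_isCont[OF hg_derivs(2)]
  show "isCont (hg a b (-1/2)) 0" "isCont (hg' a b (-1/2)) 0" "isCont k 0" "isCont k' 0"
   unfolding k_def k'_def by (rule * h1 | simp)+
  have h2: "(-1/2 + 2 :: complex) \<notin> \<int>\<^sub>\<le>\<^sub>0"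
   using Suc_not_nonpos[OF Suc_not_nonpos[OF h1(1)]] by (simp add: add.assoc)
  show "isCont (hg'' a b (-1/2)) 0" unfolding hg''_def
   by (intro continuous_intros *(1) h2) auto
 qed
 have ev: "\<forall>\<^sub>F x in at_left (1::real). 0 < x \<and> x < 1" by (rule eventually_at_leftI[of 0]) auto
 have lim1: "((\<lambda>x::real. 1 - complex_of_real x) \<longlongrightarrow> 0) (at_left 1)"
  by (rule tendsto_eq_rhs[OF tendsto_diff[OF tendsto_const tendsto_of_real[OF tendsto_ident_at]]]) simp
 have L: "((\<lambda>x::real. f (1 - complex_of_real x)) \<longlongrightarrow> f 0) (at_left 1)" if "isCont f 0" for f :: "complex => complex"
  by (rule isCont_tendsto_compose[OF that lim1])
 have real_in: "complex_of_real x \<in> D" if "0 < x" "x < 1" for x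
  using that norm_of_real[of "1 - x", where 'a=complex] by (auto simp: D_def dist_norm)
 have Wnz: "\<exists>x0\<in>D. y1 x0 * y2' x0 - y2 x0 * y1' x0 ~= 0"
 proof -
  have "((\<lambda>x::real. y1 (of_real x) * (- k' (1 - of_real x) * (1 - of_real x) - 3/2 * k (1 - of_real x)) - k (1 - of_real x) * y1' (of_real x) * (1 - of_real x)) \<longlongrightarrow>
    1 * (- k' 0 * 0 - 3/2 * k 0) - k 0 * (- hg' a b (-1/2) 0) * 0) (at_left 1)"
   unfolding y1_def y1'_def using L[OF cont(1)] by (intro tendsto_intros L cont lim1) simp
  then have "\<forall>\<^sub>F x::real in at_left 1. y1 (of_real x) * (- k' (1 - of_real x) * (1 - of_real x) - 3/2 * k (1 - of_real x)) - k (1 - of_real x) * y1' (of_real x) * (1 - of_real x) ~= 0"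
   by (rule tendsto_imp_eventually_ne) (simp add: k_def)
  with ev have "\<forall>\<^sub>F x::real in at_left 1. y1 (of_real x) * (- k' (1 - of_real x) * (1 - of_real x) - 3/2 * k (1 - of_real x)) - k (1 - of_real x) * y1' (of_real x) * (1 - of_real x) ~= 0 \<and> 0 < x \<and> x < 1"
   by eventually_elim auto
  then obtain x :: real where x: "y1 (of_real x) * (- k' (1 - of_real x) * (1 - of_real x) - 3/2 * k (1 - of_real x)) - k (1 - of_real x) * y1' (of_real x) * (1 - of_real x) ~= 0" "0 < x" "x < 1"
   using eventually_happens[of _ "at_left (1::real)"] by auto
  have nz: "1 - complex_of_real x ~= 0" using x(3) by (metis less_irrefl of_real_1 of_real_eq_iff right_minus_eq)
  have "(y1 (of_real x) * y2' (of_real x) - y2 (of_real x) * y1' (of_real x)) * (1 - of_real x) = exp (3/2 * Ln (1 - complex_of_real x)) *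
    (y1 (of_real x) * (- k' (1 - of_real x) * (1 - of_real x) - 3/2 * k (1 - of_real x)) - k (1 - of_real x) * y1' (of_real x) * (1 - of_real x))"
   unfolding y2_def y2'_def using nz by (simp add: field_simps)
  then show ?thesis using x(1) real_in[OF x(2,3)] by (metis exp_not_eq_zero mult_eq_0_iff)
 qed
 then obtain x0 where x0: "x0 \<in> D" "y1 x0 * y2' x0 - y2 x0 * y1' x0 ~= 0" by blast
 have rh: "hgr a b c holomorphic_on D"
  unfolding hgr_def[abs_def] by (intro holomorphic_intros) (use cut in auto)
 obtain \<alpha> \<beta> where ab: "!!x. x \<in> D ==> hg a b c x = \<alpha> * y1 x + \<beta> * y2 x" "!!x. x \<in> D ==> hg' a b c x = \<alpha> * y1' x + \<beta> * y2' x"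
  using solves_span[OF D s1 s2 s0 wronskian_nonzero[OF D s1 s2 rh x0]] by blast
 have pw: "exp (3/2 * Ln (1 - complex_of_real x)) = of_real (sqrt (1 - x)) * (1 - of_real x)" if "0 < x" "x < 1" for x
 proof -
  have "exp (3/2 * Ln (1 - complex_of_real x)) = exp (Ln (1 - complex_of_real x) / 2 + Ln (1 - complex_of_real x))"
   by (simp add: field_simps)
  also have "\<dots> = csqrt (1 - of_real x) * (1 - of_real x)"
  proof -
   have "1 - complex_of_real x ~= 0" using that by (auto simp: complex_eq_iff)
   then show ?thesis unfolding exp_add by (simp add: csqrt_exp_Ln)
  qed
  also have "csqrt (1 - of_real x) = of_real (sqrt (1 - x))"
   using that csqrt_of_real[of "1 - x"] by simp
  finally show ?thesis .
 qed
 have sq0: "((\<lambda>x::real. complex_of_real (sqrt (1 - x))) \<longlongrightarrow> 0) (at_left 1)"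
  by (rule tendsto_eq_rhs[OF tendsto_of_real[OF tendsto_real_sqrt[OF tendsto_diff[OF tendsto_const tendsto_ident_at]]]]) simp
 have "\<alpha> = hgA a b c"
 proof -
  have "((\<lambda>x::real. \<alpha> * hg a b (-1/2) (1 - of_real x) + \<beta> * (of_real (sqrt (1 - x)) * (1 - of_real x) * k (1 - of_real x))) \<longlongrightarrow>
   \<alpha> * hg a b (-1/2) 0 + \<beta> * (0 * 0 * k 0)) (at_left 1)"
   by (intro tendsto_intros L cont lim1 sq0)
  then have "((\<lambda>x::real. hg a b c (of_real x)) \<longlongrightarrow> \<alpha>) (at_left 1)"
  proof (rule Lim_transform_eventually[OF _ _, THEN tendsto_eq_rhs])
   show "\<forall>\<^sub>F x in at_left 1. \<alpha> * hg a b (-1/2) (1 - of_real x) + \<beta> * (of_real (sqrt (1 - x)) * (1 - of_real x) * k (1 - of_real x)) = hg a b c (of_real x)"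
    using ev
   proof eventually_elim
    case (elim x)
    then have x: "0 < x" "x < 1" by auto
    show ?case using ab(1)[OF real_in[OF x]] unfolding y1_def y2_def pw[OF x] by (simp only: mult.assoc)
   qed
  qed simp
  with hg_limit_A[OF c s] show ?thesis by (intro tendsto_unique[OF trivial_limit_at_left_real])
 qed
 moreover have "\<beta> = hgB a b c"
 proof -
  have "((\<lambda>x::real. \<alpha> * (of_real (sqrt (1 - x)) * hg'' a b (-1/2) (1 - of_real x)) +
    \<beta> * (a * b * (1 - of_real x) * k (1 - of_real x) / of_real x + (c - (a + b + 1) * of_real x) / of_real x * (3/2 * k (1 - of_real x) + (1 - of_real x) * k' (1 - of_real x)))) \<longlongrightarrow>
    \<alpha> * (0 * hg'' a b (-1/2) 0) + \<beta> * (a * b * 0 * k 0 / of_real 1 + (c - (a + b + 1) * of_real 1) / of_real 1 * (3/2 * k 0 + 0 * k' 0))) (at_left 1)"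
   by (intro tendsto_intros L cont lim1 sq0) auto
  moreover have "\<alpha> * (0 * hg'' a b (-1/2) 0) + \<beta> * (a * b * 0 * k 0 / of_real 1 + (c - (a + b + 1) * of_real 1) / of_real 1 * (3/2 * k 0 + 0 * k' 0)) = 3/4 * \<beta>"
   unfolding s k_def by simp
  ultimately have "((\<lambda>x::real. \<alpha> * (of_real (sqrt (1 - x)) * hg'' a b (-1/2) (1 - of_real x)) +
    \<beta> * (a * b * (1 - of_real x) * k (1 - of_real x) / of_real x + (c - (a + b + 1) * of_real x) / of_real x * (3/2 * k (1 - of_real x) + (1 - of_real x) * k' (1 - of_real x)))) \<longlongrightarrow> 3/4 * \<beta>) (at_left 1)"
   by (rule tendsto_eq_rhs)
  then have "((\<lambda>x::real. of_real (sqrt (1 - x)) * hg'' a b c (of_real x)) \<longlongrightarrow> 3/4 * \<beta>) (at_left 1)"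
  proof (rule Lim_transform_eventually)
   show "\<forall>\<^sub>F x::real in at_left 1. \<alpha> * (of_real (sqrt (1 - x)) * hg'' a b (-1/2) (1 - of_real x)) +
    \<beta> * (a * b * (1 - of_real x) * k (1 - of_real x) / of_real x + (c - (a + b + 1) * of_real x) / of_real x * (3/2 * k (1 - of_real x) + (1 - of_real x) * k' (1 - of_real x)))
    = of_real (sqrt (1 - x)) * hg'' a b c (of_real x)"
    using ev
   proof eventually_elim
    case (elim x)
    define X where "X = complex_of_real x"
    define S where "S = complex_of_real (sqrt (1 - x))"
    have XD: "X \<in> D" using real_in elim by (simp add: X_def)
    note cX = cut[OF XD]
    have SS: "S * S = 1 - X" unfolding S_def X_def using elim by (simp flip: of_real_mult)
    have "hg'' a b c X = hgq a b X * hg a b c X + hgr a b c X * hg' a b c X"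
     using hg''_eq[OF c, of X] cX by auto
    also have "\<dots> = \<alpha> * (hgq a b X * y1 X + hgr a b c X * y1' X) + \<beta> * (hgq a b X * y2 X + hgr a b c X * y2' X)"
     unfolding ab[OF XD] by (simp add: algebra_simps)
    also have "hgq a b X * y1 X + hgr a b c X * y1' X = hg'' a b (-1/2) (1 - X)"
    proof -
     have d1: "((\<lambda>x. 1 - x) has_field_derivative - 1) (at X)" by (auto intro!: derivative_eq_intros)
     have "(y1' has_field_derivative hg'' a b (-1/2) (1 - X)) (at X)"
      unfolding y1'_def[abs_def]
      by (rule DERIV_cong[OF DERIV_minus[OF DERIV_chain2[OF hg_derivs(2)[OF h1(1) cX(4), of a b] d1]]]) simp
     moreover have "(y1' has_field_derivative hgq a b X * y1 X + hgr a b c X * y1' X) (at X)"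
      using s1 XD unfolding solves_def by auto
     ultimately show ?thesis by (rule DERIV_unique[symmetric])
    qed
    also have "hgq a b X * y2 X + hgr a b c X * y2' X = S * (a * b / X * k (1 - X)) + S * ((c - (a + b + 1) * X) / X * (k' (1 - X) + 3/2 * k (1 - X) / (1 - X)))"
    proof -
     have "y2 X = S * (1 - X) * k (1 - X)" "y2' X = S * (1 - X) * (- k' (1 - X) - 3/2 * k (1 - X) / (1 - X))"
      unfolding y2_def y2'_def X_def S_def using pw[of x] elim by auto
     then have "hgq a b X * y2 X = S * (a * b / X * k (1 - X))" "hgr a b c X * y2' X = S * ((c - (a + b + 1) * X) / X * (k' (1 - X) + 3/2 * k (1 - X) / (1 - X)))"
      unfolding hgq_def hgr_def using cX by (simp_all add: divide_simps) (simp add: algebra_simps)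
     then show ?thesis by simp
    qed
    finally have "S * hg'' a b c X = \<alpha> * (S * hg'' a b (-1/2) (1 - X)) + \<beta> * ((S * S) * (a * b / X * k (1 - X)) + (S * S) * ((c - (a + b + 1) * X) / X * (k' (1 - X) + 3/2 * k (1 - X) / (1 - X))))"
     by (simp add: algebra_simps)
    also have "(S * S) * ((c - (a + b + 1) * X) / X * (k' (1 - X) + 3/2 * k (1 - X) / (1 - X))) = (c - (a + b + 1) * X) / X * (3/2 * k (1 - X) + (1 - X) * k' (1 - X))"
    proof -
     have "(1 - X) * (k' (1 - X) + 3/2 * k (1 - X) / (1 - X)) = 3/2 * k (1 - X) + (1 - X) * k' (1 - X)"
      using nonzero_mult_div_cancel_left[OF cX(2), of "3/2 * k (1 - X)"]
       by (simp only: distrib_left times_divide_eq_right add.commute)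
     then show ?thesis unfolding SS by (metis mult.left_commute)
    qed
    also have "(S * S) * (a * b / X * k (1 - X)) = a * b * (1 - X) * k (1 - X) / X"
     unfolding SS by simp
    finally show ?case unfolding X_def S_def by simp
   qed
  qed
  with hg_limit_B[OF c s] have "3/4 * \<beta> = 3/4 * hgB a b c" by (intro tendsto_unique[OF trivial_limit_at_left_real])
  then show ?thesis by simp
 qed
 moreover have "U \<in> D" using U by (auto simp: D_def dist_norm)
 ultimately show ?thesis using ab(1)[of U] unfolding y1_def y2_def k_def by simp
qed

section \<open>Holomorphic dependence on parameters\<close>

lemma continuous_on_deriv_param:
 fixes f :: "complex => complex => complex"
 assumes B: "open B" and C: "open C" and cont: "continuous_on (B \<times> C) (\<lambda>(z, e). f z e)"
  and hol: "!!e. e \<in> C ==> (\<lambda>z. f z e) holomorphic_on B"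
 shows "continuous_on (B \<times> C) (\<lambda>(z, e). deriv (\<lambda>z. f z e) z)"
 unfolding continuous_on_iff
proof (intro ballI allI impI)
 fix p :: "complex \<times> complex" and eps :: real
 assume p: "p \<in> B \<times> C" and eps: "eps > 0"
 obtain z0 e0 where pe: "p = (z0, e0)" "z0 \<in> B" "e0 \<in> C" using p by auto
 obtain r0 where r0: "r0 > 0" "cball z0 r0 \<subseteq> B" using B pe(2) open_contains_cball by blast
 define r where "r = r0 / 2"
 have r: "r > 0" "r0 = r + r" using r0 by (auto simp: r_def)
 obtain s where s: "s > 0" "cball e0 s \<subseteq> C" using C pe(3) open_contains_cball by blast
 have "compact (cball z0 r0 \<times> cball e0 s)" by (intro compact_Times compact_cball)
 moreover have "continuous_on (cball z0 r0 \<times> cball e0 s) (\<lambda>(z, e). f z e)"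
  by (rule continuous_on_subset[OF cont]) (use r0 s in auto)
 ultimately have "uniformly_continuous_on (cball z0 r0 \<times> cball e0 s) (\<lambda>(z, e). f z e)"
  by (intro compact_uniformly_continuous)
 then obtain d where d: "d > 0" and d': "!!x y. x \<in> cball z0 r0 \<times> cball e0 s ==> y \<in> cball z0 r0 \<times> cball e0 s ==> dist y x < d
   ==> dist ((\<lambda>(z, e). f z e) y) ((\<lambda>(z, e). f z e) x) < eps * r / 2"
  unfolding uniformly_continuous_on_def using eps r(1) by (metis half_gt_zero mult_pos_pos)
 have "continuous_on B (deriv (\<lambda>z. f z e0))"
  by (intro holomorphic_on_imp_continuous_on holomorphic_deriv hol pe B)
 then obtain d2 where d2: "d2 > 0" "!!z. z \<in> B ==> dist z z0 < d2 ==> dist (deriv (\<lambda>z. f z e0) z) (deriv (\<lambda>z. f z e0) z0) < eps / 2"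
  unfolding continuous_on_iff using pe(2) eps by (metis half_gt_zero)
 define \<delta> where "\<delta> = min (min r s) (min d d2)"
 show "\<exists>\<delta>>0. \<forall>x'\<in>B \<times> C. dist x' p < \<delta> \<longrightarrow> dist ((\<lambda>(z, e). deriv (\<lambda>z. f z e) z) x') ((\<lambda>(z, e). deriv (\<lambda>z. f z e) z) p) < eps"
 proof (intro exI[of _ \<delta>] conjI ballI impI)
  show "\<delta> > 0" using r s d d2 by (auto simp: \<delta>_def)
  fix x' assume x': "x' \<in> B \<times> C" "dist x' p < \<delta>"
  obtain z e where ze: "x' = (z, e)" "z \<in> B" "e \<in> C" using x' by auto
  have dz: "dist z z0 < \<delta>" and de: "dist e e0 < \<delta>"
   using x'(2) unfolding ze pe using dist_fst_le[of "(z,e)" "(z0,e0)"] dist_snd_le[of "(z,e)" "(z0,e0)"] by auto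
  have sub: "cball z r \<subseteq> cball z0 r0"
  proof
   fix w assume "w \<in> cball z r"
   then show "w \<in> cball z0 r0" using dz r(2) dist_triangle[of z0 w z] by (auto simp: \<delta>_def dist_commute)
  qed
  have h: "(\<lambda>w. f w e - f w e0) holomorphic_on B" by (intro holomorphic_intros hol ze pe)
  have "norm ((deriv ^^ 1) (\<lambda>w. f w e - f w e0) z) \<le> fact 1 * (eps * r / 2) / r ^ 1"
  proof (rule Cauchy_inequality)
   show "(\<lambda>w. f w e - f w e0) holomorphic_on ball z r"
    by (rule holomorphic_on_subset[OF h]) (use sub r0 ball_subset_cball in blast)
   show "continuous_on (cball z r) (\<lambda>w. f w e - f w e0)"
    by (rule holomorphic_on_imp_continuous_on, rule holomorphic_on_subset[OF h]) (use sub r0 in blast)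
   fix w assume "norm (z - w) = r"
   then have w: "w \<in> cball z0 r0" using sub by (auto simp: dist_norm)
   have "dist (f w e) (f w e0) < eps * r / 2"
    using d'[of "(w, e0)" "(w, e)"] w de s(1) by (auto simp: \<delta>_def dist_Pair_Pair dist_commute)
   then show "norm (f w e - f w e0) \<le> eps * r / 2" by (simp add: dist_norm)
  qed fact
  then have 1: "norm (deriv (\<lambda>w. f w e - f w e0) z) \<le> eps / 2" using r(1) by simp
  have "deriv (\<lambda>w. f w e - f w e0) z = deriv (\<lambda>w. f w e) z - deriv (\<lambda>w. f w e0) z"
   by (intro deriv_diff holomorphic_on_imp_differentiable_at[OF hol B] ze pe)
  then have "dist (deriv (\<lambda>w. f w e) z) (deriv (\<lambda>w. f w e0) z) \<le> eps / 2" using 1 by (simp add: dist_norm)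
  moreover have "dist (deriv (\<lambda>z. f z e0) z) (deriv (\<lambda>z. f z e0) z0) < eps / 2"
   using d2(2)[OF ze(2)] dz by (auto simp: \<delta>_def)
  ultimately have "dist (deriv (\<lambda>w. f w e) z) (deriv (\<lambda>z. f z e0) z0) < eps"
   using dist_triangle[of "deriv (\<lambda>w. f w e) z" "deriv (\<lambda>z. f z e0) z0" "deriv (\<lambda>w. f w e0) z"] by linarith
  then show "dist ((\<lambda>(z, e). deriv (\<lambda>z. f z e) z) x') ((\<lambda>(z, e). deriv (\<lambda>z. f z e) z) p) < eps"
   unfolding ze pe by simp
 qed
qed

text \<open>Cauchy's formula, with the circle parametrised by the unit interval so that the integrand depends on a parameter in a fixed box.\<close>
lemma higher_deriv_integral:
 assumes "h holomorphic_on S" "open S" "cball z0 r \<subseteq> S" "r > 0"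
 shows "((\<lambda>x. h (z0 + r * exp (2 * of_real pi * \<i> * of_real x)) * exp (- (of_nat n * (2 * of_real pi * \<i> * of_real x)))) has_integral
      of_real r ^ n * (deriv ^^ n) h z0 / fact n) {0..1}"
proof -
 have "((\<lambda>u. h u / (u - z0) ^ (Suc n)) has_contour_integral (2 * pi * \<i>) / fact n * (deriv ^^ n) h z0) (circlepath z0 r)"
 proof (rule Cauchy_has_contour_integral_higher_derivative_circlepath)
  have "h holomorphic_on cball z0 r" using assms(1,3) by (rule holomorphic_on_subset)
  then show "continuous_on (cball z0 r) h" "h holomorphic_on ball z0 r"
   using ball_subset_cball by (auto intro: holomorphic_on_imp_continuous_on holomorphic_on_subset)
 qed (use assms in simp)
 then have "((\<lambda>x. h (circlepath z0 r x) / (circlepath z0 r x - z0) ^ Suc n * vector_derivative (circlepath z0 r) (at x)) has_integral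
    (2 * pi * \<i>) / fact n * (deriv ^^ n) h z0) {0..1}"
  unfolding has_contour_integral .
 then have "((\<lambda>x. of_real r ^ n / (2 * of_real pi * \<i>) * (h (circlepath z0 r x) / (circlepath z0 r x - z0) ^ Suc n * vector_derivative (circlepath z0 r) (at x))) has_integral
    of_real r ^ n / (2 * of_real pi * \<i>) * ((2 * pi * \<i>) / fact n * (deriv ^^ n) h z0)) {0..1}"
  by (rule has_integral_mult_right)
 then have "((\<lambda>x. h (z0 + r * exp (2 * of_real pi * \<i> * of_real x)) * exp (- (of_nat n * (2 * of_real pi * \<i> * of_real x)))) has_integral
   of_real r ^ n / (2 * of_real pi * \<i>) * ((2 * pi * \<i>) / fact n * (deriv ^^ n) h z0)) {0..1}"
 proof (rule has_integral_eq[rotated])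
  fix x :: real assume x: "x \<in> {0..1}"
  define E where "E = exp (2 * of_real pi * \<i> * of_real x)"
  have E: "E ~= 0" "exp (- (of_nat n * (2 * of_real pi * \<i> * of_real x))) = 1 / E ^ n"
   by (simp_all add: E_def exp_minus exp_of_nat_mult[symmetric] divide_inverse)
  have vd: "vector_derivative (circlepath z0 r) (at x) = 2 * pi * \<i> * r * E"
   by (simp add: vector_derivative_circlepath E_def)
  have cp: "circlepath z0 r x = z0 + r * E" by (simp add: circlepath E_def)
  show "of_real r ^ n / (2 * of_real pi * \<i>) * (h (circlepath z0 r x) / (circlepath z0 r x - z0) ^ Suc n * vector_derivative (circlepath z0 r) (at x))
    = h (z0 + r * exp (2 * of_real pi * \<i> * of_real x)) * exp (- (of_nat n * (2 * of_real pi * \<i> * of_real x)))"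
   unfolding vd cp E(2) E_def[symmetric] using E(1) assms(4) by (simp add: power_mult_distrib mult_ac)
 qed
 moreover have "of_real r ^ n / (2 * of_real pi * \<i>) * ((2 * pi * \<i>) / fact n * (deriv ^^ n) h z0) = of_real r ^ n * (deriv ^^ n) h z0 / fact n"
 proof -
  have gen: "X / c * (c / F * D) = X * D / F" if "c ~= 0" for X c F D :: complex
   using that by simp
  show ?thesis unfolding of_real_mult of_real_numeral by (rule gen) simp
 qed
 ultimately show ?thesis by (simp only:)
qed

text \<open>Differentiation under the integral sign in Cauchy's formula: Taylor coefficients in one variable are holomorphic in the other.\<close>
lemma higher_deriv_param:
 fixes f :: "complex => complex => complex"
 assumes B: "open B" and C: "open C" and cont: "continuous_on (B \<times> C) (\<lambda>(z, e). f z e)"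
  and hol1: "!!e. e \<in> C ==> (\<lambda>z. f z e) holomorphic_on B"
  and hol2: "!!z. z \<in> B ==> (\<lambda>e. f z e) holomorphic_on C"
  and e: "e \<in> C"
 shows higher_deriv_param_holomorphic: "(\<lambda>z. (deriv ^^ n) (\<lambda>e. f z e) e) holomorphic_on B"
  and deriv_param_holomorphic: "!!z. z \<in> B ==> (\<lambda>e. deriv (\<lambda>z. f z e) z) holomorphic_on C"
  and deriv_higher_deriv_param: "!!z. z \<in> B ==>
    deriv (\<lambda>z. (deriv ^^ n) (\<lambda>e. f z e) e) z = (deriv ^^ n) (\<lambda>e. deriv (\<lambda>z. f z e) z) e"
proof -
 have main: "((\<lambda>z. (deriv ^^ n) (\<lambda>e. f z e) e) has_field_derivative fact n / of_real r ^ n *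
   integral {0..1} (\<lambda>x. deriv (\<lambda>z. f z (e + of_real r * exp (2 * of_real pi * \<i> * of_real x))) z0 *
   exp (- (of_nat n * (2 * of_real pi * \<i> * of_real x))))) (at z0)"
  if B: "open B" and C: "open C" and cont: "continuous_on (B \<times> C) (\<lambda>(z, e). f z e)"
  and hol1: "!!e. e \<in> C ==> (\<lambda>z. f z e) holomorphic_on B"
  and hol2: "!!z. z \<in> B ==> (\<lambda>e. f z e) holomorphic_on C"
  and e: "e \<in> C" and z0: "z0 \<in> B" and r: "r > 0" "cball e r \<subseteq> C"
  for f :: "complex => complex => complex" and B C e z0 r n
 proof -
  obtain s where s: "s > 0" "ball z0 s \<subseteq> B" using B z0 open_contains_ball by blast
  define p where "p x = e + of_real r * exp (2 * of_real pi * \<i> * of_real x)" for x :: real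
  define w where "w x = exp (- (of_nat n * (2 * of_real pi * \<i> * of_real x)))" for x :: real
  have pC: "p x \<in> C" for x
  proof -
   have "dist e (p x) = r" unfolding p_def using r(1) by (simp add: dist_norm norm_mult)
   then show ?thesis using r(2) by (auto simp: subset_iff)
  qed
  have contp: "continuous_on A p" "continuous_on A w" for A unfolding p_def w_def by (intro continuous_intros)+
  have I: "(deriv ^^ n) (\<lambda>e. f z e) e = fact n / of_real r ^ n * integral (cbox 0 1) (\<lambda>x. f z (p x) * w x)" if "z \<in> B" for z
   using integral_unique[OF higher_deriv_integral[OF hol2[OF that] C r(2,1), of n]] r(1)
   unfolding p_def w_def by (simp add: field_simps)
  have "((\<lambda>z. integral (cbox 0 1) (\<lambda>x. f z (p x) * w x)) has_field_derivative
    integral (cbox 0 1) (\<lambda>x. deriv (\<lambda>z. f z (p x)) z0 * w x)) (at z0 within ball z0 s)"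
  proof (rule leibniz_rule_field_derivative)
   show "((\<lambda>z. f z (p x) * w x) has_field_derivative deriv (\<lambda>z. f z (p x)) z * w x) (at z within ball z0 s)"
    if "z \<in> ball z0 s" for z x
    using that s holomorphic_derivI[OF hol1[OF pC] B]
    by (intro DERIV_cmult_right has_field_derivative_at_within[where s = "ball z0 s"]) auto
   show "(\<lambda>x. f z (p x) * w x) integrable_on cbox 0 1" if "z \<in> ball z0 s" for z
   proof (rule integrable_continuous)
    have "continuous_on (cbox 0 1) (\<lambda>x. (\<lambda>(z, e). f z e) (z, p x))"
     by (rule continuous_on_compose2[OF cont]) (use contp pC that s in \<open>auto intro!: continuous_intros\<close>)
    then show "continuous_on (cbox 0 1) (\<lambda>x. f z (p x) * w x)"
     by (auto intro!: continuous_intros contp)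
   qed
   have "continuous_on (ball z0 s \<times> cbox 0 1) (\<lambda>y. (\<lambda>(z, e). deriv (\<lambda>z. f z e) z) (fst y, p (snd y)))"
    by (rule continuous_on_compose2[OF continuous_on_deriv_param[OF B C cont hol1]])
      (use contp pC s in \<open>auto intro!: continuous_intros continuous_on_compose2[OF contp(1)]\<close>)
   then show "continuous_on (ball z0 s \<times> cbox 0 1) (\<lambda>(z, x). deriv (\<lambda>z. f z (p x)) z * w x)"
    unfolding case_prod_unfold by (auto intro!: continuous_intros continuous_on_compose2[OF contp(2)])
  qed (use s in auto)
  then have "((\<lambda>z. integral (cbox 0 1) (\<lambda>x. f z (p x) * w x)) has_field_derivative
    integral (cbox 0 1) (\<lambda>x. deriv (\<lambda>z. f z (p x)) z0 * w x)) (at z0)"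
   using at_within_open[of z0 "ball z0 s"] s(1) by simp
  then have "((\<lambda>z. fact n / of_real r ^ n * integral (cbox 0 1) (\<lambda>x. f z (p x) * w x)) has_field_derivative
    fact n / of_real r ^ n * integral (cbox 0 1) (\<lambda>x. deriv (\<lambda>z. f z (p x)) z0 * w x)) (at z0)"
   by (rule DERIV_cmult)
  then have "((\<lambda>z. (deriv ^^ n) (\<lambda>e. f z e) e) has_field_derivative
    fact n / of_real r ^ n * integral (cbox 0 1) (\<lambda>x. deriv (\<lambda>z. f z (p x)) z0 * w x)) (at z0)"
   by (rule has_field_derivative_transform_within_open[OF _ B z0]) (simp add: I)
  then show ?thesis unfolding p_def w_def by simp
 qed
 have ex_r: "\<exists>r>0. cball e r \<subseteq> C" if "open C" "e \<in> C" for e and C :: "complex set"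
  using that open_contains_cball by blast
 show 1: "(\<lambda>z. (deriv ^^ n) (\<lambda>e. f z e) e) holomorphic_on B"
  unfolding holomorphic_on_open[OF B] using main[OF B C cont hol1 hol2 e] ex_r[OF C e] by blast
 have cont': "continuous_on (C \<times> B) (\<lambda>(e, z). f z e)"
 proof -
  have "continuous_on (C \<times> B) (\<lambda>y. (\<lambda>(z, e). f z e) (snd y, fst y))"
   by (rule continuous_on_compose2[OF cont]) (auto intro!: continuous_intros)
  then show ?thesis by (simp add: case_prod_unfold)
 qed
 show 2: "(\<lambda>e. deriv (\<lambda>z. f z e) z) holomorphic_on C" if z: "z \<in> B" for z
 proof -
  have "(\<lambda>e. (deriv ^^ 1) (\<lambda>z. f z e) z) holomorphic_on C"
   unfolding holomorphic_on_open[OF C] using main[OF C B cont' hol2 hol1 z] ex_r[OF B z] by blast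
  then show ?thesis by simp
 qed
 show "deriv (\<lambda>z. (deriv ^^ n) (\<lambda>e. f z e) e) z = (deriv ^^ n) (\<lambda>e. deriv (\<lambda>z. f z e) z) e" if z: "z \<in> B" for z
 proof -
  obtain r where r: "r > 0" "cball e r \<subseteq> C" using ex_r[OF C e] by blast
  show ?thesis
   using DERIV_imp_deriv[OF main[OF B C cont hol1 hol2 e z r]]
    integral_unique[OF higher_deriv_integral[OF 2[OF z] C r(2,1), of n]] r(1) by simp
 qed
qed

text \<open>When all lower Taylor coefficients vanish, division by the power leaves the next coefficient in the limit.\<close>
lemma leading_coefficient_tendsto:
 assumes h: "h holomorphic_on ball 0 \<rho>" "\<rho> > 0" and z: "!!i. i < m ==> (deriv ^^ i) h 0 = 0"
 shows "((\<lambda>eps. h eps / eps ^ m) \<longlongrightarrow> (deriv ^^ m) h 0 / fact m) (at 0)"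
proof -
 define c where "c i = (deriv ^^ i) h 0 / fact i" for i
 have S: "(\<lambda>i. c i * w ^ i) sums h w" if "norm w < \<rho>" for w
  using holomorphic_power_series[OF h(1), of w] that by (simp add: c_def)
 have S': "(\<lambda>i. c (i + m) * w ^ i) sums (h w / w ^ m)" if "norm w < \<rho>" "w ~= 0" for w
 proof -
  have "(\<lambda>i. c (i + m) * w ^ (i + m)) sums h w"
   using S[OF that(1)] z by (subst sums_iff_shift) (simp add: c_def)
  from sums_divide[OF this, of "w ^ m"] show ?thesis using that(2) by (simp add: power_add)
 qed
 have sm: "summable (\<lambda>i. c (i + m) * w ^ i)" if "norm w < \<rho>" for w
  using S'[OF that] by (cases "w = 0") (auto simp: sums_iff intro: summable_finite[of "{0}"])
 have "isCont (\<lambda>w. \<Sum>i. c (i + m) * w ^ i) 0"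
  by (rule isCont_powser'[where K = "of_real (\<rho>/2)"]) (use h(2) sm in auto)
 then have "((\<lambda>w. \<Sum>i. c (i + m) * w ^ i) \<longlongrightarrow> c m) (at 0)"
  unfolding isCont_def using powser_zero[of "\<lambda>i. c (i + m)"] by simp
 then show ?thesis unfolding c_def[of m, symmetric]
 proof (rule Lim_transform_eventually)
  show "\<forall>\<^sub>F w in at 0. (\<Sum>i. c (i + m) * w ^ i) = h w / w ^ m"
   unfolding eventually_at by (rule exI[of _ \<rho>]) (use h(2) S' in \<open>auto simp: sums_iff\<close>)
 qed
qed

section \<open>Holomorphic functions of several variables\<close>

text \<open>The scaling sc is a parameter because the same notion is needed on products of copies of the complex numbers and on the phase space, whose complex structures are different constants.\<close>
definition chol :: "(complex => 'a => 'a) => ('a::real_normed_vector => complex) => 'a set => bool" where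
 "chol sc f W \<longleftrightarrow> (\<forall>q\<in>W. \<exists>D. (f has_derivative D) (at q) \<and> (\<forall>c h. D (sc c h) = c * D h))"

definition df :: "('a::real_normed_vector => complex) => 'a => 'a => complex" where
 "df f a = frechet_derivative f (at a)"

lemma chol_subset: "chol sc f W ==> V \<subseteq> W ==> chol sc f V"
 unfolding chol_def by blast

lemma chol_df:
 assumes "chol sc f W" "a \<in> W"
 shows "(f has_derivative df f a) (at a)" "df f a (sc c h) = c * df f a h"
proof -
 obtain D where D: "(f has_derivative D) (at a)" "!!c h. D (sc c h) = c * D h"
  using assms unfolding chol_def by blast
 have "D = df f a" unfolding df_def by (rule frechet_derivative_at[OF D(1)])
 then show "(f has_derivative df f a) (at a)" "df f a (sc c h) = c * df f a h" using D by auto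
qed

lemma df_eqI: "(f has_derivative D) (at a) ==> df f a = D"
 unfolding df_def using frechet_derivative_at by metis

lemma chol_isCont: "chol sc f W ==> a \<in> W ==> isCont f a"
 using chol_df(1) has_derivative_continuous by blast

lemma chol_const: "chol sc (\<lambda>_. k) W"
 unfolding chol_def by (intro ballI exI[of _ "\<lambda>_. 0"]) auto

lemma chol_mult: assumes "chol sc f W" "chol sc g W" shows "chol sc (\<lambda>x. f x * g x) W"
 unfolding chol_def
proof
 fix a assume a: "a \<in> W"
 show "\<exists>D. ((\<lambda>x. f x * g x) has_derivative D) (at a) \<and> (\<forall>c h. D (sc c h) = c * D h)"
  by (rule exI, rule conjI, rule has_derivative_mult[OF chol_df(1)[OF assms(1) a] chol_df(1)[OF assms(2) a]])
    (simp add: chol_df(2)[OF assms(1) a] chol_df(2)[OF assms(2) a] algebra_simps)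
qed

lemma chol_diff: assumes "chol sc f W" "chol sc g W" shows "chol sc (\<lambda>x. f x - g x) W"
 unfolding chol_def
proof
 fix a assume a: "a \<in> W"
 show "\<exists>D. ((\<lambda>x. f x - g x) has_derivative D) (at a) \<and> (\<forall>c h. D (sc c h) = c * D h)"
  by (rule exI, rule conjI, rule has_derivative_diff[OF chol_df(1)[OF assms(1) a] chol_df(1)[OF assms(2) a]])
    (simp add: chol_df(2)[OF assms(1) a] chol_df(2)[OF assms(2) a] algebra_simps)
qed

lemma chol_compose:
 assumes f: "chol sc f W" and \<phi>: "!!x. x \<in> V ==> \<phi> x \<in> W \<and> (\<phi> has_derivative D\<phi> x) (at x) \<and> (\<forall>c h. D\<phi> x (sc' c h) = sc c (D\<phi> x h))"
 shows "chol sc' (\<lambda>x. f (\<phi> x)) V" "x \<in> V ==> df (\<lambda>x. f (\<phi> x)) x h = df f (\<phi> x) (D\<phi> x h)"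
proof -
 have d: "((\<lambda>x. f (\<phi> x)) has_derivative (\<lambda>h. df f (\<phi> x) (D\<phi> x h))) (at x)" if "x \<in> V" for x
  using diff_chain_at[of \<phi> "D\<phi> x" x f "df f (\<phi> x)"] \<phi>[OF that] chol_df(1)[OF f] by (simp add: o_def)
 then show "chol sc' (\<lambda>x. f (\<phi> x)) V"
  unfolding chol_def using \<phi> chol_df(2)[OF f] by (intro ballI exI conjI) auto
 show "x \<in> V ==> df (\<lambda>x. f (\<phi> x)) x h = df f (\<phi> x) (D\<phi> x h)" using df_eqI[OF d] by simp
qed

lemma chol_curve:
 assumes f: "chol sc f W" and \<gamma>: "\<gamma> z \<in> W" "(\<gamma> has_derivative (\<lambda>\<mu>. sc \<mu> v)) (at z)"
 shows "((\<lambda>z. f (\<gamma> z)) has_field_derivative df f (\<gamma> z) v) (at z)"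
proof -
 have "((\<lambda>z. f (\<gamma> z)) has_derivative (\<lambda>\<mu>. df f (\<gamma> z) (sc \<mu> v))) (at z)"
  using diff_chain_at[OF \<gamma>(2) chol_df(1)[OF f \<gamma>(1)]] by (simp add: o_def)
 moreover have "(\<lambda>\<mu>. df f (\<gamma> z) (sc \<mu> v)) = (*) (df f (\<gamma> z) v)"
  by (simp add: fun_eq_iff chol_df(2)[OF f \<gamma>(1)] mult.commute)
 ultimately show ?thesis unfolding has_field_derivative_def by simp
qed

text \<open>The numerator of the differential of f / g. Unlike that differential it extends holomorphically to the zeros of g.\<close>
definition num_df :: "('a::real_normed_vector => complex) => ('a => complex) => 'a => 'a => complex" where
 "num_df f g a h = g a * df f a h - f a * df g a h"

text \<open>The wedge product of the differentials of f / g and H vanishes on W, with the denominator cleared.\<close>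
definition dependent :: "('a::real_normed_vector => complex) => ('a => complex) => ('a => complex) => 'a set => bool" where
 "dependent f g H W \<longleftrightarrow> (\<forall>a\<in>W. \<forall>h k. num_df f g a h * df H a k = num_df f g a k * df H a h)"

locale scaling =
 fixes sc :: "complex => 'a::euclidean_space => 'a"
 assumes sc_linear: "!!h. bounded_linear (\<lambda>c. sc c h)" and sc_1 [simp]: "!!h. sc 1 h = h"
begin

lemma sc_0 [simp]: "sc 0 h = 0" using linear_0[OF bounded_linear.linear[OF sc_linear]] .

lemma line_derivative: "((\<lambda>z. a + sc z h) has_derivative (\<lambda>\<mu>. sc \<mu> h)) (at z within S)"
 by (auto intro!: derivative_eq_intros bounded_linear.has_derivative[OF sc_linear])

lemma continuous_on_sc: "continuous_on S f ==> continuous_on S (\<lambda>x. sc (f x) h)"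
 by (rule bounded_linear.continuous_on[OF sc_linear])

lemma holomorphic_on_line:
 assumes "chol sc f W" "open A" "!!z. z \<in> A ==> a + sc z d \<in> W"
 shows "(\<lambda>z. f (a + sc z d)) holomorphic_on A"
 unfolding holomorphic_on_open[OF assms(2)]
 using chol_curve[OF assms(1,3) line_derivative] by blast

lemma open_line: assumes "open W" shows "open {z. a + sc z d \<in> W}"
proof -
 have "continuous_on UNIV (\<lambda>z. a + sc z d)" by (intro continuous_intros continuous_on_sc)
 from open_vimage[OF assms this] show ?thesis by (simp add: vimage_def)
qed

lemma convex_line: assumes "convex W" shows "convex {z. a + sc z d \<in> W}"
proof -
 have "linear (\<lambda>z. sc z d)" by (rule bounded_linear.linear[OF sc_linear])
 then have "convex ((\<lambda>z. sc z d) -` ((\<lambda>x. x - a) ` W))"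
  by (rule convex_linear_vimage) (rule convex_translation_subtract[OF assms])
 moreover have "(\<lambda>z. sc z d) -` ((\<lambda>x. x - a) ` W) = {z. a + sc z d \<in> W}"
  by (auto simp: image_iff eq_diff_eq add.commute)
 ultimately show ?thesis by simp
qed

text \<open>A directional derivative is a Taylor coefficient in the second of two variables.\<close>
lemma holomorphic_df_line:
 assumes W: "open W" and f: "chol sc f W" and A: "open A" "!!z. z \<in> A ==> a + sc z d \<in> W"
 shows "(\<lambda>z. df f (a + sc z d) h) holomorphic_on A"
proof -
 have "\<exists>f'. ((\<lambda>z. df f (a + sc z d) h) has_field_derivative f') (at z0)" if z0: "z0 \<in> A" for z0
 proof -
  have "open {p::complex \<times> complex. a + sc (fst p) d + sc (snd p) h \<in> W}"
  proof -
   have "continuous_on UNIV (\<lambda>p. a + sc (fst p) d + sc (snd p) h)" by (intro continuous_intros continuous_on_sc)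
   from open_vimage[OF W this] show ?thesis by (simp add: vimage_def)
  qed
  moreover have "(z0, 0) \<in> {p::complex \<times> complex. a + sc (fst p) d + sc (snd p) h \<in> W}" using A(2)[OF z0] by simp
  ultimately obtain B C where BC: "open B" "open C" "z0 \<in> B" "0 \<in> C"
   "B \<times> C \<subseteq> {p::complex \<times> complex. a + sc (fst p) d + sc (snd p) h \<in> W}"
   by (rule open_prod_elim) auto
  then have sub: "a + sc z d + sc e h \<in> W" if "z \<in> B" "e \<in> C" for z e using that by auto
  have sub': "a + sc e h + sc z d \<in> W" if "z \<in> B" "e \<in> C" for z e using sub[OF that] by (simp add: add_ac)
  have cf: "continuous_on W f" using chol_isCont[OF f] by (auto intro: continuous_at_imp_continuous_on)
  have "continuous_on (B \<times> C) (\<lambda>p. f (a + sc (fst p) d + sc (snd p) h))"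
   by (rule continuous_on_compose2[OF cf]) (use BC(5) in \<open>auto intro!: continuous_intros continuous_on_sc\<close>)
  then have cont: "continuous_on (B \<times> C) (\<lambda>(z, e). f (a + sc z d + sc e h))" by (simp add: case_prod_unfold)
  have h1: "(\<lambda>z. f (a + sc z d + sc e h)) holomorphic_on B" if "e \<in> C" for e
   using holomorphic_on_line[OF f BC(1), of "a + sc e h" d] sub' that by (simp add: add_ac)
  have h2: "(\<lambda>e. f (a + sc z d + sc e h)) holomorphic_on C" if "z \<in> B" for z
   by (rule holomorphic_on_line[OF f BC(2)]) (use sub that in auto)
  have "(\<lambda>z. (deriv ^^ 1) (\<lambda>e. f (a + sc z d + sc e h)) 0) holomorphic_on B"
   by (rule higher_deriv_param_holomorphic[OF BC(1,2) cont h1 h2 BC(4)])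
  moreover have "(deriv ^^ 1) (\<lambda>e. f (a + sc z d + sc e h)) 0 = df f (a + sc z d) h" if "z \<in> B" for z
   using DERIV_imp_deriv[OF chol_curve[OF f _ line_derivative, of "a + sc z d" 0 h]] sub[OF that BC(4)] by simp
  ultimately have "(\<lambda>z. df f (a + sc z d) h) holomorphic_on B" by (simp cong: holomorphic_cong)
  then show ?thesis using BC(1,3) holomorphic_on_open by blast
 qed
 then show ?thesis using holomorphic_on_open[OF A(1)] by blast
qed

text \<open>Join b to a point of V by a complex line: it meets the convex set W in a connected open set, on which the identity theorem in one variable applies.\<close>
lemma identity_on_convex:
 assumes W: "open W" "convex W" and V: "open V" "V \<subseteq> W" "V ~= {}" and b: "b \<in> W"
  and hol: "!!a d A. open A ==> (!!z. z \<in> A ==> a + sc z d \<in> W) ==> (\<lambda>z. F (a + sc z d)) holomorphic_on A"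
  and zero: "!!a. a \<in> V ==> F a = 0"
 shows "F b = 0"
proof -
 obtain a where a: "a \<in> V" using V by blast
 define d where "d = b - a"
 define A where "A = {z. a + sc z d \<in> W}"
 have "(\<lambda>z. F (a + sc z d)) holomorphic_on A"
  by (rule hol) (use W in \<open>auto simp: A_def intro: open_line\<close>)
 moreover have "open A" "connected A" using W by (auto simp: A_def intro!: open_line convex_line convex_connected)
 moreover have "{z. a + sc z d \<in> V} \<subseteq> A" "open {z. a + sc z d \<in> V}" using V by (auto simp: A_def intro: open_line)
 moreover have "0 \<in> {z. a + sc z d \<in> V}" using a by simp
 moreover have "1 \<in> A" using b by (simp add: A_def d_def)
 moreover have "\<exists>x. a + sc x d \<in> V" by (rule exI[of _ 0]) (simp add: a)
 ultimately have "F (a + sc 1 d) = 0"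
  using analytic_continuation_open[where s = "{z. a + sc z d \<in> V}" and s' = A and f = "\<lambda>z. F (a + sc z d)" and g = "\<lambda>_. 0" and z = 1] zero
  by auto
 then show ?thesis by (simp add: d_def)
qed

lemma chol_identity:
 assumes "open W" "convex W" "open V" "V \<subseteq> W" "V ~= {}" "b \<in> W" "chol sc f W" "!!a. a \<in> V ==> f a = 0"
 shows "f b = 0"
 by (rule identity_on_convex[OF assms(1-6), of f]) (use holomorphic_on_line[OF assms(7)] assms(8) in auto)

lemma dependent_identity:
 assumes W: "open W" "convex W" and V: "open V" "V \<subseteq> W" "V ~= {}" and f: "chol sc f W" "chol sc g W" "chol sc H W"
  and dep: "dependent f g H V"
 shows "dependent f g H W"
 unfolding dependent_def
proof (intro ballI allI)
 fix b h k assume b: "b \<in> W"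
 define F where "F a = (g a * df f a h - f a * df g a h) * df H a k - (g a * df f a k - f a * df g a k) * df H a h" for a
 have "F b = 0"
 proof (rule identity_on_convex[OF W V b])
  fix a d A assume A: "open A" "!!z. z \<in> A ==> a + sc z d \<in> W"
  show "(\<lambda>z. F (a + sc z d)) holomorphic_on A"
   unfolding F_def
   by (intro holomorphic_intros holomorphic_on_line[OF f(1) A] holomorphic_on_line[OF f(2) A]
     holomorphic_df_line[OF W(1) f(1) A] holomorphic_df_line[OF W(1) f(2) A] holomorphic_df_line[OF W(1) f(3) A])
 next
  fix a assume "a \<in> V" then show "F a = 0" using dep unfolding dependent_def num_df_def F_def by simp
 qed
 then show "num_df f g b h * df H b k = num_df f g b k * df H b h" unfolding F_def num_df_def by simp
qed

end

section \<open>Initial forms along solutions of a linear system\<close>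

type_synonym c3 = "complex \<times> complex \<times> complex"

text \<open>Zeros of a nonzero holomorphic function are isolated. Countable exceptional sets are used throughout instead of nowhere dense ones, since countable unions of them remain harmless.\<close>
lemma countable_zeros:
 fixes h :: "complex => complex"
 assumes "h holomorphic_on S" "open S" "connected S" "z0 \<in> S" "h z0 ~= 0"
 shows "countable {z\<in>S. h z = 0}"
proof (cases "h constant_on S")
 case True
 then have "{z\<in>S. h z = 0} = {}" using assms(4,5) unfolding constant_on_def by auto
 then show ?thesis by (simp only: countable_empty)
next
 case False
 obtain C where C: "!!n. compact (C n)" "!!n. C n \<subseteq> S" "(\<Union>n::nat. C n) = S"
  using open_Union_compact_subsets[OF assms(2)] by metis
 have "{z\<in>S. h z = 0} = (\<Union>n. {z\<in>C n. h z = 0})" using C(3) by auto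
 moreover have "finite {z\<in>C n. h z = 0}" for n
  by (rule holomorphic_compact_finite_zeros[OF assms(1-3) C(1,2) False])
 ultimately show ?thesis by (simp add: countable_finite)
qed

definition sc3 :: "complex => c3 => c3" where
 "sc3 c h = (c * fst h, c * fst (snd h), c * snd (snd h))"

lemma sc3_simp [simp]: "sc3 c (x, y, z) = (c * x, c * y, c * z)" by (simp add: sc3_def)

lemma bounded_linear_sc3: "bounded_linear (\<lambda>c. sc3 c h)"
 unfolding sc3_def by (intro bounded_linear_Pair bounded_linear_mult_left)

interpretation s3: scaling sc3
 by (rule scaling.intro, rule bounded_linear_sc3, simp add: sc3_def)

lemma df_linear:
 assumes "chol sc f W" "a \<in> W"
 shows "df f a (x + y) = df f a x + df f a y" "df f a (x - y) = df f a x - df f a y" "df f a 0 = 0"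
 using has_derivative_linear[OF chol_df(1)[OF assms]] by (auto simp: linear_add linear_diff linear_0)

text \<open>Two independent solutions of the linearised system near a point, bounded by M. The curve \<Psi> z t moves in the direction of the solution t * Y1 + Y2, and \<rho> bounds the parameter so that the curve stays in the polydisc.\<close>
locale frame =
 fixes \<zeta>0 :: complex and r :: real and p q s Y1 Z1 Y2 Z2 :: "complex => complex" and T M :: real
 assumes r: "r > 0" and T: "T > 0" and M: "M > 0"
  and sol1: "solves (ball \<zeta>0 r) p q s Y1 Z1" and sol2: "solves (ball \<zeta>0 r) p q s Y2 Z2"
  and W: "!!z. z \<in> ball \<zeta>0 r ==> Y1 z * Z2 z - Y2 z * Z1 z ~= 0"
  and bd: "!!z. z \<in> ball \<zeta>0 r ==> norm (Y1 z) \<le> M \<and> norm (Z1 z) \<le> M \<and> norm (Y2 z) \<le> M \<and> norm (Z2 z) \<le> M"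
begin

abbreviation "B \<equiv> ball \<zeta>0 r"
abbreviation "P \<equiv> B \<times> ball (0::complex) r \<times> ball (0::complex) r"
abbreviation "BT \<equiv> ball (0::complex) T"

definition u :: "complex => complex => complex" where "u z t = t * Y1 z + Y2 z"
definition v :: "complex => complex => complex" where "v z t = t * Z1 z + Z2 z"
definition \<Psi> :: "complex => complex => complex => c3" where
 "\<Psi> z t eps = (z, eps * u z t, eps * v z t)"
definition \<rho> :: real where "\<rho> = r / ((T + 1) * M + 1)"

lemma \<rho>: "\<rho> > 0" unfolding \<rho>_def using r T M by (simp add: add_pos_pos)

lemma open_P: "open P" "convex P" by (auto intro: open_Times convex_Times)

lemma \<Psi>_in: assumes "z \<in> B" "t \<in> BT" "eps \<in> ball 0 \<rho>" shows "\<Psi> z t eps \<in> P"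
proof -
 have *: "norm (eps * (t * a + b)) < r" if "norm a \<le> M" "norm b \<le> M" for a b
 proof -
  have "norm (t * a + b) \<le> norm t * norm a + norm b" using norm_triangle_ineq[of "t * a" b] by (simp add: norm_mult)
  also have "\<dots> \<le> T * M + M" using that assms(2) T M by (intro add_mono mult_mono) auto
  finally have "norm (t * a + b) \<le> (T + 1) * M" by (simp add: distrib_right)
  then have "norm (eps * (t * a + b)) \<le> norm eps * ((T + 1) * M)" unfolding norm_mult by (rule mult_left_mono) simp
  also have "\<dots> \<le> norm eps * ((T + 1) * M + 1)" by (rule mult_left_mono) auto
  also have "\<dots> < \<rho> * ((T + 1) * M + 1)" using assms(3) T M by (intro mult_strict_right_mono) (auto simp: add_pos_pos)
  also have "\<dots> = r" unfolding \<rho>_def using T M by (simp add: add_pos_pos less_imp_neq[symmetric])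
  finally show ?thesis .
 qed
 show ?thesis using *[of "Y1 z" "Y2 z"] *[of "Z1 z" "Z2 z"] bd[OF assms(1)] assms(1)
  by (auto simp: \<Psi>_def u_def v_def)
qed

lemma sol_derivs:
 assumes "z \<in> B"
 shows "(Y1 has_field_derivative p z * Z1 z) (at z)" "(Z1 has_field_derivative q z * Y1 z + s z * Z1 z) (at z)"
  "(Y2 has_field_derivative p z * Z2 z) (at z)" "(Z2 has_field_derivative q z * Y2 z + s z * Z2 z) (at z)"
 using sol1 sol2 assms unfolding solves_def by auto

lemma sol_hol: "Y1 holomorphic_on B" "Z1 holomorphic_on B" "Y2 holomorphic_on B" "Z2 holomorphic_on B"
 using sol_derivs holomorphic_on_open[OF open_ball] by blast+

lemma sol_cont: "continuous_on B Y1" "continuous_on B Z1" "continuous_on B Y2" "continuous_on B Z2"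
 using sol_hol by (auto intro: holomorphic_on_imp_continuous_on)

lemma \<Psi>_derivs:
 assumes z: "z \<in> B"
 shows "((\<lambda>z. \<Psi> z t eps) has_derivative (\<lambda>\<mu>. sc3 \<mu> (1, eps * (p z * v z t), eps * (q z * u z t + s z * v z t)))) (at z)"
  "((\<lambda>t. \<Psi> z t eps) has_derivative (\<lambda>\<mu>. sc3 \<mu> (0, eps * Y1 z, eps * Z1 z))) (at t)"
  "((\<lambda>eps. \<Psi> z t eps) has_derivative (\<lambda>\<mu>. sc3 \<mu> (0, u z t, v z t))) (at eps)"
proof -
 note d = sol_derivs[OF z]
 have fd: "(f has_derivative (\<lambda>\<mu>. \<mu> * f')) (at z)" if "(f has_field_derivative f') (at z)" for f f' and z :: complex
  using that by (simp add: has_field_derivative_def mult_commute_abs)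
 have hd: "((\<lambda>z. (z, f z, g z)) has_derivative (\<lambda>\<mu>. sc3 \<mu> (1, f', g'))) (at z)"
  if "(f has_field_derivative f') (at z)" "(g has_field_derivative g') (at z)" for f g f' g' and z :: complex
  using has_derivative_Pair[OF has_derivative_ident has_derivative_Pair[OF fd[OF that(1)] fd[OF that(2)]]] by simp
 have hd0: "((\<lambda>x. (z, f x, g x)) has_derivative (\<lambda>\<mu>. sc3 \<mu> (0, f', g'))) (at x)"
  if "(f has_field_derivative f') (at x)" "(g has_field_derivative g') (at x)" for f g f' g' and x :: complex
  using has_derivative_Pair[OF has_derivative_const[of z] has_derivative_Pair[OF fd[OF that(1)] fd[OF that(2)]]] by simp
 show "((\<lambda>z. \<Psi> z t eps) has_derivative (\<lambda>\<mu>. sc3 \<mu> (1, eps * (p z * v z t), eps * (q z * u z t + s z * v z t)))) (at z)"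
  unfolding \<Psi>_def
 proof (rule hd)
  show "((\<lambda>z. eps * u z t) has_field_derivative eps * (p z * v z t)) (at z)"
   unfolding u_def v_def by (rule DERIV_cong[OF DERIV_cmult[OF DERIV_add[OF DERIV_cmult[OF d(1)] d(3)]]]) (simp add: algebra_simps)
  show "((\<lambda>z. eps * v z t) has_field_derivative eps * (q z * u z t + s z * v z t)) (at z)"
   unfolding u_def v_def by (rule DERIV_cong[OF DERIV_cmult[OF DERIV_add[OF DERIV_cmult[OF d(2)] d(4)]]]) (simp add: algebra_simps)
 qed
 show "((\<lambda>t. \<Psi> z t eps) has_derivative (\<lambda>\<mu>. sc3 \<mu> (0, eps * Y1 z, eps * Z1 z))) (at t)"
  unfolding \<Psi>_def by (rule hd0) (auto simp: u_def v_def intro!: derivative_eq_intros)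
 show "((\<lambda>eps. \<Psi> z t eps) has_derivative (\<lambda>\<mu>. sc3 \<mu> (0, u z t, v z t))) (at eps)"
  unfolding \<Psi>_def by (rule hd0) (auto intro!: derivative_eq_intros)
qed

text \<open>The Taylor coefficient in eps, without the factorial, of f along the line through the origin in the direction of the solution t * Y1 + Y2.\<close>
definition coef :: "(c3 => complex) => nat => complex => complex => complex" where
 "coef f n z t = (deriv ^^ n) (\<lambda>eps. f (\<Psi> z t eps)) 0"

context
 fixes f assumes f: "chol sc3 f P"
begin

lemma deriv_along:
 assumes "z \<in> B" "t \<in> BT" "eps \<in> ball 0 \<rho>"
 shows "((\<lambda>z. f (\<Psi> z t eps)) has_field_derivative df f (\<Psi> z t eps) (1, eps * (p z * v z t), eps * (q z * u z t + s z * v z t))) (at z)"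
  "((\<lambda>t. f (\<Psi> z t eps)) has_field_derivative df f (\<Psi> z t eps) (0, eps * Y1 z, eps * Z1 z)) (at t)"
  "((\<lambda>eps. f (\<Psi> z t eps)) has_field_derivative df f (\<Psi> z t eps) (0, u z t, v z t)) (at eps)"
proof -
 note in_P = \<Psi>_in[OF assms]
 show "((\<lambda>z. f (\<Psi> z t eps)) has_field_derivative df f (\<Psi> z t eps) (1, eps * (p z * v z t), eps * (q z * u z t + s z * v z t))) (at z)"
  by (rule chol_curve[OF f, of "\<lambda>z. \<Psi> z t eps", OF in_P \<Psi>_derivs(1)[OF assms(1)]])
 show "((\<lambda>t. f (\<Psi> z t eps)) has_field_derivative df f (\<Psi> z t eps) (0, eps * Y1 z, eps * Z1 z)) (at t)"
  by (rule chol_curve[OF f, of "\<lambda>t. \<Psi> z t eps", OF in_P \<Psi>_derivs(2)[OF assms(1)]])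
 show "((\<lambda>eps. f (\<Psi> z t eps)) has_field_derivative df f (\<Psi> z t eps) (0, u z t, v z t)) (at eps)"
  by (rule chol_curve[OF f, of "\<lambda>eps. \<Psi> z t eps", OF in_P \<Psi>_derivs(3)[OF assms(1)]])
qed

lemma hol_along:
 shows "t \<in> BT ==> eps \<in> ball 0 \<rho> ==> (\<lambda>z. f (\<Psi> z t eps)) holomorphic_on B"
  "z \<in> B ==> eps \<in> ball 0 \<rho> ==> (\<lambda>t. f (\<Psi> z t eps)) holomorphic_on BT"
  "z \<in> B ==> t \<in> BT ==> (\<lambda>eps. f (\<Psi> z t eps)) holomorphic_on ball 0 \<rho>"
 unfolding holomorphic_on_open[OF open_ball] using deriv_along by blast+

lemma cont_f: "continuous_on P f"
 using chol_isCont[OF f] by (auto intro: continuous_at_imp_continuous_on)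

lemma cont_along:
 shows "t \<in> BT ==> continuous_on (B \<times> ball 0 \<rho>) (\<lambda>(z, eps). f (\<Psi> z t eps))"
  "z \<in> B ==> continuous_on (BT \<times> ball 0 \<rho>) (\<lambda>(t, eps). f (\<Psi> z t eps))"
proof -
 show "continuous_on (B \<times> ball 0 \<rho>) (\<lambda>(z, eps). f (\<Psi> z t eps))" if t: "t \<in> BT"
  unfolding case_prod_unfold
 proof (rule continuous_on_compose2[OF cont_f])
  show "continuous_on (B \<times> ball 0 \<rho>) (\<lambda>x. \<Psi> (fst x) t (snd x))"
   unfolding \<Psi>_def u_def v_def
   by (intro continuous_intros continuous_on_compose2[OF sol_cont(1)] continuous_on_compose2[OF sol_cont(2)]
     continuous_on_compose2[OF sol_cont(3)] continuous_on_compose2[OF sol_cont(4)]) auto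
 qed (use \<Psi>_in t in force)
 show "continuous_on (BT \<times> ball 0 \<rho>) (\<lambda>(t, eps). f (\<Psi> z t eps))" if z: "z \<in> B"
  unfolding case_prod_unfold
 proof (rule continuous_on_compose2[OF cont_f])
  show "continuous_on (BT \<times> ball 0 \<rho>) (\<lambda>x. \<Psi> z (fst x) (snd x))"
   unfolding \<Psi>_def u_def v_def by (intro continuous_intros)
 qed (use \<Psi>_in z in force)
qed

lemma coef_hol: "t \<in> BT ==> (\<lambda>z. coef f n z t) holomorphic_on B" "z \<in> B ==> (\<lambda>t. coef f n z t) holomorphic_on BT"
proof -
 have 0: "0 \<in> ball (0::complex) \<rho>" using \<rho> by simp
 show "(\<lambda>z. coef f n z t) holomorphic_on B" if t: "t \<in> BT"
  unfolding coef_def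
  by (rule higher_deriv_param_holomorphic[OF open_ball open_ball cont_along(1)[OF t] _ _ 0]) (use hol_along t in auto)
 show "(\<lambda>t. coef f n z t) holomorphic_on BT" if z: "z \<in> B"
  unfolding coef_def
  by (rule higher_deriv_param_holomorphic[OF open_ball open_ball cont_along(2)[OF z] _ _ 0]) (use hol_along z in auto)
qed

text \<open>If all coefficients below m vanish, the m-th one describes f to leading order, and its derivatives in z and t describe the derivatives of f along the curves; the last limit bounds the derivative in the radial direction.\<close>
lemma coef_limits:
 assumes m: "!!i z t. i < m ==> z \<in> B ==> t \<in> BT ==> coef f i z t = 0" and z: "z \<in> B" and t: "t \<in> BT"
 shows "((\<lambda>eps. f (\<Psi> z t eps) / eps ^ m) \<longlongrightarrow> coef f m z t / fact m) (at 0)"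
  "((\<lambda>eps. df f (\<Psi> z t eps) (1, eps * (p z * v z t), eps * (q z * u z t + s z * v z t)) / eps ^ m) \<longlongrightarrow> deriv (\<lambda>z. coef f m z t) z / fact m) (at 0)"
  "((\<lambda>eps. df f (\<Psi> z t eps) (0, eps * Y1 z, eps * Z1 z) / eps ^ m) \<longlongrightarrow> deriv (\<lambda>t. coef f m z t) t / fact m) (at 0)"
  "\<exists>l. ((\<lambda>eps. eps * df f (\<Psi> z t eps) (0, u z t, v z t) / eps ^ m) \<longlongrightarrow> l) (at 0)"
proof -
 have 0: "0 \<in> ball (0::complex) \<rho>" using \<rho> by simp
 have ev: "\<forall>\<^sub>F eps in at 0. eps \<in> ball (0::complex) \<rho> - {0}"
  unfolding eventually_at using \<rho> by (intro exI[of _ \<rho>]) auto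
 have zero: "deriv (\<lambda>z. h z) z0 = 0" if "!!z. z \<in> S ==> h z = 0" "open S" "z0 \<in> S" for h :: "complex => complex" and S z0
 proof -
  have "(h has_field_derivative 0) (at z0)"
   by (rule has_field_derivative_transform_within_open[OF DERIV_const[of 0] that(2,3)]) (use that in auto)
  then show ?thesis by (rule DERIV_imp_deriv)
 qed
 show "((\<lambda>eps. f (\<Psi> z t eps) / eps ^ m) \<longlongrightarrow> coef f m z t / fact m) (at 0)"
  unfolding coef_def by (rule leading_coefficient_tendsto[OF hol_along(3)[OF z t] \<rho>]) (use m z t in \<open>simp add: coef_def\<close>)
 define h1 where "h1 eps = deriv (\<lambda>z. f (\<Psi> z t eps)) z" for eps
 have A: "h1 holomorphic_on ball 0 \<rho>" "(deriv ^^ n) h1 0 = deriv (\<lambda>z. coef f n z t) z" for n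
  unfolding h1_def coef_def
  using deriv_param_holomorphic[OF open_ball open_ball cont_along(1)[OF t] hol_along(1)[OF t] hol_along(3)[OF _ t] 0 z]
   deriv_higher_deriv_param[OF open_ball open_ball cont_along(1)[OF t] hol_along(1)[OF t] hol_along(3)[OF _ t] 0 z]
  by auto
 have "((\<lambda>eps. h1 eps / eps ^ m) \<longlongrightarrow> (deriv ^^ m) h1 0 / fact m) (at 0)"
  by (rule leading_coefficient_tendsto[OF A(1) \<rho>], unfold A(2), rule zero[of B]) (use m t z in auto)
 then show "((\<lambda>eps. df f (\<Psi> z t eps) (1, eps * (p z * v z t), eps * (q z * u z t + s z * v z t)) / eps ^ m) \<longlongrightarrow> deriv (\<lambda>z. coef f m z t) z / fact m) (at 0)"
  unfolding A(2)
 proof (rule Lim_transform_eventually)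
  show "\<forall>\<^sub>F eps in at 0. h1 eps / eps ^ m = df f (\<Psi> z t eps) (1, eps * (p z * v z t), eps * (q z * u z t + s z * v z t)) / eps ^ m"
   using ev by eventually_elim (use DERIV_imp_deriv[OF deriv_along(1)[OF z t]] in \<open>auto simp: h1_def\<close>)
 qed
 define h2 where "h2 eps = deriv (\<lambda>t. f (\<Psi> z t eps)) t" for eps
 have A: "h2 holomorphic_on ball 0 \<rho>" "(deriv ^^ n) h2 0 = deriv (\<lambda>t. coef f n z t) t" for n
  unfolding h2_def coef_def
  using deriv_param_holomorphic[OF open_ball open_ball cont_along(2)[OF z] hol_along(2)[OF z] hol_along(3)[OF z] 0 t]
   deriv_higher_deriv_param[OF open_ball open_ball cont_along(2)[OF z] hol_along(2)[OF z] hol_along(3)[OF z] 0 t]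
  by auto
 have "((\<lambda>eps. h2 eps / eps ^ m) \<longlongrightarrow> (deriv ^^ m) h2 0 / fact m) (at 0)"
  by (rule leading_coefficient_tendsto[OF A(1) \<rho>], unfold A(2), rule zero[of BT]) (use m t z in auto)
 then show "((\<lambda>eps. df f (\<Psi> z t eps) (0, eps * Y1 z, eps * Z1 z) / eps ^ m) \<longlongrightarrow> deriv (\<lambda>t. coef f m z t) t / fact m) (at 0)"
  unfolding A(2)
 proof (rule Lim_transform_eventually)
  show "\<forall>\<^sub>F eps in at 0. h2 eps / eps ^ m = df f (\<Psi> z t eps) (0, eps * Y1 z, eps * Z1 z) / eps ^ m"
   using ev by eventually_elim (use DERIV_imp_deriv[OF deriv_along(2)[OF z t]] in \<open>auto simp: h2_def\<close>)
 qed
 define h3 where "h3 = deriv (\<lambda>eps. f (\<Psi> z t eps))"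
 have A: "h3 holomorphic_on ball 0 \<rho>" "(deriv ^^ n) h3 0 = coef f (Suc n) z t" for n
  unfolding h3_def coef_def using holomorphic_deriv[OF hol_along(3)[OF z t] open_ball]
  by (auto simp del: funpow.simps simp: funpow_Suc_right)
 have h3: "h3 eps = df f (\<Psi> z t eps) (0, u z t, v z t)" if "eps \<in> ball 0 \<rho>" for eps
  unfolding h3_def using DERIV_imp_deriv[OF deriv_along(3)[OF z t that]] .
 have "\<exists>l. ((\<lambda>eps. eps * h3 eps / eps ^ m) \<longlongrightarrow> l) (at 0)"
 proof (cases m)
  case 0
  have "isCont h3 0" using holomorphic_on_imp_continuous_on[OF A(1)] \<rho> by (simp add: continuous_on_eq_continuous_at)
  then have "((\<lambda>eps. eps * h3 eps) \<longlongrightarrow> 0 * h3 0) (at 0)" unfolding isCont_def by (intro tendsto_intros)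
  then show ?thesis using 0 by auto
 next
  case (Suc k)
  have "((\<lambda>eps. h3 eps / eps ^ k) \<longlongrightarrow> (deriv ^^ k) h3 0 / fact k) (at 0)"
   by (rule leading_coefficient_tendsto[OF A(1) \<rho>], unfold A(2)) (use m t z Suc in auto)
  then have "((\<lambda>eps. eps * h3 eps / eps ^ m) \<longlongrightarrow> (deriv ^^ k) h3 0 / fact k) (at 0)"
  proof (rule Lim_transform_eventually)
   show "\<forall>\<^sub>F eps in at 0. h3 eps / eps ^ k = eps * h3 eps / eps ^ m"
    using ev by eventually_elim (simp add: Suc)
  qed
  then show ?thesis by blast
 qed
 then obtain l where l: "((\<lambda>eps. eps * h3 eps / eps ^ m) \<longlongrightarrow> l) (at 0)" by blast
 have "((\<lambda>eps. eps * df f (\<Psi> z t eps) (0, u z t, v z t) / eps ^ m) \<longlongrightarrow> l) (at 0)"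
  by (rule Lim_transform_eventually[OF l]) (use ev in eventually_elim, simp add: h3)
 then show "\<exists>l. ((\<lambda>eps. eps * df f (\<Psi> z t eps) (0, u z t, v z t) / eps ^ m) \<longlongrightarrow> l) (at 0)" by blast
qed

text \<open>The curves sweep out a set with interior points, because the two solutions are independent. If all Taylor coefficients vanish, f vanishes on it and so everywhere.\<close>
lemma coef_all_zero:
 assumes z: "!!n z t. z \<in> B ==> t \<in> BT ==> coef f n z t = 0" and a: "a \<in> P"
 shows "f a = 0"
proof -
 have f0: "f (\<Psi> z t eps) = 0" if "z \<in> B" "t \<in> BT" "eps \<in> ball 0 \<rho>" for z t eps
  using holomorphic_fun_eq_0_on_ball[OF hol_along(3)[OF that(1,2)] that(3)] z[OF that(1,2)] unfolding coef_def by blast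
 define b where "b x = Y1 (fst x) * snd (snd x) - Z1 (fst x) * fst (snd x)" for x :: "c3"
 define c where "c x = fst (snd x) * Z2 (fst x) - snd (snd x) * Y2 (fst x)" for x :: "c3"
 define w where "w x = Y1 (fst x) * Z2 (fst x) - Y2 (fst x) * Z1 (fst x)" for x :: "c3"
 have cont: "continuous_on P b" "continuous_on P c" "continuous_on P w"
  unfolding b_def c_def w_def
  by (intro continuous_intros continuous_on_compose2[OF sol_cont(1)] continuous_on_compose2[OF sol_cont(2)]
     continuous_on_compose2[OF sol_cont(3)] continuous_on_compose2[OF sol_cont(4)]; auto)+
 define V where "V = P \<inter> (\<lambda>x. (T * norm (b x) - norm (c x))) -` {0<..} \<inter> (P \<inter> (\<lambda>x. (\<rho> * norm (w x) - norm (b x))) -` {0<..})"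
 have "open (P \<inter> (\<lambda>x. (T * norm (b x) - norm (c x))) -` {0<..})" "open (P \<inter> (\<lambda>x. (\<rho> * norm (w x) - norm (b x))) -` {0<..})"
  by (rule continuous_open_preimage[OF _ open_P(1)]; auto intro!: continuous_intros cont)+
 then have "open V" unfolding V_def by (rule open_Int)
 moreover have "V \<subseteq> P" unfolding V_def by blast
 moreover have "\<Psi> \<zeta>0 0 (of_real (\<rho>/2)) \<in> V"
 proof -
  have z0: "\<zeta>0 \<in> B" using r by simp
  have "\<Psi> \<zeta>0 0 (of_real (\<rho>/2)) \<in> P" using \<rho> r T by (intro \<Psi>_in) auto
  moreover have bw: "b (\<Psi> \<zeta>0 0 (of_real (\<rho>/2))) = of_real (\<rho>/2) * w (\<Psi> \<zeta>0 0 (of_real (\<rho>/2)))" and "c (\<Psi> \<zeta>0 0 (of_real (\<rho>/2))) = 0"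
   unfolding b_def c_def w_def \<Psi>_def u_def v_def by (simp_all add: algebra_simps)
  moreover have "w (\<Psi> \<zeta>0 0 (of_real (\<rho>/2))) ~= 0" unfolding w_def \<Psi>_def using W[OF z0] by simp
  moreover from this have wpos: "norm (w (\<Psi> \<zeta>0 0 (of_real (\<rho>/2)))) > 0" by (simp only: zero_less_norm_iff) simp
  moreover have nb: "norm (b (\<Psi> \<zeta>0 0 (of_real (\<rho>/2)))) = \<rho>/2 * norm (w (\<Psi> \<zeta>0 0 (of_real (\<rho>/2))))"
   unfolding bw norm_mult norm_of_real using \<rho> by simp
  moreover have "0 < T * norm (b (\<Psi> \<zeta>0 0 (of_real (\<rho>/2))))" "norm (b (\<Psi> \<zeta>0 0 (of_real (\<rho>/2)))) < \<rho> * norm (w (\<Psi> \<zeta>0 0 (of_real (\<rho>/2))))"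
   unfolding nb using mult_pos_pos[OF \<rho> wpos] T by simp_all
  ultimately show ?thesis unfolding V_def using \<rho> T by simp
 qed
 moreover have "f x = 0" if x: "x \<in> V" for x
 proof -
  obtain z \<xi> \<eta> where xe: "x = (z, \<xi>, \<eta>)" by (cases x) auto
  have zB: "z \<in> B" using x unfolding V_def xe by auto
  define eps where "eps = b x / w x"
  define t where "t = c x / b x"
  have V: "norm (c x) < T * norm (b x)" "norm (b x) < \<rho> * norm (w x)" using x unfolding V_def by auto
  have wn: "w x ~= 0" unfolding w_def xe using W[OF zB] by simp
  have bn: "b x ~= 0" using V(1) by auto
  have "eps \<in> ball 0 \<rho>" using V(2) wn by (simp add: eps_def norm_divide field_simps)
  moreover have "t \<in> BT" using V(1) bn by (simp add: t_def norm_divide field_simps)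
  moreover have "\<Psi> z t eps = x"
  proof -
   have e1: "eps * t = c x / w x" unfolding eps_def t_def using bn by simp
   have "c x * Y1 z + b x * Y2 z = w x * \<xi>" "c x * Z1 z + b x * Z2 z = w x * \<eta>"
    unfolding c_def b_def w_def xe by (simp_all add: algebra_simps)
   then have "c x / w x * Y1 z + b x / w x * Y2 z = \<xi>" "c x / w x * Z1 z + b x / w x * Z2 z = \<eta>"
    using wn by (simp_all add: add_divide_distrib[symmetric])
   then have "eps * u z t = \<xi>" "eps * v z t = \<eta>"
    unfolding u_def v_def distrib_left mult.assoc[symmetric] e1 by (simp_all add: eps_def)
   then show ?thesis unfolding \<Psi>_def xe by simp
  qed
  ultimately show ?thesis using f0[OF zB, of t eps] by simp
 qed
 ultimately show ?thesis using s3.chol_identity[OF open_P _ _ _ a f, of V] by blast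
qed

end

lemma num_df_linear:
 assumes "chol sc3 f P" "chol sc3 g P" "a \<in> P"
 shows "num_df f g a (x + y) = num_df f g a x + num_df f g a y" "num_df f g a (x - y) = num_df f g a x - num_df f g a y"
  "num_df f g a (sc3 c x) = c * num_df f g a x"
 by (simp_all only: num_df_def df_linear[OF assms(1,3)] df_linear[OF assms(2,3)] chol_df(2)[OF assms(1,3)] chol_df(2)[OF assms(2,3)])
   (simp_all add: algebra_simps)

context
 fixes f g :: "c3 => complex" and G :: "complex => complex => complex => complex"
 assumes f: "chol sc3 f P" and g: "chol sc3 g P"
  and PDE: "!!z \<xi> \<eta>. (z, \<xi>, \<eta>) \<in> P ==> g (z, \<xi>, \<eta>) ~= 0 ==> num_df f g (z, \<xi>, \<eta>) (1, p z * \<eta>, G z \<xi> \<eta>) = 0"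
  and G: "!!z a b. z \<in> B ==> ((\<lambda>eps. G z (eps * a) (eps * b) / eps) \<longlongrightarrow> q z * a + s z * b) (at 0)"
begin

text \<open>The curve eps * (t * Y1 + Y2) is a trajectory of the flow up to terms of higher order in eps. Hence invariance of f / g under the flow says, to leading order, that the quotient of the leading coefficients does not depend on z.\<close>
lemma leading_ratio_stationary:
 assumes m: "!!i z t. i < m ==> z \<in> B ==> t \<in> BT ==> coef f i z t = 0"
  and l: "!!i z t. i < l ==> z \<in> B ==> t \<in> BT ==> coef g i z t = 0"
  and z: "z \<in> B" and t: "t \<in> BT" and nz: "coef g l z t ~= 0"
 shows "coef g l z t * deriv (\<lambda>z. coef f m z t) z = coef f m z t * deriv (\<lambda>z. coef g l z t) z"
proof -
 define fz where "fz eps = df f (\<Psi> z t eps) (1, eps * (p z * v z t), eps * (q z * u z t + s z * v z t))" for eps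
 define gz where "gz eps = df g (\<Psi> z t eps) (1, eps * (p z * v z t), eps * (q z * u z t + s z * v z t))" for eps
 define ft where "ft eps = df f (\<Psi> z t eps) (0, eps * Y1 z, eps * Z1 z)" for eps
 define gt where "gt eps = df g (\<Psi> z t eps) (0, eps * Y1 z, eps * Z1 z)" for eps
 define fe where "fe eps = eps * df f (\<Psi> z t eps) (0, u z t, v z t)" for eps
 define ge where "ge eps = eps * df g (\<Psi> z t eps) (0, u z t, v z t)" for eps
 define W0 where "W0 = Y1 z * Z2 z - Y2 z * Z1 z"
 have W0: "W0 ~= 0" unfolding W0_def by (rule W[OF z])
 define \<delta> where "\<delta> eps = eps * (q z * u z t + s z * v z t) - G z (eps * u z t) (eps * v z t)" for eps
 note Lf = coef_limits[OF f m z t] and Lg = coef_limits[OF g l z t]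
 obtain lf where lf: "((\<lambda>eps. fe eps / eps ^ m) \<longlongrightarrow> lf) (at 0)" using Lf(4) unfolding fe_def by blast
 obtain lg where lg: "((\<lambda>eps. ge eps / eps ^ l) \<longlongrightarrow> lg) (at 0)" using Lg(4) unfolding ge_def by blast
 have ev0: "\<forall>\<^sub>F eps in at 0. eps \<in> ball (0::complex) \<rho> - {0}"
  unfolding eventually_at using \<rho> by (intro exI[of _ \<rho>]) auto
 have "\<forall>\<^sub>F eps in at 0. g (\<Psi> z t eps) / eps ^ l ~= 0"
 proof (rule tendsto_imp_eventually_ne[OF Lg(1)])
  show "coef g l z t / fact l ~= 0" using nz by simp
 qed
 with ev0 have ev: "\<forall>\<^sub>F eps in at 0. eps \<in> ball (0::complex) \<rho> - {0} \<and> g (\<Psi> z t eps) ~= 0"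
  by eventually_elim auto
 have \<delta>lim: "((\<lambda>eps. \<delta> eps / eps) \<longlongrightarrow> 0) (at 0)"
 proof -
  have "((\<lambda>eps. (q z * u z t + s z * v z t) - G z (eps * u z t) (eps * v z t) / eps) \<longlongrightarrow> (q z * u z t + s z * v z t) - (q z * u z t + s z * v z t)) (at 0)"
   by (intro tendsto_diff tendsto_const G z)
  then have "((\<lambda>eps. (q z * u z t + s z * v z t) - G z (eps * u z t) (eps * v z t) / eps) \<longlongrightarrow> 0) (at 0)" by simp
  then show ?thesis
   by (rule Lim_transform_eventually) (use ev0 in eventually_elim, simp add: \<delta>_def diff_divide_distrib)
 qed
 have R: "((\<lambda>eps. \<delta> eps / eps / W0 * (Y1 z * ((g (\<Psi> z t eps) / eps ^ l) * (fe eps / eps ^ m) - (f (\<Psi> z t eps) / eps ^ m) * (ge eps / eps ^ l))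
   - u z t * ((g (\<Psi> z t eps) / eps ^ l) * (ft eps / eps ^ m) - (f (\<Psi> z t eps) / eps ^ m) * (gt eps / eps ^ l)))) \<longlongrightarrow>
   0 / W0 * (Y1 z * ((coef g l z t / fact l) * lf - (coef f m z t / fact m) * lg)
   - u z t * ((coef g l z t / fact l) * (deriv (\<lambda>t. coef f m z t) t / fact m) - (coef f m z t / fact m) * (deriv (\<lambda>t. coef g l z t) t / fact l)))) (at 0)"
  by (intro tendsto_intros \<delta>lim lf lg Lf(1) Lg(1) Lf(3)[folded ft_def] Lg(3)[folded gt_def] W0)
 have L: "((\<lambda>eps. (g (\<Psi> z t eps) / eps ^ l) * (fz eps / eps ^ m) - (f (\<Psi> z t eps) / eps ^ m) * (gz eps / eps ^ l)) \<longlongrightarrow>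
   (coef g l z t / fact l) * (deriv (\<lambda>z. coef f m z t) z / fact m) - (coef f m z t / fact m) * (deriv (\<lambda>z. coef g l z t) z / fact l)) (at 0)"
  by (intro tendsto_intros Lf(1) Lg(1) Lf(2)[folded fz_def] Lg(2)[folded gz_def])
 have eq: "\<forall>\<^sub>F eps in at 0. (g (\<Psi> z t eps) / eps ^ l) * (fz eps / eps ^ m) - (f (\<Psi> z t eps) / eps ^ m) * (gz eps / eps ^ l)
  = \<delta> eps / eps / W0 * (Y1 z * ((g (\<Psi> z t eps) / eps ^ l) * (fe eps / eps ^ m) - (f (\<Psi> z t eps) / eps ^ m) * (ge eps / eps ^ l))
   - u z t * ((g (\<Psi> z t eps) / eps ^ l) * (ft eps / eps ^ m) - (f (\<Psi> z t eps) / eps ^ m) * (gt eps / eps ^ l)))"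
  using ev
 proof eventually_elim
  case (elim eps)
  then have eps: "eps \<in> ball 0 \<rho>" "eps ~= 0" and gn: "g (\<Psi> z t eps) ~= 0" by auto
  define a where "a = \<Psi> z t eps"
  have aP: "a \<in> P" unfolding a_def by (rule \<Psi>_in[OF z t eps(1)])
  note nl = num_df_linear[OF f g aP]
  have pde: "num_df f g a (1, p z * (eps * v z t), G z (eps * u z t) (eps * v z t)) = 0"
   using PDE[of z "eps * u z t" "eps * v z t"] aP gn unfolding a_def \<Psi>_def by blast
  have "num_df f g a (1, eps * (p z * v z t), eps * (q z * u z t + s z * v z t))
    = num_df f g a ((1, p z * (eps * v z t), G z (eps * u z t) (eps * v z t)) + sc3 (\<delta> eps) (0, 0, 1))"
   unfolding \<delta>_def by (simp add: mult_ac)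
  also have "\<dots> = \<delta> eps * num_df f g a (0, 0, 1)" unfolding nl pde by simp
  finally have 1: "num_df f g a (1, eps * (p z * v z t), eps * (q z * u z t + s z * v z t)) = \<delta> eps * num_df f g a (0, 0, 1)" .
  have "eps * (W0 * num_df f g a (0, 0, 1)) = num_df f g a (sc3 eps (sc3 W0 (0, 0, 1)))" unfolding nl ..
  also have "sc3 eps (sc3 W0 (0, 0, 1)) = sc3 (Y1 z) (sc3 eps (0, u z t, v z t)) - sc3 (u z t) (0, eps * Y1 z, eps * Z1 z)"
   unfolding W0_def u_def v_def by (simp add: algebra_simps)
  also have "num_df f g a \<dots> = Y1 z * (eps * num_df f g a (0, u z t, v z t)) - u z t * num_df f g a (0, eps * Y1 z, eps * Z1 z)"
   unfolding nl ..
  finally have 2: "num_df f g a (0, 0, 1) = (Y1 z * (eps * num_df f g a (0, u z t, v z t)) - u z t * num_df f g a (0, eps * Y1 z, eps * Z1 z)) / (eps * W0)"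
   using W0 eps(2) by (simp add: field_simps)
  have 3: "g a * fz eps - f a * gz eps = \<delta> eps / eps / W0 * (Y1 z * (g a * fe eps - f a * ge eps) - u z t * (g a * ft eps - f a * gt eps))"
  proof -
   have e1: "eps * num_df f g a (0, u z t, v z t) = g a * fe eps - f a * ge eps"
    unfolding num_df_def fe_def ge_def a_def by (simp add: algebra_simps)
   have e2: "num_df f g a (0, eps * Y1 z, eps * Z1 z) = g a * ft eps - f a * gt eps"
    unfolding num_df_def ft_def gt_def a_def ..
   have "g a * fz eps - f a * gz eps = num_df f g a (1, eps * (p z * v z t), eps * (q z * u z t + s z * v z t))"
    unfolding num_df_def fz_def gz_def a_def ..
   then show ?thesis unfolding 1 2 e1 e2 by simp
  qed
  define E where "E = eps ^ m * eps ^ l"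
  have quot: "x / eps ^ l * (y / eps ^ m) = x * y / E" "x / eps ^ m * (y / eps ^ l) = x * y / E" for x y
   unfolding E_def by (simp_all add: mult.commute)
  have "(g a / eps ^ l) * (fz eps / eps ^ m) - (f a / eps ^ m) * (gz eps / eps ^ l) = (g a * fz eps - f a * gz eps) / E"
   unfolding quot by (simp add: diff_divide_distrib)
  also have "\<dots> = \<delta> eps / eps / W0 * (Y1 z * ((g a * fe eps - f a * ge eps) / E) - u z t * ((g a * ft eps - f a * gt eps) / E))"
   unfolding 3 by (simp add: diff_divide_distrib right_diff_distrib)
  finally show ?case unfolding quot a_def[symmetric] by (simp add: diff_divide_distrib)
 qed
 have "(coef g l z t / fact l) * (deriv (\<lambda>z. coef f m z t) z / fact m) - (coef f m z t / fact m) * (deriv (\<lambda>z. coef g l z t) z / fact l) = 0"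
  using eventually_eq_imp_limits_eq[OF L R eq] by simp
 then show ?thesis by (simp add: field_simps)
qed

text \<open>Both f and g have a first coefficient that is not identically zero. Their quotient is the initial form of f / g, and d is the difference of the orders.\<close>
lemma initial_form:
 assumes fn: "\<exists>a\<in>P. f a ~= 0" and gn: "\<exists>a\<in>P. g a ~= 0"
 shows "\<exists>(d::int) a b N0. a holomorphic_on BT \<and> b holomorphic_on BT \<and> countable {t\<in>BT. a t = 0} \<and> countable {t\<in>BT. b t = 0} \<and> countable N0 \<and>
  (\<forall>z\<in>B - N0. \<exists>N. countable N \<and> (\<forall>t\<in>BT - N. (\<forall>\<^sub>F eps in at 0. \<Psi> z t eps \<in> P \<and> g (\<Psi> z t eps) ~= 0) \<and> a t ~= 0 \<and> b t ~= 0 \<and>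
    ((\<lambda>eps. f (\<Psi> z t eps) / g (\<Psi> z t eps) * eps powi (- d)) \<longlongrightarrow> a t / b t) (at 0)))"
proof -
 have ex: "\<exists>m z t. z \<in> B \<and> t \<in> BT \<and> coef h m z t ~= 0 \<and> (\<forall>i z t. i < m \<longrightarrow> z \<in> B \<longrightarrow> t \<in> BT \<longrightarrow> coef h i z t = 0)"
  if h: "chol sc3 h P" "\<exists>a\<in>P. h a ~= 0" for h
 proof -
  define Q where "Q n \<longleftrightarrow> (\<exists>z\<in>B. \<exists>t\<in>BT. coef h n z t ~= 0)" for n
  have "\<exists>n. Q n" using coef_all_zero[OF h(1)] h(2) unfolding Q_def by blast
  then have "Q (LEAST n. Q n)" "!!i. i < (LEAST n. Q n) ==> \<not> Q i" by (auto intro: LeastI dest: not_less_Least)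
  then show ?thesis unfolding Q_def by blast
 qed
 obtain m z1 t1 where m: "z1 \<in> B" "t1 \<in> BT" "coef f m z1 t1 ~= 0" "!!i z t. i < m ==> z \<in> B ==> t \<in> BT ==> coef f i z t = 0"
  using ex[OF f fn] by blast
 obtain l z2 t2 where l: "z2 \<in> B" "t2 \<in> BT" "coef g l z2 t2 ~= 0" "!!i z t. i < l ==> z \<in> B ==> t \<in> BT ==> coef g i z t = 0"
  using ex[OF g gn] by blast
 note zc = countable_zeros[OF _ open_ball connected_ball]
 have cz: "countable {z\<in>B. coef h n z t = 0}" if "chol sc3 h P" "t \<in> BT" "z0 \<in> B" "coef h n z0 t ~= 0" for h n t z0
  using zc[OF coef_hol(1)[OF that(1,2)] that(3)] that(4) by blast
 have ct: "countable {t\<in>BT. coef h n z t = 0}" if "chol sc3 h P" "z \<in> B" "t0 \<in> BT" "coef h n z t0 ~= 0" for h n z t0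
  using zc[OF coef_hol(2)[OF that(1,2)] that(3)] that(4) by blast
 have pick: "\<exists>x\<in>ball c R. x \<notin> N" if "countable N" "R > 0" for N and c :: complex and R
  using uncountable_ball[OF that(2), of c] that(1) countable_subset[of "ball c R" N] by blast
 obtain t' where t': "t' \<in> BT" "coef f m z1 t' ~= 0" "coef g l z2 t' ~= 0"
  using pick[OF countable_Un[OF ct[OF f m(1-3)] ct[OF g l(1-3)]] T, of 0] by auto
 obtain z' where z': "z' \<in> B" "coef f m z' t' ~= 0" "coef g l z' t' ~= 0"
  using pick[OF countable_Un[OF cz[OF f t'(1) m(1) t'(2)] cz[OF g t'(1) l(1) t'(3)]] r, of \<zeta>0] by auto
 define a where "a t = coef f m z' t / fact m" for t
 define b where "b t = coef g l z' t / fact l" for t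
 define N0 where "N0 = {z\<in>B. coef g l z t' = 0}"
 have ha: "a holomorphic_on BT" "b holomorphic_on BT"
  unfolding a_def b_def by (intro holomorphic_intros coef_hol(2)[OF f z'(1)] coef_hol(2)[OF g z'(1)]; simp)+
 have ca: "countable {t\<in>BT. a t = 0}" "countable {t\<in>BT. b t = 0}"
  unfolding a_def b_def using ct[OF f z'(1) t'(1) z'(2)] ct[OF g z'(1) t'(1) z'(3)] by simp_all
 have cN0: "countable N0" unfolding N0_def by (rule cz[OF g t'(1) z'(1,3)])
 have main: "\<exists>N. countable N \<and> (\<forall>t\<in>BT - N. (\<forall>\<^sub>F eps in at 0. \<Psi> z t eps \<in> P \<and> g (\<Psi> z t eps) ~= 0) \<and> a t ~= 0 \<and> b t ~= 0 \<and>
    ((\<lambda>eps. f (\<Psi> z t eps) / g (\<Psi> z t eps) * eps powi (- (int m - int l))) \<longlongrightarrow> a t / b t) (at 0))" if z: "z \<in> B - N0" for z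
 proof (intro exI conjI ballI)
  have zB: "z \<in> B" and gz: "coef g l z t' ~= 0" using z unfolding N0_def by auto
  define N where "N = {t\<in>BT. coef g l z t = 0} \<union> ({t\<in>BT. a t = 0} \<union> {t\<in>BT. b t = 0})"
  show "countable N" unfolding N_def by (intro countable_Un ct[OF g zB t'(1) gz] ca)
  fix t assume "t \<in> BT - N"
  then have t: "t \<in> BT" "coef g l z t ~= 0" and abn: "a t ~= 0" "b t ~= 0" unfolding N_def by auto
  show "a t ~= 0" "b t ~= 0" by fact+
  define S where "S = B - {z\<in>B. coef g l z t = 0}"
  have S: "open S" "connected S"
  proof -
   have "open (B \<inter> (\<lambda>z. coef g l z t) -` (- {0}))"
    by (rule continuous_open_preimage[OF holomorphic_on_imp_continuous_on[OF coef_hol(1)[OF g t(1)]]]) auto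
   moreover have "B \<inter> (\<lambda>z. coef g l z t) -` (- {0}) = S" unfolding S_def by auto
   ultimately show "open S" by simp
   show "connected S" unfolding S_def
    by (rule path_connected_imp_connected, rule path_connected_open_diff_countable)
      (use cz[OF g t(1) zB t(2)] in auto)
  qed
  have zS: "z \<in> S" "z' \<in> S" unfolding S_def using zB t z' abn by (auto simp: b_def)
  have "((\<lambda>z. coef f m z t / coef g l z t) has_field_derivative 0) (at w)" if "w \<in> S" for w
  proof -
   have w: "w \<in> B" "coef g l w t ~= 0" using that unfolding S_def by auto
   have "((\<lambda>z. coef f m z t / coef g l z t) has_field_derivative
     (deriv (\<lambda>z. coef f m z t) w * coef g l w t - coef f m w t * deriv (\<lambda>z. coef g l z t) w) / (coef g l w t * coef g l w t)) (at w)"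
    by (intro DERIV_divide holomorphic_derivI[OF coef_hol(1)[OF f t(1)] open_ball w(1)] holomorphic_derivI[OF coef_hol(1)[OF g t(1)] open_ball w(1)] w(2))
   then show ?thesis using leading_ratio_stationary[OF m(4) l(4) w(1) t(1) w(2)] by (simp add: mult.commute)
  qed
  then have der: "\<forall>w\<in>S - {}. ((\<lambda>z. coef f m z t / coef g l z t) has_field_derivative 0) (at w)" by blast
  then have "continuous_on S (\<lambda>z. coef f m z t / coef g l z t)"
   by (intro continuous_at_imp_continuous_on) (auto intro: DERIV_isCont)
  then obtain k where "!!w. w \<in> S ==> coef f m w t / coef g l w t = k"
   using DERIV_zero_connected_constant[OF S(2,1) finite.emptyI _ der] by blast
  then have "coef f m z t / coef g l z t = coef f m z' t / coef g l z' t" using zS by simp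
  moreover have "(x / fact m) / (y / fact l) = (x / y) * (fact l / fact m)" for x y :: complex by simp
  ultimately have ratio: "(coef f m z t / fact m) / (coef g l z t / fact l) = a t / b t"
   unfolding a_def b_def by (simp only:)
  note Lf = coef_limits(1)[OF f m(4) zB t(1)] and Lg = coef_limits(1)[OF g l(4) zB t(1)]
  have nzl: "coef g l z t / fact l ~= 0" using t(2) by simp
  have ev0: "\<forall>\<^sub>F eps in at 0. eps \<in> ball (0::complex) \<rho> - {0}"
   unfolding eventually_at using \<rho> by (intro exI[of _ \<rho>]) auto
  have "\<forall>\<^sub>F eps in at 0. g (\<Psi> z t eps) / eps ^ l ~= 0"
   by (rule tendsto_imp_eventually_ne[OF Lg nzl])
  with ev0 show "\<forall>\<^sub>F eps in at 0. \<Psi> z t eps \<in> P \<and> g (\<Psi> z t eps) ~= 0"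
   by eventually_elim (use \<Psi>_in[OF zB t(1)] in auto)
  have "((\<lambda>eps. (f (\<Psi> z t eps) / eps ^ m) / (g (\<Psi> z t eps) / eps ^ l)) \<longlongrightarrow> a t / b t) (at 0)"
   unfolding ratio[symmetric] by (rule tendsto_divide[OF Lf Lg nzl])
  then show "((\<lambda>eps. f (\<Psi> z t eps) / g (\<Psi> z t eps) * eps powi (- (int m - int l))) \<longlongrightarrow> a t / b t) (at 0)"
  proof (rule Lim_transform_eventually)
   show "\<forall>\<^sub>F eps in at 0. (f (\<Psi> z t eps) / eps ^ m) / (g (\<Psi> z t eps) / eps ^ l) = f (\<Psi> z t eps) / g (\<Psi> z t eps) * eps powi (- (int m - int l))"
    using ev0 by eventually_elim (simp add: power_int_diff)
  qed
 qed
 show ?thesis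
  by (intro exI[of _ "int m - int l"] exI[of _ a] exI[of _ b] exI[of _ N0] conjI ha ca cN0 ballI main)
qed

end

end

section \<open>Initial forms of first integrals\<close>

text \<open>The initial form of F at z: along almost every direction t in the disc of radius T, F grows like c t times the d-th power of eps.\<close>
definition small_at :: "(c3 => complex) => complex => complex => complex => complex => complex => real => int => (complex => complex) => bool" where
 "small_at F z Y1 Z1 Y2 Z2 T d c \<longleftrightarrow> (\<exists>N. countable N \<and> (\<forall>t\<in>ball 0 T - N. c t ~= 0 \<and>
   ((\<lambda>eps. F (z, eps * (t * Y1 + Y2), eps * (t * Z1 + Z2)) * eps powi (- d)) \<longlongrightarrow> c t) (at 0)))"

text \<open>The degenerate alternative to an initial form, F vanishing along almost every direction.\<close>
definition zero_at :: "(c3 => complex) => complex => complex => complex => complex => complex => real => bool" where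
 "zero_at F z Y1 Z1 Y2 Z2 T \<longleftrightarrow> (\<exists>N. countable N \<and> (\<forall>t\<in>ball 0 T - N.
   \<forall>\<^sub>F eps in at 0. F (z, eps * (t * Y1 + Y2), eps * (t * Z1 + Z2)) = 0))"

lemma pick_ball: "countable N ==> R > 0 ==> \<exists>x\<in>ball (c::complex) R. x \<notin> N"
 using uncountable_ball[of R c] countable_subset[of "ball c R" N] by blast

text \<open>Two different exponents would make one of the limits vanish.\<close>
lemma leading_term_unique:
 fixes h :: "complex => complex"
 assumes "x ~= 0" "y ~= 0" and lims: "((\<lambda>eps. h eps * eps powi (- d)) \<longlongrightarrow> x) (at 0)" "((\<lambda>eps. h eps * eps powi (- d')) \<longlongrightarrow> y) (at 0)"
 shows "d = d'" "x = y"
proof -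
 have ne: "\<forall>\<^sub>F eps in at 0. eps ~= (0::complex)" by (auto simp: eventually_at intro: exI[of _ 1])
 have *: False if dd: "d < d'" and c: "x ~= 0" "y ~= 0"
  "((\<lambda>eps. h eps * eps powi (- d)) \<longlongrightarrow> x) (at 0)" "((\<lambda>eps. h eps * eps powi (- d')) \<longlongrightarrow> y) (at 0)" for d d' :: int and x y and h :: "complex => complex"
 proof -
  have "((\<lambda>eps. (h eps * eps powi (- d')) * eps ^ nat (d' - d)) \<longlongrightarrow> y * 0 ^ nat (d' - d)) (at 0)"
   by (intro tendsto_intros c)
  moreover have "\<forall>\<^sub>F eps in at 0. (h eps * eps powi (- d')) * eps ^ nat (d' - d) = h eps * eps powi (- d)"
   using ne
  proof eventually_elim
   case (elim eps)
   have "eps powi (- d') * eps ^ nat (d' - d) = eps powi (- d') * eps powi (d' - d)"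
    using dd by (simp add: power_int_def)
   also have "\<dots> = eps powi (- d)" using elim by (simp add: power_int_add[symmetric])
   finally show ?case by (simp add: mult.assoc)
  qed
  ultimately have "y * 0 ^ nat (d' - d) = x" by (rule eventually_eq_imp_limits_eq[OF _ c(3)]) simp
  moreover have "(0::complex) ^ nat (d' - d) = 0" using dd by simp
  ultimately show False using c(1) by simp
 qed
 show dd: "d = d'"
 proof (rule ccontr)
  assume "d ~= d'"
  then consider "d < d'" | "d' < d" by linarith
  then show False
  proof cases
   case 1 show False by (rule *[OF 1 assms])
  next
   case 2 show False by (rule *[OF 2 assms(2,1) lims(2,1)])
  qed
 qed
 show "x = y" using lims dd tendsto_unique[OF at_neq_bot] by blast
qed

lemma small_at_unique:
 assumes "small_at F z Y1 Z1 Y2 Z2 T d c" "small_at F z Y1 Z1 Y2 Z2 T d' c'" "T > 0"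
 shows "d = d'" "\<exists>N. countable N \<and> (\<forall>t\<in>ball 0 T - N. c t = c' t)"
proof -
 obtain N where N: "countable N" "!!t. t \<in> ball 0 T - N ==> c t ~= 0 \<and>
   ((\<lambda>eps. F (z, eps * (t * Y1 + Y2), eps * (t * Z1 + Z2)) * eps powi (- d)) \<longlongrightarrow> c t) (at 0)"
  using assms(1) unfolding small_at_def by blast
 obtain N' where N': "countable N'" "!!t. t \<in> ball 0 T - N' ==> c' t ~= 0 \<and>
   ((\<lambda>eps. F (z, eps * (t * Y1 + Y2), eps * (t * Z1 + Z2)) * eps powi (- d')) \<longlongrightarrow> c' t) (at 0)"
  using assms(2) unfolding small_at_def by blast
 obtain t where t: "t \<in> ball 0 T" "t \<notin> N \<union> N'" using pick_ball[of "N \<union> N'" T 0] N(1) N'(1) assms(3) by auto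
 have t': "t \<in> ball 0 T - N" "t \<in> ball 0 T - N'" using t by auto
 note ct = N(2)[OF t'(1)] and ct' = N'(2)[OF t'(2)]
 show dd: "d = d'"
  by (rule leading_term_unique(1)[OF conjunct1[OF ct] conjunct1[OF ct'] conjunct2[OF ct] conjunct2[OF ct']])
 show "\<exists>N. countable N \<and> (\<forall>t\<in>ball 0 T - N. c t = c' t)"
 proof (intro exI[of _ "N \<union> N'"] conjI ballI)
  show "countable (N \<union> N')" using N(1) N'(1) by auto
  fix t assume "t \<in> ball 0 T - (N \<union> N')"
  then show "c t = c' t" using N(2)[of t] N'(2)[of t] dd tendsto_unique[OF at_neq_bot] by blast
 qed
qed

lemma small_at_not_zero_at:
 assumes "small_at F z Y1 Z1 Y2 Z2 T d c" "zero_at F z Y1 Z1 Y2 Z2 T" "T > 0"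
 shows False
proof -
 obtain N where N: "countable N" "!!t. t \<in> ball 0 T - N ==> c t ~= 0 \<and>
   ((\<lambda>eps. F (z, eps * (t * Y1 + Y2), eps * (t * Z1 + Z2)) * eps powi (- d)) \<longlongrightarrow> c t) (at 0)"
  using assms(1) unfolding small_at_def by blast
 obtain N' where N': "countable N'" "!!t. t \<in> ball 0 T - N' ==> \<forall>\<^sub>F eps in at 0. F (z, eps * (t * Y1 + Y2), eps * (t * Z1 + Z2)) = 0"
  using assms(2) unfolding zero_at_def by blast
 obtain t where t: "t \<in> ball 0 T" "t \<notin> N \<union> N'" using pick_ball[of "N \<union> N'" T 0] N(1) N'(1) assms(3) by auto
 have "\<forall>\<^sub>F eps in at 0. F (z, eps * (t * Y1 + Y2), eps * (t * Z1 + Z2)) * eps powi (- d) = 0"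
  using N'(2)[of t] t by (auto elim: eventually_mono)
 then have "c t = 0" using N(2)[of t] t eventually_eq_imp_limits_eq[OF _ tendsto_const[of 0]] at_neq_bot by blast
 then show False using N(2)[of t] t by auto
qed

definition quot_form :: "real => (complex => complex) => bool" where
 "quot_form T c \<longleftrightarrow> (\<exists>a b. a holomorphic_on ball 0 T \<and> b holomorphic_on ball 0 T \<and> countable {t\<in>ball 0 T. a t = 0} \<and>
   countable {t\<in>ball 0 T. b t = 0} \<and> c = (\<lambda>t. a t / b t))"

text \<open>The function G gives the second component of a nonlinear system in the coordinates \<xi>, \<eta>; the last assumption says that q and s are its linearisation at the origin.\<close>
locale linear_system =
 fixes D :: "complex set" and p q s Y1 Z1 Y2 Z2 :: "complex => complex" and G :: "complex => complex => complex => complex"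
 assumes D: "open D" "connected D"
  and sol1: "solves D p q s Y1 Z1" and sol2: "solves D p q s Y2 Z2"
  and W: "!!z. z \<in> D ==> Y1 z * Z2 z - Y2 z * Z1 z ~= 0"
  and G: "!!z a b. z \<in> D ==> ((\<lambda>eps. G z (eps * a) (eps * b) / eps) \<longlongrightarrow> q z * a + s z * b) (at 0)"
begin

text \<open>Near the zero section over z0, F is a quotient of holomorphic functions that is invariant under the nonlinear flow.\<close>
definition rep :: "(c3 => complex) => complex => real => (c3 => complex) => (c3 => complex) => bool" where
 "rep F z0 r f g \<longleftrightarrow> r > 0 \<and> ball z0 r \<subseteq> D \<and> chol sc3 f (ball z0 r \<times> ball 0 r \<times> ball 0 r) \<and> chol sc3 g (ball z0 r \<times> ball 0 r \<times> ball 0 r) \<and>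
   (\<exists>a\<in>ball z0 r \<times> ball 0 r \<times> ball 0 r. g a ~= 0) \<and>
   (\<forall>z \<xi> \<eta>. (z, \<xi>, \<eta>) \<in> ball z0 r \<times> ball 0 r \<times> ball 0 r \<longrightarrow> g (z, \<xi>, \<eta>) ~= 0 \<longrightarrow>
    F (z, \<xi>, \<eta>) = f (z, \<xi>, \<eta>) / g (z, \<xi>, \<eta>) \<and> num_df f g (z, \<xi>, \<eta>) (1, p z * \<eta>, G z \<xi> \<eta>) = 0)"

lemma repD:
 assumes "rep F z0 r f g" "(z, \<xi>, \<eta>) \<in> ball z0 r \<times> ball 0 r \<times> ball 0 r" "g (z, \<xi>, \<eta>) ~= 0"
 shows "F (z, \<xi>, \<eta>) = f (z, \<xi>, \<eta>) / g (z, \<xi>, \<eta>)" "num_df f g (z, \<xi>, \<eta>) (1, p z * \<eta>, G z \<xi> \<eta>) = 0"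
proof -
 have "\<forall>z \<xi> \<eta>. (z, \<xi>, \<eta>) \<in> ball z0 r \<times> ball 0 r \<times> ball 0 r \<longrightarrow> g (z, \<xi>, \<eta>) ~= 0 \<longrightarrow>
    F (z, \<xi>, \<eta>) = f (z, \<xi>, \<eta>) / g (z, \<xi>, \<eta>) \<and> num_df f g (z, \<xi>, \<eta>) (1, p z * \<eta>, G z \<xi> \<eta>) = 0"
  using assms(1) unfolding rep_def by (elim conjE)
 from this[rule_format, OF assms(2,3)] show "F (z, \<xi>, \<eta>) = f (z, \<xi>, \<eta>) / g (z, \<xi>, \<eta>)" "num_df f g (z, \<xi>, \<eta>) (1, p z * \<eta>, G z \<xi> \<eta>) = 0"
  by auto
qed

abbreviation "small F z T d c \<equiv> small_at F z (Y1 z) (Z1 z) (Y2 z) (Z2 z) T d c"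
abbreviation "zero F z T \<equiv> zero_at F z (Y1 z) (Z1 z) (Y2 z) (Z2 z) T"

text \<open>This is the local existence of initial forms, for a given representation; exceptional points z and t form countable sets.\<close>
lemma rep_nonzero:
 assumes rep: "rep F z0 r f g" and T: "T > 0" and fn: "\<exists>a\<in>ball z0 r \<times> ball 0 r \<times> ball 0 r. f a ~= 0" and z1: "z1 \<in> ball z0 r"
 shows "\<exists>r'>0. \<exists>d a b N0. ball z1 r' \<subseteq> ball z0 r \<and> a holomorphic_on ball 0 T \<and> b holomorphic_on ball 0 T \<and> countable {t\<in>ball 0 T. a t = 0} \<and>
  countable {t\<in>ball 0 T. b t = 0} \<and> countable N0 \<and> (\<forall>z\<in>ball z1 r' - N0. small F z T d (\<lambda>t. a t / b t)) \<and>
  (\<forall>z\<in>ball z1 r' - N0. \<exists>N. countable N \<and> (\<forall>t\<in>ball 0 T - N. \<forall>\<^sub>F eps in at 0.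
    (z, eps * (t * Y1 z + Y2 z), eps * (t * Z1 z + Z2 z)) \<in> ball z0 r \<times> ball 0 r \<times> ball 0 r \<and>
    g (z, eps * (t * Y1 z + Y2 z), eps * (t * Z1 z + Z2 z)) ~= 0))"
proof -
 have hol: "h holomorphic_on D" if "h \<in> {Y1, Z1, Y2, Z2}" for h
  using that sol1 sol2 unfolding solves_def holomorphic_on_open[OF D(1)] by blast
 have z1D: "z1 \<in> D" using rep z1 unfolding rep_def by auto
 define M where "M = norm (Y1 z1) + norm (Z1 z1) + norm (Y2 z1) + norm (Z2 z1) + 1"
 have ex: "\<exists>e>0. \<forall>z\<in>ball z1 e. norm (h z) \<le> M" if h: "h \<in> {Y1, Z1, Y2, Z2}" for h
 proof -
  have "isCont h z1" using holomorphic_on_imp_continuous_on[OF hol[OF h]] D(1) z1D continuous_on_eq_continuous_at by blast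
  then obtain e where e: "e > 0" "!!z. dist z z1 < e ==> dist (h z) (h z1) < 1"
   unfolding continuous_at_eps_delta using zero_less_one by blast
  have "norm (h z) \<le> M" if "z \<in> ball z1 e" for z
  proof -
   have "norm (h z) \<le> norm (h z1) + dist (h z) (h z1)" by (simp add: dist_norm norm_triangle_sub)
   also have "\<dots> \<le> norm (h z1) + 1" using e(2)[of z] that by (simp add: dist_commute)
   also have "\<dots> \<le> M" using h unfolding M_def by (auto simp: add_nonneg_nonneg)
   finally show ?thesis .
  qed
  then show ?thesis using e(1) by blast
 qed
 obtain e1 e2 e3 e4 where e: "e1 > 0" "e2 > 0" "e3 > 0" "e4 > 0" "\<forall>z\<in>ball z1 e1. norm (Y1 z) \<le> M" "\<forall>z\<in>ball z1 e2. norm (Z1 z) \<le> M"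
  "\<forall>z\<in>ball z1 e3. norm (Y2 z) \<le> M" "\<forall>z\<in>ball z1 e4. norm (Z2 z) \<le> M"
  using ex[of Y1] ex[of Z1] ex[of Y2] ex[of Z2] by blast
 obtain e5 where e5: "e5 > 0" "ball z1 e5 \<subseteq> ball z0 r" by (rule openE[OF open_ball z1])
 define r' where "r' = Min {r, e1, e2, e3, e4, e5}"
 have r0: "r > 0" using rep unfolding rep_def by blast
 have r': "r' > 0" "r' \<le> r" "r' \<le> e1" "r' \<le> e2" "r' \<le> e3" "r' \<le> e4" "r' \<le> e5" unfolding r'_def using e(1-4) e5(1) r0 by auto
 have bb: "ball z1 r' \<subseteq> ball z0 r" using e5(2) subset_ball[OF r'(7)] by blast
 have bD: "ball z1 r' \<subseteq> D" using bb rep unfolding rep_def by auto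
 interpret fr: frame z1 r' p q s Y1 Z1 Y2 Z2 T M
 proof
  show "M > 0" unfolding M_def by (simp add: add_nonneg_pos)
  show "solves (ball z1 r') p q s Y1 Z1" "solves (ball z1 r') p q s Y2 Z2"
   using sol1 sol2 bD unfolding solves_def by blast+
  show "Y1 z * Z2 z - Y2 z * Z1 z ~= 0" if "z \<in> ball z1 r'" for z using W bD that by blast
  show "norm (Y1 z) \<le> M \<and> norm (Z1 z) \<le> M \<and> norm (Y2 z) \<le> M \<and> norm (Z2 z) \<le> M" if "z \<in> ball z1 r'" for z
   using that e(5-8) r' by auto
 qed (use r' T in auto)
 let ?P = "ball z1 r' \<times> ball (0::complex) r' \<times> ball (0::complex) r'"
 let ?Q = "ball z0 r \<times> ball (0::complex) r \<times> ball (0::complex) r"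
 have PP: "?P \<subseteq> ?Q" using bb subset_ball[OF r'(2)] by blast
 have ff: "chol sc3 f ?Q" "chol sc3 g ?Q" using rep unfolding rep_def by auto
 note f = chol_subset[OF ff(1) PP] and g = chol_subset[OF ff(2) PP]
 have oP0: "open ?Q" "convex ?Q" by (auto intro: open_Times convex_Times)
 have nz: "\<exists>a\<in>?P. h a ~= 0" if h: "chol sc3 h ?Q" "\<exists>a\<in>?Q. h a ~= 0" for h
 proof (rule ccontr)
  assume "\<not> (\<exists>a\<in>?P. h a ~= 0)"
  then have h0: "h a = 0" if "a \<in> ?P" for a using that by blast
  have "(z1, 0, 0) \<in> ?P" using r'(1) by simp
  then have "?P ~= {}" by blast
  then have "h b = 0" if "b \<in> ?Q" for b
   using s3.chol_identity[OF oP0 fr.open_P(1) PP _ that h(1) h0] by blast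
  then show False using h(2) by blast
 qed
 have fn': "\<exists>a\<in>?P. f a ~= 0" using nz[OF ff(1) fn] .
 have gn': "\<exists>a\<in>?P. g a ~= 0" using nz[OF ff(2)] rep unfolding rep_def by blast
 have pde: "num_df f g (z, \<xi>, \<eta>) (1, p z * \<eta>, G z \<xi> \<eta>) = 0" if "(z, \<xi>, \<eta>) \<in> ?P" "g (z, \<xi>, \<eta>) ~= 0" for z \<xi> \<eta>
  by (rule repD(2)[OF rep subsetD[OF PP that(1)] that(2)])
 have Gz: "((\<lambda>eps. G z (eps * a) (eps * b) / eps) \<longlongrightarrow> q z * a + s z * b) (at 0)" if "z \<in> ball z1 r'" for z a b
  by (rule G[OF subsetD[OF bD that]])
 have IF: "\<exists>(d::int) a b N0. a holomorphic_on ball 0 T \<and> b holomorphic_on ball 0 T \<and> countable {t\<in>ball 0 T. a t = 0} \<and> countable {t\<in>ball 0 T. b t = 0} \<and> countable N0 \<and>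
  (\<forall>z\<in>ball z1 r' - N0. \<exists>N. countable N \<and> (\<forall>t\<in>ball 0 T - N. (\<forall>\<^sub>F eps in at 0. fr.\<Psi> z t eps \<in> ?P \<and> g (fr.\<Psi> z t eps) ~= 0) \<and> a t ~= 0 \<and> b t ~= 0 \<and>
    ((\<lambda>eps. f (fr.\<Psi> z t eps) / g (fr.\<Psi> z t eps) * eps powi (- d)) \<longlongrightarrow> a t / b t) (at 0)))"
  by (rule fr.initial_form[OF f g _ _ fn' gn']) (rule pde Gz; assumption)+
 obtain d a b N0 where X: "a holomorphic_on ball 0 T \<and> b holomorphic_on ball 0 T \<and> countable {t\<in>ball 0 T. a t = 0} \<and> countable {t\<in>ball 0 T. b t = 0} \<and> countable N0 \<and>
  (\<forall>z\<in>ball z1 r' - N0. \<exists>N. countable N \<and> (\<forall>t\<in>ball 0 T - N. (\<forall>\<^sub>F eps in at 0. fr.\<Psi> z t eps \<in> ?P \<and> g (fr.\<Psi> z t eps) ~= 0) \<and> a t ~= 0 \<and> b t ~= 0 \<and>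
    ((\<lambda>eps. f (fr.\<Psi> z t eps) / g (fr.\<Psi> z t eps) * eps powi (- d)) \<longlongrightarrow> a t / b t) (at 0)))"
  using IF by (elim exE) (rule that)
 note * = X[THEN conjunct1] X[THEN conjunct2, THEN conjunct1] X[THEN conjunct2, THEN conjunct2, THEN conjunct1]
  X[THEN conjunct2, THEN conjunct2, THEN conjunct2, THEN conjunct1] X[THEN conjunct2, THEN conjunct2, THEN conjunct2, THEN conjunct2, THEN conjunct1]
 note ** = X[THEN conjunct2, THEN conjunct2, THEN conjunct2, THEN conjunct2, THEN conjunct2, THEN bspec]
 have "small F z T d (\<lambda>t. a t / b t)" if z: "z \<in> ball z1 r' - N0" for z
 proof -
  obtain N where N: "countable N" "!!t. t \<in> ball 0 T - N ==> (\<forall>\<^sub>F eps in at 0. fr.\<Psi> z t eps \<in> ?P \<and> g (fr.\<Psi> z t eps) ~= 0) \<and> a t ~= 0 \<and> b t ~= 0 \<and>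
    ((\<lambda>eps. f (fr.\<Psi> z t eps) / g (fr.\<Psi> z t eps) * eps powi (- d)) \<longlongrightarrow> a t / b t) (at 0)"
   using **[OF z] by blast
  have "((\<lambda>eps. F (z, eps * (t * Y1 z + Y2 z), eps * (t * Z1 z + Z2 z)) * eps powi (- d)) \<longlongrightarrow> a t / b t) (at 0)"
   if t: "t \<in> ball 0 T - N" for t
  proof (rule Lim_transform_eventually)
   show "((\<lambda>eps. f (fr.\<Psi> z t eps) / g (fr.\<Psi> z t eps) * eps powi (- d)) \<longlongrightarrow> a t / b t) (at 0)" using N(2)[OF t] by blast
   have "\<forall>\<^sub>F eps in at 0. fr.\<Psi> z t eps \<in> ?P \<and> g (fr.\<Psi> z t eps) ~= 0" using N(2)[OF t] by blast
   then show "\<forall>\<^sub>F eps in at 0. f (fr.\<Psi> z t eps) / g (fr.\<Psi> z t eps) * eps powi (- d) = F (z, eps * (t * Y1 z + Y2 z), eps * (t * Z1 z + Z2 z)) * eps powi (- d)"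
   proof eventually_elim
    case (elim eps)
    have "F (fr.\<Psi> z t eps) = f (fr.\<Psi> z t eps) / g (fr.\<Psi> z t eps)"
     unfolding fr.\<Psi>_def
     by (rule repD(1)[OF rep subsetD[OF PP conjunct1[OF elim], unfolded fr.\<Psi>_def] conjunct2[OF elim, unfolded fr.\<Psi>_def]])
    then show ?case unfolding fr.\<Psi>_def fr.u_def fr.v_def by simp
   qed
  qed
  then show ?thesis unfolding small_at_def using N by (intro exI[of _ N]) auto
 qed
 moreover have "\<exists>N. countable N \<and> (\<forall>t\<in>ball 0 T - N. \<forall>\<^sub>F eps in at 0.
    (z, eps * (t * Y1 z + Y2 z), eps * (t * Z1 z + Z2 z)) \<in> ?Q \<and>
    g (z, eps * (t * Y1 z + Y2 z), eps * (t * Z1 z + Z2 z)) ~= 0)" if z: "z \<in> ball z1 r' - N0" for z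
 proof -
  obtain N where N: "countable N" "!!t. t \<in> ball 0 T - N ==> (\<forall>\<^sub>F eps in at 0. fr.\<Psi> z t eps \<in> ?P \<and> g (fr.\<Psi> z t eps) ~= 0)"
   using **[OF z] by blast
  have "\<forall>\<^sub>F eps in at 0. (z, eps * (t * Y1 z + Y2 z), eps * (t * Z1 z + Z2 z)) \<in> ?Q \<and>
    g (z, eps * (t * Y1 z + Y2 z), eps * (t * Z1 z + Z2 z)) ~= 0" if "t \<in> ball 0 T - N" for t
   using N(2)[OF that]
  proof eventually_elim
   case (elim eps)
   show ?case using subsetD[OF PP conjunct1[OF elim]] conjunct2[OF elim] unfolding fr.\<Psi>_def fr.u_def fr.v_def by (rule conjI)
  qed
  then show ?thesis using N(1) by blast
 qed
 ultimately show ?thesis using r'(1) bb *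
  by (intro exI[of _ r'] conjI exI[of _ d] exI[of _ a] exI[of _ b] exI[of _ N0]) auto
qed

lemma rep_zero:
 assumes rep: "rep F z0 r f g" and T: "T > 0" and f0: "!!a. a\<in>ball z0 r \<times> ball 0 r \<times> ball 0 r ==> f a = 0" and z1: "z1 \<in> ball z0 r"
 shows "\<exists>r'>0. \<exists>N0. ball z1 r' \<subseteq> ball z0 r \<and> countable N0 \<and> (\<forall>z\<in>ball z1 r' - N0. zero F z T)"
proof -
 let ?Q = "ball z0 r \<times> ball (0::complex) r \<times> ball (0::complex) r"
 have r1: "rep (\<lambda>_. 1) z0 r g g" unfolding rep_def
 proof (intro conjI allI impI)
  note R = rep[unfolded rep_def]
  show "r > 0" using R by (elim conjE)
  show "ball z0 r \<subseteq> D" using R by (elim conjE)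
  show "chol sc3 g ?Q" using R by (elim conjE)
  then show "chol sc3 g ?Q" .
  show "\<exists>a\<in>?Q. g a ~= 0" using R by (elim conjE)
 qed (simp_all add: num_df_def)
 have gn: "\<exists>a\<in>?Q. g a ~= 0" using rep unfolding rep_def by (elim conjE)
 have F0: "F a = 0" if a: "a \<in> ?Q" "g a ~= 0" for a
 proof -
  obtain z \<xi> \<eta> where e: "a = (z, \<xi>, \<eta>)" by (cases a)
  have "F a = f a / g a" using repD(1)[OF rep] a unfolding e by blast
  then show ?thesis using f0[OF a(1)] by simp
 qed
 from rep_nonzero[OF r1 T gn z1] show ?thesis
 proof (elim exE conjE)
  fix r' d and a b :: "complex => complex" and N0
  assume *: "r' > 0" "ball z1 r' \<subseteq> ball z0 r" "countable N0"
   and N: "\<forall>z\<in>ball z1 r' - N0. \<exists>N. countable N \<and> (\<forall>t\<in>ball 0 T - N. \<forall>\<^sub>F eps in at 0.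
    (z, eps * (t * Y1 z + Y2 z), eps * (t * Z1 z + Z2 z)) \<in> ?Q \<and> g (z, eps * (t * Y1 z + Y2 z), eps * (t * Z1 z + Z2 z)) ~= 0)"
 have "zero F z T" if z: "z \<in> ball z1 r' - N0" for z
 proof -
  obtain N' where N': "countable N'" "!!t. t\<in>ball 0 T - N' ==> \<forall>\<^sub>F eps in at 0.
    (z, eps * (t * Y1 z + Y2 z), eps * (t * Z1 z + Z2 z)) \<in> ?Q \<and> g (z, eps * (t * Y1 z + Y2 z), eps * (t * Z1 z + Z2 z)) ~= 0"
   using N[THEN bspec, OF z] by blast
  show ?thesis unfolding zero_at_def
   by (intro exI[of _ N'] conjI ballI N'(1)) (rule eventually_mono[OF N'(2)], use F0 in auto)
 qed
  then show ?thesis using * by blast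
 qed
qed

definition near_small :: "(c3 => complex) => real => int => (complex => complex) => complex => bool" where
 "near_small F T d c z0 \<longleftrightarrow> (\<exists>r>0. \<exists>N. countable N \<and> (\<forall>z\<in>ball z0 r - N. small F z T d c))"
definition near_zero :: "(c3 => complex) => real => complex => bool" where
 "near_zero F T z0 \<longleftrightarrow> (\<exists>r>0. \<exists>N. countable N \<and> (\<forall>z\<in>ball z0 r - N. zero F z T))"
lemma small_cong:
 assumes "small F z T d c" "countable N" "\<forall>t\<in>ball 0 T - N. c t = c' t"
 shows "small F z T d c'"
proof -
 obtain N1 where N1: "countable N1" "\<forall>t\<in>ball 0 T - N1. c t ~= 0 \<and>
   ((\<lambda>eps. F (z, eps * (t * Y1 z + Y2 z), eps * (t * Z1 z + Z2 z)) * eps powi (- d)) \<longlongrightarrow> c t) (at 0)"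
  using assms(1) unfolding small_at_def by blast
 show ?thesis unfolding small_at_def
 proof (intro exI[of _ "N1 \<union> N"] conjI ballI)
  show "countable (N1 \<union> N)" using N1(1) assms(2) by auto
  fix t assume t: "t \<in> ball 0 T - (N1 \<union> N)"
  have "c' t = c t" using assms(3) t by auto
  then show "c' t ~= 0" "((\<lambda>eps. F (z, eps * (t * Y1 z + Y2 z), eps * (t * Z1 z + Z2 z)) * eps powi (- d)) \<longlongrightarrow> c' t) (at 0)"
   using N1(2) t by auto
 qed
qed

lemma rep_diff_const:
 assumes "rep F z0 r f g"
 shows "rep (\<lambda>a. F a - k) z0 r (\<lambda>a. f a - k * g a) g"
 unfolding rep_def
proof (intro conjI allI impI)
 note R = assms[unfolded rep_def]
 show "r > 0" using R by (elim conjE)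
 show "ball z0 r \<subseteq> D" using R by (elim conjE)
 have f: "chol sc3 f (ball z0 r \<times> ball 0 r \<times> ball 0 r)" using R by (elim conjE)
 show g: "chol sc3 g (ball z0 r \<times> ball 0 r \<times> ball 0 r)" using R by (elim conjE)
 show "chol sc3 (\<lambda>a. f a - k * g a) (ball z0 r \<times> ball 0 r \<times> ball 0 r)"
  by (intro chol_diff chol_mult chol_const f g)
 show "\<exists>a\<in>ball z0 r \<times> ball 0 r \<times> ball 0 r. g a ~= 0" using R by (elim conjE)
 fix z \<xi> \<eta> assume a: "(z, \<xi>, \<eta>) \<in> ball z0 r \<times> ball 0 r \<times> ball 0 r" "g (z, \<xi>, \<eta>) ~= 0"
 note rd = repD[OF assms a]
 show "F (z, \<xi>, \<eta>) - k = (f (z, \<xi>, \<eta>) - k * g (z, \<xi>, \<eta>)) / g (z, \<xi>, \<eta>)"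
  unfolding rd(1) using a(2) by (simp add: diff_divide_distrib)
 have "df (\<lambda>a. f a - k * g a) (z, \<xi>, \<eta>) = (\<lambda>h. df f (z, \<xi>, \<eta>) h - k * df g (z, \<xi>, \<eta>) h)"
  by (rule df_eqI, rule has_derivative_diff[OF chol_df(1)[OF f a(1)] has_derivative_mult_right[OF chol_df(1)[OF g a(1)]]])
 then show "num_df (\<lambda>a. f a - k * g a) g (z, \<xi>, \<eta>) (1, p z * \<eta>, G z \<xi> \<eta>) = 0"
  using rd(2) unfolding num_df_def by (simp add: algebra_simps)
qed

text \<open>Initial forms at neighbouring points agree by stationarity, and D is connected.\<close>
theorem initial_form_global:
 assumes T: "T > 0" and rep: "!!z0. z0 \<in> D ==> \<exists>r f g. rep F z0 r f g"
 shows "(\<forall>z0\<in>D. near_zero F T z0) \<or> (\<exists>d c. quot_form T c \<and> (\<forall>z0\<in>D. near_small F T d c z0))"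
proof (cases "D = {}")
 case False
 define R where "R x y \<longleftrightarrow> (near_zero F T x \<and> near_zero F T y) \<or> (\<exists>d c. quot_form T c \<and> near_small F T d c x \<and> near_small F T d c y)" for x y
 have excl: False if nz: "near_zero F T x" and ns: "near_small F T d c x" for x d c
 proof -
  obtain r N where 1: "r > 0" "countable N" "\<forall>z\<in>ball x r - N. zero F z T" using nz unfolding near_zero_def by blast
  obtain r' N' where 2: "r' > 0" "countable N'" "\<forall>z\<in>ball x r' - N'. small F z T d c" using ns unfolding near_small_def by blast
  obtain z where "z \<in> ball x (min r r')" "z \<notin> N \<union> N'" using pick_ball[of "N \<union> N'" "min r r'" x] 1 2 by auto
  then have "small F z T d c" "zero F z T" using 1(3) 2(3) by auto
  then show False by (rule small_at_not_zero_at[OF _ _ T])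
 qed
 have uniq: "near_small F T d c y" if n: "near_small F T d c x" "near_small F T d' c' x" "near_small F T d' c' y" for x y d c d' c'
 proof -
  obtain r N where 1: "r > 0" "countable N" "\<forall>z\<in>ball x r - N. small F z T d c" using n(1) unfolding near_small_def by blast
  obtain r' N' where 2: "r' > 0" "countable N'" "\<forall>z\<in>ball x r' - N'. small F z T d' c'" using n(2) unfolding near_small_def by blast
  obtain z where z: "z \<in> ball x (min r r')" "z \<notin> N \<union> N'" using pick_ball[of "N \<union> N'" "min r r'" x] 1 2 by auto
  have s: "small F z T d c" "small F z T d' c'" using z 1 2 by auto
  obtain N2 where N2: "countable N2" "\<forall>t\<in>ball 0 T - N2. c' t = c t" using small_at_unique(2)[OF s(2,1) T] by blast
  have dd: "d' = d" using small_at_unique(1)[OF s(2,1) T] .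
  obtain r3 N3 where 3: "r3 > 0" "countable N3" "\<forall>z\<in>ball y r3 - N3. small F z T d' c'" using n(3) unfolding near_small_def by blast
  have "\<forall>z\<in>ball y r3 - N3. small F z T d c"
  proof
   fix w assume "w \<in> ball y r3 - N3"
   then have "small F w T d' c'" using 3(3) by blast
   then show "small F w T d c" unfolding dd by (rule small_cong[OF _ N2])
  qed
  then show ?thesis unfolding near_small_def using 3(1,2) by (intro exI conjI)
 qed
 have loc: "\<exists>U. openin (top_of_set D) U \<and> x \<in> U \<and> (\<forall>y\<in>U. R x y)" if x: "x \<in> D" for x
 proof -
  obtain r f g where rfg: "rep F x r f g" using rep[OF x] by blast
  then have r: "r > 0" "ball x r \<subseteq> D" unfolding rep_def by auto
  have xr: "x \<in> ball x r" using r by simp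
  show ?thesis
  proof (cases "\<forall>a\<in>ball x r \<times> ball 0 r \<times> ball 0 r. f a = 0")
   case True
   have nz: "near_zero F T y" if "y \<in> ball x r" for y
    using rep_zero[OF rfg T _ that] True unfolding near_zero_def by blast
   have "R x y" if "y \<in> ball x r" for y
    unfolding R_def using nz[OF xr] nz[OF that] by blast
   moreover have "openin (top_of_set D) (ball x r)"
    using r(2) by (simp add: openin_open_eq[OF D(1)])
   ultimately show ?thesis using xr by blast
  next
   case False
   then have fn: "\<exists>a\<in>ball x r \<times> ball 0 r \<times> ball 0 r. f a ~= 0" by blast
   from rep_nonzero[OF rfg T fn xr] show ?thesis
   proof (elim exE conjE)
    fix r' d a b N0
    assume *: "r' > 0" "ball x r' \<subseteq> ball x r" "a holomorphic_on ball 0 T" "b holomorphic_on ball 0 T" "countable {t\<in>ball 0 T. a t = 0}"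
    "countable {t\<in>ball 0 T. b t = 0}" "countable N0" "\<forall>z\<in>ball x r' - N0. small F z T d (\<lambda>t. a t / b t)"
   define c where "c = (\<lambda>t. a t / b t)"
   have q: "quot_form T c" unfolding quot_form_def c_def using *(3-6) by blast
   have ns: "near_small F T d c y" if y: "y \<in> ball x r'" for y
   proof -
    obtain r2 where "r2 > 0" "ball y r2 \<subseteq> ball x r'" using openE[OF open_ball y] by blast
    then show ?thesis using *(7,8) unfolding near_small_def c_def by blast
   qed
   have xr': "x \<in> ball x r'" using *(1) by simp
   have "R x y" if "y \<in> ball x r'" for y
    unfolding R_def using q ns[OF xr'] ns[OF that] by blast
   moreover have "openin (top_of_set D) (ball x r')"
    using *(2) r(2) by (simp add: openin_open_eq[OF D(1)] subset_trans)
   ultimately show ?thesis using xr' by blast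
   qed
  qed
 qed
 have RR: "R x y" if "x \<in> D" "y \<in> D" for x y
 proof (rule connected_equivalence_relation[OF D(2) that, of R])
  show "R y x" if "R x y" for x y using that unfolding R_def by blast
  show "R x z" if "R x y" "R y z" for x y z
   using that excl uniq unfolding R_def by blast
 qed (use loc in auto)
 obtain x where x: "x \<in> D" using False by blast
 show ?thesis
 proof (cases "near_zero F T x")
  case True
  have "near_zero F T y" if "y \<in> D" for y
   using RR[OF x that] True excl[OF True] unfolding R_def by (elim disjE exE conjE) auto
  then show ?thesis by simp
 next
  case False
  then obtain d c where dc: "quot_form T c" "near_small F T d c x" using RR[OF x x] unfolding R_def by (elim disjE exE conjE) auto
  have "near_small F T d c y" if "y \<in> D" for y
   using RR[OF x that] False uniq[OF dc(2)] unfolding R_def by (elim disjE exE conjE) auto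
  then show ?thesis using dc(1) by (intro disjI2 exI conjI ballI)
 qed
qed auto

end

section \<open>The monodromy argument\<close>

lemma factor_at_0:
 assumes "f holomorphic_on ball 0 T" "T > 0" "countable {t\<in>ball 0 T. f t = 0}"
 shows "\<exists>n g r. 0 < r \<and> r \<le> T \<and> g holomorphic_on ball 0 r \<and> (\<forall>w\<in>ball 0 r. f w = w ^ n * g w \<and> g w ~= 0)"
proof (cases "f 0 = 0")
 case False
 have "isCont f 0" using holomorphic_on_imp_continuous_on[OF assms(1)] assms(2) by (simp add: continuous_on_eq_continuous_at)
 then have "\<forall>\<^sub>F w in at 0. f w ~= 0" unfolding isCont_def by (rule tendsto_imp_eventually_ne) (rule False)
 then obtain r where r: "r > 0" "!!w. w ~= 0 ==> dist w 0 < r ==> f w ~= 0" unfolding eventually_at by auto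
 have "f w ~= 0" if "w \<in> ball 0 (min r T)" for w using r(2)[of w] False that by (cases "w = 0") auto
 moreover have "f holomorphic_on ball 0 (min r T)" by (rule holomorphic_on_subset[OF assms(1)]) auto
 ultimately show ?thesis using r(1) assms(2)
  by (intro exI[of _ 0] exI[of _ f] exI[of _ "min r T"]) auto
next
 case True
 obtain w where w: "w \<in> ball 0 T" "f w ~= 0" using pick_ball[OF assms(3,2), of 0] by auto
 have zT: "0 \<in> ball (0::complex) T" using assms(2) by simp
 have nc: "\<not> f constant_on ball 0 T" using w True assms(2) unfolding constant_on_def by (metis centre_in_ball)
 obtain g r n where g: "0 < n" "0 < r" "ball (0::complex) r \<subseteq> ball 0 T" "g holomorphic_on ball 0 r"
   "!!w. w \<in> ball 0 r ==> f w = (w - 0) ^ n * g w" "!!w. w \<in> ball 0 r ==> g w ~= 0"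
  by (rule holomorphic_factor_zero_nonconstant[OF assms(1) open_ball connected_ball zT True nc]) (rule that)
 have "r \<le> T" using g(2,3) by (simp add: ball_subset_ball_iff)
 then show ?thesis using g by (intro exI[of _ n] exI[of _ g] exI[of _ r]) auto
qed

lemma holomorphic_zero_off_countable:
 assumes "h holomorphic_on ball c r" "countable N" "!!t. t \<in> ball c r - N ==> h t = 0" "t \<in> ball c r"
 shows "h t = 0"
proof (rule ccontr)
 assume "h t ~= 0"
 then have "countable {z\<in>ball c r. h z = 0}" using countable_zeros[OF assms(1) open_ball connected_ball assms(4)] by blast
 then have "countable ({z\<in>ball c r. h z = 0} \<union> N)" using assms(2) by auto
 moreover have "ball c r \<subseteq> {z\<in>ball c r. h z = 0} \<union> N" using assms(3) by auto
 ultimately show False using uncountable_ball[of r c] countable_subset assms(4) by (metis ball_eq_empty empty_iff not_le)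
qed

text \<open>Divide by the power of t given by the order at 0. What remains is nonzero at 0 and invariant under a contraction, hence constant, by continuity at 0.\<close>
lemma monomial_of_scaling:
 fixes c :: "complex => complex"
 assumes q: "quot_form T c" and T: "T > 0" and \<mu>: "norm \<mu> < 1" "\<mu> ~= 0" and N: "countable N"
  and eq: "!!t. t \<in> ball 0 T - N ==> c t ~= 0 \<and> c t = K * c (\<mu> * t)"
 shows "\<exists>C n N'. C ~= 0 \<and> countable N' \<and> (\<forall>t\<in>ball 0 T - N'. t ~= 0 \<and> c t = C * t powi n) \<and> K * \<mu> powi n = 1"
proof -
 obtain a b where ab: "a holomorphic_on ball 0 T" "b holomorphic_on ball 0 T" "countable {t\<in>ball 0 T. a t = 0}"
   "countable {t\<in>ball 0 T. b t = 0}" "c = (\<lambda>t. a t / b t)" using q unfolding quot_form_def by blast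
 obtain i ga ra where ga: "0 < ra" "ra \<le> T" "ga holomorphic_on ball 0 ra" "!!w. w\<in>ball 0 ra ==> a w = w ^ i * ga w \<and> ga w ~= 0"
  using factor_at_0[OF ab(1) T ab(3)] by blast
 obtain j gb rb where gb: "0 < rb" "rb \<le> T" "gb holomorphic_on ball 0 rb" "!!w. w\<in>ball 0 rb ==> b w = w ^ j * gb w \<and> gb w ~= 0"
  using factor_at_0[OF ab(2) T ab(4)] by blast
 define r where "r = min ra rb"
 have r: "r > 0" "r \<le> T" "r \<le> ra" "r \<le> rb" using ga gb unfolding r_def by auto
 define h where "h w = ga w / gb w" for w
 define n where "n = int i - int j"
 have hh: "h holomorphic_on ball 0 r"
  unfolding h_def by (intro holomorphic_intros holomorphic_on_subset[OF ga(3)] holomorphic_on_subset[OF gb(3)]) (use gb(4) r in auto)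
 have cw: "c w = w powi n * h w" if "w \<in> ball 0 r" "w ~= 0" for w
  using ga(4)[of w] gb(4)[of w] that r unfolding ab(5) h_def n_def by (simp add: power_int_diff)
 define \<kappa> where "\<kappa> = K * \<mu> powi n"
 have scale: "\<mu> * w \<in> ball 0 r" if "w \<in> ball 0 r" for w
 proof -
  have "norm (\<mu> * w) \<le> 1 * norm w" unfolding norm_mult using \<mu>(1) by (intro mult_right_mono) auto
  then show ?thesis using that by simp
 qed
 have hs: "(\<lambda>w. h (\<mu> * w)) holomorphic_on ball 0 r"
 proof -
  have "(h \<circ> (\<lambda>w. \<mu> * w)) holomorphic_on ball 0 r"
   by (rule holomorphic_on_compose_gen[OF _ hh]) (use scale in \<open>auto intro!: holomorphic_intros\<close>)
  then show ?thesis by (simp add: o_def)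
 qed
 have h\<kappa>: "h w - \<kappa> * h (\<mu> * w) = 0" if w: "w \<in> ball 0 r" for w
 proof (rule holomorphic_zero_off_countable[OF _ _ _ w])
  show "(\<lambda>w. h w - \<kappa> * h (\<mu> * w)) holomorphic_on ball 0 r" by (intro holomorphic_intros hh hs)
  show "countable (insert 0 N)" using N by simp
  fix t assume t: "t \<in> ball 0 r - insert 0 N"
  have "c t = K * c (\<mu> * t)" using eq[of t] t r by auto
  then have "t powi n * h t = K * ((\<mu> * t) powi n * h (\<mu> * t))"
   using cw[of t] cw[of "\<mu> * t"] scale[of t] t \<mu>(2) by auto
  then have "t powi n * h t = t powi n * (\<kappa> * h (\<mu> * t))" unfolding \<kappa>_def power_int_mult_distrib by (simp add: mult_ac)
  then show "h t - \<kappa> * h (\<mu> * t) = 0" using t by simp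
 qed
 have h0: "h 0 ~= 0" unfolding h_def using ga(4)[of 0] gb(4)[of 0] ga(1) gb(1) by simp
 have \<kappa>1: "\<kappa> = 1" using h\<kappa>[of 0] r(1) h0 by simp
 have hc: "h w = h 0" if w: "w \<in> ball 0 r" for w
 proof -
  have it: "\<mu> ^ m * w \<in> ball 0 r \<and> h (\<mu> ^ m * w) = h w" for m
  proof (induction m)
   case (Suc m)
   then show ?case using scale[of "\<mu> ^ m * w"] h\<kappa>[of "\<mu> ^ m * w"] \<kappa>1 by (simp add: mult.assoc)
  qed (use w in simp)
  have "(\<lambda>m. \<mu> ^ m * w) \<longlonglongrightarrow> 0 * w" by (intro tendsto_intros LIMSEQ_power_zero \<mu>)
  moreover have "isCont h 0" using holomorphic_on_imp_continuous_on[OF hh] r(1) by (simp add: continuous_on_eq_continuous_at)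
  ultimately have "(\<lambda>m. h (\<mu> ^ m * w)) \<longlonglongrightarrow> h 0" by (intro isCont_tendsto_compose[of 0 h]) auto
  then have "(\<lambda>m::nat. h w) \<longlonglongrightarrow> h 0" using it by simp
  then show ?thesis by (simp add: LIMSEQ_const_iff)
 qed
 have id: "a t * t ^ j = h 0 * (t ^ i * b t)" if "t \<in> ball 0 T" for t
 proof (rule analytic_continuation_open[where s = "ball 0 r" and s' = "ball 0 T" and f = "\<lambda>t. a t * t ^ j" and g = "\<lambda>t. h 0 * (t ^ i * b t)"])
  show "(\<lambda>t. a t * t ^ j) holomorphic_on ball 0 T" "(\<lambda>t. h 0 * (t ^ i * b t)) holomorphic_on ball 0 T"
   by (intro holomorphic_intros ab)+
  show "a z * z ^ j = h 0 * (z ^ i * b z)" if z: "z \<in> ball 0 r" for z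
  proof -
   have "a z = z ^ i * ga z" "b z = z ^ j * gb z" "gb z ~= 0" using ga(4)[of z] gb(4)[of z] z r by auto
   moreover have "ga z = h 0 * gb z" using hc[OF z] calculation(3) unfolding h_def[of z] by (simp add: field_simps)
   ultimately show ?thesis by (simp add: mult_ac)
  qed
  show "ball 0 r \<subseteq> ball (0::complex) T" using r(2) by (rule subset_ball)
 qed (use r that in auto)
 define N' where "N' = insert 0 {t\<in>ball 0 T. b t = 0}"
 have "t ~= 0 \<and> c t = h 0 * t powi n" if t: "t \<in> ball 0 T - N'" for t
 proof -
  have t': "t \<in> ball 0 T" "t ~= 0" "b t ~= 0" using t unfolding N'_def by auto
  have "a t = h 0 * (t powi n) * b t"
   using id[OF t'(1)] t'(2) unfolding n_def by (simp add: power_int_diff field_simps)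
  then show ?thesis using t' unfolding ab(5) by simp
 qed
 moreover have "countable N'" unfolding N'_def using ab(4) by simp
 ultimately show ?thesis using h0 \<kappa>1 unfolding \<kappa>_def by (intro exI[of _ "h 0"] exI[of _ n] exI[of _ N']) auto
qed

lemma limit_rescale:
 assumes "((\<lambda>eps. h eps * eps powi (- d)) \<longlongrightarrow> c) (at 0)" "w ~= (0::complex)"
 shows "((\<lambda>eps. h (eps * w) * eps powi (- d)) \<longlongrightarrow> w powi d * c) (at 0)"
proof -
 have "filterlim (\<lambda>eps. eps * w) (at 0) (at 0)"
  unfolding filterlim_at using assms(2) by (auto simp: eventually_at intro!: tendsto_eq_intros exI[of _ 1])
 then have "((\<lambda>eps. h (eps * w) * (eps * w) powi (- d)) \<longlongrightarrow> c) (at 0)" by (rule filterlim_compose[OF assms(1)])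
 then have "((\<lambda>eps. w powi d * (h (eps * w) * (eps * w) powi (- d))) \<longlongrightarrow> w powi d * c) (at 0)" by (rule tendsto_mult_left)
 moreover have "w powi d * (h (eps * w) * (eps * w) powi (- d)) = h (eps * w) * eps powi (- d)" for eps
  using assms(2) by (simp add: power_int_mult_distrib power_int_minus)
 ultimately show ?thesis by simp
qed

text \<open>Taking n-th roots, the quadratic polynomial Q t = (t * r11 + r21) * (t * r12 + r22) is a constant multiple of t: the quotient takes finitely many values. The second difference of Q is a multiple of r11 * r12, that of a linear function vanishes.\<close>
lemma monomial_substitution:
 assumes n: "n ~= (0::int)" and C: "C ~= 0" "C' ~= 0" and r: "\<rho> > 0" and N: "countable N"
  and eq: "!!t. t \<in> ball t1 \<rho> - N ==> t ~= 0 \<and> C' * t powi n = C * ((t * r11 + r21) * (t * r12 + r22)) powi n"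
 shows "r11 * r12 = (0::complex)"
proof -
 define Q where "Q t = (t * r11 + r21) * (t * r12 + r22)" for t
 obtain t2 where t2: "t2 \<in> ball t1 \<rho>" "t2 ~= 0" using pick_ball[of "{0}" \<rho> t1] r by auto
 obtain e where e: "e > 0" "ball t2 e \<subseteq> ball t1 \<rho> - {0}"
  using openE[of "ball t1 \<rho> - {0}" t2] t2 by (auto intro: open_Diff)
 have tnz: "t ~= 0" if "t \<in> ball t2 e" for t using e(2) that by blast
 define h where "h t = Q t / t" for t
 have hh: "h holomorphic_on ball t2 e" unfolding h_def Q_def by (intro holomorphic_intros) (use tnz in auto)
 define S where "S = {w::complex. w ^ nat \<bar>n\<bar> = C' / C} \<union> {w. w ^ nat \<bar>n\<bar> = C / C'}"
 have "finite S" unfolding S_def using finite_roots_unity n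
  by (intro finite_UnI) (rule finite_nth_roots; use n in simp)+
 moreover have inS: "h t \<in> S" if "t \<in> ball t2 e - N" for t
 proof -
  have "t \<in> ball t1 \<rho> - N" using that e by auto
  from eq[OF this] have t: "t ~= 0" "C' * t powi n = C * Q t powi n" unfolding Q_def by auto
  have "h t powi n = C' / C" unfolding h_def power_int_divide_distrib using t C by (simp add: field_simps)
  then show ?thesis unfolding S_def power_int_def using n C
   by (cases "n \<ge> 0") (auto simp: field_simps)
 qed
 ultimately have "h constant_on ball t2 e"
 proof -
  assume S: "finite S"
  obtain t3 where t3: "t3 \<in> ball t2 e - N" using pick_ball[OF N e(1), of t2] by auto
  show ?thesis
  proof (rule ccontr)
   assume nc: "\<not> h constant_on ball t2 e"
   have "countable {t\<in>ball t2 e. h t - w = 0}" for w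
   proof -
    have "\<exists>z\<in>ball t2 e. h z - w ~= 0" using nc unfolding constant_on_def by auto
    then obtain z where z: "z \<in> ball t2 e" "h z - w ~= 0" by blast
    show ?thesis by (rule countable_zeros[where h = "\<lambda>t. h t - w", OF _ open_ball connected_ball z]) (intro holomorphic_intros hh)
   qed
   then have "countable (N \<union> (\<Union>w\<in>S. {t\<in>ball t2 e. h t - w = 0}))"
    using N countable_finite[OF S] by auto
   moreover have "ball t2 e \<subseteq> N \<union> (\<Union>w\<in>S. {t\<in>ball t2 e. h t - w = 0})" using inS by (simp add: subset_iff) blast
   ultimately show False using uncountable_ball[OF e(1)] countable_subset by blast
  qed
 qed
 then obtain \<kappa> where \<kappa>: "!!t. t \<in> ball t2 e ==> h t = \<kappa>" unfolding constant_on_def by blast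
 have Qk: "Q t = \<kappa> * t" if "t \<in> ball t2 e" for t using \<kappa>[OF that] e that unfolding h_def by (auto simp: field_simps)
 define \<delta> where "\<delta> = complex_of_real (e/2)"
 have "Q (t2 + \<delta>) + Q (t2 - \<delta>) - 2 * Q t2 = 2 * (r11 * r12) * \<delta>^2" unfolding Q_def by (simp add: power2_eq_square algebra_simps)
 moreover have "Q (t2 + \<delta>) + Q (t2 - \<delta>) - 2 * Q t2 = 0"
  using Qk[of "t2 + \<delta>"] Qk[of "t2 - \<delta>"] Qk[of t2] e(1) by (simp add: \<delta>_def dist_norm algebra_simps)
 ultimately show ?thesis using e(1) by (simp add: \<delta>_def)
qed

text \<open>The half plane is the universal covering, by exp, of the punctured unit disc around the singular point 0 of the variational equation.\<close>
definition D1 :: "complex set" where "D1 = {\<tau>. Re \<tau> < 0}"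
text \<open>The punctured disc in z, where z ^ 2 = 1 - exp \<tau>, is a double covering of a neighbourhood of the singular point 1.\<close>
definition D2 :: "complex set" where "D2 = ball 0 1 - {0}"

context linear_system
begin

lemma near_smallE:
 assumes "near_small F T d c z0"
 obtains r N where "r > 0" "countable N" "!!z. z \<in> ball z0 r - N ==> small F z T d c"
 using assms unfolding near_small_def by (elim exE conjE) (rule that, assumption+, rule bspec)

lemma near_zeroE:
 assumes "near_zero F T z0"
 obtains r N where "r > 0" "countable N" "!!z. z \<in> ball z0 r - N ==> zero F z T"
 using assms unfolding near_zero_def by (elim exE conjE) (rule that, assumption+, rule bspec)

end

text \<open>One variational equation on two domains. The translation by per is the loop around the first singular point and acts diagonally on the solutions; the map z to - z is the loop around the second one, with the matrix r. The domains are glued along zz.\<close>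
locale monodromy =
 A: linear_system D1 p1 q1 s1 \<psi>1 \<psi>1' \<psi>2 \<psi>2' G1 + Bs: linear_system D2 p2 q2 s2 \<Psi>1 \<Psi>1' \<Psi>2 \<Psi>2' G2
 for p1 q1 s1 \<psi>1 \<psi>1' \<psi>2 \<psi>2' G1 p2 q2 s2 \<Psi>1 \<Psi>1' \<Psi>2 \<Psi>2' G2 +
 fixes lam :: real and per :: complex and r11 r12 r21 r22 :: complex and \<tau>0 :: complex and \<rho> :: real and zz :: "complex => complex"
 assumes lam: "0 < lam" "lam < 1" and per: "Re per = 0"
  and mono: "!!\<tau>. \<tau> \<in> D1 ==> \<psi>1 (\<tau> + per) = lam * \<psi>1 \<tau> \<and> \<psi>1' (\<tau> + per) = lam * \<psi>1' \<tau> \<and>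
    \<psi>2 (\<tau> + per) = \<psi>2 \<tau> / lam \<and> \<psi>2' (\<tau> + per) = \<psi>2' \<tau> / lam"
  and r12: "r12 ~= 0" and r11: "r11 ~= 0"
  and flip: "!!z. z \<in> D2 ==> \<Psi>1 z = r11 * \<Psi>1 (- z) + r12 * \<Psi>2 (- z) \<and> \<Psi>1' z = r11 * \<Psi>1' (- z) + r12 * \<Psi>2' (- z) \<and>
    \<Psi>2 z = r21 * \<Psi>1 (- z) + r22 * \<Psi>2 (- z) \<and> \<Psi>2' z = r21 * \<Psi>1' (- z) + r22 * \<Psi>2' (- z)"
  and \<rho>: "\<rho> > 0" "ball \<tau>0 \<rho> \<subseteq> D1"
  and zz: "inj_on zz (ball \<tau>0 \<rho>)" "zz holomorphic_on ball \<tau>0 \<rho>" "!!\<tau>. \<tau> \<in> ball \<tau>0 \<rho> ==> zz \<tau> \<in> D2"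
  and match: "!!\<tau>. \<tau> \<in> ball \<tau>0 \<rho> ==> \<psi>1 \<tau> = \<Psi>1 (zz \<tau>) \<and> \<psi>1' \<tau> = \<Psi>1' (zz \<tau>) \<and> \<psi>2 \<tau> = \<Psi>2 (zz \<tau>) \<and> \<psi>2' \<tau> = \<Psi>2' (zz \<tau>)"
begin

text \<open>A first integral, restricted to an energy level, seen on the two sheets over the half plane (the two directions in which a geodesic is traversed) and on the punctured disc that joins them.\<close>
definition triple :: "(c3 => complex) => (c3 => complex) => (c3 => complex) => bool" where
 "triple Fp Fm F2 \<longleftrightarrow> (\<forall>z\<in>D1. \<exists>r f g. A.rep Fp z r f g) \<and> (\<forall>z\<in>D1. \<exists>r f g. A.rep Fm z r f g) \<and> (\<forall>z\<in>D2. \<exists>r f g. Bs.rep F2 z r f g) \<and>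
  (\<forall>\<tau>\<in>D1. \<forall>\<xi> \<eta>. Fp (\<tau> + per, \<xi>, \<eta>) = Fp (\<tau>, \<xi>, \<eta>) \<and> Fm (\<tau> + per, \<xi>, \<eta>) = Fm (\<tau>, \<xi>, \<eta>)) \<and>
  (\<forall>\<tau>\<in>ball \<tau>0 \<rho>. \<forall>\<xi> \<eta>. Fp (\<tau>, \<xi>, \<eta>) = F2 (zz \<tau>, \<xi>, \<eta>) \<and> Fm (\<tau>, \<xi>, \<eta>) = F2 (- zz \<tau>, \<xi>, \<eta>))"

lemma per_D1: "\<tau> \<in> D1 ==> \<tau> + per \<in> D1" using per by (simp add: D1_def)
lemma neg_D2: "z \<in> D2 ==> - z \<in> D2" by (auto simp: D2_def)
lemma \<tau>0_D1: "\<tau>0 \<in> D1" "\<tau>0 \<in> ball \<tau>0 \<rho>" using \<rho> by auto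

text \<open>The loop multiplies the first solution by lam and the second one by 1 / lam, so the direction t becomes lam ^ 2 * t after rescaling of eps. Since the function is periodic, its initial form is scaled into itself. The degree d is twice the exponent because the product of the two solutions is unchanged.\<close>
lemma periodic_monomial:
 assumes T: "T > 0" and q: "quot_form T c" and ns: "\<forall>z\<in>D1. A.near_small F T d c z"
  and pF: "\<forall>\<tau>\<in>D1. \<forall>\<xi> \<eta>. F (\<tau> + per, \<xi>, \<eta>) = F (\<tau>, \<xi>, \<eta>)"
 shows "\<exists>C n N. C ~= 0 \<and> countable N \<and> (\<forall>t\<in>ball 0 T - N. t ~= 0 \<and> c t = C * t powi n) \<and> d = 2 * n"
proof -
 obtain ra Na where a: "ra > 0" "countable Na" "\<forall>z\<in>ball \<tau>0 ra - Na. A.small F z T d c"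
  using ns \<tau>0_D1(1) unfolding A.near_small_def by blast
 obtain rb Nb where b: "rb > 0" "countable Nb" "\<forall>z\<in>ball (\<tau>0 + per) rb - Nb. A.small F z T d c"
  using ns per_D1[OF \<tau>0_D1(1)] unfolding A.near_small_def by blast
 have cN: "countable (Na \<union> (\<lambda>z. z - per) ` Nb)" using a(2) b(2) by auto
 obtain \<tau> where t: "\<tau> \<in> ball \<tau>0 (min (min ra rb) \<rho>)" "\<tau> \<notin> Na \<union> (\<lambda>z. z - per) ` Nb"
  using pick_ball[OF cN, of "min (min ra rb) \<rho>" \<tau>0] a(1) b(1) \<rho>(1) by auto
 have tD: "\<tau> \<in> D1" using t(1) \<rho>(2) by auto
 have 1: "A.small F \<tau> T d c" using a(3) t by auto
 have "\<tau> + per \<in> ball (\<tau>0 + per) rb" using t(1) by (auto simp: dist_norm)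
 moreover have "\<tau> + per \<notin> Nb" using t(2) by (force simp: image_iff)
 ultimately have 2: "A.small F (\<tau> + per) T d c" using b(3) by auto
 define h where "h x eps = F (\<tau>, eps * (x * \<psi>1 \<tau> + \<psi>2 \<tau>), eps * (x * \<psi>1' \<tau> + \<psi>2' \<tau>))" for x eps
 obtain N1 where N1: "countable N1" "!!t. t \<in> ball 0 T - N1 ==> c t ~= 0 \<and> ((\<lambda>eps. h t eps * eps powi (- d)) \<longlongrightarrow> c t) (at 0)"
  using 1 unfolding small_at_def h_def by blast
 have h2: "F (\<tau> + per, eps * (t * \<psi>1 (\<tau> + per) + \<psi>2 (\<tau> + per)), eps * (t * \<psi>1' (\<tau> + per) + \<psi>2' (\<tau> + per)))
   = h (lam^2 * t) (eps * (1 / lam))" for t eps :: complex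
 proof -
  have l: "complex_of_real lam ~= 0" using lam by simp
  have "eps * (t * (lam * x) + y / lam) = eps * (1 / lam) * (lam^2 * t * x + y)" for x y :: complex
   using l by (simp add: field_simps power2_eq_square)
  then show ?thesis using pF tD mono[OF tD] unfolding h_def by simp
 qed
 obtain N2 where N2': "countable N2" "\<forall>t\<in>ball 0 T - N2. c t ~= 0 \<and> ((\<lambda>eps. F (\<tau> + per, eps * (t * \<psi>1 (\<tau> + per) + \<psi>2 (\<tau> + per)), eps * (t * \<psi>1' (\<tau> + per) + \<psi>2' (\<tau> + per))) * eps powi (- d)) \<longlongrightarrow> c t) (at 0)"
  using 2 unfolding small_at_def by (elim exE conjE) (rule that)
 have N2: "countable N2" "!!t::complex. t \<in> ball 0 T - N2 ==> c t ~= 0 \<and> ((\<lambda>eps::complex. h (of_real (lam^2) * t) (eps * of_real (1 / lam)) * eps powi (- d)) \<longlongrightarrow> c t) (at 0)"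
  using N2'(1) N2'(2)[unfolded h2] by (simp, blast)
 define N where "N = N1 \<union> N2 \<union> (\<lambda>x. x / lam^2) ` N1"
 have l2: "complex_of_real (lam^2) ~= 0" "norm (complex_of_real (lam^2)) < 1"
  using lam by (auto simp: power_less_one_iff norm_power abs_square_less_1)
 have rel: "c t ~= 0 \<and> c t = of_real (1 / lam) powi d * c (of_real (lam^2) * t)" if t: "t \<in> ball 0 T - N" for t
 proof -
  have t12: "t \<in> ball 0 T - N1" "t \<in> ball 0 T - N2" using t unfolding N_def by auto
  have "norm (of_real (lam^2) * t) \<le> 1 * norm t" unfolding norm_mult using l2(2) by (intro mult_right_mono) auto
  moreover have "of_real (lam^2) * t \<notin> N1"
  proof
   assume "of_real (lam^2) * t \<in> N1"
   then have "(of_real (lam^2) * t) / lam^2 \<in> (\<lambda>x. x / lam^2) ` N1" by (rule imageI)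
   moreover have "(of_real (lam^2) * t) / lam^2 = t" using l2(1) by simp
   ultimately show False using t unfolding N_def by auto
  qed
  ultimately have t3: "of_real (lam^2) * t \<in> ball 0 T - N1" using t12 by auto
  have "((\<lambda>eps. h (of_real (lam^2) * t) (eps * of_real (1 / lam)) * eps powi (- d)) \<longlongrightarrow> of_real (1 / lam) powi d * c (of_real (lam^2) * t)) (at 0)"
   by (rule limit_rescale) (use N1(2)[OF t3] lam in auto)
  moreover have "((\<lambda>eps. h (of_real (lam^2) * t) (eps * of_real (1 / lam)) * eps powi (- d)) \<longlongrightarrow> c t) (at 0)"
   using N2(2)[OF t12(2)] by simp
  ultimately show ?thesis using N2(2)[OF t12(2)] tendsto_unique[OF at_neq_bot] by blast
 qed
 have "countable N" unfolding N_def using N1(1) N2(1) by auto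
 from monomial_of_scaling[OF q T l2(2,1) this rel] obtain C n N' where *: "C ~= 0" "countable N'" "\<forall>t\<in>ball 0 T - N'. t ~= 0 \<and> c t = C * t powi n"
  "of_real (1 / lam) powi d * complex_of_real (lam^2) powi n = 1" by blast
 have "d = 2 * n"
 proof -
  have l0: "complex_of_real lam ~= 0" using lam by simp
  have "of_real (lam powi (2 * n - d)) = (1 / complex_of_real lam) powi d * of_real (lam^2) powi n"
   using l0 by (simp add: power_int_diff power_int_mult power_int_divide_distrib)
  then have "complex_of_real (lam powi (2 * n - d)) = of_real 1" using *(4) by (simp add: of_real_divide)
  then have "lam powi (2 * n - d) = 1" by (simp only: of_real_eq_iff)
  then have "2 * n - d = 0"
  proof -
   assume e: "lam powi (2 * n - d) = 1"
   have "of_int (2 * n - d) * ln lam = ln (lam powr of_int (2 * n - d))" using lam by (simp add: ln_powr)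
   also have "\<dots> = 0" using powr_real_of_int'[of lam "2 * n - d"] lam e by simp
   finally show ?thesis using lam ln_less_zero[of lam] by (simp del: of_int_diff)
  qed
  then show ?thesis by simp
 qed
 then show ?thesis using * by blast
qed

text \<open>A point that is generic on all three domains at once.\<close>
lemma pick_\<tau>:
 assumes "r1 > 0" "countable N1" "r2 > 0" "countable N2" "r3 > 0" "countable N3"
 shows "\<exists>\<tau>\<in>ball \<tau>0 \<rho>. \<tau> \<in> ball \<tau>0 r1 - N1 \<and> zz \<tau> \<in> ball (zz \<tau>0) r2 - N2 \<and> - zz \<tau> \<in> ball (- zz \<tau>0) r3 - N3"
proof -
 have "isCont zz \<tau>0" using holomorphic_on_imp_continuous_on[OF zz(2)] \<tau>0_D1(2) by (simp add: continuous_on_eq_continuous_at)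
 then obtain e where e: "e > 0" "!!x. dist x \<tau>0 < e ==> dist (zz x) (zz \<tau>0) < min r2 r3"
  unfolding continuous_at_eps_delta using assms(1,3,5) by (metis min_less_iff_conj)
 define A where "A = {\<tau>\<in>ball \<tau>0 \<rho>. zz \<tau> \<in> N2 \<union> uminus ` N3}"
 have "countable A"
 proof (rule countable_image_inj_on)
  show "countable (zz ` A)" by (rule countable_subset[of _ "N2 \<union> uminus ` N3"]) (use assms in \<open>auto simp: A_def\<close>)
  show "inj_on zz A" by (rule inj_on_subset[OF zz(1)]) (auto simp: A_def)
 qed
 then obtain \<tau> where t: "\<tau> \<in> ball \<tau>0 (min (min e r1) \<rho>)" "\<tau> \<notin> A \<union> N1"
  using pick_ball[of "A \<union> N1" "min (min e r1) \<rho>" \<tau>0] e(1) assms \<rho>(1) by auto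
 have "dist (zz \<tau>) (zz \<tau>0) < min r2 r3" by (rule e(2)) (use t in \<open>auto simp: dist_commute\<close>)
 moreover have "zz \<tau> \<notin> N2" "- zz \<tau> \<notin> N3" using t unfolding A_def by (auto simp: image_iff)
 ultimately show ?thesis using t by (intro bexI[of _ \<tau>]) (auto simp: dist_commute dist_norm norm_minus_commute)
qed

text \<open>On both sheets the initial form is a monomial in t. The matrix r transports one into the other, which is possible only for exponent 0 because neither r11 nor r12 vanishes.\<close>
lemma initial_form_constant:
 assumes tr: "triple Fp Fm F2" and T: "norm t1 < T" "norm ((t1 * r11 + r21) / (t1 * r12 + r22)) < T" and t1: "t1 * r12 + r22 ~= 0"
 shows "(\<forall>z\<in>D1. A.near_zero Fp T z) \<or> (\<exists>C. C ~= 0 \<and> (\<forall>z\<in>D1. A.near_small Fp T 0 (\<lambda>_. C) z))"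
proof -
 have T0: "T > 0" using T(1) norm_ge_zero[of t1] by linarith
 have reps: "!!z. z\<in>D1 ==> \<exists>r f g. A.rep Fp z r f g" "!!z. z\<in>D1 ==> \<exists>r f g. A.rep Fm z r f g" "!!z. z\<in>D2 ==> \<exists>r f g. Bs.rep F2 z r f g"
  and perF: "\<forall>\<tau>\<in>D1. \<forall>\<xi> \<eta>. Fp (\<tau> + per, \<xi>, \<eta>) = Fp (\<tau>, \<xi>, \<eta>)" "\<forall>\<tau>\<in>D1. \<forall>\<xi> \<eta>. Fm (\<tau> + per, \<xi>, \<eta>) = Fm (\<tau>, \<xi>, \<eta>)"
  and glue: "!!\<tau> \<xi> \<eta>. \<tau>\<in>ball \<tau>0 \<rho> ==> Fp (\<tau>, \<xi>, \<eta>) = F2 (zz \<tau>, \<xi>, \<eta>)" "!!\<tau> \<xi> \<eta>. \<tau>\<in>ball \<tau>0 \<rho> ==> Fm (\<tau>, \<xi>, \<eta>) = F2 (- zz \<tau>, \<xi>, \<eta>)"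
  using tr unfolding triple_def by simp_all
 have zz0: "zz \<tau>0 \<in> D2" "- zz \<tau>0 \<in> D2" using zz(3) \<tau>0_D1(2) neg_D2 by auto
 show ?thesis
 proof (cases "\<forall>z\<in>D1. A.near_zero Fp T z")
  case False
  then obtain d c where c: "quot_form T c" "\<forall>z\<in>D1. A.near_small Fp T d c z"
   using A.initial_form_global[OF T0 reps(1)] by blast
  obtain C n N where Cn: "C ~= 0" "countable N" "\<forall>t\<in>ball 0 T - N. t ~= 0 \<and> c t = C * t powi n" "d = 2 * n"
   using periodic_monomial[OF T0 c perF(1)] by (elim exE conjE) (rule that)
  show ?thesis
  proof (cases "n = 0")
   case True
   have "A.near_small Fp T 0 (\<lambda>_. C) z" if zD: "z \<in> D1" for z
   proof -
    obtain r N' where 1: "r > 0" "countable N'" "\<forall>z\<in>ball z r - N'. A.small Fp z T d c" using c(2)[rule_format, OF zD] unfolding A.near_small_def by (elim exE conjE) (rule that)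
    have "A.small Fp w T 0 (\<lambda>_. C)" if "w \<in> ball z r - N'" for w
     
    proof -
     have "A.small Fp w T d c" using 1(3) that by blast
     then have "A.small Fp w T d (\<lambda>_. C)"
      by (rule A.small_cong[OF _ Cn(2)]) (use Cn(1,3) True in simp)
     then show ?thesis using Cn(4) True by simp
    qed
    then show ?thesis unfolding A.near_small_def using 1 by blast
   qed
   then show ?thesis using Cn(1) by blast
  next
   case n: False
   obtain ra Na where a: "ra > 0" "countable Na" "!!z. z\<in>ball \<tau>0 ra - Na ==> A.small Fp z T d c"
    by (rule A.near_smallE[OF c(2)[rule_format, OF \<tau>0_D1(1)]]) blast
   have eqF: "small_at Fp \<tau> y1 y1' y2 y2' T d c = small_at F2 (zz \<tau>) y1 y1' y2 y2' T d c" if "\<tau> \<in> ball \<tau>0 \<rho>" for \<tau> y1 y1' y2 y2' d c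
    unfolding small_at_def glue(1)[OF that] ..
   \<comment> \<open>The sheet meets the punctured disc in zz \<tau>, where both functions have the same values and the same solutions.\<close>
   have "\<not> (\<forall>z\<in>D2. Bs.near_zero F2 T z)"
   proof
    assume "\<forall>z\<in>D2. Bs.near_zero F2 T z"
    then have "Bs.near_zero F2 T (zz \<tau>0)" using zz0(1) by blast
    then obtain rb Nb where b: "rb > 0" "countable Nb" "!!z. z\<in>ball (zz \<tau>0) rb - Nb ==> Bs.zero F2 z T"
     by (rule Bs.near_zeroE) blast
    obtain \<tau> where t: "\<tau> \<in> ball \<tau>0 \<rho>" "\<tau> \<in> ball \<tau>0 ra - Na" "zz \<tau> \<in> ball (zz \<tau>0) rb - Nb"
     using pick_\<tau>[OF a(1,2) b(1,2) zero_less_one, of "{}"] by auto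
    have "small_at F2 (zz \<tau>) (\<psi>1 \<tau>) (\<psi>1' \<tau>) (\<psi>2 \<tau>) (\<psi>2' \<tau>) T d c" using a(3)[OF t(2)] eqF[OF t(1)] by simp
    moreover have "zero_at F2 (zz \<tau>) (\<psi>1 \<tau>) (\<psi>1' \<tau>) (\<psi>2 \<tau>) (\<psi>2' \<tau>) T" using b(3)[OF t(3)] match[OF t(1)] by simp
    ultimately show False by (rule small_at_not_zero_at[OF _ _ T0])
   qed
   then obtain d2 c2 where c2: "\<forall>z\<in>D2. Bs.near_small F2 T d2 c2 z"
    using Bs.initial_form_global[OF T0 reps(3)] by blast
   obtain rb Nb where b: "rb > 0" "countable Nb" "!!z. z\<in>ball (zz \<tau>0) rb - Nb ==> Bs.small F2 z T d2 c2"
    by (rule Bs.near_smallE[OF c2[rule_format, OF zz0(1)]]) blast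
   obtain rc Nc where cc: "rc > 0" "countable Nc" "!!z. z\<in>ball (- zz \<tau>0) rc - Nc ==> Bs.small F2 z T d2 c2"
    by (rule Bs.near_smallE[OF c2[rule_format, OF zz0(2)]]) blast
   have "d = d2 \<and> (\<exists>N. countable N \<and> (\<forall>t\<in>ball 0 T - N. c t = c2 t))"
   proof -
    obtain \<tau> where t: "\<tau> \<in> ball \<tau>0 \<rho>" "\<tau> \<in> ball \<tau>0 ra - Na" "zz \<tau> \<in> ball (zz \<tau>0) rb - Nb"
     using pick_\<tau>[OF a(1,2) b(1,2) zero_less_one, of "{}"] by auto
    have 1: "small_at F2 (zz \<tau>) (\<psi>1 \<tau>) (\<psi>1' \<tau>) (\<psi>2 \<tau>) (\<psi>2' \<tau>) T d c" using a(3)[OF t(2)] eqF[OF t(1)] by simp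
    have 2: "small_at F2 (zz \<tau>) (\<psi>1 \<tau>) (\<psi>1' \<tau>) (\<psi>2 \<tau>) (\<psi>2' \<tau>) T d2 c2" using b(3)[OF t(3)] match[OF t(1)] by simp
    show ?thesis using small_at_unique[OF 1 2 T0] by blast
   qed
   then obtain Nd where d2: "d2 = d" and Nd: "countable Nd" "\<forall>t\<in>ball 0 T - Nd. c t = c2 t" by blast
   \<comment> \<open>The other sheet meets it in - zz \<tau>. There r rewrites the solution in direction t as w t times the one in direction m t.\<close>
   define w where "w t = t * r12 + r22" for t
   define m where "m t = (t * r11 + r21) / w t" for t
   have det: "r11 * r22 - r12 * r21 ~= 0"
   proof
    assume "r11 * r22 - r12 * r21 = 0"
    moreover have "\<Psi>1 (zz \<tau>0) * \<Psi>2' (zz \<tau>0) - \<Psi>2 (zz \<tau>0) * \<Psi>1' (zz \<tau>0)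
     = (r11 * r22 - r12 * r21) * (\<Psi>1 (- zz \<tau>0) * \<Psi>2' (- zz \<tau>0) - \<Psi>2 (- zz \<tau>0) * \<Psi>1' (- zz \<tau>0))"
     using flip[OF zz0(1)] by (simp only:) (simp add: algebra_simps)
    ultimately show False using Bs.W[OF zz0(1)] by simp
   qed
   have "isCont w t1" "isCont m t1" unfolding m_def w_def using t1 by (auto intro!: continuous_intros)
   then have "\<forall>\<^sub>F t in at t1. w t ~= 0" "\<forall>\<^sub>F t in at t1. m t \<in> ball 0 T"
    unfolding isCont_def using t1 T(2)
    by - (rule tendsto_imp_eventually_ne, assumption, simp add: w_def, rule topological_tendstoD, assumption, simp_all add: m_def w_def)
   moreover have "\<forall>\<^sub>F t in at t1. t \<in> ball 0 T" using T(1) by (intro eventually_at_in_open') auto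
   ultimately have "\<forall>\<^sub>F t in at t1. w t ~= 0 \<and> m t \<in> ball 0 T \<and> t \<in> ball 0 T" by eventually_elim auto
   then obtain e where e: "e > 0" "!!t. t \<in> ball t1 e - {t1} ==> w t ~= 0 \<and> m t \<in> ball 0 T \<and> t \<in> ball 0 T"
    unfolding eventually_at by (auto simp: dist_commute)
   have inj: "countable {t\<in>ball t1 e - {t1}. m t \<in> A}" if "countable A" for A
   proof (rule countable_image_inj_on)
    show "countable (m ` {t\<in>ball t1 e - {t1}. m t \<in> A})" by (rule countable_subset[OF _ that]) auto
    show "inj_on m {t\<in>ball t1 e - {t1}. m t \<in> A}"
    proof (rule inj_onI)
     fix x y assume xy: "x \<in> {t\<in>ball t1 e - {t1}. m t \<in> A}" "y \<in> {t\<in>ball t1 e - {t1}. m t \<in> A}" "m x = m y"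
     have "w x ~= 0" "w y ~= 0" using e(2) xy by auto
     then have "(x * r11 + r21) * w y = (y * r11 + r21) * w x" using xy(3) unfolding m_def by (simp add: field_simps)
     then have "(x - y) * (r11 * r22 - r12 * r21) = 0" unfolding w_def by (simp add: algebra_simps)
     then show "x = y" using det by simp
    qed
   qed
   have other: "\<exists>N. countable N \<and> (\<forall>t\<in>ball t1 e - N. w t ~= 0 \<and> m t \<in> ball 0 T \<and> t \<in> ball 0 T \<and> c2 (m t) = C * m t powi n \<and> c2 (m t) ~= 0 \<and>
     ((\<lambda>eps. Fm (\<tau>, eps * (t * \<psi>1 \<tau> + \<psi>2 \<tau>), eps * (t * \<psi>1' \<tau> + \<psi>2' \<tau>)) * eps powi (- d)) \<longlongrightarrow> w t powi d * c2 (m t)) (at 0))"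
    if t: "\<tau> \<in> ball \<tau>0 \<rho>" "- zz \<tau> \<in> ball (- zz \<tau>0) rc - Nc" for \<tau>
   proof -
    define z where "z = zz \<tau>"
    define h where "h s eps = F2 (- z, eps * (s * \<Psi>1 (- z) + \<Psi>2 (- z)), eps * (s * \<Psi>1' (- z) + \<Psi>2' (- z)))" for s eps
    obtain N1 where N1: "countable N1" "!!s. s \<in> ball 0 T - N1 ==> c2 s ~= 0 \<and> ((\<lambda>eps. h s eps * eps powi (- d)) \<longlongrightarrow> c2 s) (at 0)"
     using cc(3)[OF t(2)] unfolding small_at_def h_def z_def d2 by blast
    define N2 where "N2 = insert t1 {t\<in>ball t1 e - {t1}. m t \<in> N1 \<union> (Nd \<union> N)}"
    have "countable N2" unfolding N2_def using inj[of "N1 \<union> (Nd \<union> N)"] N1(1) Nd(1) Cn(2) by auto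
    moreover have "w s ~= 0 \<and> m s \<in> ball 0 T \<and> s \<in> ball 0 T \<and> c2 (m s) = C * m s powi n \<and> c2 (m s) ~= 0 \<and>
     ((\<lambda>eps. Fm (\<tau>, eps * (s * \<psi>1 \<tau> + \<psi>2 \<tau>), eps * (s * \<psi>1' \<tau> + \<psi>2' \<tau>)) * eps powi (- d)) \<longlongrightarrow> w s powi d * c2 (m s)) (at 0)"
     if s: "s \<in> ball t1 e - N2" for s
    proof -
     have ws: "w s ~= 0" "m s \<in> ball 0 T" "s \<in> ball 0 T" and mN: "m s \<notin> N1" "m s \<notin> Nd" "m s \<notin> N"
      using e(2)[of s] s unfolding N2_def by auto
     have lim: "((\<lambda>eps. h (m s) (eps * w s) * eps powi (- d)) \<longlongrightarrow> w s powi d * c2 (m s)) (at 0)"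
      by (rule limit_rescale) (use N1(2)[of "m s"] ws mN in auto)
     have "h (m s) (eps * w s) = Fm (\<tau>, eps * (s * \<psi>1 \<tau> + \<psi>2 \<tau>), eps * (s * \<psi>1' \<tau> + \<psi>2' \<tau>))" for eps
     proof -
      have wm: "w s * m s = s * r11 + r21" unfolding m_def using ws(1) by simp
      have e: "eps * w s * (m s * x + y) = eps * (s * (r11 * x + r12 * y) + (r21 * x + r22 * y))" for x y
      proof -
       have "eps * w s * (m s * x + y) = eps * ((w s * m s) * x + w s * y)" by (simp add: algebra_simps)
       also have "\<dots> = eps * (s * (r11 * x + r12 * y) + (r21 * x + r22 * y))" by (simp only: wm) (simp add: w_def algebra_simps)
       finally show ?thesis .
      qed
      have fl: "r11 * \<Psi>1 (- z) + r12 * \<Psi>2 (- z) = \<psi>1 \<tau>" "r11 * \<Psi>1' (- z) + r12 * \<Psi>2' (- z) = \<psi>1' \<tau>"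
       "r21 * \<Psi>1 (- z) + r22 * \<Psi>2 (- z) = \<psi>2 \<tau>" "r21 * \<Psi>1' (- z) + r22 * \<Psi>2' (- z) = \<psi>2' \<tau>"
       using flip[OF zz(3)[OF t(1)]] match[OF t(1)] unfolding z_def by auto
      show ?thesis unfolding h_def e fl unfolding glue(2)[OF t(1)] z_def ..
     qed
     then have "((\<lambda>eps. Fm (\<tau>, eps * (s * \<psi>1 \<tau> + \<psi>2 \<tau>), eps * (s * \<psi>1' \<tau> + \<psi>2' \<tau>)) * eps powi (- d)) \<longlongrightarrow> w s powi d * c2 (m s)) (at 0)"
      using lim by simp
     moreover have "c2 (m s) = C * m s powi n"
     proof -
      have "m s \<in> ball 0 T - Nd" "m s \<in> ball 0 T - N" using ws(2) mN by blast+
      from bspec[OF Nd(2) this(1)] bspec[OF Cn(3) this(2)] show ?thesis by simp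
     qed
     moreover have "c2 (m s) ~= 0"
     proof -
      have "m s \<in> ball 0 T - N1" using ws(2) mN by blast
      from N1(2)[OF this] show ?thesis by (rule conjunct1)
     qed
     ultimately show ?thesis using ws by (intro conjI)
    qed
    ultimately show ?thesis by blast
   qed
   have False
   proof (cases "\<forall>z\<in>D1. A.near_zero Fm T z")
    case True
    then have "A.near_zero Fm T \<tau>0" using \<tau>0_D1(1) by blast
    then obtain rf Nf where f: "rf > 0" "countable Nf" "!!z. z\<in>ball \<tau>0 rf - Nf ==> A.zero Fm z T"
     by (rule A.near_zeroE) blast
    obtain \<tau> where t: "\<tau> \<in> ball \<tau>0 \<rho>" "\<tau> \<in> ball \<tau>0 rf - Nf" "- zz \<tau> \<in> ball (- zz \<tau>0) rc - Nc"
     using pick_\<tau>[OF f(1,2) zero_less_one _ cc(1,2), of "{}"] by auto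
    obtain N3 where N3: "countable N3" "!!t. t\<in>ball t1 e - N3 ==> w t ~= 0 \<and> m t \<in> ball 0 T \<and> t \<in> ball 0 T \<and> c2 (m t) = C * m t powi n \<and> c2 (m t) ~= 0 \<and>
     ((\<lambda>eps. Fm (\<tau>, eps * (t * \<psi>1 \<tau> + \<psi>2 \<tau>), eps * (t * \<psi>1' \<tau> + \<psi>2' \<tau>)) * eps powi (- d)) \<longlongrightarrow> w t powi d * c2 (m t)) (at 0)"
     using other[OF t(1,3)] by blast
    obtain N4 where N4: "countable N4" "!!t. t \<in> ball 0 T - N4 ==> \<forall>\<^sub>F eps in at 0. Fm (\<tau>, eps * (t * \<psi>1 \<tau> + \<psi>2 \<tau>), eps * (t * \<psi>1' \<tau> + \<psi>2' \<tau>)) = 0"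
     using f(3)[OF t(2)] unfolding zero_at_def by blast
    obtain s where s: "s \<in> ball t1 e" "s \<notin> N3 \<union> N4" using pick_ball[of "N3 \<union> N4" e t1] N3(1) N4(1) e(1) by auto
    have s3: "s \<in> ball t1 e - N3" using s by auto
    have s4: "s \<in> ball 0 T - N4" using s N3(2)[OF s3] by auto
    have "\<forall>\<^sub>F eps in at 0. Fm (\<tau>, eps * (s * \<psi>1 \<tau> + \<psi>2 \<tau>), eps * (s * \<psi>1' \<tau> + \<psi>2' \<tau>)) * eps powi (- d) = 0"
     using N4(2)[OF s4] by (auto elim: eventually_mono)
    moreover have "((\<lambda>eps. Fm (\<tau>, eps * (s * \<psi>1 \<tau> + \<psi>2 \<tau>), eps * (s * \<psi>1' \<tau> + \<psi>2' \<tau>)) * eps powi (- d)) \<longlongrightarrow> w s powi d * c2 (m s)) (at 0)"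
     using N3(2)[OF s3] by blast
    ultimately have wc: "w s powi d * c2 (m s) = 0"
     using eventually_eq_imp_limits_eq[OF _ tendsto_const[of 0]] at_neq_bot by blast
    have "w s ~= 0" "c2 (m s) ~= 0" using N3(2)[OF s3] by blast+
    then show False using wc by simp
   next
    case False
    then obtain d' c' where c': "quot_form T c'" "\<forall>z\<in>D1. A.near_small Fm T d' c' z"
     using A.initial_form_global[OF T0 reps(2)] by blast
    obtain C' n' N' where Cn': "C' ~= 0" "countable N'" "\<forall>t\<in>ball 0 T - N'. t ~= 0 \<and> c' t = C' * t powi n'" "d' = 2 * n'"
     using periodic_monomial[OF T0 c' perF(2)] by (elim exE conjE) (rule that)
    obtain rf Nf where f: "rf > 0" "countable Nf" "!!z. z\<in>ball \<tau>0 rf - Nf ==> A.small Fm z T d' c'"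
     by (rule A.near_smallE[OF c'(2)[rule_format, OF \<tau>0_D1(1)]]) blast
    obtain \<tau> where t: "\<tau> \<in> ball \<tau>0 \<rho>" "\<tau> \<in> ball \<tau>0 rf - Nf" "- zz \<tau> \<in> ball (- zz \<tau>0) rc - Nc"
     using pick_\<tau>[OF f(1,2) zero_less_one _ cc(1,2), of "{}"] by auto
    obtain N3 where N3: "countable N3" "!!t. t\<in>ball t1 e - N3 ==> w t ~= 0 \<and> m t \<in> ball 0 T \<and> t \<in> ball 0 T \<and> c2 (m t) = C * m t powi n \<and> c2 (m t) ~= 0 \<and>
     ((\<lambda>eps. Fm (\<tau>, eps * (t * \<psi>1 \<tau> + \<psi>2 \<tau>), eps * (t * \<psi>1' \<tau> + \<psi>2' \<tau>)) * eps powi (- d)) \<longlongrightarrow> w t powi d * c2 (m t)) (at 0)"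
     using other[OF t(1,3)] by blast
    obtain N4 where N4: "countable N4" "!!t. t \<in> ball 0 T - N4 ==> c' t ~= 0 \<and> ((\<lambda>eps. Fm (\<tau>, eps * (t * \<psi>1 \<tau> + \<psi>2 \<tau>), eps * (t * \<psi>1' \<tau> + \<psi>2' \<tau>)) * eps powi (- d')) \<longlongrightarrow> c' t) (at 0)"
     using f(3)[OF t(2)] unfolding small_at_def by blast
    have rel: "d = d' \<and> s ~= 0 \<and> C' * s powi n = C * ((s * r11 + r21) * (s * r12 + r22)) powi n" if s: "s \<in> ball t1 e - (N3 \<union> (N4 \<union> N'))" for s
    proof -
     have s3: "s \<in> ball t1 e - N3" using s by auto
     note w3 = N3(2)[OF s3]
     have s4: "s \<in> ball 0 T - N4" and s5: "s \<in> ball 0 T - N'" using s w3 by auto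
     note w4 = N4(2)[OF s4]
     have ws: "w s ~= 0" "c2 (m s) ~= 0" using w3 by blast+
     have wl: "w s powi d * c2 (m s) ~= 0" using ws by simp
     have 1: "d = d'" "w s powi d * c2 (m s) = c' s"
      using leading_term_unique[OF wl conjunct1[OF w4] _ conjunct2[OF w4]] w3 by blast+
     have "n' = n" using 1(1) Cn(4) Cn'(4) by simp
     then have "C' * s powi n = w s powi (2 * n) * (C * m s powi n)" using 1 Cn(4) bspec[OF Cn'(3) s5] w3 by (metis (no_types))
     also have "\<dots> = C * ((w s * m s) * w s) powi n"
      by (simp add: power_int_mult_distrib power_int_mult power2_eq_square mult_ac)
     also have "w s * m s = s * r11 + r21" unfolding m_def using w3 by simp
     finally show ?thesis using 1(1) bspec[OF Cn'(3) s5] unfolding w_def by (intro conjI) blast+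
    qed
    have cN: "countable (N3 \<union> (N4 \<union> N'))" using N3(1) N4(1) Cn'(2) by auto
    have "r11 * r12 = 0"
     by (rule monomial_substitution[OF n Cn(1) Cn'(1) e(1) cN, of t1]) (use rel in blast)
    then show False using r11 r12 by simp
   qed
   then show ?thesis ..
  qed
 qed blast
qed

text \<open>Subtract the constant value of the initial form. The difference is again a first integral; an initial form of it would be a nonzero constant of degree 0, while its limit is 0.\<close>
theorem constant_on_level:
 assumes tr: "triple Fp Fm F2"
 shows "\<exists>T>0. \<exists>k. \<forall>z\<in>D1. A.near_zero (\<lambda>a. Fp a - k) T z"
proof -
 have "\<exists>t1. t1 * r12 + r22 ~= 0"
 proof (cases "r22 = 0")
  case True then show ?thesis using r12 by (intro exI[of _ 1]) simp
 next
  case False then show ?thesis by (intro exI[of _ 0]) simp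
 qed
 then obtain t1 where t1: "t1 * r12 + r22 ~= 0" by blast
 define T where "T = norm t1 + norm ((t1 * r11 + r21) / (t1 * r12 + r22)) + 1"
 have T: "norm t1 < T" "norm ((t1 * r11 + r21) / (t1 * r12 + r22)) < T" "T > 0"
  unfolding T_def using norm_ge_zero[of t1] norm_ge_zero[of "(t1 * r11 + r21) / (t1 * r12 + r22)"] by linarith+
 have sub: "triple (\<lambda>a. Fp a - k) (\<lambda>a. Fm a - k) (\<lambda>a. F2 a - k)" for k
  unfolding triple_def
 proof (intro conjI ballI allI)
  show "\<exists>r f g. A.rep (\<lambda>a. Fp a - k) z r f g" if zD: "z \<in> D1" for z
   using tr zD A.rep_diff_const unfolding triple_def by meson
  show "\<exists>r f g. A.rep (\<lambda>a. Fm a - k) z r f g" if zD: "z \<in> D1" for z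
   using tr zD A.rep_diff_const unfolding triple_def by meson
  show "\<exists>r f g. Bs.rep (\<lambda>a. F2 a - k) z r f g" if zD: "z \<in> D2" for z
   using tr zD Bs.rep_diff_const unfolding triple_def by meson
 qed (use tr in \<open>simp_all add: triple_def\<close>)
 from initial_form_constant[OF tr T(1,2) t1] show ?thesis
 proof
  assume "\<forall>z\<in>D1. A.near_zero Fp T z"
  then show ?thesis using T(3) by (intro exI[of _ T] conjI exI[of _ 0]) auto
 next
  assume "\<exists>C. C ~= 0 \<and> (\<forall>z\<in>D1. A.near_small Fp T 0 (\<lambda>_. C) z)"
  then obtain C where C: "A.near_small Fp T 0 (\<lambda>_. C) \<tau>0" using \<tau>0_D1(1) by blast
  from initial_form_constant[OF sub[of C] T(1,2) t1] show ?thesis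
  proof
   assume "\<forall>z\<in>D1. A.near_zero (\<lambda>a. Fp a - C) T z"
   then show ?thesis using T(3) by blast
  next
   assume "\<exists>C'. C' ~= 0 \<and> (\<forall>z\<in>D1. A.near_small (\<lambda>a. Fp a - C) T 0 (\<lambda>_. C') z)"
   then obtain C' where C': "C' ~= 0" "A.near_small (\<lambda>a. Fp a - C) T 0 (\<lambda>_. C') \<tau>0" using \<tau>0_D1(1) by blast
   obtain ra Na where a: "ra > 0" "countable Na" "!!z. z\<in>ball \<tau>0 ra - Na ==> A.small Fp z T 0 (\<lambda>_. C)"
    by (rule A.near_smallE[OF C]) blast
   obtain rb Nb where b: "rb > 0" "countable Nb" "!!z. z\<in>ball \<tau>0 rb - Nb ==> A.small (\<lambda>a. Fp a - C) z T 0 (\<lambda>_. C')"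
    by (rule A.near_smallE[OF C'(2)]) blast
   obtain z where z: "z \<in> ball \<tau>0 (min ra rb)" "z \<notin> Na \<union> Nb" using pick_ball[of "Na \<union> Nb" "min ra rb" \<tau>0] a(1,2) b(1,2) by auto
   obtain N1 where N1: "countable N1" "!!t. t\<in>ball 0 T - N1 ==> ((\<lambda>eps. Fp (z, eps * (t * \<psi>1 z + \<psi>2 z), eps * (t * \<psi>1' z + \<psi>2' z))) \<longlongrightarrow> C) (at 0)"
   proof -
    have "A.small Fp z T 0 (\<lambda>_. C)" using a(3)[of z] z by auto
    then show ?thesis unfolding small_at_def by (elim exE conjE) (rule that, assumption, simp)
   qed
   obtain N2 where N2: "countable N2" "!!t. t\<in>ball 0 T - N2 ==> ((\<lambda>eps. Fp (z, eps * (t * \<psi>1 z + \<psi>2 z), eps * (t * \<psi>1' z + \<psi>2' z)) - C) \<longlongrightarrow> C') (at 0)"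
   proof -
    have "A.small (\<lambda>a. Fp a - C) z T 0 (\<lambda>_. C')" using b(3)[of z] z by auto
    then show ?thesis unfolding small_at_def by (elim exE conjE) (rule that, assumption, simp)
   qed
   obtain t where t: "t \<in> ball 0 T - N1" "t \<in> ball 0 T - N2" using pick_ball[of "N1 \<union> N2" T 0] N1(1) N2(1) T(3) by auto
   have "C - C = C'" using tendsto_unique[OF at_neq_bot tendsto_diff[OF N1(2)[OF t(1)] tendsto_const[of C]] N2(2)[OF t(2)]] .
   then show ?thesis using C'(1) by simp
  qed
 qed
qed

end

section \<open>The normal variational equation\<close>

definition linq :: "complex => complex" where "linq U = - 6 / (1 - U)"
definition lins :: "complex => complex" where "lins U = - (4 - U) / (1 - U)"

definition rate1 :: "complex => complex" where "rate1 \<tau> = 1 / 6"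
definition rate2 :: "complex => complex" where "rate2 z = - z / (3 * (1 - z\<^sup>2))"

text \<open>The solution with exponent r at the singular point 0, where exp \<tau> is the local coordinate.\<close>
definition psi :: "complex => complex => complex" where
 "psi r \<tau> = exp (r * \<tau>) * hg r (r + 1/6) (2 * r + 5/3) (exp \<tau>)"
definition psi' :: "complex => complex => complex" where
 "psi' r \<tau> = 6 * (exp (r * \<tau>) * (r * hg r (r + 1/6) (2 * r + 5/3) (exp \<tau>) + exp \<tau> * hg' r (r + 1/6) (2 * r + 5/3) (exp \<tau>)))"

text \<open>The same solution near the singular point 1, written out by the connection formula as an even part and z ^ 3 times an even part.\<close>
definition Psi :: "complex => complex => complex" where
 "Psi r z = exp (r * Ln (1 - z\<^sup>2)) * (hgA r (r + 1/6) (2 * r + 5/3) * hg r (r + 1/6) (-1/2) (z\<^sup>2)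
   + hgB r (r + 1/6) (2 * r + 5/3) * (z^3 * hg (r + 5/3) (r + 3/2) (5/2) (z\<^sup>2)))"
text \<open>Derivatives are taken with respect to the coordinate s of the geodesic, hence the division by the rate.\<close>
definition Psi' :: "complex => complex => complex" where
 "Psi' r z = deriv (Psi r) z / rate2 z"

text \<open>The exponents at 0 are the two roots of this equation; they are not real.\<close>
definition indicial :: "complex => bool" where "indicial r \<longleftrightarrow> 6 * r\<^sup>2 + 4 * r + 1 = 0 \<and> Im r ~= 0"

lemma indicial_lower: "indicial r ==> 2 * r + 5/3 \<notin> \<int>\<^sub>\<le>\<^sub>0"
 by (auto simp: indicial_def elim!: nonpos_Ints_cases' dest!: arg_cong[where f = Im])

text \<open>The hypergeometric equation for the series turns into the variational equation exactly because r is a root of the indicial equation.\<close>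
lemma psi_solves:
 assumes "indicial r"
 shows "solves D1 rate1 (\<lambda>\<tau>. rate1 \<tau> * linq (exp \<tau>)) (\<lambda>\<tau>. rate1 \<tau> * lins (exp \<tau>)) (psi r) (psi' r)"
 unfolding solves_def
proof (intro ballI conjI)
 fix \<tau> assume t: "\<tau> \<in> D1"
 define U where "U = exp \<tau>"
 have U: "norm U < 1" "U ~= 0" using t unfolding U_def D1_def by auto
 have U1: "1 - U ~= 0" using U(1) by auto
 define f f' f'' where "f = hg r (r + 1/6) (2 * r + 5/3)" and "f' = hg' r (r + 1/6) (2 * r + 5/3)" and "f'' = hg'' r (r + 1/6) (2 * r + 5/3)"
 have d: "(f has_field_derivative f' U) (at (exp \<tau>))" "(f' has_field_derivative f'' U) (at (exp \<tau>))"
  using hg_derivs[OF indicial_lower[OF assms] U(1)] unfolding f_def f'_def f''_def U_def by auto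
 have dE: "(exp has_field_derivative exp \<tau>) (at \<tau>)" by (rule DERIV_exp)
 have dr: "((\<lambda>\<tau>. exp (r * \<tau>)) has_field_derivative exp (r * \<tau>) * r) (at \<tau>)"
  by (auto intro!: derivative_eq_intros)
 note df = DERIV_chain2[OF d(1) dE] and df' = DERIV_chain2[OF d(2) dE]
 have "((\<lambda>\<tau>. exp (r * \<tau>) * f (exp \<tau>)) has_field_derivative rate1 \<tau> * psi' r \<tau>) (at \<tau>)"
  by (rule DERIV_cong[OF DERIV_mult[OF dr df]]) (simp add: rate1_def psi'_def f_def f'_def U_def algebra_simps)
 then show "(psi r has_field_derivative rate1 \<tau> * psi' r \<tau>) (at \<tau>)"
  unfolding psi_def[abs_def] f_def .
 have dd: "((\<lambda>\<tau>. 6 * (exp (r * \<tau>) * (r * f (exp \<tau>) + exp \<tau> * f' (exp \<tau>)))) has_field_derivative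
   6 * (exp (r * \<tau>) * (r\<^sup>2 * f U + (2 * r + 1) * U * f' U + U\<^sup>2 * f'' U))) (at \<tau>)"
  by (rule DERIV_cong[OF DERIV_cmult[OF DERIV_mult[OF dr DERIV_add[OF DERIV_cmult[OF df] DERIV_mult[OF dE df']]]]])
   (simp add: U_def power2_eq_square algebra_simps)
 have f2: "(1 - U) * (U\<^sup>2 * f'' U) = U * (r * (r + 1/6)) * f U + U * ((2 * r + 7/6) * U - (2 * r + 5/3)) * f' U"
 proof -
  have x: "(1 - U) * (U\<^sup>2 * (x / (U * (1 - U)) * v)) = U * x * v" for x v :: complex
   using U(2) U1 by (simp add: power2_eq_square)
  have y: "r + (r + 1/6) + 1 = 2 * r + 7/6" by simp
  show ?thesis unfolding f''_def hg''_eq[OF indicial_lower[OF assms] U] hgq_def hgr_def distrib_left x y f_def f'_def ..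
 qed
 have key: "6 * ((1 - U) * (r\<^sup>2 * f U + (2 * r + 1) * U * f' U) + (1 - U) * (U\<^sup>2 * f'' U))
   + ((4 - U) * (r * f U + U * f' U) + f U) = 0"
 proof -
  have "6 * ((1 - U) * (r\<^sup>2 * f U + (2 * r + 1) * U * f' U) + (1 - U) * (U\<^sup>2 * f'' U))
   + ((4 - U) * (r * f U + U * f' U) + f U) = (6 * r\<^sup>2 + 4 * r + 1) * f U"
   unfolding f2 by (simp add: algebra_simps power2_eq_square)
  then show ?thesis using assms unfolding indicial_def by simp
 qed
 have "6 * (exp (r * \<tau>) * (r\<^sup>2 * f U + (2 * r + 1) * U * f' U + U\<^sup>2 * f'' U)) =
   rate1 \<tau> * linq U * (exp (r * \<tau>) * f U) + rate1 \<tau> * lins U * (6 * (exp (r * \<tau>) * (r * f U + U * f' U)))" (is "?L = ?R")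
 proof -
  have "(1 - U) * (?L - ?R) = exp (r * \<tau>) * (6 * ((1 - U) * (r\<^sup>2 * f U + (2 * r + 1) * U * f' U) + (1 - U) * (U\<^sup>2 * f'' U))
   + ((4 - U) * (r * f U + U * f' U) + f U))"
  proof -
   have l: "(1 - U) * linq U = - 6" "(1 - U) * lins U = - (4 - U)"
    unfolding linq_def lins_def using U1 nonzero_mult_div_cancel_left[OF U1] by (simp_all only: times_divide_eq_right)
   have "(1 - U) * ?R = rate1 \<tau> * ((1 - U) * linq U) * (exp (r * \<tau>) * f U) + rate1 \<tau> * ((1 - U) * lins U) * (6 * (exp (r * \<tau>) * (r * f U + U * f' U)))"
    by (simp add: algebra_simps)
   then have R: "(1 - U) * ?R = rate1 \<tau> * (- 6) * (exp (r * \<tau>) * f U) + rate1 \<tau> * (- (4 - U)) * (6 * (exp (r * \<tau>) * (r * f U + U * f' U)))"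
    unfolding l .
   have "(1 - U) * (?L - ?R) = (1 - U) * ?L - (1 - U) * ?R" by (rule right_diff_distrib)
   also note R
   finally have F: "(1 - U) * (?L - ?R) = (1 - U) * ?L - (rate1 \<tau> * (- 6) * (exp (r * \<tau>) * f U) + rate1 \<tau> * (- (4 - U)) * (6 * (exp (r * \<tau>) * (r * f U + U * f' U))))" .
   show ?thesis by (rule trans[OF F]) (simp add: rate1_def field_simps)
  qed
  then show ?thesis using key U1 by simp
 qed
 with dd show "(psi' r has_field_derivative rate1 \<tau> * linq (exp \<tau>) * psi r \<tau> + rate1 \<tau> * lins (exp \<tau>) * psi' r \<tau>) (at \<tau>)"
  unfolding psi'_def[abs_def] psi_def f_def f'_def U_def by simp
qed

lemma D2_one_minus: assumes "z \<in> ball 0 1" shows "norm (z\<^sup>2) < 1" "1 - z\<^sup>2 \<notin> \<real>\<^sub>\<le>\<^sub>0" "1 - z\<^sup>2 ~= (0::complex)"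
proof -
 show n: "norm (z\<^sup>2) < 1" using assms by (simp add: norm_power abs_square_less_1)
 then have "Re (z\<^sup>2) < 1" using complex_Re_le_cmod[of "z\<^sup>2"] by linarith
 then show "1 - z\<^sup>2 \<notin> \<real>\<^sub>\<le>\<^sub>0" by (auto simp: complex_nonpos_Reals_iff)
 then show "1 - z\<^sup>2 ~= 0" by auto
qed

lemma half_not_nonpos: "(-1/2::complex) \<notin> \<int>\<^sub>\<le>\<^sub>0" "(5/2::complex) \<notin> \<int>\<^sub>\<le>\<^sub>0"
proof -
 show "(-1/2::complex) \<notin> \<int>\<^sub>\<le>\<^sub>0"
 proof
  assume "(-1/2::complex) \<in> \<int>\<^sub>\<le>\<^sub>0"
  then obtain n where "(-1/2::complex) = - of_nat n" by (elim nonpos_Ints_cases')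
  then have "(of_nat (2 * n)::complex) = of_nat 1" by (simp add: field_simps)
  then have "2 * n = 1" by (simp only: of_nat_eq_iff)
  then show False by presburger
 qed
 show "(5/2::complex) \<notin> \<int>\<^sub>\<le>\<^sub>0" by (auto elim!: nonpos_Ints_cases' dest!: arg_cong[where f = Re])
qed

lemma holomorphic_Psi: "Psi r holomorphic_on ball 0 1"
proof -
 have h: "(\<lambda>z. hg a b c (z\<^sup>2)) holomorphic_on ball 0 1" if "c \<notin> \<int>\<^sub>\<le>\<^sub>0" for a b c
 proof -
  have "(hg a b c \<circ> (\<lambda>z. z\<^sup>2)) holomorphic_on ball 0 1"
   by (rule holomorphic_on_compose_gen[OF _ holomorphic_hg[OF that]]) (use D2_one_minus(1) in \<open>auto intro!: holomorphic_intros simp: norm_power abs_square_less_1\<close>)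
  then show ?thesis by (simp add: o_def)
 qed
 show ?thesis unfolding Psi_def[abs_def]
  by (intro holomorphic_intros h half_not_nonpos) (use D2_one_minus(2) in auto)
qed

text \<open>The region where both expansions converge and the root z ^ 3 of (z ^ 2) ^ 3 is the principal one.\<close>
definition overlap :: "complex set" where "overlap = {z. norm z < 1 \<and> norm (1 - z\<^sup>2) < 1 \<and> Re z > 0}"

lemma open_overlap: "open overlap"
proof -
 have "overlap = ball 0 1 \<inter> (\<lambda>z. 1 - z\<^sup>2) -` ball 0 1 \<inter> {z. Re z > 0}" unfolding overlap_def by auto
 moreover have "open ((\<lambda>z::complex. 1 - z\<^sup>2) -` ball 0 1)" by (intro open_vimage continuous_intros open_ball)
 moreover have "open {z. Re z > 0}" using open_halfspace_Re_gt[of 0] by simp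
 ultimately show ?thesis by (metis open_Int open_ball)
qed

lemma overlap_D2: "overlap \<subseteq> D2" "z \<in> overlap ==> Ln (1 - z\<^sup>2) \<in> D1"
proof -
 show "overlap \<subseteq> D2" unfolding overlap_def D2_def by auto
 assume z: "z \<in> overlap"
 then have "1 - z\<^sup>2 ~= 0" using D2_one_minus(3)[of z] unfolding overlap_def by auto
 then show "Ln (1 - z\<^sup>2) \<in> D1" using z unfolding D1_def overlap_def by simp
qed

lemma Psi_overlap:
 assumes r: "indicial r" and z: "z \<in> overlap"
 shows "Psi r z = psi r (Ln (1 - z\<^sup>2))"
proof -
 have n: "norm z < 1" "norm (1 - z\<^sup>2) < 1" "Re z > 0" using z unfolding overlap_def by auto
 have n2: "norm (z\<^sup>2) < 1" "1 - z\<^sup>2 ~= 0" using D2_one_minus[of z] n(1) by auto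
 have "z ~= 0" using n(3) by auto
 have "Ln (z\<^sup>2) = 2 * Ln z"
  by (rule Ln_unique) (use Re_Ln_pos_lt_imp[OF n(3)] \<open>z ~= 0\<close> in \<open>auto simp: exp_double abs_less_iff\<close>)
 then have "exp (3/2 * Ln (z\<^sup>2)) = exp (of_nat 3 * Ln z)" by simp
 also have "\<dots> = z ^ 3" unfolding exp_of_nat_mult using \<open>z ~= 0\<close> by simp
 finally have e: "exp (3/2 * Ln (z\<^sup>2)) = z ^ 3" .
 have "hg r (r + 1/6) (2 * r + 5/3) (1 - z\<^sup>2) = hgA r (r + 1/6) (2 * r + 5/3) * hg r (r + 1/6) (-1/2) (1 - (1 - z\<^sup>2))
   + hgB r (r + 1/6) (2 * r + 5/3) * (exp (3/2 * Ln (1 - (1 - z\<^sup>2))) * hg (r + 1/6 + 3/2) (r + 3/2) (5/2) (1 - (1 - z\<^sup>2)))"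
  by (rule hg_connection[OF indicial_lower[OF r]]) (use n n2 in simp_all)
 also have "1 - (1 - z\<^sup>2) = z\<^sup>2" by simp
 also have "r + 1/6 + 3/2 = r + 5/3" by simp
 finally show ?thesis unfolding Psi_def psi_def e using n2(2) by simp
qed

lemma Psi'_overlap:
 assumes r: "indicial r" and z: "z \<in> overlap"
 shows "Psi' r z = psi' r (Ln (1 - z\<^sup>2))"
proof -
 have z2: "z \<in> D2" using overlap_D2(1) z by blast
 have n2: "1 - z\<^sup>2 \<notin> \<real>\<^sub>\<le>\<^sub>0" "1 - z\<^sup>2 ~= 0" using D2_one_minus[of z] z2 unfolding D2_def by auto
 have dl: "((\<lambda>z. Ln (1 - z\<^sup>2)) has_field_derivative - 2 * z / (1 - z\<^sup>2)) (at z)"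
  using n2 by (auto intro!: derivative_eq_intros simp: field_simps)
 have dp: "(psi r has_field_derivative rate1 (Ln (1 - z\<^sup>2)) * psi' r (Ln (1 - z\<^sup>2))) (at (Ln (1 - z\<^sup>2)))"
  using psi_solves[OF r] overlap_D2(2)[OF z] unfolding solves_def by blast
 have "(Psi r has_field_derivative rate1 (Ln (1 - z\<^sup>2)) * psi' r (Ln (1 - z\<^sup>2)) * (- 2 * z / (1 - z\<^sup>2))) (at z)"
  by (rule has_field_derivative_transform_within_open[OF DERIV_chain2[OF dp dl] open_overlap z]) (simp add: Psi_overlap[OF r])
 then have "deriv (Psi r) z = rate2 z * psi' r (Ln (1 - z\<^sup>2))"
  using n2 by (subst DERIV_imp_deriv) (auto simp: rate1_def rate2_def field_simps)
 moreover have "rate2 z ~= 0" using z2 n2 unfolding rate2_def D2_def by auto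
 ultimately show ?thesis unfolding Psi'_def by simp
qed

lemma D2_props: "open D2" "connected D2" "open D1" "connected D1"
proof -
 show "open D2" "connected D2" unfolding D2_def
  by (auto intro!: connected_open_delete)
 show "open D1" "connected D1" unfolding D1_def
  by (auto intro!: convex_connected convex_halfspace_Re_lt open_halfspace_Re_lt)
qed

lemma rate2_nz: "z \<in> D2 ==> rate2 z ~= 0" using D2_one_minus(3)[of z] unfolding D2_def rate2_def by auto
lemma holomorphic_rate2: "rate2 holomorphic_on D2"
 unfolding rate2_def[abs_def] by (intro holomorphic_intros) (use D2_one_minus(3) in \<open>auto simp: D2_def\<close>)

lemma holomorphic_coeff2:
 "(\<lambda>z. rate2 z * linq (1 - z\<^sup>2)) holomorphic_on D2" "(\<lambda>z. rate2 z * lins (1 - z\<^sup>2)) holomorphic_on D2"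
 unfolding linq_def lins_def
 by (intro holomorphic_intros holomorphic_rate2; force simp: D2_def)+

text \<open>On the overlap this is the equation for psi in another variable; it extends by the identity theorem.\<close>
lemma Psi_solves:
 assumes r: "indicial r"
 shows "solves D2 rate2 (\<lambda>z. rate2 z * linq (1 - z\<^sup>2)) (\<lambda>z. rate2 z * lins (1 - z\<^sup>2)) (Psi r) (Psi' r)"
proof -
 have hP: "Psi r holomorphic_on D2" by (rule holomorphic_on_subset[OF holomorphic_Psi]) (auto simp: D2_def)
 have hP': "Psi' r holomorphic_on D2"
  unfolding Psi'_def[abs_def] by (intro holomorphic_intros holomorphic_deriv hP holomorphic_rate2 D2_props rate2_nz)
 \<comment> \<open>R is the right-hand side of the equation for the second component.\<close>
 define R where "R z = rate2 z * linq (1 - z\<^sup>2) * Psi r z + rate2 z * lins (1 - z\<^sup>2) * Psi' r z" for z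
 have hR: "R holomorphic_on D2" unfolding R_def[abs_def]
  by (intro holomorphic_on_add holomorphic_on_mult holomorphic_coeff2 hP hP')
 have eq: "deriv (Psi' r) z = R z" if z: "z \<in> D2" for z
 proof (rule analytic_continuation_open[OF open_overlap D2_props(1) _ D2_props(2) overlap_D2(1) holomorphic_deriv[OF hP' D2_props(1)] hR _ z])
  have "1 - (4/5)\<^sup>2 = (9/25::complex)" by (simp add: power2_eq_square)
  then have "norm (1 - (4/5)\<^sup>2 :: complex) < 1" by (simp only: norm_divide) simp
  then have "(4/5::complex) \<in> overlap" unfolding overlap_def by (simp add: norm_divide)
  then show "overlap ~= {}" by blast
  fix w assume w: "w \<in> overlap"
  have w2: "w \<in> D2" using overlap_D2(1) w by blast
  have n2: "1 - w\<^sup>2 \<notin> \<real>\<^sub>\<le>\<^sub>0" "1 - w\<^sup>2 ~= 0" using D2_one_minus[of w] w2 unfolding D2_def by auto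
  have dl: "((\<lambda>z. Ln (1 - z\<^sup>2)) has_field_derivative - 2 * w / (1 - w\<^sup>2)) (at w)"
   using n2 by (auto intro!: derivative_eq_intros simp: field_simps)
  define \<tau> where "\<tau> = Ln (1 - w\<^sup>2)"
  have dp: "(psi' r has_field_derivative rate1 \<tau> * linq (exp \<tau>) * psi r \<tau> + rate1 \<tau> * lins (exp \<tau>) * psi' r \<tau>) (at (Ln (1 - w\<^sup>2)))"
   using psi_solves[OF r] overlap_D2(2)[OF w] unfolding solves_def \<tau>_def by blast
  have "(Psi' r has_field_derivative (rate1 \<tau> * linq (exp \<tau>) * psi r \<tau> + rate1 \<tau> * lins (exp \<tau>) * psi' r \<tau>) * (- 2 * w / (1 - w\<^sup>2))) (at w)"
   by (rule has_field_derivative_transform_within_open[OF DERIV_chain2[OF dp dl] open_overlap w]) (simp add: Psi'_overlap[OF r])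
  then have "deriv (Psi' r) w = (rate1 \<tau> * linq (exp \<tau>) * psi r \<tau> + rate1 \<tau> * lins (exp \<tau>) * psi' r \<tau>) * (- 2 * w / (1 - w\<^sup>2))"
   by (rule DERIV_imp_deriv)
  also have "exp \<tau> = 1 - w\<^sup>2" unfolding \<tau>_def using n2(2) by simp
  also have "psi r \<tau> = Psi r w" unfolding \<tau>_def using Psi_overlap[OF r w] by simp
  also have "psi' r \<tau> = Psi' r w" unfolding \<tau>_def using Psi'_overlap[OF r w] by simp_all
  finally have 1: "deriv (Psi' r) w = (rate1 \<tau> * linq (1 - w\<^sup>2) * Psi r w + rate1 \<tau> * lins (1 - w\<^sup>2) * Psi' r w) * (- 2 * w / (1 - w\<^sup>2))" .
  have 2: "rate2 w = rate1 \<tau> * (- 2 * w / (1 - w\<^sup>2))" using n2 unfolding rate1_def rate2_def by (simp add: field_simps)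
  show "deriv (Psi' r) w = R w" unfolding 1 R_def 2 by (simp add: algebra_simps)
 qed
 show ?thesis unfolding solves_def
 proof (intro ballI conjI)
  fix z assume z: "z \<in> D2"
  show "(Psi r has_field_derivative rate2 z * Psi' r z) (at z)"
   using holomorphic_derivI[OF hP D2_props(1) z] rate2_nz[OF z] unfolding Psi'_def by simp
  show "(Psi' r has_field_derivative rate2 z * linq (1 - z\<^sup>2) * Psi r z + rate2 z * lins (1 - z\<^sup>2) * Psi' r z) (at z)"
   using holomorphic_derivI[OF hP' D2_props(1) z] unfolding eq[OF z] R_def .
 qed
qed

definition rho1 :: complex where "rho1 = Complex (-1/3) (sqrt 2 / 6)"
definition rho2 :: complex where "rho2 = Complex (-1/3) (- sqrt 2 / 6)"

lemma indicial_rho: "indicial rho1" "indicial rho2"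
 by (simp_all add: indicial_def rho1_def rho2_def complex_eq_iff power2_eq_square)

lemma rho_sum: "rho2 = - 2/3 - rho1" by (simp add: complex_eq_iff rho1_def rho2_def)

text \<open>As exp \<tau> tends to 0 the Wronskian behaves like the difference of the exponents times a power.\<close>
lemma psi_wronskian:
 assumes t: "\<tau> \<in> D1"
 shows "psi rho1 \<tau> * psi' rho2 \<tau> - psi rho2 \<tau> * psi' rho1 \<tau> ~= 0"
proof -
 define f f' where "f r = hg r (r + 1/6) (2 * r + 5/3)" and "f' r = hg' r (r + 1/6) (2 * r + 5/3)" for r
 define w where "w U = f rho1 U * (6 * (rho2 * f rho2 U + U * f' rho2 U)) - f rho2 U * (6 * (rho1 * f rho1 U + U * f' rho1 U))" for U
 have c: "isCont (f r) 0" "isCont (f' r) 0" if "indicial r" for r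
  unfolding f_def f'_def using hg_derivs[OF indicial_lower[OF that], of 0 r "r + 1/6"] by (auto intro: DERIV_isCont)
 have "isCont w 0" unfolding w_def[abs_def] by (intro continuous_intros c indicial_rho)
 then have "(w \<longlongrightarrow> w 0) (at 0)" unfolding isCont_def .
 moreover have "w 0 ~= 0" by (simp add: w_def f_def rho1_def rho2_def complex_eq_iff)
 ultimately have "\<forall>\<^sub>F U in at 0. w U ~= 0" by (rule tendsto_imp_eventually_ne)
 then obtain d where d: "d > 0" "!!U. U ~= 0 ==> dist U 0 < d ==> w U ~= 0" unfolding eventually_at by auto
 define x where "x = min (ln (d/2)) (-1)"
 have "exp x \<le> exp (ln (d/2))" unfolding x_def by (subst exp_le_cancel_iff) simp
 then have x: "exp x < d" "x < 0" using d(1) unfolding x_def by auto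
 define \<sigma> where "\<sigma> = complex_of_real x"
 have w: "w (exp \<sigma>) ~= 0" by (rule d(2)) (use x in \<open>auto simp: \<sigma>_def\<close>)
 have s: "\<sigma> \<in> D1" using x(2) unfolding D1_def \<sigma>_def by simp
 have "psi rho1 \<sigma> * psi' rho2 \<sigma> - psi rho2 \<sigma> * psi' rho1 \<sigma> = exp (rho1 * \<sigma>) * exp (rho2 * \<sigma>) * w (exp \<sigma>)"
  unfolding psi_def psi'_def w_def f_def f'_def by (simp add: algebra_simps)
 then have W: "psi rho1 \<sigma> * psi' rho2 \<sigma> - psi rho2 \<sigma> * psi' rho1 \<sigma> ~= 0" using w by simp
 show ?thesis
 proof (rule wronskian_nonzero[OF D2_props(3,4) psi_solves psi_solves _ s W t])
  show "(\<lambda>\<tau>. rate1 \<tau> * lins (exp \<tau>)) holomorphic_on D1"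
   unfolding rate1_def lins_def
  proof (intro holomorphic_intros)
   fix \<tau> assume "\<tau> \<in> D1"
   then have "norm (exp \<tau>) < 1" by (simp add: D1_def)
   then have "exp \<tau> ~= 1" by (metis norm_one less_irrefl)
   then show "1 - exp \<tau> ~= 0" by simp
  qed
 qed (rule indicial_rho)+
qed

definition zbase :: "complex => complex" where "zbase \<tau> = csqrt (1 - exp \<tau>)"

definition base_dom :: "complex set" where "base_dom = {\<tau>. Re \<tau> < 0 \<and> \<bar>Im \<tau>\<bar> < pi \<and> norm (1 - exp \<tau>) < 1}"

lemma base_dom_ball: "\<exists>\<rho>>0. ball (of_real (- ln 2)) \<rho> \<subseteq> base_dom"
proof -
 have "base_dom = {\<tau>. Re \<tau> < 0} \<inter> {\<tau>. Im \<tau> < pi} \<inter> {\<tau>. Im \<tau> > - pi} \<inter> (\<lambda>\<tau>. 1 - exp \<tau>) -` ball 0 1"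
  unfolding base_dom_def by auto
 moreover have "open ((\<lambda>\<tau>::complex. 1 - exp \<tau>) -` ball 0 1)" by (intro open_vimage continuous_intros open_ball)
 ultimately have "open base_dom"
  using open_Int open_halfspace_Re_lt open_halfspace_Im_lt open_halfspace_Im_gt by (metis (no_types))
 moreover have e2: "exp (complex_of_real (- ln 2)) = 1/2" by (simp add: exp_minus exp_of_real flip: of_real_minus)
 have "norm (1 - exp (complex_of_real (- ln 2))) < 1" unfolding e2 by simp
 then have "of_real (- ln 2) \<in> base_dom" unfolding base_dom_def by simp
 ultimately show ?thesis unfolding open_contains_ball by blast
qed

lemma zbase_props:
 assumes t: "\<tau> \<in> base_dom"
 shows "zbase \<tau> \<in> overlap" "Ln (1 - (zbase \<tau>)\<^sup>2) = \<tau>"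
proof -
 have e: "norm (exp \<tau>) < 1" "norm (1 - exp \<tau>) < 1" "- pi < Im \<tau>" "Im \<tau> \<le> pi" using t unfolding base_dom_def by auto
 have "Re (exp \<tau>) < 1" using complex_Re_le_cmod[of "exp \<tau>"] e(1) by linarith
 then have R: "Re (1 - exp \<tau>) > 0" by simp
 have z2: "(zbase \<tau>)\<^sup>2 = 1 - exp \<tau>" unfolding zbase_def by simp
 have "norm (zbase \<tau>)^2 = norm (1 - exp \<tau>)" unfolding zbase_def by (simp flip: norm_power)
 then have "norm (zbase \<tau>)^2 < 1" using e(2) by simp
 then have "norm (zbase \<tau>) < 1" by (simp add: abs_square_less_1)
 moreover have "Re (zbase \<tau>) > 0"
  using R unfolding zbase_def by (simp add: add_nonneg_pos)
 ultimately show "zbase \<tau> \<in> overlap" unfolding overlap_def using z2 e(1) by simp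
 show "Ln (1 - (zbase \<tau>)\<^sup>2) = \<tau>" unfolding z2 using Ln_exp[OF e(3,4)] by simp
qed

lemma zbase_holomorphic: "zbase holomorphic_on base_dom"
 unfolding zbase_def[abs_def]
proof (intro holomorphic_intros)
 fix \<tau> assume "\<tau> \<in> base_dom"
 then have e: "norm (exp \<tau>) < 1" unfolding base_dom_def by auto
 have "Re (exp \<tau>) < 1" using complex_Re_le_cmod[of "exp \<tau>"] e(1) by linarith
 then show "1 - exp \<tau> \<notin> \<real>\<^sub>\<le>\<^sub>0" by (auto simp: complex_nonpos_Reals_iff)
qed

lemma zbase_inj: "inj_on zbase base_dom"
 by (rule inj_on_inverseI[of _ "\<lambda>z. Ln (1 - z\<^sup>2)"]) (rule zbase_props(2))

lemma Psi_wronskian: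
 assumes z: "z \<in> D2"
 shows "Psi rho1 z * Psi' rho2 z - Psi rho2 z * Psi' rho1 z ~= 0"
proof -
 obtain \<tau> where t: "\<tau> \<in> base_dom" using base_dom_ball by (metis centre_in_ball subsetD)
 note zt = zbase_props[OF t]
 have td: "\<tau> \<in> D1" using overlap_D2(2)[OF zt(1)] zt(2) by simp
 have W: "Psi rho1 (zbase \<tau>) * Psi' rho2 (zbase \<tau>) - Psi rho2 (zbase \<tau>) * Psi' rho1 (zbase \<tau>) ~= 0"
  using psi_wronskian[OF td] Psi_overlap[OF _ zt(1)] Psi'_overlap[OF _ zt(1)] indicial_rho zt(2) by simp
 show ?thesis
  by (rule wronskian_nonzero[OF D2_props(1,2) Psi_solves Psi_solves holomorphic_coeff2(2) subsetD[OF overlap_D2(1) zt(1)] W z]) (rule indicial_rho)+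
qed

lemma Psi_reflected_solves:
 assumes r: "indicial r"
 shows "solves D2 rate2 (\<lambda>z. rate2 z * linq (1 - z\<^sup>2)) (\<lambda>z. rate2 z * lins (1 - z\<^sup>2)) (\<lambda>z. Psi r (- z)) (\<lambda>z. Psi' r (- z))"
 unfolding solves_def
proof (intro ballI conjI)
 fix z assume "z \<in> D2"
 then have z: "- z \<in> D2" by (auto simp: D2_def)
 have m: "rate2 (- z) = - rate2 z" by (simp add: rate2_def)
 have d: "(uminus has_field_derivative - 1) (at z)" by (auto intro!: derivative_eq_intros)
 have s: "(Psi r has_field_derivative rate2 (- z) * Psi' r (- z)) (at (- z))"
  "(Psi' r has_field_derivative rate2 (- z) * linq (1 - (- z)\<^sup>2) * Psi r (- z) + rate2 (- z) * lins (1 - (- z)\<^sup>2) * Psi' r (- z)) (at (- z))"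
  using Psi_solves[OF r] z unfolding solves_def by blast+
 show "((\<lambda>z. Psi r (- z)) has_field_derivative rate2 z * Psi' r (- z)) (at z)"
  by (rule DERIV_cong[OF DERIV_chain2[OF s(1) d]]) (simp add: m)
 show "((\<lambda>z. Psi' r (- z)) has_field_derivative rate2 z * linq (1 - z\<^sup>2) * Psi r (- z) + rate2 z * lins (1 - z\<^sup>2) * Psi' r (- z)) (at z)"
  by (rule DERIV_cong[OF DERIV_chain2[OF s(2) d]]) (simp add: m algebra_simps)
qed

text \<open>The coefficients of the system are such that reflection in z maps solutions to solutions.\<close>
lemma Psi_flip:
 assumes r: "indicial r"
 shows "\<exists>\<alpha> \<beta>. \<forall>z\<in>D2. Psi r z = \<alpha> * Psi rho1 (- z) + \<beta> * Psi rho2 (- z) \<and> Psi' r z = \<alpha> * Psi' rho1 (- z) + \<beta> * Psi' rho2 (- z)"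
 by (rule solves_span[OF D2_props(1,2) Psi_reflected_solves Psi_reflected_solves Psi_solves[OF r]])
  (use Psi_wronskian[of "- _"] in \<open>auto intro: indicial_rho simp: D2_def\<close>)

text \<open>The exponents add up to -2/3, so that the reflection formula applies to these products.\<close>
lemma Gamma_sines:
 "rGamma (rho1 + 5/3) * rGamma rho2 = sin (of_real pi * rho2) / of_real pi"
 "rGamma (rho1 + 3/2) * rGamma (rho2 + 1/6) = sin (of_real pi * (rho2 + 1/6)) / of_real pi"
 "rGamma (rho2 + 5/3) * rGamma rho1 = sin (of_real pi * rho1) / of_real pi"
 "rGamma (rho2 + 3/2) * rGamma (rho1 + 1/6) = sin (of_real pi * (rho1 + 1/6)) / of_real pi"
 using rGamma_reflection_complex[of rho2] rGamma_reflection_complex[of "rho2 + 1/6"]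
  rGamma_reflection_complex[of rho1] rGamma_reflection_complex[of "rho1 + 1/6"]
 by (simp_all add: rho_sum mult.commute algebra_simps)

lemma hgAB_nonzero:
 assumes "indicial r" shows "hgA r (r + 1/6) (2 * r + 5/3) ~= 0" "hgB r (r + 1/6) (2 * r + 5/3) ~= 0"
proof -
 have n: "x \<notin> \<int>\<^sub>\<le>\<^sub>0" if "Im x ~= 0" for x :: complex
  using that by (auto elim!: nonpos_Ints_cases')
 have i: "Im r ~= 0" using assms unfolding indicial_def by simp
 have "(of_real (3/2)::complex) \<notin> \<int>\<^sub>\<le>\<^sub>0" "(of_real (1/2)::complex) \<notin> \<int>\<^sub>\<le>\<^sub>0"
  by (auto elim!: nonpos_Ints_cases' dest!: arg_cong[where f = Re])
 then show "hgA r (r + 1/6) (2 * r + 5/3) ~= 0" "hgB r (r + 1/6) (2 * r + 5/3) ~= 0"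
  unfolding hgA_def hgB_def using i by (auto simp: Gamma_eq_zero_iff rGamma_eq_zero_iff n)
qed

text \<open>By the reflection formula the expression is a nonzero multiple of sin (pi * rho1) * sin (pi * (rho1 + 1/6)) + sin (pi * rho2) * sin (pi * (rho2 + 1/6)), and rho1 + rho2 = - 2/3 turns this into cos (pi / 6).\<close>
lemma connection_not_swapped:
 "hgA rho1 (rho1 + 1/6) (2 * rho1 + 5/3) * hgB rho2 (rho2 + 1/6) (2 * rho2 + 5/3)
  + hgA rho2 (rho2 + 1/6) (2 * rho2 + 5/3) * hgB rho1 (rho1 + 1/6) (2 * rho1 + 5/3) ~= 0" (is "?S ~= 0")
proof -
 define K where "K = 4/3 * Gamma (2 * rho1 + 5/3) * Gamma (2 * rho2 + 5/3) * Gamma (of_real (3/2)) * Gamma (of_real (1/2) :: complex)"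
 have K: "K ~= 0"
 proof -
  have "(of_real (3/2)::complex) \<notin> \<int>\<^sub>\<le>\<^sub>0" "(of_real (1/2)::complex) \<notin> \<int>\<^sub>\<le>\<^sub>0"
   by (auto elim!: nonpos_Ints_cases' dest!: arg_cong[where f = Re])
  then show ?thesis unfolding K_def using indicial_lower indicial_rho by (auto simp: Gamma_eq_zero_iff)
 qed
 have a: "2 * r + 5/3 - r = r + 5/3" "2 * r + 5/3 - (r + 1/6) = r + 3/2" for r :: complex by (simp_all add: algebra_simps)
 \<comment> \<open>Pair the factors whose arguments add up to 1.\<close>
 have "?S = K * ((rGamma (rho1 + 5/3) * rGamma rho2) * (rGamma (rho1 + 3/2) * rGamma (rho2 + 1/6))
   + (rGamma (rho2 + 5/3) * rGamma rho1) * (rGamma (rho2 + 3/2) * rGamma (rho1 + 1/6)))"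
  unfolding hgA_def hgB_def a K_def by (simp add: algebra_simps)
 also have "\<dots> = K / (of_real pi)\<^sup>2 * (sin (of_real pi * rho2) * sin (of_real pi * (rho2 + 1/6)) + sin (of_real pi * rho1) * sin (of_real pi * (rho1 + 1/6)))"
  unfolding Gamma_sines by (simp add: field_simps power2_eq_square)
 also have "sin (of_real pi * rho2) * sin (of_real pi * (rho2 + 1/6)) + sin (of_real pi * rho1) * sin (of_real pi * (rho1 + 1/6)) = of_real (cos (pi/6))"
 proof -
  define x where "x = of_real pi * rho1 + of_real (pi/12)"
  have p: "of_real pi * rho1 = x - of_real (pi/12)" "of_real pi * (rho1 + 1/6) = x + of_real (pi/12)"
   "of_real pi * rho2 = - of_real (pi/2) - x - of_real (pi/12)" "of_real pi * (rho2 + 1/6) = - of_real (pi/2) - x + of_real (pi/12)"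
   unfolding x_def rho_sum by (simp_all add: algebra_simps)
  have ss: "sin (a - b) * sin (a + b) = (sin a)\<^sup>2 - (sin b)\<^sup>2" for a b :: complex
   using sin_cos_squared_add[of a] sin_cos_squared_add[of b] unfolding sin_add sin_diff by algebra
  have v: "sin (complex_of_real (pi/2)) = 1" "cos (complex_of_real (pi/2)) = 0"
   by (simp_all only: sin_of_real cos_of_real sin_pi_half cos_pi_half of_real_1 of_real_0)
  have s2: "sin (- of_real (pi/2) - x) = - cos x"
   unfolding sin_diff sin_minus cos_minus v by simp
  have "sin (of_real pi * rho2) * sin (of_real pi * (rho2 + 1/6)) + sin (of_real pi * rho1) * sin (of_real pi * (rho1 + 1/6))
   = (cos x)\<^sup>2 + (sin x)\<^sup>2 - 2 * (sin (of_real (pi/12)))\<^sup>2"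
   unfolding p ss s2 by simp
  also have "\<dots> = 1 - 2 * (sin (of_real (pi/12)))\<^sup>2" by simp
  also have "\<dots> = of_real (1 - 2 * (sin (pi/12))\<^sup>2)" by (simp only: sin_of_real of_real_diff of_real_mult of_real_power of_real_numeral of_real_1)
  also have "1 - 2 * (sin (pi/12))\<^sup>2 = cos (pi/6)" using cos_double_sin[of "pi/12"] by simp
  finally show ?thesis .
 qed
 finally show ?thesis using K cos_30 by simp
qed

text \<open>Reflection fixes the even part of a solution and negates the odd part. If r12 = 0, the first solution would be an eigenvector, but both of its parts are nonzero. If r11 = 0, the connection coefficients would satisfy the relation that the preceding lemma excludes.\<close>
lemma flip_nonzero:
 assumes fl: "!!z. z \<in> D2 ==> Psi rho1 z = r11 * Psi rho1 (- z) + r12 * Psi rho2 (- z)"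
 shows "r11 ~= 0" "r12 ~= 0"
proof -
 define A B where "A r = hgA r (r + 1/6) (2 * r + 5/3)" and "B r = hgB r (r + 1/6) (2 * r + 5/3)" for r
 define e where "e r z = exp (r * Ln (1 - z\<^sup>2)) * (A r * hg r (r + 1/6) (-1/2) (z\<^sup>2))" for r z
 define od where "od r z = exp (r * Ln (1 - z\<^sup>2)) * (B r * hg (r + 5/3) (r + 3/2) (5/2) (z\<^sup>2))" for r z
 have P: "Psi r z = e r z + z^3 * od r z" "Psi r (- z) = e r z - z^3 * od r z" for r z
  unfolding Psi_def e_def od_def A_def B_def by (simp_all add: algebra_simps)
 have eq: "e rho1 z = r11 * e rho1 z + r12 * e rho2 z" "od rho1 z = - r11 * od rho1 z - r12 * od rho2 z" if z: "z \<in> D2" for z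
 proof -
  have z': "- z \<in> D2" "z ~= 0" using z by (auto simp: D2_def)
  note f = fl[OF z, unfolded P(2)[of _ z], unfolded P(1)[of _ z]] fl[OF z'(1), unfolded minus_minus, unfolded P(2)[of _ z], unfolded P(1)[of _ z]]
  have "2 * e rho1 z = 2 * (r11 * e rho1 z + r12 * e rho2 z)" using f by algebra
  then show "e rho1 z = r11 * e rho1 z + r12 * e rho2 z" by (simp only: mult_cancel_left) simp
  have "z^3 * (2 * od rho1 z) = z^3 * (2 * (- r11 * od rho1 z - r12 * od rho2 z))" using f by algebra
  then have "2 * od rho1 z = 2 * (- r11 * od rho1 z - r12 * od rho2 z)" using z'(2) by (metis mult_cancel_left power_not_zero)
  then show "od rho1 z = - r11 * od rho1 z - r12 * od rho2 z" by (simp only: mult_cancel_left) simp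
 qed
 have c: "isCont (\<lambda>z. hg a b c (z\<^sup>2)) 0" if "c \<notin> \<int>\<^sub>\<le>\<^sub>0" for a b c
  by (rule isCont_o2[where g = "hg a b c"]) (auto intro!: continuous_intros DERIV_isCont[OF hg_derivs(1)[OF that]])
 have lim: "(e r \<longlongrightarrow> A r) (at 0)" "(od r \<longlongrightarrow> B r) (at 0)" for r
 proof -
  have "isCont (e r) 0" "isCont (od r) 0"
   unfolding e_def[abs_def] od_def[abs_def] by (intro continuous_intros c half_not_nonpos isCont_Ln'; simp)+
  then show "(e r \<longlongrightarrow> A r) (at 0)" "(od r \<longlongrightarrow> B r) (at 0)" unfolding isCont_def by (simp_all add: e_def od_def)
 qed
 have ev: "\<forall>\<^sub>F z in at 0. z \<in> D2" unfolding eventually_at D2_def by (intro exI[of _ 1]) auto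
 have Ae: "A rho1 = r11 * A rho1 + r12 * A rho2"
 proof (rule eventually_eq_imp_limits_eq[OF lim(1)[of rho1]])
  show "((\<lambda>z. r11 * e rho1 z + r12 * e rho2 z) \<longlongrightarrow> r11 * A rho1 + r12 * A rho2) (at 0)" by (intro tendsto_intros lim)
  show "\<forall>\<^sub>F z in at 0. e rho1 z = r11 * e rho1 z + r12 * e rho2 z" using ev by eventually_elim (rule eq)
 qed simp
 have Be: "B rho1 = - r11 * B rho1 - r12 * B rho2"
 proof (rule eventually_eq_imp_limits_eq[OF lim(2)[of rho1]])
  show "((\<lambda>z. - r11 * od rho1 z - r12 * od rho2 z) \<longlongrightarrow> - r11 * B rho1 - r12 * B rho2) (at 0)" by (intro tendsto_intros lim)
  show "\<forall>\<^sub>F z in at 0. od rho1 z = - r11 * od rho1 z - r12 * od rho2 z" using ev by eventually_elim (rule eq)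
 qed simp
 have nz: "A rho1 ~= 0" "B rho1 ~= 0" unfolding A_def B_def using hgAB_nonzero indicial_rho by auto
 show "r12 ~= 0"
 proof
  assume "r12 = 0"
  then have "r11 = 1" "r11 = - 1" using Ae Be nz by (auto simp: minus_equation_iff)
  then show False by simp
 qed
 show "r11 ~= 0"
 proof
  assume "r11 = 0"
  then have "A rho1 * B rho2 + A rho2 * B rho1 = 0" using Ae Be by (simp add: algebra_simps)
  then show False using connection_not_swapped unfolding A_def B_def by simp
 qed
qed

definition lam0 :: real where "lam0 = exp (- 2 * pi * sqrt 2)"
definition per0 :: complex where "per0 = Complex 0 (12 * pi)"

lemma lam0: "0 < lam0" "lam0 < 1" by (auto simp: lam0_def)
lemma exp_per0: "exp (\<tau> + per0) = exp \<tau>"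
proof -
 have "per0 = 2 * of_int 6 * of_real pi * \<i>" by (simp add: per0_def complex_eq_iff)
 then have "exp per0 = 1" using exp_integer_2pi[of "of_int 6"] by (simp add: mult_ac)
 then show ?thesis by (simp add: exp_add)
qed

text \<open>The period is six times 2 * pi * \<i> because the phase space is periodic in s = (const + \<tau>) / 6. The real parts -1/3 of the exponents then disappear, and the imaginary parts give the real multipliers.\<close>
lemma psi_mono:
 "psi rho1 (\<tau> + per0) = lam0 * psi rho1 \<tau>" "psi' rho1 (\<tau> + per0) = lam0 * psi' rho1 \<tau>"
 "psi rho2 (\<tau> + per0) = psi rho2 \<tau> / lam0" "psi' rho2 (\<tau> + per0) = psi' rho2 \<tau> / lam0"
proof -
 have p: "exp (2 * of_int k * of_real pi * \<i>) = 1" for k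
  using exp_integer_2pi[of "of_int k"] by simp
 have "rho1 * per0 = of_real (- 2 * pi * sqrt 2) + 2 * of_int (-2) * of_real pi * \<i>"
  by (simp add: rho1_def per0_def complex_eq_iff)
 then have 1: "exp (rho1 * (\<tau> + per0)) = lam0 * exp (rho1 * \<tau>)"
  unfolding distrib_left exp_add lam0_def using p[of "-2"] by (simp only: exp_add exp_of_real mult_1_right) (simp add: mult.commute)
 have "rho2 * per0 = of_real (2 * pi * sqrt 2) + 2 * of_int (-2) * of_real pi * \<i>"
  by (simp add: rho2_def per0_def complex_eq_iff)
 then have 2: "exp (rho2 * (\<tau> + per0)) = exp (rho2 * \<tau>) / lam0"
  unfolding distrib_left exp_add lam0_def using p[of "-2"] by (simp only: exp_add exp_of_real mult_1_right) (simp add: exp_minus field_simps)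
 show "psi rho1 (\<tau> + per0) = lam0 * psi rho1 \<tau>" "psi' rho1 (\<tau> + per0) = lam0 * psi' rho1 \<tau>"
  "psi rho2 (\<tau> + per0) = psi rho2 \<tau> / lam0" "psi' rho2 (\<tau> + per0) = psi' rho2 \<tau> / lam0"
  unfolding psi_def psi'_def 1 2 exp_per0 by simp_all
qed

section \<open>Geodesics in logarithmic coordinates\<close>

text \<open>Like has_derivative together with complex linearity, but in the form of rules that compute the derivative.\<close>
definition cder :: "(complex => 'a => 'a) => ('a::real_normed_vector => complex) => 'a => ('a => complex) => bool" where
 "cder sc f a L \<longleftrightarrow> (f has_derivative L) (at a) \<and> (\<forall>c h. L (sc c h) = c * L h)"

lemma cderD: "cder sc f a L ==> (f has_derivative L) (at a)" "cder sc f a L ==> L (sc c h) = c * L h"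
 unfolding cder_def by auto

lemma cder_const: "cder sc (\<lambda>_. k) a (\<lambda>_. 0)" unfolding cder_def by auto

lemma cder_add: "cder sc f a L ==> cder sc g a M ==> cder sc (\<lambda>x. f x + g x) a (\<lambda>h. L h + M h)"
 unfolding cder_def by (auto intro!: has_derivative_add simp: algebra_simps)

lemma cder_diff: "cder sc f a L ==> cder sc g a M ==> cder sc (\<lambda>x. f x - g x) a (\<lambda>h. L h - M h)"
 unfolding cder_def by (auto intro!: has_derivative_diff simp: algebra_simps)

lemma cder_mult: "cder sc f a L ==> cder sc g a M ==> cder sc (\<lambda>x. f x * g x) a (\<lambda>h. f a * M h + L h * g a)"
 unfolding cder_def by (intro conjI has_derivative_mult) (auto simp: algebra_simps)

lemma cder_comp:
 assumes "cder sc f a L" "(\<phi> has_field_derivative d) (at (f a))"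
 shows "cder sc (\<lambda>x. \<phi> (f x)) a (\<lambda>h. d * L h)"
 using assms diff_chain_at[of f L a \<phi> "(*) d"] unfolding cder_def has_field_derivative_def by (auto simp: o_def)

lemma cder_unique: assumes "cder sc f a L" "cder sc f a M" shows "L = M"
 using assms has_derivative_unique unfolding cder_def by blast

lemma cder_cong: "cder sc f a L ==> (!!h. L h = M h) ==> cder sc f a M"
 by (simp add: cder_def) (metis ext)

lemma cder_transform: "cder sc f a L ==> open A ==> a \<in> A ==> (!!x. x \<in> A ==> f x = g x) ==> cder sc g a L"
 unfolding cder_def by (meson has_derivative_transform_within_open)

lemma chol_cder: "(!!a. a \<in> W ==> \<exists>L. cder sc f a L) ==> chol sc f W"
 unfolding chol_def cder_def by blast

lemma cder_df: "cder sc f a L ==> df f a = L" by (rule df_eqI[OF cderD(1)])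

type_synonym c4 = "complex \<times> c3"

definition sc4 :: "complex => c4 => c4" where
 "sc4 c a = (c * fst a, c * fst (snd a), c * fst (snd (snd a)), c * snd (snd (snd a)))"

lemma sc4_simp [simp]: "sc4 c (x, y, z, w) = (c * x, c * y, c * z, c * w)" by (simp add: sc4_def)

lemma bounded_linear_sc4: "bounded_linear (\<lambda>c. sc4 c h)"
 unfolding sc4_def by (intro bounded_linear_intros)

interpretation s4: scaling sc4
 by (intro scaling.intro bounded_linear_sc4) (simp add: sc4_def)

lemma cder_proj:
 "cder sc4 (\<lambda>a. fst a) a (\<lambda>h. fst h)" "cder sc4 (\<lambda>a. fst (snd a)) a (\<lambda>h. fst (snd h))"
 "cder sc4 (\<lambda>a. fst (snd (snd a))) a (\<lambda>h. fst (snd (snd h)))" "cder sc4 (\<lambda>a. snd (snd (snd a))) a (\<lambda>h. snd (snd (snd h)))"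
 unfolding cder_def sc4_def by (auto intro!: derivative_eq_intros)

text \<open>The sum of the inverse squares of the coordinates at the point (exp (s + \<xi>), exp (s - \<xi>), exp (- 2 * s)) of the surface. It vanishes where the metric degenerates.\<close>
definition NN :: "complex => complex => complex" where
 "NN s \<xi> = exp (- 2 * s) * (exp (2 * \<xi>) + exp (- 2 * \<xi>)) + exp (4 * s)"

definition UU :: "c4 set" where "UU = {a. NN (fst a) (fst (snd a)) ~= 0}"

definition mu :: "c4 => complex" where
 "mu a = (case a of (s, \<xi>, \<sigma>, \<omega>) => (6 * \<sigma>\<^sup>2 + 2 * \<omega>\<^sup>2) / NN s \<xi>)"

text \<open>The geodesic vector field in the coordinates s, \<xi> of the surface and their velocities \<sigma>, \<omega>.\<close>
definition X4 :: "c4 => c4" where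
 "X4 a = (case a of (s, \<xi>, \<sigma>, \<omega>) => (\<sigma>, \<omega>, 2 * \<sigma>\<^sup>2 - mu a * exp (4 * s) / 2,
   - mu a * exp (- 2 * s) * (exp (2 * \<xi>) - exp (- 2 * \<xi>)) / 2 - 2 * \<sigma> * \<omega>))"

definition H4 :: "c4 => complex" where
 "H4 a = (case a of (s, \<xi>, \<sigma>, \<omega>) => (exp (2 * s) * (exp (2 * \<xi>) * (\<sigma> + \<omega>)\<^sup>2 + exp (- 2 * \<xi>) * (\<sigma> - \<omega>)\<^sup>2) + 4 * exp (- 4 * s) * \<sigma>\<^sup>2) / 2)"

text \<open>Twice the kinetic energy for the velocity \<sigma> = 1, \<omega> = \<eta>.\<close>
definition gq :: "complex => complex => complex => complex" where
 "gq s \<xi> \<eta> = exp (2 * s) * (exp (2 * \<xi>) * (1 + \<eta>)\<^sup>2 + exp (- 2 * \<xi>) * (1 - \<eta>)\<^sup>2) + 4 * exp (- 4 * s)"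

definition kap :: "complex => complex => complex => complex" where
 "kap s \<xi> \<eta> = 2 - (3 + \<eta>\<^sup>2) * exp (4 * s) / NN s \<xi>"

text \<open>The second derivative of \<xi> with respect to s along a geodesic, as a function of s, \<xi> and the slope \<eta>.\<close>
definition Gf :: "complex => complex => complex => complex" where
 "Gf s \<xi> \<eta> = - ((3 + \<eta>\<^sup>2) * exp (- 2 * s) * (exp (2 * \<xi>) - exp (- 2 * \<xi>)) / NN s \<xi>) - 2 * \<eta> - \<eta> * kap s \<xi> \<eta>"

text \<open>Conservation of energy along the geodesics parametrised by s, where kap is the logarithmic derivative of the velocity \<sigma>. After clearing the exponentials it is a polynomial identity.\<close>
lemma energy_identity:
 assumes N: "NN s \<xi> ~= 0"
 shows "exp (2 * s) * 2 * (exp (2 * \<xi>) * (1 + \<eta>)\<^sup>2 + exp (- 2 * \<xi>) * (1 - \<eta>)\<^sup>2) - 16 * exp (- 4 * s)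
   + \<eta> * (exp (2 * s) * (2 * exp (2 * \<xi>) * (1 + \<eta>)\<^sup>2 - 2 * exp (- 2 * \<xi>) * (1 - \<eta>)\<^sup>2))
   + Gf s \<xi> \<eta> * (exp (2 * s) * (2 * exp (2 * \<xi>) * (1 + \<eta>) - 2 * exp (- 2 * \<xi>) * (1 - \<eta>)))
   + 2 * gq s \<xi> \<eta> * kap s \<xi> \<eta> = 0"
proof -
 define S x y n where "S = exp (2 * s)" and "x = exp (2 * \<xi>)" and "y = exp (- 2 * \<xi>)" and "n = (3 + \<eta>\<^sup>2) / NN s \<xi>"
 define R i where "R = exp (- 4 * s)" and "i = exp (- 2 * s)"
 have xy: "x * y = 1" unfolding x_def y_def by (simp flip: exp_add)
 have iS: "i * S = 1" unfolding i_def S_def by (simp flip: exp_add)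
 have R: "R = i * i" unfolding R_def i_def by (simp flip: exp_add)
 have e4: "exp (4 * s) = S * S" unfolding S_def by (simp flip: exp_add)
 have nN: "n * (i * (x + y) + S * S) = 3 + \<eta>\<^sup>2"
  using N unfolding n_def NN_def e4 i_def[symmetric] x_def[symmetric] y_def[symmetric] by simp
 have k: "kap s \<xi> \<eta> = 2 - n * (S * S)" unfolding kap_def n_def e4 by simp
 have G: "Gf s \<xi> \<eta> = - n * i * (x - y) - 2 * \<eta> - \<eta> * (2 - n * (S * S))"
  unfolding Gf_def k i_def x_def y_def n_def by simp
 have n': "n * (x + y + S * S * S) = (3 + \<eta>\<^sup>2) * S"
 proof -
  have "n * (x + y + S * S * S) = n * ((i * S) * (x + y) + S * S * S)" using iS by simp
  also have "\<dots> = (n * (i * (x + y) + S * S)) * S" by (simp add: algebra_simps)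
  finally show ?thesis unfolding nN .
 qed
 \<comment> \<open>Only the product of Gf with S = exp (2 * s) occurs, which is free of negative powers of S.\<close>
 define A B where "A = 1 + \<eta>" and "B = 1 - \<eta>"
 define g where "g = Gf s \<xi> \<eta>"
 have RS: "R * (S * S) = 1" unfolding R using iS by (simp add: algebra_simps)
 have gS: "g * S = - n * (x - y) - 4 * \<eta> * S + \<eta> * n * (S * S * S)"
 proof -
  have "g * S = - n * (x - y) * (i * S) - 4 * \<eta> * S + \<eta> * n * (S * S * S)" unfolding g_def G by (simp add: algebra_simps)
  then show ?thesis unfolding iS by simp
 qed
 have "S * 2 * (x * A\<^sup>2 + y * B\<^sup>2) - 16 * R + \<eta> * (S * (2 * x * A\<^sup>2 - 2 * y * B\<^sup>2)) + g * (S * (2 * x * A - 2 * y * B))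
   + 2 * (S * (x * A\<^sup>2 + y * B\<^sup>2) + 4 * R) * (2 - n * (S * S))
  = S * 2 * (x * A\<^sup>2 + y * B\<^sup>2) + \<eta> * (S * (2 * x * A\<^sup>2 - 2 * y * B\<^sup>2)) + (g * S) * (2 * x * A - 2 * y * B)
   + 2 * S * (x * A\<^sup>2 + y * B\<^sup>2) * (2 - n * (S * S)) - 8 * n * (R * (S * S))"
  by (simp add: algebra_simps)
 also have "\<dots> = - 2 * (x * A + y * B) * (n * (x + y + S * S * S) - (3 + \<eta>\<^sup>2) * S) + 8 * n * (x * y - 1)"
  unfolding gS RS A_def B_def by algebra
 also have "\<dots> = 0" unfolding n' xy by simp
 finally show ?thesis
  unfolding gq_def k R_def S_def x_def y_def A_def B_def g_def .
qed

lemma H4_scale: "H4 (s, \<xi>, P, P * \<eta>) = P\<^sup>2 * gq s \<xi> \<eta> / 2"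
 unfolding H4_def gq_def by (simp add: algebra_simps power2_eq_square)

lemma X4_scale: "X4 (s, \<xi>, P, P * \<eta>) = (P, P * \<eta>, P\<^sup>2 * kap s \<xi> \<eta>, P\<^sup>2 * (Gf s \<xi> \<eta> + \<eta> * kap s \<xi> \<eta>))"
 unfolding X4_def mu_def Gf_def kap_def divide_inverse
 by (simp add: algebra_simps power2_eq_square)

text \<open>A parametrisation z of the coordinate s on which the speed \<gamma> of the geodesic \<xi> = 0 is single-valued: it is a square root of the energy factor.\<close>
locale sheet =
 fixes D :: "complex set" and s \<gamma> p :: "complex => complex"
 assumes D: "open D" "connected D"
  and s: "!!z. z \<in> D ==> (s has_field_derivative p z) (at z)" and p: "!!z. z \<in> D ==> p z ~= 0"
  and \<gamma>: "\<gamma> holomorphic_on D" "!!z. z \<in> D ==> \<gamma> z ~= 0" "!!z. z \<in> D ==> (\<gamma> z)\<^sup>2 = gq (s z) 0 0"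
begin

definition rat :: "c4 => complex" where
 "rat a = (case a of (z, \<xi>, \<eta>, k) => gq (s z) \<xi> \<eta> / (\<gamma> z)\<^sup>2)"
definition EE :: "c4 => complex" where
 "EE a = \<gamma> (fst a) * csqrt (rat a)"
definition PP :: "c4 => complex" where "PP a = snd (snd (snd a)) / EE a"
text \<open>The point of the phase space on the level of energy k ^ 2 / 2 above s, \<xi> with slope \<eta>. The root of the energy is the one that continues \<gamma>.\<close>
definition Th :: "c4 => c4" where
 "Th a = (s (fst a), fst (snd a), PP a, PP a * fst (snd (snd a)))"
text \<open>The domain where the principal root is holomorphic and the energy level is regular.\<close>
definition Om :: "c4 set" where
 "Om = {a. fst a \<in> D \<and> NN (s (fst a)) (fst (snd a)) ~= 0 \<and> rat a \<notin> \<real>\<^sub>\<le>\<^sub>0 \<and> snd (snd (snd a)) ~= 0}"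

lemma EE_sq: "fst a \<in> D ==> (EE a)\<^sup>2 = gq (s (fst a)) (fst (snd a)) (fst (snd (snd a)))"
 unfolding EE_def rat_def power_mult_distrib using \<gamma>(2) by (simp add: case_prod_unfold)

lemma Om_nz: assumes "a \<in> Om" shows "EE a ~= 0" "PP a ~= 0" "fst a \<in> D"
proof -
 have "rat a ~= 0" using assms unfolding Om_def by auto
 then show "EE a ~= 0" "PP a ~= 0" "fst a \<in> D" using assms \<gamma>(2) unfolding Om_def PP_def EE_def by auto
qed

lemma s_cont: "continuous_on D s" by (intro continuous_at_imp_continuous_on ballI DERIV_isCont[OF s])
lemma open_D: "open (D \<times> (UNIV :: (c3) set))" using D(1) by (intro open_Times) auto

lemma rat_cont: "continuous_on (D \<times> UNIV) rat"
 unfolding rat_def case_prod_unfold gq_def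
 by (intro continuous_intros continuous_on_compose2[OF s_cont] continuous_on_compose2[OF holomorphic_on_imp_continuous_on[OF \<gamma>(1)]]) (use \<gamma>(2) in auto)

lemma open_Om: "open Om"
proof -
 let ?f = "\<lambda>a. (NN (s (fst a)) (fst (snd a)), rat a, snd (snd (snd a)))"
 have "continuous_on (D \<times> UNIV) ?f"
  unfolding NN_def by (intro continuous_intros rat_cont continuous_on_compose2[OF s_cont]) auto
 then have "open ((D \<times> UNIV) \<inter> ?f -` ((- {0}) \<times> (- \<real>\<^sub>\<le>\<^sub>0) \<times> (- {0})))"
  by (rule continuous_open_preimage[OF _ open_D]) (auto intro!: open_Times)
 moreover have "(D \<times> UNIV) \<inter> ?f -` ((- {0}) \<times> (- \<real>\<^sub>\<le>\<^sub>0) \<times> (- {0})) = Om" unfolding Om_def by auto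
 ultimately show ?thesis by simp
qed

lemma base_Om: assumes "z \<in> D" "k ~= 0" shows "(z, 0, 0, k) \<in> Om"
proof -
 have "NN (s z) 0 = exp (2 * s z) * gq (s z) 0 0 / 2"
 proof -
  have e: "exp (2 * s z) * exp (2 * s z) = exp (4 * s z)" "exp (2 * s z) * exp (- 4 * s z) = exp (- 2 * s z)" by (simp_all flip: exp_add)
  have "exp (2 * s z) * gq (s z) 0 0 / 2 = exp (2 * s z) * exp (2 * s z) + 2 * (exp (2 * s z) * exp (- 4 * s z))"
   unfolding gq_def by (simp add: algebra_simps)
  then show ?thesis unfolding e NN_def by simp
 qed
 then have "NN (s z) 0 ~= 0" using \<gamma>(2,3)[OF assms(1)] by (metis divide_eq_0_iff exp_not_eq_zero mult_eq_0_iff power_not_zero zero_neq_numeral)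
 moreover have "rat (z, 0, 0, k) = 1" unfolding rat_def by (simp add: \<gamma>(3)[OF assms(1), symmetric] \<gamma>(2)[OF assms(1)])
 ultimately show ?thesis using assms unfolding Om_def by simp
qed

lemma Th_base: assumes "z \<in> D" shows "Th (z, 0, 0, k) = (s z, 0, k / \<gamma> z, 0)"
 unfolding Th_def PP_def EE_def rat_def by (simp add: \<gamma>(3)[OF assms(1), symmetric] \<gamma>(2)[OF assms(1)])

lemma Th_H: "a \<in> Om ==> H4 (Th a) = (snd (snd (snd a)))\<^sup>2 / 2"
 unfolding Th_def H4_scale EE_sq[OF Om_nz(3), symmetric] using Om_nz(1) by (simp add: PP_def power_divide)

lemma Th_UU: "a \<in> Om ==> Th a \<in> UU" unfolding Th_def Om_def UU_def by simp

lemma gq_der: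
 assumes z: "fst a \<in> D"
 shows "cder sc4 (\<lambda>a. gq (s (fst a)) (fst (snd a)) (fst (snd (snd a)))) a
  (\<lambda>h. (exp (2 * s (fst a)) * 2 * (exp (2 * fst (snd a)) * (1 + fst (snd (snd a)))\<^sup>2 + exp (- 2 * fst (snd a)) * (1 - fst (snd (snd a)))\<^sup>2) - 16 * exp (- 4 * s (fst a))) * (p (fst a) * fst h)
   + (exp (2 * s (fst a)) * (2 * exp (2 * fst (snd a)) * (1 + fst (snd (snd a)))\<^sup>2 - 2 * exp (- 2 * fst (snd a)) * (1 - fst (snd (snd a)))\<^sup>2)) * fst (snd h)
   + (exp (2 * s (fst a)) * (2 * exp (2 * fst (snd a)) * (1 + fst (snd (snd a))) - 2 * exp (- 2 * fst (snd a)) * (1 - fst (snd (snd a))))) * fst (snd (snd h)))"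
proof -
 have e: "cder sc4 (\<lambda>a. exp (c * s (fst a))) a (\<lambda>h. (c * exp (c * s (fst a))) * (p (fst a) * fst h))" for c
 proof -
  have "cder sc4 (\<lambda>a. s (fst a)) a (\<lambda>h. p (fst a) * fst h)" by (rule cder_comp[OF cder_proj(1)]) (rule s[OF z])
  then show ?thesis by (rule cder_comp) (auto intro!: derivative_eq_intros)
 qed
 have x: "cder sc4 (\<lambda>a. exp (c * fst (snd a))) a (\<lambda>h. (c * exp (c * fst (snd a))) * fst (snd h))" for c
  by (rule cder_comp[OF cder_proj(2)]) (auto intro!: derivative_eq_intros)
 have pl: "cder sc4 (\<lambda>a. (1 + fst (snd (snd a)))\<^sup>2) a (\<lambda>h. (2 * (1 + fst (snd (snd a)))) * fst (snd (snd h)))"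
  by (rule cder_comp[OF cder_proj(3), of "\<lambda>x. (1 + x)\<^sup>2"]) (auto intro!: derivative_eq_intros)
 have mi: "cder sc4 (\<lambda>a. (1 - fst (snd (snd a)))\<^sup>2) a (\<lambda>h. (- 2 * (1 - fst (snd (snd a)))) * fst (snd (snd h)))"
  by (rule cder_comp[OF cder_proj(3), of "\<lambda>x. (1 - x)\<^sup>2"]) (auto intro!: derivative_eq_intros)
 show ?thesis unfolding gq_def
  by (rule cder_cong[OF cder_add[OF cder_mult[OF e cder_add[OF cder_mult[OF x pl] cder_mult[OF x mi]]] cder_mult[OF cder_const e]]])
   (simp add: algebra_simps)
qed

lemma EE_der: assumes a: "a \<in> Om" shows "\<exists>M. cder sc4 EE a M"
proof -
 have z: "fst a \<in> D" by (rule Om_nz(3)[OF a])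
 have "cder sc4 (\<lambda>a. \<gamma> (fst a)) a (\<lambda>h. deriv \<gamma> (fst a) * fst h)"
  by (rule cder_comp[OF cder_proj(1)]) (rule holomorphic_derivI[OF \<gamma>(1) D(1) z])
 note g = this
 have "cder sc4 (\<lambda>a. inverse ((\<gamma> (fst a))\<^sup>2)) a (\<lambda>h. (- (inverse ((\<gamma> (fst a))\<^sup>2) * (2 * \<gamma> (fst a)) * inverse ((\<gamma> (fst a))\<^sup>2))) * (deriv \<gamma> (fst a) * fst h))"
  by (rule cder_comp[OF g, of "\<lambda>x. inverse (x\<^sup>2)"]) (use \<gamma>(2)[OF z] in \<open>auto intro!: derivative_eq_intros simp: power2_eq_square\<close>)
 note i = this
 have "(\<lambda>a. gq (s (fst a)) (fst (snd a)) (fst (snd (snd a))) * inverse ((\<gamma> (fst a))\<^sup>2)) = rat"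
  by (simp add: fun_eq_iff rat_def case_prod_unfold divide_inverse)
 then obtain L where L: "cder sc4 rat a L" using cder_mult[OF gq_der[OF z] i] by auto
 have "rat a \<notin> \<real>\<^sub>\<le>\<^sub>0" using a unfolding Om_def by auto
 then have "(csqrt has_field_derivative inverse (2 * csqrt (rat a))) (at (rat a))" by (rule has_field_derivative_csqrt)
 from cder_mult[OF g cder_comp[OF L this]] show ?thesis unfolding EE_def[abs_def] by blast
qed

text \<open>Differentiation of the square of the root gives its derivative; along the reduced flow the energy identity evaluates it.\<close>
lemma Th_der:
 assumes a: "(z, \<xi>, \<eta>, k) \<in> Om"
 shows "\<exists>L. (Th has_derivative (\<lambda>h. (p z * fst h, fst (snd h), L h, L h * \<eta> + PP (z, \<xi>, \<eta>, k) * fst (snd (snd h))))) (at (z, \<xi>, \<eta>, k))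
  \<and> (\<forall>c h. L (sc4 c h) = c * L h) \<and> L (1, p z * \<eta>, p z * Gf (s z) \<xi> \<eta>, 0) = p z * PP (z, \<xi>, \<eta>, k) * kap (s z) \<xi> \<eta>"
proof -
 let ?a = "(z, \<xi>, \<eta>, k)"
 have z: "z \<in> D" and nz: "EE ?a ~= 0" and N: "NN (s z) \<xi> ~= 0" using Om_nz[OF a] a unfolding Om_def by auto
 obtain M where M: "cder sc4 EE ?a M" using EE_der[OF a] by blast
 define L where "L h = inverse (EE ?a) * snd (snd (snd h)) - k * (M h * inverse ((EE ?a)\<^sup>2))" for h :: c4
 have i: "cder sc4 (\<lambda>a. inverse (EE a)) ?a (\<lambda>h. - inverse ((EE ?a)\<^sup>2) * M h)"
  by (rule cder_comp[OF M, of inverse]) (use nz in \<open>auto intro!: derivative_eq_intros simp: power2_eq_square\<close>)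
 have P: "cder sc4 PP ?a L"
  unfolding PP_def[abs_def] divide_inverse
  by (rule cder_cong[OF cder_mult[OF cder_proj(4) i]]) (simp add: L_def algebra_simps)
 have zz: "cder sc4 (\<lambda>a. s (fst a)) ?a (\<lambda>h. p z * fst h)" by (rule cder_comp[OF cder_proj(1)]) (use s[OF z] in simp)
 have Pe: "cder sc4 (\<lambda>a. PP a * fst (snd (snd a))) ?a (\<lambda>h. L h * \<eta> + PP ?a * fst (snd (snd h)))"
  by (rule cder_cong[OF cder_mult[OF P cder_proj(3)]]) simp
 have "(Th has_derivative (\<lambda>h. (p z * fst h, fst (snd h), L h, L h * \<eta> + PP ?a * fst (snd (snd h))))) (at ?a)"
  unfolding Th_def[abs_def]
  by (intro has_derivative_Pair cderD(1)[OF zz] cderD(1)[OF cder_proj(2)] cderD(1)[OF P] cderD(1)[OF Pe])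
 moreover have "L (1, p z * \<eta>, p z * Gf (s z) \<xi> \<eta>, 0) = p z * PP ?a * kap (s z) \<xi> \<eta>" (is "L ?h = _")
 proof -
  have A1: "cder sc4 (\<lambda>a. EE a * EE a) ?a (\<lambda>h. EE ?a * M h + M h * EE ?a)" by (rule cder_mult[OF M M])
  have A2: "cder sc4 (\<lambda>a. EE a * EE a) ?a (\<lambda>h. (exp (2 * s z) * 2 * (exp (2 * \<xi>) * (1 + \<eta>)\<^sup>2 + exp (- 2 * \<xi>) * (1 - \<eta>)\<^sup>2) - 16 * exp (- 4 * s z)) * (p z * fst h)
   + (exp (2 * s z) * (2 * exp (2 * \<xi>) * (1 + \<eta>)\<^sup>2 - 2 * exp (- 2 * \<xi>) * (1 - \<eta>)\<^sup>2)) * fst (snd h)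
   + (exp (2 * s z) * (2 * exp (2 * \<xi>) * (1 + \<eta>) - 2 * exp (- 2 * \<xi>) * (1 - \<eta>))) * fst (snd (snd h)))"
   by (rule cder_transform[OF gq_der[of ?a, simplified fst_conv snd_conv, OF z] open_D])
    (use z EE_sq in \<open>auto simp: power2_eq_square\<close>)
  have "EE ?a * M ?h + M ?h * EE ?a = (exp (2 * s z) * 2 * (exp (2 * \<xi>) * (1 + \<eta>)\<^sup>2 + exp (- 2 * \<xi>) * (1 - \<eta>)\<^sup>2) - 16 * exp (- 4 * s z)) * (p z * 1)
   + (exp (2 * s z) * (2 * exp (2 * \<xi>) * (1 + \<eta>)\<^sup>2 - 2 * exp (- 2 * \<xi>) * (1 - \<eta>)\<^sup>2)) * (p z * \<eta>)
   + (exp (2 * s z) * (2 * exp (2 * \<xi>) * (1 + \<eta>) - 2 * exp (- 2 * \<xi>) * (1 - \<eta>))) * (p z * Gf (s z) \<xi> \<eta>)"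
   using fun_cong[OF cder_unique[OF A1 A2], of ?h] by (simp only: fst_conv snd_conv)
  also have "\<dots> = p z * (exp (2 * s z) * 2 * (exp (2 * \<xi>) * (1 + \<eta>)\<^sup>2 + exp (- 2 * \<xi>) * (1 - \<eta>)\<^sup>2) - 16 * exp (- 4 * s z)
   + \<eta> * (exp (2 * s z) * (2 * exp (2 * \<xi>) * (1 + \<eta>)\<^sup>2 - 2 * exp (- 2 * \<xi>) * (1 - \<eta>)\<^sup>2))
   + Gf (s z) \<xi> \<eta> * (exp (2 * s z) * (2 * exp (2 * \<xi>) * (1 + \<eta>) - 2 * exp (- 2 * \<xi>) * (1 - \<eta>))))"
   by (simp only: distrib_left right_diff_distrib mult_ac mult_1_right mult_1_left)
  also have "\<dots> = p z * - (2 * gq (s z) \<xi> \<eta> * kap (s z) \<xi> \<eta>)"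
   unfolding energy_identity[OF N, THEN eq_neg_iff_add_eq_0[THEN iffD2]] ..
  also have "gq (s z) \<xi> \<eta> = (EE ?a)\<^sup>2" using EE_sq[of ?a] z by simp
  finally have "2 * EE ?a * M ?h = 2 * EE ?a * (- p z * EE ?a * kap (s z) \<xi> \<eta>)" by (simp add: power2_eq_square algebra_simps)
  then have Mh: "M ?h = - p z * EE ?a * kap (s z) \<xi> \<eta>" using nz by (simp only: mult_cancel_left) simp
  show ?thesis unfolding L_def Mh PP_def using nz by (simp add: power2_eq_square field_simps)
 qed
 ultimately show ?thesis using cderD(2)[OF P] by blast
qed

end

text \<open>The linearisation along the geodesic \<xi> = 0 is the variational equation in the variable U = - exp (6 * s) / 2.\<close>
lemma Gf_linear:
 assumes U: "U ~= 1" and s: "exp (6 * s) = - 2 * U"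
 shows "((\<lambda>eps. p * Gf s (eps * a) (eps * b) / eps) \<longlongrightarrow> p * (- 6 / (1 - U)) * a + p * (- (4 - U) / (1 - U)) * b) (at 0)"
proof -
 define i S where "i = exp (- 2 * s)" and "S = exp (4 * s)"
 have iS: "S = exp (6 * s) * i" unfolding i_def S_def by (simp flip: exp_add)
 have i0: "i ~= 0" unfolding i_def by simp
 have N0: "NN s 0 = i * (2 * (1 - U))" unfolding NN_def i_def[symmetric] S_def[symmetric] unfolding iS s by (simp add: algebra_simps)
 have nz: "NN s 0 ~= 0" unfolding N0 using U i0 by simp
 have dN: "((\<lambda>eps. NN s (eps * a)) has_field_derivative 0) (at 0)"
  unfolding NN_def by (auto intro!: derivative_eq_intros)
 define A where "A eps = - (3 + (eps * b)\<^sup>2) * i * (exp (2 * (eps * a)) - exp (- 2 * (eps * a)))" for eps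
 define B where "B eps = (eps * b) * ((3 + (eps * b)\<^sup>2) * S)" for eps
 have dA: "(A has_field_derivative - 12 * i * a) (at 0)" unfolding A_def[abs_def] by (auto intro!: derivative_eq_intros)
 have dB: "(B has_field_derivative 3 * S * b) (at 0)" unfolding B_def[abs_def] by (auto intro!: derivative_eq_intros)
 have d4: "((\<lambda>eps. 4 * (eps * b)) has_field_derivative 4 * b) (at 0)" by (auto intro!: derivative_eq_intros)
 have eq: "(\<lambda>eps. Gf s (eps * a) (eps * b)) = (\<lambda>eps. (A eps + B eps) / NN s (eps * a) - 4 * (eps * b))"
  unfolding Gf_def kap_def A_def B_def i_def S_def by (simp add: fun_eq_iff divide_inverse algebra_simps)
 have "((\<lambda>eps. (A eps + B eps) / NN s (eps * a) - 4 * (eps * b)) has_field_derivative (- 12 * i * a + 3 * S * b) / NN s 0 - 4 * b) (at 0)"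
  by (rule DERIV_cong[OF DERIV_diff[OF DERIV_divide[OF DERIV_add[OF dA dB] dN] d4]]) (use nz in auto)
 moreover have "Gf s (0 * a) (0 * b) = 0" unfolding Gf_def by simp
 ultimately have "((\<lambda>eps. Gf s (eps * a) (eps * b) / eps) \<longlongrightarrow> (- 12 * i * a + 3 * S * b) / NN s 0 - 4 * b) (at 0)"
  unfolding eq[symmetric] has_field_derivative_iff by simp
 then have "((\<lambda>eps. p * (Gf s (eps * a) (eps * b) / eps)) \<longlongrightarrow> p * ((- 12 * i * a + 3 * S * b) / NN s 0 - 4 * b)) (at 0)"
  by (rule tendsto_mult_left)
 moreover have e: "(- 12 * i * a + 3 * S * b) / NN s 0 - 4 * b = (- 6 / (1 - U)) * a + (- (4 - U) / (1 - U)) * b"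
  unfolding N0 iS s using i0 U by (simp add: divide_simps) (simp add: algebra_simps)
 moreover have l: "p * (Gf s (eps * a) (eps * b) / eps) = p * Gf s (eps * a) (eps * b) / eps" for eps by simp
 ultimately show ?thesis unfolding e l by (simp only: distrib_left mult.assoc)
qed

section \<open>Meromorphic functions on energy levels\<close>

text \<open>A local representation of a meromorphic first integral of the geodesic flow.\<close>
definition rep4 :: "(c4 => complex) => c4 set => (c4 => complex) => (c4 => complex) => bool" where
 "rep4 F W f g \<longleftrightarrow> open W \<and> W \<subseteq> UU \<and> chol sc4 f W \<and> chol sc4 g W \<and> W \<subseteq> closure {a\<in>W. g a ~= 0} \<and>
   (\<forall>a\<in>W. g a ~= 0 \<longrightarrow> F a = f a / g a \<and> num_df f g a (X4 a) = 0)"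

definition polydisc :: "complex => complex => real => c4 set" where
 "polydisc z k r = ball z r \<times> ball 0 r \<times> ball 0 r \<times> ball k r"

definition tridisc :: "complex => real => (c3) set" where
 "tridisc z r = ball z r \<times> ball 0 r \<times> ball 0 r"

lemma num_df_linear:
 assumes "chol sc4 f W" "chol sc4 g W" "a \<in> W"
 shows "num_df f g a (x + y) = num_df f g a x + num_df f g a y" "num_df f g a (sc4 c x) = c * num_df f g a x"
proof -
 have l: "linear (df f a)" "linear (df g a)"
  using chol_df(1)[OF assms(1,3)] chol_df(1)[OF assms(2,3)] has_derivative_linear by auto
 show "num_df f g a (x + y) = num_df f g a x + num_df f g a y" "num_df f g a (sc4 c x) = c * num_df f g a x"
  unfolding num_df_def chol_df(2)[OF assms(1,3)] chol_df(2)[OF assms(2,3)] linear_add[OF l(1)] linear_add[OF l(2)]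
  by (simp_all add: algebra_simps)
qed

lemma chol_H4: "chol sc4 H4 W"
proof (rule chol_cder)
 fix a :: c4 assume "a \<in> W"
 have e: "cder sc4 (\<lambda>a. exp (c * fst a)) a (\<lambda>h. (c * exp (c * fst a)) * fst h)" for c
  by (rule cder_comp[OF cder_proj(1)]) (auto intro!: derivative_eq_intros)
 have x: "cder sc4 (\<lambda>a. exp (c * fst (snd a))) a (\<lambda>h. (c * exp (c * fst (snd a))) * fst (snd h))" for c
  by (rule cder_comp[OF cder_proj(2)]) (auto intro!: derivative_eq_intros)
 have sq: "\<exists>L. cder sc4 (\<lambda>a. (f a)\<^sup>2) a L" if "cder sc4 f a M" for f M
  using cder_mult[OF that that] unfolding power2_eq_square by blast
 obtain L1 where 1: "cder sc4 (\<lambda>a. (fst (snd (snd a)) + snd (snd (snd a)))\<^sup>2) a L1" using sq[OF cder_add[OF cder_proj(3,4)]] by blast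
 obtain L2 where 2: "cder sc4 (\<lambda>a. (fst (snd (snd a)) - snd (snd (snd a)))\<^sup>2) a L2" using sq[OF cder_diff[OF cder_proj(3,4)]] by blast
 obtain L3 where 3: "cder sc4 (\<lambda>a. (fst (snd (snd a)))\<^sup>2) a L3" using sq[OF cder_proj(3)] by blast
 have "H4 = (\<lambda>a. (exp (2 * fst a) * (exp (2 * fst (snd a)) * (fst (snd (snd a)) + snd (snd (snd a)))\<^sup>2 + exp (- 2 * fst (snd a)) * (fst (snd (snd a)) - snd (snd (snd a)))\<^sup>2)
   + 4 * exp (- 4 * fst a) * (fst (snd (snd a)))\<^sup>2) * (1 / 2))"
  by (simp add: fun_eq_iff H4_def)
 then show "\<exists>L. cder sc4 H4 a L"
  using cder_mult[OF cder_add[OF cder_mult[OF e[of 2] cder_add[OF cder_mult[OF x[of 2] 1] cder_mult[OF x[of "- 2"] 2]]]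
   cder_mult[OF cder_mult[OF cder_const[of _ 4] e[of "- 4"]] 3]] cder_const[of _ "1 / 2"]] by auto
qed

context sheet
begin

definition DL :: "c4 => c4 => complex" where
 "DL a = (SOME L. (Th has_derivative (\<lambda>h. (p (fst a) * fst h, fst (snd h), L h, L h * fst (snd (snd a)) + PP a * fst (snd (snd h))))) (at a)
  \<and> (\<forall>c h. L (sc4 c h) = c * L h) \<and> L (1, p (fst a) * fst (snd (snd a)), p (fst a) * Gf (s (fst a)) (fst (snd a)) (fst (snd (snd a))), 0)
    = p (fst a) * PP a * kap (s (fst a)) (fst (snd a)) (fst (snd (snd a))))"
definition DTh :: "c4 => c4 => c4" where
 "DTh a h = (p (fst a) * fst h, fst (snd h), DL a h, DL a h * fst (snd (snd a)) + PP a * fst (snd (snd h)))"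

lemma DTh:
 assumes "a \<in> Om"
 shows "(Th has_derivative DTh a) (at a)" "DTh a (sc4 c h) = sc4 c (DTh a h)"
  "DL a (1, p (fst a) * fst (snd (snd a)), p (fst a) * Gf (s (fst a)) (fst (snd a)) (fst (snd (snd a))), 0)
    = p (fst a) * PP a * kap (s (fst a)) (fst (snd a)) (fst (snd (snd a)))"
proof -
 obtain z \<xi> \<eta> k where a: "a = (z, \<xi>, \<eta>, k)" by (cases a)
 have ex: "\<exists>L. (Th has_derivative (\<lambda>h. (p (fst a) * fst h, fst (snd h), L h, L h * fst (snd (snd a)) + PP a * fst (snd (snd h))))) (at a)
  \<and> (\<forall>c h. L (sc4 c h) = c * L h) \<and> L (1, p (fst a) * fst (snd (snd a)), p (fst a) * Gf (s (fst a)) (fst (snd a)) (fst (snd (snd a))), 0)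
    = p (fst a) * PP a * kap (s (fst a)) (fst (snd a)) (fst (snd (snd a)))"
  using Th_der[of z \<xi> \<eta> k] assms unfolding a by (simp only: fst_conv snd_conv)
 note * = someI_ex[OF ex, folded DL_def]
 show "(Th has_derivative DTh a) (at a)" unfolding DTh_def[abs_def] using * by blast
 show "DTh a (sc4 c h) = sc4 c (DTh a h)" unfolding DTh_def using * by (simp add: sc4_def algebra_simps)
 show "DL a (1, p (fst a) * fst (snd (snd a)), p (fst a) * Gf (s (fst a)) (fst (snd a)) (fst (snd (snd a))), 0)
    = p (fst a) * PP a * kap (s (fst a)) (fst (snd a)) (fst (snd (snd a)))" using * by blast
qed

text \<open>The reduced flow on an energy level is mapped to the geodesic flow up to a change of time.\<close>
lemma DTh_flow:
 assumes a: "(z, \<xi>, \<eta>, k) \<in> Om"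
 shows "DTh (z, \<xi>, \<eta>, k) (1, p z * \<eta>, p z * Gf (s z) \<xi> \<eta>, 0) = sc4 (p z / PP (z, \<xi>, \<eta>, k)) (X4 (Th (z, \<xi>, \<eta>, k)))"
proof -
 define P where "P = PP (z, \<xi>, \<eta>, k)"
 have nz: "P ~= 0" unfolding P_def by (rule Om_nz(2)[OF a])
 have "Th (z, \<xi>, \<eta>, k) = (s z, \<xi>, P, P * \<eta>)" unfolding Th_def P_def by simp
 then show ?thesis using DTh(3)[OF a] nz unfolding DTh_def P_def[symmetric]
  by (simp add: X4_scale P_def[symmetric] power2_eq_square algebra_simps)
qed

lemma polydisc_exists:
 assumes z: "z0 \<in> D" and k: "k0 ~= 0" and W: "open W" "Th (z0, 0, 0, k0) \<in> W"
 shows "\<exists>r>0. ball z0 r \<subseteq> D \<and> polydisc z0 k0 r \<subseteq> Om \<and> Th ` polydisc z0 k0 r \<subseteq> W"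
proof -
 have "continuous_on Om Th" by (intro continuous_at_imp_continuous_on ballI has_derivative_continuous[OF DTh(1)])
 then have o: "open (Om \<inter> Th -` W)" by (rule continuous_open_preimage[OF _ open_Om W(1)])
 have "(z0, 0, 0, k0) \<in> Om \<inter> Th -` W" using base_Om[OF z k] W(2) by simp
 then obtain e where e: "e > 0" "ball (z0, 0, 0, k0) e \<subseteq> Om \<inter> Th -` W" using o openE by blast
 have sub: "polydisc z0 k0 (e / 4) \<subseteq> ball (z0, 0, 0, k0) e"
 proof
  fix x assume x: "x \<in> polydisc z0 k0 (e / 4)"
  obtain z \<xi> \<eta> k where xx: "x = (z, \<xi>, \<eta>, k)" by (cases x)
  have n: "dist z0 z < e/4" "dist 0 \<xi> < e/4" "dist 0 \<eta> < e/4" "dist k0 k < e/4" using x unfolding xx polydisc_def by auto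
  have "dist (z0, 0, 0, k0) x \<le> dist z0 z + (dist 0 \<xi> + (dist 0 \<eta> + dist k0 k))"
   unfolding xx dist_Pair_Pair
   by (intro order.trans[OF sqrt_sum_squares_le_sum] add_mono order_refl sqrt_sum_squares_le_sum) auto
  then show "x \<in> ball (z0, 0, 0, k0) e" using n by simp
 qed
 have pd: "polydisc z0 k0 (e / 4) \<subseteq> Om" using sub e(2) by blast
 have "ball z0 (e / 4) \<subseteq> D"
 proof
  fix z assume "z \<in> ball z0 (e / 4)"
  then have "(z, 0, 0, k0) \<in> polydisc z0 k0 (e / 4)" using e(1) unfolding polydisc_def by simp
  then show "z \<in> D" using pd Om_nz(3) by fastforce
 qed
 then show ?thesis using e pd sub by (intro exI[of _ "e / 4"]) auto
qed

lemma s_open_map: assumes "open B" "B \<subseteq> D" "B ~= {}" shows "open (s ` B)"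
proof (rule open_mapping_thm[of s D B])
 show "s holomorphic_on D" using s unfolding holomorphic_on_open[OF D(1)] by blast
 show "\<not> s constant_on D"
 proof
  assume "s constant_on D"
  then obtain c where c: "!!z. z \<in> D ==> s z = c" unfolding constant_on_def by blast
  obtain z where z: "z \<in> D" using assms by blast
  have "((\<lambda>_. c) has_field_derivative 0) (at z)" by simp
  then have "(s has_field_derivative 0) (at z)"
   by (rule has_field_derivative_transform_within_open[OF _ D(1) z]) (simp add: c)
  then have "p z = 0" using s[OF z] DERIV_unique by blast
  then show False using p[OF z] by simp
 qed
qed (use assms D in auto)

text \<open>The point can be recovered from s by the open mapping theorem, from the slope \<omega> / \<sigma>, and from the energy.\<close>
lemma Th_covers:
 assumes z: "z0 \<in> D" and k: "k0 ~= 0" and r: "r > 0" and pd: "polydisc z0 k0 r \<subseteq> Om" "ball z0 r \<subseteq> D"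
 shows "\<exists>S. open S \<and> Th (z0, 0, 0, k0) \<in> S \<and> S \<subseteq> Th ` polydisc z0 k0 r"
proof -
 define \<sigma>0 where "\<sigma>0 = k0 / \<gamma> z0"
 have \<sigma>0: "\<sigma>0 ~= 0" unfolding \<sigma>0_def using k \<gamma>(2)[OF z] by simp
 define K where "K a = snd (snd (snd a)) * EE (fst a, fst (snd a), fst (snd (snd a)), 1)" for a :: c4
 define Om' :: "c4 set" where "Om' = {a. (fst a, fst (snd a), fst (snd (snd a)), 1::complex) \<in> Om}"
 have cj: "continuous_on UNIV (\<lambda>a::c4. (fst a, fst (snd a), fst (snd (snd a)), 1::complex))" by (intro continuous_intros)
 have "open Om'" using open_vimage[OF open_Om cj] unfolding Om'_def vimage_def by simp
 have cE: "continuous_on Om EE"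
  using EE_der cderD(1) has_derivative_continuous by (intro continuous_at_imp_continuous_on) blast
 have cK: "continuous_on Om' K" unfolding K_def
  by (intro continuous_intros continuous_on_compose2[OF cE]) (auto simp: Om'_def)
 have oK: "open (Om' \<inter> K -` (ball k0 r))" by (rule continuous_open_preimage[OF cK \<open>open Om'\<close> open_ball])
 have E0: "EE (z0, 0, 0, 1) = \<gamma> z0" unfolding EE_def rat_def by (simp add: \<gamma>(3)[OF z, symmetric] \<gamma>(2)[OF z])
 have "(z0, 0, 0, \<sigma>0) \<in> Om' \<inter> K -` (ball k0 r)"
  using base_Om[OF z, of 1] r \<gamma>(2)[OF z] unfolding Om'_def K_def by (simp add: E0 \<sigma>0_def)
 then obtain e where e: "e > 0" "ball (z0, 0, 0, \<sigma>0) e \<subseteq> Om' \<inter> K -` (ball k0 r)" using oK openE by blast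
 define \<delta> where "\<delta> = min (e / 4) r"
 have \<delta>: "\<delta> > 0" "\<delta> \<le> r" "\<delta> \<le> e/4" unfolding \<delta>_def using e(1) r by auto
 define V where "V = {a::c4. fst (snd (snd a)) ~= 0}"
 have oV: "open V"
 proof -
  have "open ((\<lambda>a::c4. fst (snd (snd a))) -` (- {0}))" by (intro open_vimage continuous_intros)
  then show ?thesis unfolding V_def vimage_def by simp
 qed
 define S where "S = V \<inter> (\<lambda>a. (fst a, fst (snd a), fst (snd (snd a)), snd (snd (snd a)) / fst (snd (snd a)))) -` (s ` ball z0 \<delta> \<times> ball 0 \<delta> \<times> ball \<sigma>0 \<delta> \<times> ball 0 \<delta>)"
 have oS: "open S" unfolding S_def
 proof (rule continuous_open_preimage[OF _ oV])
  show "continuous_on V (\<lambda>a::c4. (fst a, fst (snd a), fst (snd (snd a)), snd (snd (snd a)) / fst (snd (snd a))))"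
   by (intro continuous_intros) (auto simp: V_def)
  have "open (s ` ball z0 \<delta>)" by (rule s_open_map) (use \<delta> pd(2) in auto)
  then show "open (s ` ball z0 \<delta> \<times> ball (0::complex) \<delta> \<times> ball \<sigma>0 \<delta> \<times> ball (0::complex) \<delta>)" by (intro open_Times) auto
 qed
 moreover have "Th (z0, 0, 0, k0) \<in> S"
  unfolding Th_base[OF z] S_def V_def using \<sigma>0 \<delta>(1) by (simp add: \<sigma>0_def)
 moreover have "S \<subseteq> Th ` polydisc z0 k0 r"
 proof
  fix q assume q: "q \<in> S"
  obtain s' \<xi> \<sigma> \<omega> where qq: "q = (s', \<xi>, \<sigma>, \<omega>)" by (cases q)
  obtain z where z': "z \<in> ball z0 \<delta>" "s' = s z" and o: "\<sigma> ~= 0" "\<xi> \<in> ball 0 \<delta>" "\<sigma> \<in> ball \<sigma>0 \<delta>" "\<omega> / \<sigma> \<in> ball 0 \<delta>"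
   using q unfolding qq S_def V_def by auto
  define \<eta> where "\<eta> = \<omega> / \<sigma>"
  have "dist (z0, 0, 0, \<sigma>0) (z, \<xi>, \<eta>, \<sigma>) \<le> dist z0 z + (dist 0 \<xi> + (dist 0 \<eta> + dist \<sigma>0 \<sigma>))"
   unfolding dist_Pair_Pair
   by (intro order.trans[OF sqrt_sum_squares_le_sum] add_mono order_refl sqrt_sum_squares_le_sum) auto
  moreover have "dist z0 z < e/4" "dist 0 \<xi> < e/4" "dist 0 \<eta> < e/4" "dist \<sigma>0 \<sigma> < e/4" using z'(1) o \<delta> unfolding \<eta>_def by auto
  ultimately have "dist (z0, 0, 0, \<sigma>0) (z, \<xi>, \<eta>, \<sigma>) < e" by linarith
  then have m: "(z, \<xi>, \<eta>, \<sigma>) \<in> Om' \<inter> K -` (ball k0 r)" using e(2) by auto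
  define k where "k = K (z, \<xi>, \<eta>, \<sigma>)"
  have kr: "k \<in> ball k0 r" using m unfolding k_def by auto
  have E1: "EE (z, \<xi>, \<eta>, 1) = EE (z, \<xi>, \<eta>, k)" unfolding EE_def rat_def by simp
  have nz: "EE (z, \<xi>, \<eta>, 1) ~= 0" using Om_nz(1)[of "(z, \<xi>, \<eta>, 1)"] m unfolding Om'_def by simp
  have "PP (z, \<xi>, \<eta>, k) = \<sigma>" unfolding PP_def E1[symmetric] using nz by (simp add: k_def K_def)
  then have "Th (z, \<xi>, \<eta>, k) = q" unfolding Th_def qq z'(2) \<eta>_def using o(1) by simp
  moreover have "(z, \<xi>, \<eta>, k) \<in> polydisc z0 k0 r" using z'(1) o(2,4) kr \<delta>(2) unfolding polydisc_def \<eta>_def by auto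
  ultimately show "q \<in> Th ` polydisc z0 k0 r" by force
 qed
 ultimately show ?thesis by blast
qed

definition slice :: "(c4 => complex) => complex => c3 => complex" where
 "slice F k a = F (Th (fst a, fst (snd a), snd (snd a), k))"

lemma slice_chol:
 assumes f: "chol sc4 f W" and pd: "polydisc z0 k0 r \<subseteq> Om" "Th ` polydisc z0 k0 r \<subseteq> W" and k: "k \<in> ball k0 r"
 shows "chol sc3 (slice f k) (tridisc z0 r)"
  "a \<in> tridisc z0 r ==> df (slice f k) a h = df f (Th (fst a, fst (snd a), snd (snd a), k)) (DTh (fst a, fst (snd a), snd (snd a), k) (fst h, fst (snd h), snd (snd h), 0))"
proof -
 have der: "Th (fst x, fst (snd x), snd (snd x), k) \<in> W \<and> ((\<lambda>x. Th (fst x, fst (snd x), snd (snd x), k)) has_derivative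
   (\<lambda>h. DTh (fst x, fst (snd x), snd (snd x), k) (fst h, fst (snd h), snd (snd h), 0))) (at x) \<and>
   (\<forall>c h. DTh (fst x, fst (snd x), snd (snd x), k) (fst (sc3 c h), fst (snd (sc3 c h)), snd (snd (sc3 c h)), 0) = sc4 c (DTh (fst x, fst (snd x), snd (snd x), k) (fst h, fst (snd h), snd (snd h), 0)))"
  if x: "x \<in> tridisc z0 r" for x
 proof -
  have p: "(fst x, fst (snd x), snd (snd x), k) \<in> polydisc z0 k0 r" using x k unfolding tridisc_def polydisc_def by auto
  then have o: "(fst x, fst (snd x), snd (snd x), k) \<in> Om" using pd(1) by blast
  have "((\<lambda>x::complex\<times>complex\<times>complex. (fst x, fst (snd x), snd (snd x), k)) has_derivative (\<lambda>h. (fst h, fst (snd h), snd (snd h), 0))) (at x)"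
   by (auto intro!: derivative_eq_intros)
  from diff_chain_at[OF this DTh(1)[OF o]] have "((\<lambda>x. Th (fst x, fst (snd x), snd (snd x), k)) has_derivative
   (\<lambda>h. DTh (fst x, fst (snd x), snd (snd x), k) (fst h, fst (snd h), snd (snd h), 0))) (at x)" by (simp add: o_def)
  moreover have "DTh (fst x, fst (snd x), snd (snd x), k) (fst (sc3 c h), fst (snd (sc3 c h)), snd (snd (sc3 c h)), 0) = sc4 c (DTh (fst x, fst (snd x), snd (snd x), k) (fst h, fst (snd h), snd (snd h), 0))" for c h
  proof -
   have "(fst (sc3 c h), fst (snd (sc3 c h)), snd (snd (sc3 c h)), 0) = sc4 c (fst h, fst (snd h), snd (snd h), 0)"
    by (cases h) (simp add: sc3_def)
   then show ?thesis by (simp only: DTh(2)[OF o])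
  qed
  ultimately show ?thesis using p pd(2) by blast
 qed
 show "chol sc3 (slice f k) (tridisc z0 r)" unfolding slice_def[abs_def] by (rule chol_compose(1)[OF f der])
 show "a \<in> tridisc z0 r ==> df (slice f k) a h = df f (Th (fst a, fst (snd a), snd (snd a), k)) (DTh (fst a, fst (snd a), snd (snd a), k) (fst h, fst (snd h), snd (snd h), 0))"
  unfolding slice_def[abs_def] by (rule chol_compose(2)[OF f der])
qed

lemma holomorphic_in_level:
 assumes f: "chol sc4 f W" and pd: "polydisc z0 k0 r \<subseteq> Om" "Th ` polydisc z0 k0 r \<subseteq> W" and a: "a \<in> tridisc z0 r"
 shows "(\<lambda>k. slice f k a) holomorphic_on ball k0 r"
proof -
 have c: "chol sc4 (\<lambda>x. f (Th x)) (polydisc z0 k0 r)"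
  by (rule chol_compose(1)[OF f, where D\<phi> = DTh]) (use pd DTh in blast)
 have "(\<lambda>k. f (Th ((fst a, fst (snd a), snd (snd a), 0) + sc4 k (0, 0, 0, 1)))) holomorphic_on ball k0 r"
  by (rule s4.holomorphic_on_line[OF c open_ball]) (use a in \<open>auto simp: tridisc_def polydisc_def\<close>)
 then show ?thesis unfolding slice_def by simp
qed

text \<open>The denominator is nonzero at some point, and along the energy through that point its zeros are isolated.\<close>
lemma bad_levels_countable:
 assumes g: "chol sc4 g W" and pd: "polydisc z0 k0 r \<subseteq> Om" "Th ` polydisc z0 k0 r \<subseteq> W" and nz: "\<exists>a\<in>polydisc z0 k0 r. g (Th a) ~= 0"
 shows "countable {k\<in>ball k0 r. \<forall>a\<in>tridisc z0 r. slice g k a = 0}"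
proof -
 obtain z \<xi> \<eta> k where a: "(z, \<xi>, \<eta>, k) \<in> polydisc z0 k0 r" "g (Th (z, \<xi>, \<eta>, k)) ~= 0" using nz by (metis prod_cases4)
 have t: "(z, \<xi>, \<eta>) \<in> tridisc z0 r" and k: "k \<in> ball k0 r" using a(1) unfolding polydisc_def tridisc_def by auto
 have "countable {k\<in>ball k0 r. slice g k (z, \<xi>, \<eta>) = 0}"
  by (rule countable_zeros[OF holomorphic_in_level[OF g pd t] open_ball connected_ball k]) (use a(2) in \<open>simp add: slice_def\<close>)
 then show ?thesis by (rule countable_subset[rotated]) (use t in auto)
qed

lemma local_data:
 assumes reps: "!!a. a \<in> UU ==> \<exists>W f g. a \<in> W \<and> rep4 F W f g" and z: "z0 \<in> D" and k: "k0 ~= 0"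
 shows "\<exists>r W f g. r > 0 \<and> rep4 F W f g \<and> ball z0 r \<subseteq> D \<and> polydisc z0 k0 r \<subseteq> Om \<and> Th ` polydisc z0 k0 r \<subseteq> W \<and> (\<exists>a\<in>polydisc z0 k0 r. g (Th a) ~= 0)"
proof -
 have "Th (z0, 0, 0, k0) \<in> UU" by (rule Th_UU[OF base_Om[OF z k]])
 then obtain W f g where W: "Th (z0, 0, 0, k0) \<in> W" "rep4 F W f g" using reps by blast
 have oW: "open W" "W \<subseteq> closure {a\<in>W. g a ~= 0}" using W(2) unfolding rep4_def by auto
 obtain r where r: "r > 0" "ball z0 r \<subseteq> D" "polydisc z0 k0 r \<subseteq> Om" "Th ` polydisc z0 k0 r \<subseteq> W"
  using polydisc_exists[OF z k oW(1) W(1)] by blast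
 obtain S where S: "open S" "Th (z0, 0, 0, k0) \<in> S" "S \<subseteq> Th ` polydisc z0 k0 r" using Th_covers[OF z k r(1,3,2)] by blast
 have "Th (z0, 0, 0, k0) \<in> closure {a\<in>W. g a ~= 0}" using W(1) oW(2) by blast
 then have "S \<inter> {a\<in>W. g a ~= 0} ~= {}" using open_Int_closure_eq_empty[OF S(1)] S(2) by blast
 then have "\<exists>a\<in>polydisc z0 k0 r. g (Th a) ~= 0" using S(3) by blast
 then show ?thesis using r W(2) by blast
qed

text \<open>If f / g is constant on most levels, then by continuity f (a) g (a') = f (a') g (a) for two points of any level. Differentiating at a = a' shows that the differential of f / g kills the tangent space of the level, which is the kernel of the differential of the energy. The fourth direction, a change of velocity with fixed slope, is transversal to the levels.\<close>
lemma dependent_of_constant_levels: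
 assumes rep: "rep4 F W f g" and z: "z0 \<in> D" and k0: "k0 ~= 0" and r: "r > 0" "ball z0 r \<subseteq> D"
  and pd: "polydisc z0 k0 r \<subseteq> Om" "Th ` polydisc z0 k0 r \<subseteq> W" and B: "countable B"
  and const: "!!k. k \<in> ball k0 r - B ==> \<exists>c. \<forall>a\<in>tridisc z0 r. slice f k a = c * slice g k a"
 shows "\<exists>S. open S \<and> S ~= {} \<and> S \<subseteq> W \<and> dependent f g H4 S"
proof -
 have f: "chol sc4 f W" and g: "chol sc4 g W" using rep unfolding rep4_def by auto
 have propn: "slice f k a * slice g k a' = slice f k a' * slice g k a" if k: "k \<in> ball k0 r" and a: "a \<in> tridisc z0 r" "a' \<in> tridisc z0 r" for k a a'
 proof -
  have "slice f k a * slice g k a' - slice f k a' * slice g k a = 0"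
  proof (rule holomorphic_zero_off_countable[OF _ B _ k])
   show "(\<lambda>k. slice f k a * slice g k a' - slice f k a' * slice g k a) holomorphic_on ball k0 r"
    by (intro holomorphic_intros holomorphic_in_level[OF f pd] holomorphic_in_level[OF g pd] a)
   fix k assume "k \<in> ball k0 r - B"
   then obtain c where "\<forall>a\<in>tridisc z0 r. slice f k a = c * slice g k a" using const by blast
   then show "slice f k a * slice g k a' - slice f k a' * slice g k a = 0" using a by simp
  qed
  then show ?thesis by simp
 qed
 have opT: "open (tridisc z0 r)" unfolding tridisc_def by (intro open_Times) auto
 have dep: "num_df f g (Th x) h * df H4 (Th x) h' = num_df f g (Th x) h' * df H4 (Th x) h" if x: "x \<in> polydisc z0 k0 r" for x h h'
 proof -
  obtain z1 \<xi> \<eta> k where xx: "x = (z1, \<xi>, \<eta>, k)" by (cases x)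
  define a where "a = (z1, \<xi>, \<eta>)"
  have a: "a \<in> tridisc z0 r" and k: "k \<in> ball k0 r" using x unfolding xx a_def polydisc_def tridisc_def by auto
  have xa: "x = (fst a, fst (snd a), snd (snd a), k)" unfolding xx a_def by simp
  have xO: "x \<in> Om" and xW: "Th x \<in> W" using x pd by auto
  have zD: "z1 \<in> D" using x r(2) unfolding xx polydisc_def by auto
  have tan: "num_df f g (Th x) (DTh x (e1, e2, e3, 0)) = 0" "df H4 (Th x) (DTh x (e1, e2, e3, 0)) = 0" for e1 e2 e3
  proof -
   have df: "(slice f k has_derivative df (slice f k) a) (at a)" by (rule chol_df(1)[OF slice_chol(1)[OF f pd k] a])
   have dg: "(slice g k has_derivative df (slice g k) a) (at a)" by (rule chol_df(1)[OF slice_chol(1)[OF g pd k] a])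
   have d1: "((\<lambda>b. slice f k b * slice g k a - slice f k a * slice g k b) has_derivative
     (\<lambda>h. df (slice f k) a h * slice g k a - slice f k a * df (slice g k) a h)) (at a)"
    by (intro has_derivative_diff has_derivative_mult_left has_derivative_mult_right df dg)
   have d2: "((\<lambda>b. slice f k b * slice g k a - slice f k a * slice g k b) has_derivative (\<lambda>h. 0)) (at a)"
    by (rule has_derivative_transform_within_open[OF has_derivative_const[of 0] opT a]) (use propn[OF k _ a] in simp)
   have "df (slice f k) a (e1, e2, e3) * slice g k a - slice f k a * df (slice g k) a (e1, e2, e3) = 0"
    by (rule fun_cong[OF has_derivative_unique[OF d1 d2], of "(e1, e2, e3)"])
   then show "num_df f g (Th x) (DTh x (e1, e2, e3, 0)) = 0"
    unfolding num_df_def slice_chol(2)[OF f pd k a] slice_chol(2)[OF g pd k a] by (simp add: slice_def xa[symmetric] mult.commute)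
   have dH: "(slice H4 k has_derivative df (slice H4 k) a) (at a)" by (rule chol_df(1)[OF slice_chol(1)[OF chol_H4 pd k] a])
   have "(slice H4 k has_derivative (\<lambda>h. 0)) (at a)"
   proof (rule has_derivative_transform_within_open[OF has_derivative_const[of "k\<^sup>2 / 2"] opT a])
    fix b assume "b \<in> tridisc z0 r"
    then have "(fst b, fst (snd b), snd (snd b), k) \<in> Om" using k pd(1) unfolding tridisc_def polydisc_def by auto
    then show "k\<^sup>2 / 2 = slice H4 k b" unfolding slice_def using Th_H by simp
   qed
   then have "df (slice H4 k) a = (\<lambda>h. 0)" using dH has_derivative_unique by blast
   then show "df H4 (Th x) (DTh x (e1, e2, e3, 0)) = 0"
    using slice_chol(2)[OF chol_H4[of W] pd k a, of "(e1, e2, e3)"] by (simp add: xa[symmetric])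
  qed
  have P: "PP x ~= 0" by (rule Om_nz(2)[OF xO])
  have pz: "p z1 ~= 0" by (rule p[OF zD])
  have lin: "df H4 (Th x) (u + v) = df H4 (Th x) u + df H4 (Th x) v" for u v
   using linear_add[OF has_derivative_linear[OF chol_df(1)[OF chol_H4[of UNIV] UNIV_I]]] .
  have dec: "\<exists>c. num_df f g (Th x) h = c * num_df f g (Th x) (0, 0, 1, \<eta>) \<and> df H4 (Th x) h = c * df H4 (Th x) (0, 0, 1, \<eta>)" for h
  proof -
   obtain h1 h2 h3 h4 where h: "h = (h1, h2, h3, h4)" by (cases h)
   \<comment> \<open>Choose e tangent to the level so that h minus its image has the slope of V = (0, 0, 1, \<eta>).\<close>
   define e where "e = (h1 / p z1, h2, (h4 - \<eta> * h3) / PP x, 0::complex)"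
   define c where "c = h3 - DL x e"
   have hd: "h = DTh x e + sc4 c (0, 0, 1, \<eta>)"
    unfolding DTh_def h e_def[symmetric] c_def using P pz by (simp add: xx e_def algebra_simps) (simp add: xx[symmetric] field_simps)?
   note t0 = tan[of "h1 / p z1" h2 "(h4 - \<eta> * h3) / PP x", folded e_def]
   have "num_df f g (Th x) h = c * num_df f g (Th x) (0, 0, 1, \<eta>)"
    unfolding hd num_df_linear[OF f g xW] t0 by simp
   moreover have "df H4 (Th x) h = c * df H4 (Th x) (0, 0, 1, \<eta>)"
    unfolding hd lin chol_df(2)[OF chol_H4[of UNIV] UNIV_I] t0 by simp
   ultimately show ?thesis by (intro exI[of _ c] conjI)
  qed
  obtain c where c: "num_df f g (Th x) h = c * num_df f g (Th x) (0, 0, 1, \<eta>)" "df H4 (Th x) h = c * df H4 (Th x) (0, 0, 1, \<eta>)" using dec by blast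
  obtain c' where c': "num_df f g (Th x) h' = c' * num_df f g (Th x) (0, 0, 1, \<eta>)" "df H4 (Th x) h' = c' * df H4 (Th x) (0, 0, 1, \<eta>)" using dec by blast
  show ?thesis unfolding c c' by simp
 qed
 obtain S where S: "open S" "Th (z0, 0, 0, k0) \<in> S" "S \<subseteq> Th ` polydisc z0 k0 r" using Th_covers[OF z k0 r(1) pd(1) r(2)] by blast
 have "dependent f g H4 S" unfolding dependent_def using dep S(3) by blast
 then show ?thesis using S pd(2) by blast
qed

end

locale flow_sheet = sheet D s \<gamma> p + L: linear_system D p q' s' Y1 Z1 Y2 Z2 "\<lambda>z \<xi> \<eta>. p z * Gf (s z) \<xi> \<eta>"
 for D s \<gamma> p q' s' Y1 Z1 Y2 Z2
begin

lemma slice_rep: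
 assumes rep: "rep4 F W f g" and r: "r > 0" "ball z0 r \<subseteq> D"
  and pd: "polydisc z0 k0 r \<subseteq> Om" "Th ` polydisc z0 k0 r \<subseteq> W" and k: "k \<in> ball k0 r" and nz: "\<exists>a\<in>tridisc z0 r. slice g k a ~= 0"
  and r1: "r1 > 0" "ball z1 r1 \<subseteq> ball z0 r" "r1 \<le> r"
 shows "L.rep (slice F k) z1 r1 (slice f k) (slice g k)"
proof -
 have f: "chol sc4 f W" and g: "chol sc4 g W" using rep unfolding rep4_def by auto
 have sub: "tridisc z1 r1 \<subseteq> tridisc z0 r" using r1 unfolding tridisc_def by auto
 have oT: "open (tridisc z r)" "convex (tridisc z r)" for z r unfolding tridisc_def by (auto intro!: open_Times convex_Times)
 note c = slice_chol[OF f pd k] slice_chol[OF g pd k]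
 have nz1: "\<exists>a\<in>tridisc z1 r1. slice g k a ~= 0"
 proof (rule ccontr)
  assume "\<not> ?thesis"
  then have z: "slice g k a = 0" if "a \<in> tridisc z1 r1" for a using that by blast
  have "(z1, 0, 0) \<in> tridisc z1 r1" using r1(1) unfolding tridisc_def by simp
  then have ne: "tridisc z1 r1 ~= {}" by blast
  have "slice g k b = 0" if "b \<in> tridisc z0 r" for b
   by (rule s3.chol_identity[OF oT oT(1) sub ne that c(3) z])
  then show False using nz by blast
 qed
 have pde: "slice F k (z, \<xi>, \<eta>) = slice f k (z, \<xi>, \<eta>) / slice g k (z, \<xi>, \<eta>) \<and> num_df (slice f k) (slice g k) (z, \<xi>, \<eta>) (1, p z * \<eta>, p z * Gf (s z) \<xi> \<eta>) = 0"
  if a: "(z, \<xi>, \<eta>) \<in> tridisc z1 r1" and n: "slice g k (z, \<xi>, \<eta>) ~= 0" for z \<xi> \<eta>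
 proof -
  have a0: "(z, \<xi>, \<eta>) \<in> tridisc z0 r" using a sub by blast
  have x: "(z, \<xi>, \<eta>, k) \<in> polydisc z0 k0 r" using a0 k unfolding tridisc_def polydisc_def by auto
  have xO: "(z, \<xi>, \<eta>, k) \<in> Om" and xW: "Th (z, \<xi>, \<eta>, k) \<in> W" using x pd by auto
  have R: "F (Th (z, \<xi>, \<eta>, k)) = f (Th (z, \<xi>, \<eta>, k)) / g (Th (z, \<xi>, \<eta>, k))" "num_df f g (Th (z, \<xi>, \<eta>, k)) (X4 (Th (z, \<xi>, \<eta>, k))) = 0"
   using rep xW n unfolding rep4_def slice_def by auto
  have "num_df (slice f k) (slice g k) (z, \<xi>, \<eta>) (1, p z * \<eta>, p z * Gf (s z) \<xi> \<eta>)
   = num_df f g (Th (z, \<xi>, \<eta>, k)) (DTh (z, \<xi>, \<eta>, k) (1, p z * \<eta>, p z * Gf (s z) \<xi> \<eta>, 0))"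
   unfolding num_df_def c(2)[OF a0] c(4)[OF a0] by (simp add: slice_def)
  also have "\<dots> = 0" unfolding DTh_flow[OF xO] num_df_linear(2)[OF f g xW] R(2) by simp
  finally show ?thesis using R(1) by (simp add: slice_def)
 qed
 have bD: "ball z1 r1 \<subseteq> D" using r1 r(2) by blast
 show ?thesis unfolding L.rep_def tridisc_def[symmetric]
 proof (intro conjI allI impI)
  show "0 < r1" by (rule r1(1))
  show "\<exists>a\<in>tridisc z1 r1. slice g k a ~= 0" by (rule nz1)
  show "ball z1 r1 \<subseteq> D" by (rule bD)
  show "chol sc3 (slice f k) (tridisc z1 r1)" "chol sc3 (slice g k) (tridisc z1 r1)"
   by (rule chol_subset[OF c(1) sub], rule chol_subset[OF c(3) sub])
  fix z \<xi> \<eta> assume "(z, \<xi>, \<eta>) \<in> tridisc z1 r1" "slice g k (z, \<xi>, \<eta>) ~= 0"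
  note pde' = pde[OF this]
  show "slice F k (z, \<xi>, \<eta>) = slice f k (z, \<xi>, \<eta>) / slice g k (z, \<xi>, \<eta>)"
   by (rule conjunct1[OF pde'])
  show "num_df (slice f k) (slice g k) (z, \<xi>, \<eta>) (1, p z * \<eta>, p z * Gf (s z) \<xi> \<eta>) = 0"
   by (rule conjunct2[OF pde'])
 qed
qed

text \<open>Countably many polydiscs suffice to cover all points (z, k), and each of them excludes countably many levels.\<close>
lemma generic_level:
 assumes reps: "!!a. a \<in> UU ==> \<exists>W f g. a \<in> W \<and> rep4 F W f g"
 shows "\<exists>B. countable B \<and> (\<forall>k. k ~= 0 \<longrightarrow> k \<notin> B \<longrightarrow> (\<forall>z\<in>D. \<exists>r f g. L.rep (slice F k) z r f g))"
proof -
 define I where "I = D \<times> (- {0::complex})"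
 have "\<forall>i\<in>I. \<exists>r W f g. r > 0 \<and> rep4 F W f g \<and> ball (fst i) r \<subseteq> D \<and> polydisc (fst i) (snd i) r \<subseteq> Om \<and> Th ` polydisc (fst i) (snd i) r \<subseteq> W \<and> (\<exists>a\<in>polydisc (fst i) (snd i) r. g (Th a) ~= 0)"
  using local_data[OF reps] unfolding I_def by auto
 then obtain r W f g where i: "!!i. i \<in> I ==> r i > 0 \<and> rep4 F (W i) (f i) (g i) \<and> ball (fst i) (r i) \<subseteq> D \<and> polydisc (fst i) (snd i) (r i) \<subseteq> Om \<and>
   Th ` polydisc (fst i) (snd i) (r i) \<subseteq> W i \<and> (\<exists>a\<in>polydisc (fst i) (snd i) (r i). g i (Th a) ~= 0)" by metis
 define C where "C i = ball (fst i) (r i) \<times> ball (snd i) (r i)" for i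
 obtain \<F> where F': "\<F> \<subseteq> C ` I" "countable \<F>" "\<Union> \<F> = \<Union> (C ` I)"
  by (rule Lindelof[of "C ` I"]) (auto simp: C_def intro!: open_Times)
 then obtain J where J: "J \<subseteq> I" "countable J" "\<F> = C ` J" using countable_subset_image[of \<F> C I] by blast
 define B where "B = (\<Union>i\<in>J. {k\<in>ball (snd i) (r i). \<forall>a\<in>tridisc (fst i) (r i). slice (g i) k a = 0})"
 have "countable B" unfolding B_def
 proof (rule countable_UN[OF J(2)])
  fix j assume "j \<in> J"
  then have j: "r j > 0 \<and> rep4 F (W j) (f j) (g j) \<and> ball (fst j) (r j) \<subseteq> D \<and> polydisc (fst j) (snd j) (r j) \<subseteq> Om \<and>
   Th ` polydisc (fst j) (snd j) (r j) \<subseteq> W j \<and> (\<exists>a\<in>polydisc (fst j) (snd j) (r j). g j (Th a) ~= 0)" using i J(1) by blast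
  then have "chol sc4 (g j) (W j)" unfolding rep4_def by blast
  then show "countable {k\<in>ball (snd j) (r j). \<forall>a\<in>tridisc (fst j) (r j). slice (g j) k a = 0}"
   by (rule bad_levels_countable) (use j in blast)+
 qed
 moreover have "\<exists>r f g. L.rep (slice F k) z r f g" if k: "k ~= 0" "k \<notin> B" and z: "z \<in> D" for k z
 proof -
  have zk: "(z, k) \<in> I" using k z unfolding I_def by simp
  then have "(z, k) \<in> C (z, k)" using i[OF zk] unfolding C_def by auto
  then have "(z, k) \<in> \<Union> (C ` J)" using F'(3) J(3) zk by blast
  then obtain j where j: "j \<in> J" "z \<in> ball (fst j) (r j)" "k \<in> ball (snd j) (r j)" unfolding C_def by auto
  have jj: "r j > 0 \<and> rep4 F (W j) (f j) (g j) \<and> ball (fst j) (r j) \<subseteq> D \<and> polydisc (fst j) (snd j) (r j) \<subseteq> Om \<and>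
   Th ` polydisc (fst j) (snd j) (r j) \<subseteq> W j" using i[of j] j(1) J(1) by blast
  have nz: "\<exists>a\<in>tridisc (fst j) (r j). slice (g j) k a ~= 0" using k(2) j unfolding B_def by blast
  obtain e where e: "e > 0" "ball z e \<subseteq> ball (fst j) (r j)" using openE[OF open_ball j(2)] by blast
  have "L.rep (slice F k) z (min e (r j)) (slice (f j) k) (slice (g j) k)"
  proof (rule slice_rep[of F "W j" "f j" "g j" "r j" "fst j" "snd j"])
   show "ball z (min e (r j)) \<subseteq> ball (fst j) (r j)" using e(2) by (auto simp: subset_iff)
  qed (use jj nz j(3) e(1) in auto)
  then show ?thesis by blast
 qed
 ultimately show ?thesis by (intro exI[of _ B] conjI allI impI ballI)
qed

end

section \<open>Dependence of first integrals in the chart\<close>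

text \<open>The shift makes exp (6 * s) equal to - 2 * U, so that the singular points of the variational equation are U = 0 and U = 1.\<close>
definition cc0 :: complex where "cc0 = of_real (ln 2) + \<i> * of_real pi"
definition sv1 :: "complex => complex" where "sv1 \<tau> = (cc0 + \<tau>) / 6"
definition sv2 :: "complex => complex" where "sv2 z = (cc0 + Ln (1 - z\<^sup>2)) / 6"
text \<open>On the half plane the two signs of the speed give two sheets; on the punctured disc z itself is the root of 1 - U, and the two signs are exchanged by reflection.\<close>
definition gp :: "complex => complex" where "gp \<tau> = 2 * exp (- 2 * sv1 \<tau>) * csqrt (1 - exp \<tau>)"
definition gm :: "complex => complex" where "gm \<tau> = - gp \<tau>"
definition g2 :: "complex => complex" where "g2 z = 2 * exp (- 2 * sv2 z) * z"

lemma exp_cc0: "exp cc0 = - 2"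
 unfolding cc0_def exp_add by (simp add: exp_of_real mult.commute[of \<i>])

lemma exp_sv: "exp (6 * sv1 \<tau>) = - 2 * exp \<tau>" "z \<in> D2 ==> exp (6 * sv2 z) = - 2 * (1 - z\<^sup>2)"
proof -
 have e: "6 * (y / 6) = y" for y :: complex by simp
 show "exp (6 * sv1 \<tau>) = - 2 * exp \<tau>" unfolding sv1_def e exp_add exp_cc0 ..
 show "exp (6 * sv2 z) = - 2 * (1 - z\<^sup>2)" if "z \<in> D2"
  using D2_one_minus(3)[of z] that unfolding sv2_def e exp_add exp_cc0 D2_def by simp
qed

lemma gq_00:
 assumes "exp (6 * s) = - 2 * U" "w\<^sup>2 = 1 - U"
 shows "(2 * exp (- 2 * s) * w)\<^sup>2 = gq s 0 0"
proof -
 have "exp (2 * s) = exp (6 * s) * exp (- 4 * s)" by (simp flip: exp_add)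
 then have e: "exp (2 * s) = - 2 * U * exp (- 4 * s)" using assms(1) by simp
 have "exp (- 2 * s) * exp (- 2 * s) = exp (- 4 * s)" by (simp flip: exp_add)
 then have "(2 * exp (- 2 * s) * w)\<^sup>2 = 4 * exp (- 4 * s) * w\<^sup>2" by (simp add: power2_eq_square mult_ac)
 then show ?thesis unfolding gq_def e assms(2) by (simp add: algebra_simps)
qed

lemma D1_exp: assumes "\<tau> \<in> D1" shows "1 - exp \<tau> \<notin> \<real>\<^sub>\<le>\<^sub>0" "1 - exp \<tau> ~= 0" "exp \<tau> ~= 1"
proof -
 have "norm (exp \<tau>) < 1" using assms by (simp add: D1_def)
 then have "Re (exp \<tau>) < 1" using complex_Re_le_cmod[of "exp \<tau>"] by linarith
 then show "1 - exp \<tau> \<notin> \<real>\<^sub>\<le>\<^sub>0" by (auto simp: complex_nonpos_Reals_iff)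
 then show "1 - exp \<tau> ~= 0" by auto
 then show "exp \<tau> ~= 1" by auto
qed

lemma sheet_p: "sheet D1 sv1 gp rate1"
proof
 show "open D1" "connected D1" by (rule D2_props)+
 fix \<tau> assume t: "\<tau> \<in> D1"
 show "(sv1 has_field_derivative rate1 \<tau>) (at \<tau>)" unfolding sv1_def[abs_def] rate1_def by (auto intro!: derivative_eq_intros)
 show "rate1 \<tau> ~= 0" by (simp add: rate1_def)
 show "gp \<tau> ~= 0" unfolding gp_def using D1_exp[OF t] by simp
 show "(gp \<tau>)\<^sup>2 = gq (sv1 \<tau>) 0 0" unfolding gp_def by (rule gq_00[OF exp_sv(1)]) simp
next
 show "gp holomorphic_on D1" unfolding gp_def[abs_def] sv1_def by (intro holomorphic_intros D1_exp) auto
qed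

lemma sheet_m: "sheet D1 sv1 gm rate1"
proof -
 interpret sheet D1 sv1 gp rate1 by (rule sheet_p)
 show ?thesis
  by unfold_locales (use D s p \<gamma> in \<open>auto simp: gm_def[abs_def] intro!: holomorphic_intros\<close>)
qed

lemma sheet_2: "sheet D2 sv2 g2 rate2"
proof
 show "open D2" "connected D2" by (rule D2_props)+
 fix z assume z: "z \<in> D2"
 have n: "1 - z\<^sup>2 \<notin> \<real>\<^sub>\<le>\<^sub>0" "1 - z\<^sup>2 ~= 0" "z ~= 0" using z D2_one_minus[of z] unfolding D2_def by auto
 show "(sv2 has_field_derivative rate2 z) (at z)" unfolding sv2_def[abs_def] rate2_def
  using n by (auto intro!: derivative_eq_intros simp: field_simps)
 show "rate2 z ~= 0" by (rule rate2_nz[OF z])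
 show "g2 z ~= 0" unfolding g2_def using n by simp
 show "(g2 z)\<^sup>2 = gq (sv2 z) 0 0" unfolding g2_def by (rule gq_00[OF exp_sv(2)[OF z]]) simp
next
 show "g2 holomorphic_on D2" unfolding g2_def[abs_def] sv2_def
  by (intro holomorphic_intros) (use D2_one_minus in \<open>auto simp: D2_def\<close>)
qed

lemma lin1: "linear_system D1 rate1 (\<lambda>\<tau>. rate1 \<tau> * linq (exp \<tau>)) (\<lambda>\<tau>. rate1 \<tau> * lins (exp \<tau>)) (psi rho1) (psi' rho1) (psi rho2) (psi' rho2)
  (\<lambda>z \<xi> \<eta>. rate1 z * Gf (sv1 z) \<xi> \<eta>)"
proof
 fix z a b :: complex assume z: "z \<in> D1"
 show "((\<lambda>eps. rate1 z * Gf (sv1 z) (eps * a) (eps * b) / eps) \<longlongrightarrow> rate1 z * linq (exp z) * a + rate1 z * lins (exp z) * b) (at 0)"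
  unfolding linq_def lins_def by (rule Gf_linear[OF D1_exp(3)[OF z] exp_sv(1)])
qed (use D2_props psi_solves indicial_rho psi_wronskian in auto)

lemma lin2: "linear_system D2 rate2 (\<lambda>z. rate2 z * linq (1 - z\<^sup>2)) (\<lambda>z. rate2 z * lins (1 - z\<^sup>2)) (Psi rho1) (Psi' rho1) (Psi rho2) (Psi' rho2)
  (\<lambda>z \<xi> \<eta>. rate2 z * Gf (sv2 z) \<xi> \<eta>)"
proof
 fix z a b :: complex assume z: "z \<in> D2"
 have "1 - z\<^sup>2 ~= 1" using z by (auto simp: D2_def)
 then show "((\<lambda>eps. rate2 z * Gf (sv2 z) (eps * a) (eps * b) / eps) \<longlongrightarrow> rate2 z * linq (1 - z\<^sup>2) * a + rate2 z * lins (1 - z\<^sup>2) * b) (at 0)"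
  unfolding linq_def lins_def by (rule Gf_linear[OF _ exp_sv(2)[OF z]])
qed (use D2_props Psi_solves indicial_rho Psi_wronskian in auto)

lemma monodromy_instance:
 "\<exists>r11 r12 r21 r22 \<rho>. ball (of_real (- ln 2)) \<rho> \<subseteq> base_dom \<and>
  monodromy rate1 (\<lambda>\<tau>. rate1 \<tau> * linq (exp \<tau>)) (\<lambda>\<tau>. rate1 \<tau> * lins (exp \<tau>)) (psi rho1) (psi' rho1) (psi rho2) (psi' rho2)
  (\<lambda>z \<xi> \<eta>. rate1 z * Gf (sv1 z) \<xi> \<eta>)
  rate2 (\<lambda>z. rate2 z * linq (1 - z\<^sup>2)) (\<lambda>z. rate2 z * lins (1 - z\<^sup>2)) (Psi rho1) (Psi' rho1) (Psi rho2) (Psi' rho2)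
  (\<lambda>z \<xi> \<eta>. rate2 z * Gf (sv2 z) \<xi> \<eta>) lam0 per0 r11 r12 r21 r22 (of_real (- ln 2)) \<rho> zbase"
proof -
 obtain \<rho> where \<rho>: "\<rho> > 0" "ball (of_real (- ln 2)) \<rho> \<subseteq> base_dom" using base_dom_ball by blast
 obtain r11 r12 where f1: "!!z. z \<in> D2 ==> Psi rho1 z = r11 * Psi rho1 (- z) + r12 * Psi rho2 (- z) \<and> Psi' rho1 z = r11 * Psi' rho1 (- z) + r12 * Psi' rho2 (- z)"
  using Psi_flip[OF indicial_rho(1)] by blast
 obtain r21 r22 where f2: "!!z. z \<in> D2 ==> Psi rho2 z = r21 * Psi rho1 (- z) + r22 * Psi rho2 (- z) \<and> Psi' rho2 z = r21 * Psi' rho1 (- z) + r22 * Psi' rho2 (- z)"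
  using Psi_flip[OF indicial_rho(2)] by blast
 have nz: "r11 ~= 0" "r12 ~= 0" using flip_nonzero f1 by blast+
 have bD: "base_dom \<subseteq> D1" unfolding base_dom_def D1_def by auto
 have zm: "psi r \<tau> = Psi r (zbase \<tau>)" "psi' r \<tau> = Psi' r (zbase \<tau>)" if "indicial r" "\<tau> \<in> ball (of_real (- ln 2)) \<rho>" for r \<tau>
  using zbase_props[of \<tau>] Psi_overlap[OF that(1), of "zbase \<tau>"] Psi'_overlap[OF that(1), of "zbase \<tau>"] that(2) \<rho>(2) by auto
 have "monodromy_axioms (psi rho1) (psi' rho1) (psi rho2) (psi' rho2) (Psi rho1) (Psi' rho1) (Psi rho2) (Psi' rho2) lam0 per0 r11 r12 r21 r22 (of_real (- ln 2)) \<rho> zbase"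
 proof
  show "0 < lam0" "lam0 < 1" by (rule lam0)+
  show "Re per0 = 0" by (simp add: per0_def)
  show "r12 ~= 0" "r11 ~= 0" by (rule nz)+
  show "\<rho> > 0" by (rule \<rho>)
  show "ball (of_real (- ln 2)) \<rho> \<subseteq> D1" using \<rho>(2) bD by blast
  show "inj_on zbase (ball (of_real (- ln 2)) \<rho>)" by (rule inj_on_subset[OF zbase_inj \<rho>(2)])
  show "zbase holomorphic_on ball (of_real (- ln 2)) \<rho>" by (rule holomorphic_on_subset[OF zbase_holomorphic \<rho>(2)])
  show "zbase \<tau> \<in> D2" if "\<tau> \<in> ball (of_real (- ln 2)) \<rho>" for \<tau>
   using zbase_props(1)[of \<tau>] overlap_D2(1) that \<rho>(2) by blast
  show "psi rho1 \<tau> = Psi rho1 (zbase \<tau>) \<and> psi' rho1 \<tau> = Psi' rho1 (zbase \<tau>) \<and> psi rho2 \<tau> = Psi rho2 (zbase \<tau>) \<and> psi' rho2 \<tau> = Psi' rho2 (zbase \<tau>)"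
   if "\<tau> \<in> ball (of_real (- ln 2)) \<rho>" for \<tau>
   by (intro conjI zm indicial_rho that)
 qed (use f1 f2 psi_mono in auto)
 then have "monodromy rate1 (\<lambda>\<tau>. rate1 \<tau> * linq (exp \<tau>)) (\<lambda>\<tau>. rate1 \<tau> * lins (exp \<tau>)) (psi rho1) (psi' rho1) (psi rho2) (psi' rho2)
  (\<lambda>z \<xi> \<eta>. rate1 z * Gf (sv1 z) \<xi> \<eta>)
  rate2 (\<lambda>z. rate2 z * linq (1 - z\<^sup>2)) (\<lambda>z. rate2 z * lins (1 - z\<^sup>2)) (Psi rho1) (Psi' rho1) (Psi rho2) (Psi' rho2)
  (\<lambda>z \<xi> \<eta>. rate2 z * Gf (sv2 z) \<xi> \<eta>) lam0 per0 r11 r12 r21 r22 (of_real (- ln 2)) \<rho> zbase"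
  by (rule monodromy.intro[OF lin1 lin2])
 then show ?thesis using \<rho>(2) by blast
qed

text \<open>For all but countably many levels the restriction of F to the two sheets and to the punctured disc satisfies the hypotheses of the monodromy argument, hence is constant near the geodesic \<xi> = 0.\<close>
lemma open_dependence:
 assumes reps: "!!a. a \<in> UU ==> \<exists>W f g. a \<in> W \<and> rep4 F W f g"
  and per: "!!s \<xi> \<sigma> \<omega>. F (s + 2 * of_real pi * \<i>, \<xi>, \<sigma>, \<omega>) = F (s, \<xi>, \<sigma>, \<omega>)"
 shows "\<exists>W f g S. rep4 F W f g \<and> open S \<and> S ~= {} \<and> S \<subseteq> W \<and> dependent f g H4 S"
proof -
 interpret P: flow_sheet D1 sv1 gp rate1 "\<lambda>\<tau>. rate1 \<tau> * linq (exp \<tau>)" "\<lambda>\<tau>. rate1 \<tau> * lins (exp \<tau>)" "psi rho1" "psi' rho1" "psi rho2" "psi' rho2"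
  by (rule flow_sheet.intro[OF sheet_p lin1])
 interpret M: flow_sheet D1 sv1 gm rate1 "\<lambda>\<tau>. rate1 \<tau> * linq (exp \<tau>)" "\<lambda>\<tau>. rate1 \<tau> * lins (exp \<tau>)" "psi rho1" "psi' rho1" "psi rho2" "psi' rho2"
  by (rule flow_sheet.intro[OF sheet_m lin1])
 interpret Q: flow_sheet D2 sv2 g2 rate2 "\<lambda>z. rate2 z * linq (1 - z\<^sup>2)" "\<lambda>z. rate2 z * lins (1 - z\<^sup>2)" "Psi rho1" "Psi' rho1" "Psi rho2" "Psi' rho2"
  by (rule flow_sheet.intro[OF sheet_2 lin2])
 obtain r11 r12 r21 r22 \<rho> where bd: "ball (of_real (- ln 2)) \<rho> \<subseteq> base_dom" and mon: "monodromy rate1 (\<lambda>\<tau>. rate1 \<tau> * linq (exp \<tau>)) (\<lambda>\<tau>. rate1 \<tau> * lins (exp \<tau>)) (psi rho1) (psi' rho1) (psi rho2) (psi' rho2)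
  (\<lambda>z \<xi> \<eta>. rate1 z * Gf (sv1 z) \<xi> \<eta>)
  rate2 (\<lambda>z. rate2 z * linq (1 - z\<^sup>2)) (\<lambda>z. rate2 z * lins (1 - z\<^sup>2)) (Psi rho1) (Psi' rho1) (Psi rho2) (Psi' rho2)
  (\<lambda>z \<xi> \<eta>. rate2 z * Gf (sv2 z) \<xi> \<eta>) lam0 per0 r11 r12 r21 r22 (of_real (- ln 2)) \<rho> zbase"
  using monodromy_instance by blast
 interpret m: monodromy rate1 "\<lambda>\<tau>. rate1 \<tau> * linq (exp \<tau>)" "\<lambda>\<tau>. rate1 \<tau> * lins (exp \<tau>)" "psi rho1" "psi' rho1" "psi rho2" "psi' rho2"
  "\<lambda>z \<xi> \<eta>. rate1 z * Gf (sv1 z) \<xi> \<eta>"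
  rate2 "\<lambda>z. rate2 z * linq (1 - z\<^sup>2)" "\<lambda>z. rate2 z * lins (1 - z\<^sup>2)" "Psi rho1" "Psi' rho1" "Psi rho2" "Psi' rho2"
  "\<lambda>z \<xi> \<eta>. rate2 z * Gf (sv2 z) \<xi> \<eta>" lam0 per0 r11 r12 r21 r22 "of_real (- ln 2)" \<rho> zbase
  by (rule mon)
 obtain B1 where B1: "countable B1" "!!k. k ~= 0 ==> k \<notin> B1 ==> (\<forall>z\<in>D1. \<exists>r f g. P.L.rep (P.slice F k) z r f g)"
  using P.generic_level[OF reps] by blast
 obtain B2 where B2: "countable B2" "!!k. k ~= 0 ==> k \<notin> B2 ==> (\<forall>z\<in>D1. \<exists>r f g. P.L.rep (M.slice F k) z r f g)"
  using M.generic_level[OF reps] by blast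
 obtain B3 where B3: "countable B3" "!!k. k ~= 0 ==> k \<notin> B3 ==> (\<forall>z\<in>D2. \<exists>r f g. Q.L.rep (Q.slice F k) z r f g)"
  using Q.generic_level[OF reps] by blast
 define \<tau>0 :: complex where "\<tau>0 = of_real (- ln 2)"
 have t0: "\<tau>0 \<in> D1" unfolding \<tau>0_def by (rule m.\<tau>0_D1(1))
 obtain r W f g where d: "r > 0" "rep4 F W f g" "ball \<tau>0 r \<subseteq> D1" "polydisc \<tau>0 1 r \<subseteq> P.Om" "P.Th ` polydisc \<tau>0 1 r \<subseteq> W"
  "\<exists>a\<in>polydisc \<tau>0 1 r. g (P.Th a) ~= 0" using P.local_data[OF reps t0 one_neq_zero] by blast
 have g: "chol sc4 g W" using d(2) unfolding rep4_def by blast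
 define B4 where "B4 = {k\<in>ball 1 r. \<forall>a\<in>tridisc \<tau>0 r. P.slice g k a = 0}"
 have B4: "countable B4" unfolding B4_def by (rule P.bad_levels_countable[OF g d(4,5,6)])
 define B where "B = insert 0 (B1 \<union> B2 \<union> B3 \<union> B4)"
 have B: "countable B" unfolding B_def using B1(1) B2(1) B3(1) B4 by auto
 have sper: "sv1 (\<tau> + per0) = sv1 \<tau> + 2 * of_real pi * \<i>" for \<tau>
  unfolding sv1_def per0_def by (simp add: complex_eq_iff)
 have eper: "exp (of_int n * (s + 2 * of_real pi * \<i>)) = exp (of_int n * s)" for n s
 proof -
  have "exp (2 * of_int n * of_real pi * \<i>) = 1" using exp_integer_2pi[of "of_int n"] by simp
  moreover have "of_int n * (s + 2 * of_real pi * \<i>) = of_int n * s + 2 * of_int n * of_real pi * \<i>" by (simp add: algebra_simps)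
  ultimately show ?thesis by (simp add: exp_add)
 qed
 have eper': "exp (2 * (s + 2 * of_real pi * \<i>)) = exp (2 * s)" "exp (- 2 * (s + 2 * of_real pi * \<i>)) = exp (- 2 * s)" "exp (- 4 * (s + 2 * of_real pi * \<i>)) = exp (- 4 * s)" for s
  using eper[of 2 s] eper[of "-2" s] eper[of "-4" s] by simp_all
 have gper: "gq (s + 2 * of_real pi * \<i>) \<xi> \<eta> = gq s \<xi> \<eta>" for s \<xi> \<eta> unfolding gq_def eper' ..
 have gpp: "gp (\<tau> + per0) = gp \<tau>" for \<tau> unfolding gp_def sper eper' exp_per0 ..
 have gmp: "gm (\<tau> + per0) = gm \<tau>" for \<tau> unfolding gm_def gpp ..
 have zb: "sv2 (zbase \<tau>) = sv1 \<tau>" "sv2 (- zbase \<tau>) = sv1 \<tau>" "g2 (zbase \<tau>) = gp \<tau>" "g2 (- zbase \<tau>) = gm \<tau>" if "\<tau> \<in> ball \<tau>0 \<rho>" for \<tau>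
 proof -
  have "Ln (1 - (zbase \<tau>)\<^sup>2) = \<tau>" using zbase_props(2) that bd unfolding \<tau>0_def by blast
  then show a: "sv2 (zbase \<tau>) = sv1 \<tau>" "sv2 (- zbase \<tau>) = sv1 \<tau>" unfolding sv2_def sv1_def by simp_all
  show "g2 (zbase \<tau>) = gp \<tau>" "g2 (- zbase \<tau>) = gm \<tau>" unfolding g2_def gm_def gp_def a by (simp_all add: zbase_def)
 qed
 have const: "\<exists>c. \<forall>a\<in>tridisc \<tau>0 r. P.slice f k a = c * P.slice g k a" if k: "k \<in> ball 1 r - B" for k
 proof -
  have kB: "k ~= 0" "k \<notin> B1" "k \<notin> B2" "k \<notin> B3" "k \<notin> B4" and kb: "k \<in> ball 1 r" using k unfolding B_def by auto
  have "m.triple (P.slice F k) (M.slice F k) (Q.slice F k)"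
   unfolding m.triple_def
  proof (intro conjI ballI allI)
   fix z assume "z \<in> D1"
   then show "\<exists>r f g. P.L.rep (P.slice F k) z r f g" "\<exists>r f g. P.L.rep (M.slice F k) z r f g" using B1(2)[OF kB(1,2)] B2(2)[OF kB(1,3)] by blast+
  next
   fix z assume "z \<in> D2"
   then show "\<exists>r f g. Q.L.rep (Q.slice F k) z r f g" using B3(2)[OF kB(1,4)] by blast
  next
   fix \<tau> \<xi> \<eta>
   show "P.slice F k (\<tau> + per0, \<xi>, \<eta>) = P.slice F k (\<tau>, \<xi>, \<eta>)"
    unfolding P.slice_def P.Th_def P.PP_def P.EE_def P.rat_def by (simp add: sper gpp gper per)
   show "M.slice F k (\<tau> + per0, \<xi>, \<eta>) = M.slice F k (\<tau>, \<xi>, \<eta>)"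
    unfolding M.slice_def M.Th_def M.PP_def M.EE_def M.rat_def by (simp add: sper gmp gper per)
  next
   fix \<tau> \<xi> \<eta> :: complex assume "\<tau> \<in> ball (of_real (- ln 2)) \<rho>"
   then have t: "\<tau> \<in> ball \<tau>0 \<rho>" unfolding \<tau>0_def .
   show "P.slice F k (\<tau>, \<xi>, \<eta>) = Q.slice F k (zbase \<tau>, \<xi>, \<eta>)"
    unfolding P.slice_def P.Th_def P.PP_def P.EE_def P.rat_def Q.slice_def Q.Th_def Q.PP_def Q.EE_def Q.rat_def by (simp add: zb[OF t])
   show "M.slice F k (\<tau>, \<xi>, \<eta>) = Q.slice F k (- zbase \<tau>, \<xi>, \<eta>)"
    unfolding M.slice_def M.Th_def M.PP_def M.EE_def M.rat_def Q.slice_def Q.Th_def Q.PP_def Q.EE_def Q.rat_def by (simp add: zb[OF t])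
  qed
  from m.constant_on_level[OF this] obtain T c where T: "T > 0" "P.L.near_zero (\<lambda>a. P.slice F k a - c) T \<tau>0" using t0 by blast
  have nz: "\<exists>a\<in>tridisc \<tau>0 r. P.slice g k a ~= 0" using kB(5) kb unfolding B4_def by blast
  have "P.L.rep (P.slice F k) \<tau>0 r (P.slice f k) (P.slice g k)"
   by (rule P.slice_rep[OF d(2,1,3,4,5) kb nz d(1) order_refl order_refl])
  then have rp: "P.L.rep (\<lambda>a. P.slice F k a - c) \<tau>0 r (\<lambda>a. P.slice f k a - c * P.slice g k a) (P.slice g k)" by (rule P.L.rep_diff_const)
  have "\<not> (\<exists>a\<in>ball \<tau>0 r \<times> ball 0 r \<times> ball 0 r. P.slice f k a - c * P.slice g k a ~= 0)"
  proof
   assume fn: "\<exists>a\<in>ball \<tau>0 r \<times> ball 0 r \<times> ball 0 r. P.slice f k a - c * P.slice g k a ~= 0"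
   have "\<tau>0 \<in> ball \<tau>0 r" using d(1) by simp
   from P.L.rep_nonzero[OF rp T(1) fn this] show False
   proof (elim exE conjE)
    fix r' n a b N0
    assume r': "r' > 0" "countable N0" "\<forall>z\<in>ball \<tau>0 r' - N0. P.L.small (\<lambda>a. P.slice F k a - c) z T n (\<lambda>t. a t / b t)"
    obtain r2 N2 where N2: "r2 > 0" "countable N2" "!!z. z \<in> ball \<tau>0 r2 - N2 ==> P.L.zero (\<lambda>a. P.slice F k a - c) z T"
     by (rule P.L.near_zeroE[OF T(2)]) blast
    obtain z where z: "z \<in> ball \<tau>0 (min r' r2)" "z \<notin> N0 \<union> N2" using pick_ball[of "N0 \<union> N2" "min r' r2" \<tau>0] r'(1,2) N2(1,2) by auto
    have "z \<in> ball \<tau>0 r' - N0" "z \<in> ball \<tau>0 r2 - N2" using z by auto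
    then show False using small_at_not_zero_at[OF bspec[OF r'(3)] N2(3) T(1)] by blast
   qed
  qed
  then have "\<forall>a\<in>tridisc \<tau>0 r. P.slice f k a = c * P.slice g k a" unfolding tridisc_def by auto
  then show ?thesis by blast
 qed
 have "\<exists>S. open S \<and> S ~= {} \<and> S \<subseteq> W \<and> dependent f g H4 S"
  by (rule P.dependent_of_constant_levels[OF d(2) t0 one_neq_zero d(1,3,4,5) B const])
 then show ?thesis using d(2) by blast
qed

text \<open>A complex line minus the countable zero set of a holomorphic function is connected.\<close>
lemma connected_UU: "connected UU"
 unfolding connected_iff_connected_component
proof (intro ballI)
 fix a b :: c4 assume ab: "a \<in> UU" "b \<in> UU"
 define l where "l t = a + sc4 t (b - a)" for t
 define h where "h t = NN (fst a + t * (fst b - fst a)) (fst (snd a) + t * (fst (snd b) - fst (snd a)))" for t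
 have hl: "l t \<in> UU \<longleftrightarrow> h t ~= 0" for t unfolding UU_def l_def h_def sc4_def by (cases a, cases b) simp
 have hh: "h holomorphic_on UNIV" unfolding h_def[abs_def] NN_def by (intro holomorphic_intros)
 have l01: "l 0 = a" "l 1 = b" unfolding l_def by simp_all
 have "countable {t\<in>UNIV. h t = 0}"
  by (rule countable_zeros[OF hh open_UNIV connected_UNIV UNIV_I[of 0]]) (use hl[of 0] l01 ab in simp)
 then have "connected (- {t\<in>UNIV. h t = 0})" by (intro path_connected_imp_connected path_connected_complement_countable) simp_all
 moreover have "continuous_on UNIV l" unfolding l_def[abs_def] by (intro continuous_intros s4.continuous_on_sc)
 ultimately have "connected (l ` (- {t\<in>UNIV. h t = 0}))" by (rule connected_continuous_image[OF continuous_on_subset[OF _ subset_UNIV], rotated])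
 moreover have "l ` (- {t\<in>UNIV. h t = 0}) \<subseteq> UU" using hl by auto
 moreover have "a \<in> l ` (- {t\<in>UNIV. h t = 0})" "b \<in> l ` (- {t\<in>UNIV. h t = 0})"
  using hl[of 0] hl[of 1] l01 ab by (auto intro: image_eqI[of _ _ 0] image_eqI[of _ _ 1])
 ultimately show "connected_component UU a b" unfolding connected_component_def by blast
qed

text \<open>Differentiate f g' = f' g.\<close>
lemma num_df_change:
 fixes f g f' g' :: "c4 => complex"
 assumes S: "open S" and c: "chol sc4 f S" "chol sc4 g S" "chol sc4 f' S" "chol sc4 g' S"
  and eq: "!!x. x \<in> S ==> f x * g' x = f' x * g x" and x: "x \<in> S"
 shows "(g' x)\<^sup>2 * num_df f g x h = (g x)\<^sup>2 * num_df f' g' x h"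
proof -
 have d1: "((\<lambda>x. f x * g' x) has_derivative (\<lambda>h. f x * df g' x h + df f x h * g' x)) (at x)"
  by (rule has_derivative_mult[OF chol_df(1)[OF c(1) x] chol_df(1)[OF c(4) x]])
 have d2: "((\<lambda>x. f' x * g x) has_derivative (\<lambda>h. f' x * df g x h + df f' x h * g x)) (at x)"
  by (rule has_derivative_mult[OF chol_df(1)[OF c(3) x] chol_df(1)[OF c(2) x]])
 have d2': "((\<lambda>x. f x * g' x) has_derivative (\<lambda>h. f' x * df g x h + df f' x h * g x)) (at x)"
  by (rule has_derivative_transform_within_open[OF d2 S x]) (simp add: eq)
 have e: "f x * df g' x h + df f x h * g' x = f' x * df g x h + df f' x h * g x"
  by (rule fun_cong[OF has_derivative_unique[OF d1 d2'], of h])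
 have "(g' x)\<^sup>2 * num_df f g x h - (g x)\<^sup>2 * num_df f' g' x h =
   g x * g' x * ((f x * df g' x h + df f x h * g' x) - (f' x * df g x h + df f' x h * g x)) - (g' x * df g x h + g x * df g' x h) * (f x * g' x - f' x * g x)"
  unfolding num_df_def by (simp add: power2_eq_square algebra_simps)
 then show ?thesis using e eq[OF x] by simp
qed

lemma dependent_change:
 fixes f g f' g' :: "c4 => complex"
 assumes S: "open S" and c: "chol sc4 f S" "chol sc4 g S" "chol sc4 f' S" "chol sc4 g' S"
  and eq: "!!x. x \<in> S ==> f x * g' x = f' x * g x" and nz: "!!x. x \<in> S ==> g' x ~= 0" and dep: "dependent f' g' H S"
 shows "dependent f g H S"
 unfolding dependent_def
proof (intro ballI allI)
 fix x h k assume x: "x \<in> S"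
 note n = num_df_change[OF S c eq x]
 have "(g' x)\<^sup>2 * (num_df f g x h * df H x k) = (g x)\<^sup>2 * (num_df f' g' x h * df H x k)" using n[of h] by (simp add: mult.assoc[symmetric])
 also have "\<dots> = (g x)\<^sup>2 * (num_df f' g' x k * df H x h)"
  by (simp only: dep[unfolded dependent_def, rule_format, OF x, of h k])
 also have "\<dots> = (g' x)\<^sup>2 * (num_df f g x k * df H x h)" using n[of k] by (simp add: mult.assoc[symmetric])
 finally show "num_df f g x h * df H x k = num_df f g x k * df H x h" using nz[OF x] by simp
qed

lemma chol_open_nonzero:
 assumes "chol sc f W" "open W" shows "open {x\<in>W. f x ~= 0}"
proof -
 have "continuous_on W f" using chol_isCont[OF assms(1)] by (auto intro: continuous_at_imp_continuous_on)
 then have "open (W \<inter> f -` (- {0}))" by (rule continuous_open_preimage[OF _ assms(2)]) auto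
 moreover have "W \<inter> f -` (- {0}) = {x\<in>W. f x ~= 0}" by auto
 ultimately show ?thesis by simp
qed

lemma rep4_dense:
 assumes "rep4 F W f g" "open S" "S \<subseteq> W" "S ~= {}" shows "\<exists>x\<in>S. g x ~= 0"
proof -
 obtain x where "x \<in> S" using assms by blast
 then have "x \<in> closure {a\<in>W. g a ~= 0}" using assms unfolding rep4_def by blast
 then have "S \<inter> {a\<in>W. g a ~= 0} ~= {}" using open_Int_closure_eq_empty[OF assms(2)] \<open>x \<in> S\<close> by blast
 then show ?thesis by blast
qed

definition depends_at :: "(c4 => complex) => c4 => bool" where
 "depends_at F a \<longleftrightarrow> (\<exists>e>0. \<exists>W f g. rep4 F W f g \<and> ball a e \<subseteq> W \<and> dependent f g H4 (ball a e))"

text \<open>On a smaller open set the two representations describe the same function; from there the dependence spreads over the ball by the identity theorem.\<close>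
lemma depends_at_spread:
 assumes rep: "rep4 F W f g" and e: "ball a e \<subseteq> W" and b: "b \<in> ball a e" "depends_at F b"
 shows "dependent f g H4 (ball a e)"
proof -
 obtain e' W' f' g' where *: "e' > 0" "rep4 F W' f' g'" "ball b e' \<subseteq> W'" "dependent f' g' H4 (ball b e')" using b(2) unfolding depends_at_def by blast
 have c: "chol sc4 f W" "chol sc4 g W" "chol sc4 f' W'" "chol sc4 g' W'" "open W" "open W'" using rep *(2) unfolding rep4_def by auto
 define S where "S = {x\<in>ball b e' \<inter> ball a e. g x ~= 0}"
 define S' where "S' = {x\<in>S. g' x ~= 0}"
 have oS: "open S" unfolding S_def by (rule chol_open_nonzero[OF chol_subset[OF c(2)]]) (use e in auto)
 have "\<exists>x\<in>ball b e' \<inter> ball a e. g x ~= 0"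
 proof (rule rep4_dense[OF rep])
  have "b \<in> ball b e' \<inter> ball a e" using b(1) *(1) by simp
  then show "ball b e' \<inter> ball a e ~= {}" by blast
 qed (use e in auto)
 then have nS: "S ~= {}" unfolding S_def by blast
 have SW: "S \<subseteq> W" "S \<subseteq> W'" using e *(3) unfolding S_def by auto
 have oS': "open S'" unfolding S'_def by (rule chol_open_nonzero[OF chol_subset[OF c(4) SW(2)] oS])
 have nS': "S' ~= {}" using rep4_dense[OF *(2) oS SW(2) nS] unfolding S'_def by blast
 have SS: "S' \<subseteq> W" "S' \<subseteq> W'" "S' \<subseteq> ball a e" "S' \<subseteq> ball b e'" using SW unfolding S'_def S_def by auto
 have "dependent f g H4 S'"
 proof (rule dependent_change[OF oS' chol_subset[OF c(1) SS(1)] chol_subset[OF c(2) SS(1)] chol_subset[OF c(3) SS(2)] chol_subset[OF c(4) SS(2)]])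
  fix x assume x: "x \<in> S'"
  then have g: "g x ~= 0" "g' x ~= 0" unfolding S'_def S_def by auto
  show "g' x ~= 0" by (rule g)
  have "F x = f x / g x" "F x = f' x / g' x" using rep *(2) x SS g unfolding rep4_def by blast+
  then show "f x * g' x = f' x * g x" using g by (simp add: field_simps)
 next
  show "dependent f' g' H4 S'" using *(4) SS(4) unfolding dependent_def by blast
 qed
 then show ?thesis
  using s4.dependent_identity[OF open_ball convex_ball oS' SS(3) nS' chol_subset[OF c(1) e] chol_subset[OF c(2) e] chol_H4] by blast
qed

text \<open>The set of points where the dependence holds is open and closed in the connected domain, and it is not empty by the preceding analysis.\<close>
lemma depends_everywhere:
 assumes reps: "!!a. a \<in> UU ==> \<exists>W f g. a \<in> W \<and> rep4 F W f g"
  and per: "!!s \<xi> \<sigma> \<omega>. F (s + 2 * of_real pi * \<i>, \<xi>, \<sigma>, \<omega>) = F (s, \<xi>, \<sigma>, \<omega>)"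
  and a: "a \<in> UU"
 shows "depends_at F a"
proof (rule ccontr)
 assume na: "\<not> depends_at F a"
 have UUW: "W \<subseteq> UU" "open W" if "rep4 F W f g" for W f g using that unfolding rep4_def by auto
 define T1 where "T1 = {b\<in>UU. depends_at F b}"
 define T2 where "T2 = {b\<in>UU. \<not> depends_at F b}"
 have dsub: "depends_at F c" if b: "depends_at F b" "e > 0" "True" "rep4 F W f g" "ball b e \<subseteq> W" "dependent f g H4 (ball b e)" "c \<in> ball b e" for b c e W f g
 proof -
  obtain e' where e': "e' > 0" "ball c e' \<subseteq> ball b e" using openE[OF open_ball b(7)] by blast
  show ?thesis unfolding depends_at_def
   using e' b(4,5) b(6) unfolding dependent_def by (meson subset_trans subsetD)
 qed
 have "open T1" unfolding open_contains_ball
 proof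
  fix b assume b: "b \<in> T1"
  then obtain e W f g where *: "e > 0" "rep4 F W f g" "ball b e \<subseteq> W" "dependent f g H4 (ball b e)" unfolding T1_def depends_at_def by blast
  have "ball b e \<subseteq> T1" using dsub[OF _ *(1) TrueI *(2-4)] b UUW[OF *(2)] *(3) unfolding T1_def by blast
  then show "\<exists>e>0. ball b e \<subseteq> T1" using *(1) by blast
 qed
 moreover have "open T2" unfolding open_contains_ball
 proof
  fix b assume b: "b \<in> T2"
  then obtain W f g where W: "b \<in> W" "rep4 F W f g" using reps unfolding T2_def by blast
  obtain e where e: "e > 0" "ball b e \<subseteq> W" using UUW[OF W(2)] W(1) openE by blast
  have "c \<in> T2" if c: "c \<in> ball b e" for c
  proof (rule ccontr)
   assume "c \<notin> T2"
   then have "depends_at F c" using c e(2) UUW[OF W(2)] unfolding T2_def by blast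
   then have "dependent f g H4 (ball b e)" by (rule depends_at_spread[OF W(2) e(2) c])
   then have "depends_at F b" unfolding depends_at_def using e W(2) by blast
   then show False using b unfolding T2_def by blast
  qed
  then show "\<exists>e>0. ball b e \<subseteq> T2" using e(1) by blast
 qed
 moreover have "T1 \<inter> UU ~= {}"
 proof -
  obtain W f g S where S: "rep4 F W f g" "open S" "S ~= {}" "S \<subseteq> W" "dependent f g H4 S" using open_dependence[OF reps per] by blast
  obtain b where b: "b \<in> S" using S(3) by blast
  obtain e where e: "e > 0" "ball b e \<subseteq> S" using openE[OF S(2) b] by blast
  have "dependent f g H4 (ball b e)" using S(5) e(2) unfolding dependent_def by blast
  then have "depends_at F b" unfolding depends_at_def using e S(1,4) by blast
  then show ?thesis using b S(4) UUW[OF S(1)] unfolding T1_def by blast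
 qed
 moreover have "T2 \<inter> UU ~= {}" "T1 \<inter> T2 \<inter> UU = {}" "UU \<subseteq> T1 \<union> T2" using a na unfolding T1_def T2_def by auto
 ultimately show False using connected_UU unfolding connected_def by blast
qed

lemma H4_euler: "df H4 (s, \<xi>, \<sigma>, \<omega>) (0, 0, \<sigma>, \<omega>) = 2 * H4 (s, \<xi>, \<sigma>, \<omega>)"
proof -
 have "((\<lambda>t. (s, \<xi>, \<sigma>, \<omega>) + sc4 t (0, 0, \<sigma>, \<omega>)) has_derivative (\<lambda>\<mu>. sc4 \<mu> (0, 0, \<sigma>, \<omega>))) (at 0)" by (rule s4.line_derivative)
 from chol_curve[OF chol_H4 UNIV_I this]
 have 1: "((\<lambda>t. H4 (s, \<xi>, \<sigma> + t * \<sigma>, \<omega> + t * \<omega>)) has_field_derivative df H4 (s, \<xi>, \<sigma>, \<omega>) (0, 0, \<sigma>, \<omega>)) (at 0)" by simp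
 have "H4 (s, \<xi>, \<sigma> + t * \<sigma>, \<omega> + t * \<omega>) = (1 + t)\<^sup>2 * H4 (s, \<xi>, \<sigma>, \<omega>)" for t
  unfolding H4_def by (simp add: power2_eq_square algebra_simps)
 moreover have "((\<lambda>t. (1 + t)\<^sup>2 * H4 (s, \<xi>, \<sigma>, \<omega>)) has_field_derivative 2 * H4 (s, \<xi>, \<sigma>, \<omega>)) (at 0)" by (auto intro!: derivative_eq_intros)
 ultimately show ?thesis using 1 DERIV_unique by simp
qed

text \<open>Where the energy has a nonzero differential, both differentials are multiples of it. The energy is homogeneous of degree 2 in the velocities, so by Euler's identity this holds wherever it is not zero; the identity theorem does the rest.\<close>
theorem first_integrals_dependent:
 assumes reps1: "!!a. a \<in> UU ==> \<exists>W f g. a \<in> W \<and> rep4 F1 W f g" and reps2: "!!a. a \<in> UU ==> \<exists>W f g. a \<in> W \<and> rep4 F2 W f g"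
  and per1: "!!s \<xi> \<sigma> \<omega>. F1 (s + 2 * of_real pi * \<i>, \<xi>, \<sigma>, \<omega>) = F1 (s, \<xi>, \<sigma>, \<omega>)"
  and per2: "!!s \<xi> \<sigma> \<omega>. F2 (s + 2 * of_real pi * \<i>, \<xi>, \<sigma>, \<omega>) = F2 (s, \<xi>, \<sigma>, \<omega>)"
  and B: "open B" "a \<in> B" "B \<subseteq> UU" and f1: "chol sc4 f1 B" "!!x. x \<in> B ==> F1 x = f1 x" and f2: "chol sc4 f2 B" "!!x. x \<in> B ==> F2 x = f2 x"
 shows "df f1 a h * df f2 a k = df f1 a k * df f2 a h"
proof -
 obtain e where e: "e > 0" "ball a e \<subseteq> B" using openE[OF B(1,2)] by blast
 have c: "chol sc4 f1 (ball a e)" "chol sc4 f2 (ball a e)" using chol_subset f1(1) f2(1) e(2) by blast+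
 have one: "num_df f (\<lambda>_. 1) x h = df f x h" for f :: "c4 => complex" and x h
 proof -
  have "df (\<lambda>_::c4. 1::complex) x = (\<lambda>_. 0)" by (rule df_eqI) simp
  then show ?thesis unfolding num_df_def by simp
 qed
 have dep: "dependent f (\<lambda>_. 1) H4 (ball a e)"
  if f: "chol sc4 f B" "!!x. x \<in> B ==> F x = f x" and da: "depends_at F a" for F f
 proof -
  obtain e' W n d where *: "e' > 0" "rep4 F W n d" "ball a e' \<subseteq> W" "dependent n d H4 (ball a e')" using da unfolding depends_at_def by blast
  have cc: "chol sc4 n W" "chol sc4 d W" using *(2) unfolding rep4_def by auto
  define S where "S = {x\<in>ball a e \<inter> ball a e'. d x ~= 0}"
  have oS: "open S" unfolding S_def by (rule chol_open_nonzero[OF chol_subset[OF cc(2)]]) (use *(3) in auto)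
  have "\<exists>x\<in>ball a e \<inter> ball a e'. d x ~= 0"
  proof (rule rep4_dense[OF *(2)])
   have "a \<in> ball a e \<inter> ball a e'" using e(1) *(1) by simp
   then show "ball a e \<inter> ball a e' ~= {}" by blast
  qed (use *(3) in auto)
  then have nS: "S ~= {}" unfolding S_def by blast
  have SS: "S \<subseteq> W" "S \<subseteq> B" "S \<subseteq> ball a e" "S \<subseteq> ball a e'" using *(3) e(2) unfolding S_def by auto
  have "dependent f (\<lambda>_. 1) H4 S"
  proof (rule dependent_change[OF oS chol_subset[OF f(1) SS(2)] chol_const chol_subset[OF cc(1) SS(1)] chol_subset[OF cc(2) SS(1)]])
   fix x assume x: "x \<in> S"
   then show d: "d x ~= 0" unfolding S_def by blast
   have "F x = n x / d x" using *(2) x SS(1) d unfolding rep4_def by blast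
   then show "f x * d x = n x * 1" using f(2)[of x] x SS(2) d by (auto simp: field_simps)
  next
   show "dependent n d H4 S" using *(4) SS(4) unfolding dependent_def by blast
  qed
  then show ?thesis
   using s4.dependent_identity[OF open_ball convex_ball oS SS(3) nS chol_subset[OF f(1) e(2)] chol_const chol_H4] by blast
 qed
 have aU: "a \<in> UU" using B by blast
 have dp1: "dependent f1 (\<lambda>_. 1) H4 (ball a e)" by (rule dep[OF f1 depends_everywhere[OF reps1 per1 aU]])
 have dp2: "dependent f2 (\<lambda>_. 1) H4 (ball a e)" by (rule dep[OF f2 depends_everywhere[OF reps2 per2 aU]])
 define S where "S = {x\<in>ball a e. H4 x ~= 0}"
 have oS: "open S" unfolding S_def by (rule chol_open_nonzero[OF chol_H4 open_ball])
 have nS: "S ~= {}"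
 proof
  assume "S = {}"
  then have z: "H4 x = 0" if "x \<in> ball a e" for x using that unfolding S_def by blast
  have ne: "ball a e ~= {}" using e(1) by simp
  have "H4 (0, 0, 1, 0) = 0"
   by (rule s4.chol_identity[OF open_UNIV convex_UNIV open_ball subset_UNIV ne UNIV_I chol_H4 z])
  then show False unfolding H4_def by simp
 qed
 have "dependent f1 (\<lambda>_. 1) f2 S" unfolding dependent_def one
 proof (intro ballI allI)
  fix x h k assume x: "x \<in> S"
  obtain s \<xi> \<sigma> \<omega> where xx: "x = (s, \<xi>, \<sigma>, \<omega>)" by (cases x)
  define w :: c4 where "w = (0, 0, \<sigma>, \<omega>)"
  have w: "df H4 x w ~= 0" using x H4_euler[of s \<xi> \<sigma> \<omega>] unfolding S_def xx w_def by simp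
  have xb: "x \<in> ball a e" using x unfolding S_def by simp
  have 1: "df f1 x v = df f1 x w / df H4 x w * df H4 x v" for v
   using dp1[unfolded dependent_def one, rule_format, OF xb, of v w] w by (simp add: field_simps)
  have 2: "df f2 x v = df f2 x w / df H4 x w * df H4 x v" for v
   using dp2[unfolded dependent_def one, rule_format, OF xb, of v w] w by (simp add: field_simps)
  show "df f1 x h * df f2 x k = df f1 x k * df f2 x h"
   by (subst (1) 1[of h], subst (1) 2[of k], subst (1) 1[of k], subst (1) 2[of h]) simp
 qed
 then have "dependent f1 (\<lambda>_. 1) f2 (ball a e)"
  using s4.dependent_identity[OF open_ball convex_ball oS _ nS c(1) chol_const c(2)] unfolding S_def by blast
 from this[unfolded dependent_def one, rule_format, of a h k] show ?thesis using e(1) by simp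
qed

section \<open>Vectors with three components\<close>

no_notation fps_nth (infixl "$" 75)

definition vec3 :: "'a => 'a => 'a => 'a::zero ^ 3" where "vec3 x y z = vector [x, y, z]"

lemma vec3_nth [simp]: "vec3 x y z $ 1 = x" "vec3 x y z $ 2 = y" "vec3 x y z $ 3 = z"
 by (simp_all add: vec3_def vector_3)

lemma vec3_eqI: "a $ 1 = b $ 1 ==> a $ 2 = b $ 2 ==> a $ 3 = b $ 3 ==> a = (b :: 'a ^ 3)"
 by (simp add: vec_eq_iff forall_3)

lemma cform3: "cform v w = (v :: complex ^ 3) $ 1 * w $ 1 + v $ 2 * w $ 2 + v $ 3 * w $ 3"
 unfolding cform_def by (simp add: sum_3)

lemma has_derivative_vec3:
 fixes f1 f2 f3 :: "'b::real_normed_vector => complex"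
 assumes "(f1 has_derivative A1) (at a)" "(f2 has_derivative A2) (at a)" "(f3 has_derivative A3) (at a)"
 shows "((\<lambda>x. vec3 (f1 x) (f2 x) (f3 x)) has_derivative (\<lambda>h. vec3 (A1 h) (A2 h) (A3 h))) (at a)"
proof -
 have "linear (\<lambda>p::c3. vec3 (fst p) (fst (snd p)) (snd (snd p)))"
  by (rule linearI) (auto intro!: vec3_eqI)
 then have "bounded_linear (\<lambda>p::c3. vec3 (fst p) (fst (snd p)) (snd (snd p)))"
  by (simp add: linear_conv_bounded_linear)
 from bounded_linear.has_derivative[OF this has_derivative_Pair[OF assms(1) has_derivative_Pair[OF assms(2,3)]]]
 show ?thesis by simp
qed

lemma has_derivative_nth: "(f has_derivative D) F ==> ((\<lambda>x. f x $ i) has_derivative (\<lambda>h. D h $ i)) F" for f :: "'b::real_normed_vector => complex ^ 3"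
 by (rule bounded_linear.has_derivative[OF bounded_linear_vec_nth])

lemma polynomial_holomorphic:
 assumes "complex_polynomial_function f" and c: "!!i. (\<lambda>t. c t $ i) holomorphic_on A"
 shows "(\<lambda>t. f (c t)) holomorphic_on A"
 using assms(1) by induction (auto intro!: holomorphic_intros c)

lemma polynomial_differentiable:
 fixes f :: "complex ^ 3 => complex"
 assumes "complex_polynomial_function f"
 shows "(f has_derivative frechet_derivative f (at r)) (at r)"
proof -
 have "f differentiable (at r)" using assms
 proof induction
  case (coord i)
  show ?case unfolding differentiable_def using bounded_linear_imp_has_derivative[OF bounded_linear_vec_nth] by blast
 qed auto
 then show ?thesis by (simp add: frechet_derivative_works)
qed

section \<open>The complexified surface\<close>

definition surf :: "(complex ^ 3) set" where "surf = {r. r $ 1 * r $ 2 * r $ 3 = 1}"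

lemma surf_nz: assumes "r \<in> surf" shows "r $ 1 ~= 0" "r $ 2 ~= 0" "r $ 3 ~= 0"
 using assms unfolding surf_def by auto

lemma real_zeros_imp_zero:
 assumes "h holomorphic_on UNIV" "!!x::real. h (of_real x) = 0" shows "h z = 0"
proof (rule ccontr)
 assume "h z ~= 0"
 then have "countable {t\<in>UNIV. h t = 0}" using countable_zeros[OF assms(1) open_UNIV connected_UNIV UNIV_I] by blast
 then have "countable (range complex_of_real)" by (rule countable_subset[rotated]) (use assms(2) in auto)
 then have "countable (UNIV :: real set)" by (rule countable_image_inj_on) (simp add: inj_of_real)
 then show False using uncountable_UNIV_real by blast
qed

definition octant_point :: "real => real => real ^ 3" where "octant_point a b = vec3 (exp a) (exp b) (exp (- a - b))"

text \<open>A polynomial that vanishes on the positive octant, parametrised by exponentials of real numbers, vanishes for complex exponents too: the identity theorem is applied in each of the two variables.\<close>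
lemma zariski_closure_surface:
 assumes S0: "!!a b. octant_point a b \<in> S0" "S0 \<subseteq> {r. r $ 1 * r $ 2 * r $ 3 = 1}"
 shows "zariski_closure (complexify ` S0) = surf"
proof (intro subset_antisym subsetI)
 fix r assume r: "r \<in> zariski_closure (complexify ` S0)"
 have "complex_polynomial_function (\<lambda>r::complex^3. r $ 1 * r $ 2 * r $ 3 + (-1))"
  by (intro complex_polynomial_function.intros)
 moreover have "x $ 1 * x $ 2 * x $ 3 + (-1) = 0" if x: "x \<in> complexify ` S0" for x
 proof -
  obtain y where y: "y \<in> S0" "x = complexify y" using x by blast
  have e: "y $ 1 * y $ 2 * y $ 3 = 1" using y(1) S0(2) by auto
  have "of_real (y $ 1 * y $ 2 * y $ 3) = (of_real 1::complex)" unfolding e ..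
  then show ?thesis unfolding y(2) complexify_def by simp
 qed
 ultimately have v: "(\<lambda>r::complex^3. r $ 1 * r $ 2 * r $ 3 + (-1)) \<in> vanishing_ideal (complexify ` S0)" unfolding vanishing_ideal_def by blast
 have "\<forall>f\<in>vanishing_ideal (complexify ` S0). f r = 0" using r unfolding zariski_closure_def by simp
 from bspec[OF this v] have "r $ 1 * r $ 2 * r $ 3 + (-1) = 0" .
 then show "r \<in> surf" unfolding surf_def by simp
next
 fix r assume r: "r \<in> surf"
 note nz = surf_nz[OF r]
 show "r \<in> zariski_closure (complexify ` S0)" unfolding zariski_closure_def
 proof (intro CollectI ballI)
  fix f assume "f \<in> vanishing_ideal (complexify ` S0)"
  then have f: "complex_polynomial_function f" "!!x. x \<in> S0 ==> f (complexify x) = 0" unfolding vanishing_ideal_def by auto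
  define e where "e a b = vec3 (exp a) (exp b) (exp (- a - b))" for a b :: complex
  have comp: "e a b $ i = (if i = 1 then exp a else if i = 2 then exp b else exp (- a - b))" for a b and i :: 3
   using exhaust_3[of i] unfolding e_def by auto
  have h1: "(\<lambda>a. f (e a b)) holomorphic_on UNIV" for b
  proof (rule polynomial_holomorphic[OF f(1)], unfold comp)
   show "(\<lambda>a. if i = 1 then exp a else if i = 2 then exp b else exp (- a - b)) holomorphic_on UNIV" for i :: 3
    by (cases "i = 1"; cases "i = 2") (auto intro!: holomorphic_intros)
  qed
  have h2: "(\<lambda>b. f (e a b)) holomorphic_on UNIV" for a
  proof (rule polynomial_holomorphic[OF f(1)], unfold comp)
   show "(\<lambda>b. if i = 1 then exp a else if i = 2 then exp b else exp (- a - b)) holomorphic_on UNIV" for i :: 3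
    by (cases "i = 1"; cases "i = 2") (auto intro!: holomorphic_intros)
  qed
  have z: "f (e (of_real a) (of_real b)) = 0" for a b :: real
  proof -
   have "complexify (octant_point a b) = e (of_real a) (of_real b)"
    unfolding octant_point_def e_def complexify_def by (rule vec3_eqI) (simp_all flip: exp_of_real of_real_minus of_real_diff)
   then show ?thesis using f(2)[OF S0(1)] by metis
  qed
  have "f (e a (of_real b)) = 0" for a and b :: real by (rule real_zeros_imp_zero[OF h1 z])
  then have "f (e a b) = 0" for a b by (rule real_zeros_imp_zero[OF h2])
  moreover have "r = e (Ln (r $ 1)) (Ln (r $ 2))"
  proof (rule vec3_eqI)
   have "r $ 3 = 1 / (r $ 1 * r $ 2)" using r nz unfolding surf_def by (simp add: field_simps)
   then show "r $ 3 = e (Ln (r $ 1)) (Ln (r $ 2)) $ 3" unfolding e_def using nz by (simp add: exp_diff exp_minus field_simps)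
  qed (use nz in \<open>simp_all add: e_def\<close>)
  ultimately show "f r = 0" by metis
 qed
qed

lemma octant_in_component:
 "octant_point a b \<in> connected_component_set {r :: real^3. r $ 1 * r $ 2 * r $ 3 = 1} (vec3 1 1 1)"
proof -
 define O' where "O' = range (\<lambda>p. octant_point (fst p) (snd p))"
 have lim: "continuous_on UNIV (\<lambda>p. octant_point (fst p) (snd p))"
 proof -
  have "octant_point (fst p) (snd p) = (\<chi> i. if i = 1 then exp (fst p) else if i = 2 then exp (snd p) else exp (- fst p - snd p))" for p
   unfolding octant_point_def by (rule vec3_eqI) simp_all
  moreover have "continuous_on UNIV (\<lambda>p::real \<times> real. \<chi> i. if i = (1::3) then exp (fst p) else if i = 2 then exp (snd p) else exp (- fst p - snd p))"
  proof (rule continuous_on_vec_lambda)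
   fix i :: 3
   show "continuous_on UNIV (\<lambda>p::real \<times> real. if i = 1 then exp (fst p) else if i = 2 then exp (snd p) else exp (- fst p - snd p))"
    by (cases "i = 1"; cases "i = 2") (auto intro!: continuous_intros)
  qed
  ultimately show ?thesis by simp
 qed
 have "connected O'" unfolding O'_def by (rule connected_continuous_image[OF lim connected_UNIV])
 moreover have "O' \<subseteq> {r. r $ 1 * r $ 2 * r $ 3 = 1}" unfolding O'_def octant_point_def by (auto simp flip: exp_add)
 moreover have "vec3 1 1 1 \<in> O'" unfolding O'_def octant_point_def by (rule image_eqI[of _ _ "(0, 0)"]) simp_all
 ultimately have "O' \<subseteq> connected_component_set {r. r $ 1 * r $ 2 * r $ 3 = 1} (vec3 1 1 1)" by (intro connected_component_maximal)
 then show ?thesis using rangeI[of "\<lambda>p. octant_point (fst p) (snd p)" "(a, b)"] unfolding O'_def by auto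
qed

definition conormal :: "complex ^ 3 => complex ^ 3" where "conormal r = vec3 (1 / r $ 1) (1 / r $ 2) (1 / r $ 3)"

text \<open>One inclusion comes from the equation xyz = 1 itself, the other from the curves with coordinates x * exp (t * v / x), which stay on the surface.\<close>
lemma zariski_tangent_surf:
 assumes r: "r \<in> surf" shows "zariski_tangent surf r = {v. cform (conormal r) v = 0}"
proof (intro subset_antisym subsetI CollectI)
 note nz = surf_nz[OF r]
 fix v assume v: "v \<in> zariski_tangent surf r"
 have "complex_polynomial_function (\<lambda>r::complex^3. r $ 1 * r $ 2 * r $ 3 + (-1))"
  by (intro complex_polynomial_function.intros)
 then have "(\<lambda>r::complex^3. r $ 1 * r $ 2 * r $ 3 + (-1)) \<in> vanishing_ideal surf" unfolding vanishing_ideal_def surf_def by auto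
 then have f0: "frechet_derivative (\<lambda>r::complex^3. r $ 1 * r $ 2 * r $ 3 + (-1)) (at r) v = 0" using v unfolding zariski_tangent_def by blast
 have n: "((\<lambda>r::complex^3. r $ i) has_derivative (\<lambda>h. h $ i)) (at r)" for i by (rule bounded_linear_imp_has_derivative[OF bounded_linear_vec_nth])
 have "((\<lambda>r::complex^3. r $ 1 * r $ 2 * r $ 3 + (-1)) has_derivative (\<lambda>h. (r $ 1 * r $ 2) * h $ 3 + (r $ 1 * h $ 2 + h $ 1 * r $ 2) * r $ 3 + 0)) (at r)"
  by (intro has_derivative_add has_derivative_mult n has_derivative_const)
 from frechet_derivative_at[OF this, symmetric] f0 have "r $ 1 * r $ 2 * v $ 3 + (r $ 1 * v $ 2 + v $ 1 * r $ 2) * r $ 3 = 0" by simp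
 moreover have "cform (conormal r) v * (r $ 1 * r $ 2 * r $ 3) = r $ 1 * r $ 2 * v $ 3 + (r $ 1 * v $ 2 + v $ 1 * r $ 2) * r $ 3"
  unfolding cform3 conormal_def using nz by (simp add: field_simps)
 ultimately show "cform (conormal r) v = 0" using nz by simp
next
 note nz = surf_nz[OF r]
 fix v assume "v \<in> {v. cform (conormal r) v = 0}"
 then have v: "v $ 1 / r $ 1 + v $ 2 / r $ 2 + v $ 3 / r $ 3 = 0" unfolding cform3 conormal_def by simp
 show "v \<in> zariski_tangent surf r" unfolding zariski_tangent_def
 proof (intro CollectI ballI)
  fix f assume f: "f \<in> vanishing_ideal surf"
  define c where "c t = vec3 (r $ 1 * exp (t * (v $ 1 / r $ 1))) (r $ 2 * exp (t * (v $ 2 / r $ 2))) (r $ 3 * exp (t * (v $ 3 / r $ 3)))" for t :: complex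
  have d: "((\<lambda>t. x * exp (t * (w / x))) has_derivative (\<lambda>h. h * w)) (at 0)" if "x ~= 0" for x w :: complex
  proof -
   have "((\<lambda>t. x * exp (t * (w / x))) has_field_derivative w) (at 0)" using that by (auto intro!: derivative_eq_intros)
   then show ?thesis unfolding has_field_derivative_def by (rule has_derivative_eq_rhs) (simp add: fun_eq_iff mult.commute)
  qed
  have cd: "(c has_derivative (\<lambda>h. vec3 (h * v $ 1) (h * v $ 2) (h * v $ 3))) (at 0)"
   unfolding c_def[abs_def] by (intro has_derivative_vec3 d nz)
  have c0: "c 0 = r" unfolding c_def by (rule vec3_eqI) simp_all
  have pf: "complex_polynomial_function f" using f unfolding vanishing_ideal_def by auto
  have fc: "(f \<circ> c has_derivative frechet_derivative f (at r) \<circ> (\<lambda>h. vec3 (h * v $ 1) (h * v $ 2) (h * v $ 3))) (at 0)"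
   using diff_chain_at[OF cd polynomial_differentiable[OF pf, of "c 0"]] unfolding c0 .
  have fc0: "f \<circ> c = (\<lambda>_. 0)"
  proof
   fix t
   have "t * (v $ 1 / r $ 1) + t * (v $ 2 / r $ 2) + t * (v $ 3 / r $ 3) = t * (v $ 1 / r $ 1 + v $ 2 / r $ 2 + v $ 3 / r $ 3)" by (simp only: distrib_left)
   also have "\<dots> = 0" using v by simp
   finally have "exp (t * (v $ 1 / r $ 1)) * exp (t * (v $ 2 / r $ 2)) * exp (t * (v $ 3 / r $ 3)) = 1" by (metis exp_add exp_zero)
   moreover have "c t $ 1 * c t $ 2 * c t $ 3 = (r $ 1 * r $ 2 * r $ 3) * (exp (t * (v $ 1 / r $ 1)) * exp (t * (v $ 2 / r $ 2)) * exp (t * (v $ 3 / r $ 3)))"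
    unfolding c_def by simp
   ultimately have "c t \<in> surf" using r unfolding surf_def by simp
   then show "(f \<circ> c) t = 0" using f unfolding vanishing_ideal_def by simp
  qed
  have "frechet_derivative f (at r) \<circ> (\<lambda>h. vec3 (h * v $ 1) (h * v $ 2) (h * v $ 3)) = (\<lambda>_. 0)"
   by (rule has_derivative_unique[OF fc[unfolded fc0] has_derivative_const])
  from fun_cong[OF this, of 1] have "frechet_derivative f (at r) (vec3 (1 * v $ 1) (1 * v $ 2) (1 * v $ 3)) = 0" unfolding comp_apply .
  moreover have "vec3 (1 * v $ 1) (1 * v $ 2) (1 * v $ 3) = v" by (rule vec3_eqI) simp_all
  ultimately show "frechet_derivative f (at r) v = 0" by simp
 qed
qed

lemma tangent_plane_orthogonal:
 assumes r: "r \<in> surf" and x: "!!w. cform (conormal r) w = 0 ==> cform x w = 0"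
 shows "\<exists>c. x = c *s conormal r"
proof -
 note nz = surf_nz[OF r]
 have 1: "cform x (vec3 (r $ 1) (- r $ 2) 0) = 0" by (rule x) (use nz in \<open>simp add: cform3 conormal_def\<close>)
 have 2: "cform x (vec3 0 (r $ 2) (- r $ 3)) = 0" by (rule x) (use nz in \<open>simp add: cform3 conormal_def\<close>)
 show ?thesis using 1 2 nz
  by (intro exI[of _ "x $ 1 * r $ 1"] vec3_eqI) (simp_all add: cform3 conormal_def field_simps)
qed

lemma dim_tangent_plane:
 assumes r: "r \<in> surf" shows "vec.dim {v. cform (conormal r) v = 0} = 2"
proof -
 note nz = surf_nz[OF r]
 define b1 b2 where "b1 = vec3 (r $ 1) (- r $ 2) 0" and "b2 = vec3 0 (r $ 2) (- r $ 3)"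
 have ne: "b1 ~= b2" "b2 ~= 0" "b1 \<notin> vec.span {b2}"
 proof -
  have "b1 $ 1 = r $ 1" "b2 $ 1 = 0" "b2 $ 2 = r $ 2" unfolding b1_def b2_def by simp_all
  then show "b1 ~= b2" "b2 ~= 0" using nz by auto
  show "b1 \<notin> vec.span {b2}"
  proof
   assume "b1 \<in> vec.span {b2}"
   then obtain k where "b1 = k *s b2" unfolding vec.span_singleton by blast
   then have "b1 $ 1 = k * b2 $ 1" by simp
   then show False using nz unfolding b1_def b2_def by simp
  qed
 qed
 have ind: "vec.independent {b1, b2}" using ne by (simp add: vec.independent_insert)
 have sub: "{b1, b2} \<subseteq> {v. cform (conormal r) v = 0}" using nz unfolding b1_def b2_def by (simp add: cform3 conormal_def)
 have span: "{v. cform (conormal r) v = 0} \<subseteq> vec.span {b1, b2}"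
 proof
  fix v assume "v \<in> {v. cform (conormal r) v = 0}"
  then have v: "v $ 1 / r $ 1 + v $ 2 / r $ 2 + v $ 3 / r $ 3 = 0" unfolding cform3 conormal_def by simp
  then have v2: "v $ 2 / r $ 2 = - (v $ 1 / r $ 1) - v $ 3 / r $ 3" by (simp add: algebra_simps eq_neg_iff_add_eq_0)
  have "v $ 2 = r $ 2 * (v $ 2 / r $ 2)" using nz by simp
  then have "v $ 2 = r $ 2 * (- (v $ 1 / r $ 1) - v $ 3 / r $ 3)" unfolding v2 .
  then have "v = (v $ 1 / r $ 1) *s b1 + (- v $ 3 / r $ 3) *s b2"
   unfolding b1_def b2_def using nz by (intro vec3_eqI) (simp_all add: algebra_simps)
  moreover have "(v $ 1 / r $ 1) *s b1 + (- v $ 3 / r $ 3) *s b2 \<in> vec.span {b1, b2}"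
   by (intro vec.span_add vec.span_scale vec.span_base) auto
  ultimately show "v \<in> vec.span {b1, b2}" by metis
 qed
 show ?thesis by (rule vec.dim_unique[OF sub span ind]) (use ne in simp)
qed

text \<open>The phase space in coordinates: the conormal vector has entries 1/x, 1/y, 1/z, and the metric degenerates exactly where it is isotropic.\<close>
definition PS :: "phase set" where
 "PS = {(r, v). r \<in> surf \<and> cform (conormal r) (conormal r) ~= 0 \<and> cform (conormal r) v = 0}"

lemma cform_scale: fixes x y :: "complex ^ 3" shows "cform (c *s x) y = c * cform x y" "cform x (c *s y) = c * cform x y"
 unfolding cform3 by (simp_all add: algebra_simps)

lemma cform_add: fixes x y z :: "complex ^ 3" shows "cform (x + y) z = cform x z + cform y z" "cform x (y + z) = cform x y + cform x z"
 "cform (x - y) z = cform x z - cform y z" "cform x (y - z) = cform x y - cform x z" "cform (- x) z = - cform x z" "cform x 0 = 0" "cform 0 x = 0"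
 unfolding cform3 by (simp_all add: algebra_simps)

lemma cform_commute: "cform x y = cform y (x :: complex ^ 3)" unfolding cform3 by (simp add: mult.commute)

lemma phase_space_surf: "phase_space surf = PS"
proof -
 have "r \<in> nondegenerate_part surf \<longleftrightarrow> r \<in> surf \<and> cform (conormal r) (conormal r) ~= 0" for r
 proof
  assume "r \<in> nondegenerate_part surf"
  then have r: "r \<in> surf" and nd: "!!v. v \<in> zariski_tangent surf r ==> (\<forall>w\<in>zariski_tangent surf r. cform v w = 0) ==> v = 0"
   unfolding nondegenerate_part_def by auto
  have "cform (conormal r) (conormal r) ~= 0"
  proof
   assume "cform (conormal r) (conormal r) = 0"
   then have "conormal r = 0" by (intro nd) (auto simp: zariski_tangent_surf[OF r])
   then have "conormal r $ 1 = 0" by simp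
   then show False using surf_nz[OF r] unfolding conormal_def by simp
  qed
  then show "r \<in> surf \<and> cform (conormal r) (conormal r) ~= 0" using r by simp
 next
  assume r: "r \<in> surf \<and> cform (conormal r) (conormal r) ~= 0"
  have "v = 0" if v: "cform (conormal r) v = 0" "!!w. cform (conormal r) w = 0 ==> cform v w = 0" for v
  proof -
   obtain c where c: "v = c *s conormal r" using tangent_plane_orthogonal[OF _ v(2)] r by blast
   then have "c * cform (conormal r) (conormal r) = 0" using v(1) by (simp add: cform_scale)
   then show ?thesis using c r by simp
  qed
  then show "r \<in> nondegenerate_part surf" unfolding nondegenerate_part_def
   using r zariski_tangent_surf dim_tangent_plane by auto
 qed
 then show ?thesis unfolding phase_space_def PS_def using zariski_tangent_surf by (auto simp: nondegenerate_part_def)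
qed

section \<open>The chart and the tangent spaces\<close>

text \<open>Logarithmic coordinates on the surface and the velocities of these coordinates.\<close>
definition chart :: "c4 => phase" where
 "chart a = (case a of (s, \<xi>, \<sigma>, \<omega>) =>
   (vec3 (exp (s + \<xi>)) (exp (s - \<xi>)) (exp (- 2 * s)),
   vec3 (exp (s + \<xi>) * (\<sigma> + \<omega>)) (exp (s - \<xi>) * (\<sigma> - \<omega>)) (exp (- 2 * s) * (- 2 * \<sigma>))))"

definition dchart :: "c4 => c4 => phase" where
 "dchart a h = (case a of (s, \<xi>, \<sigma>, \<omega>) => case h of (h1, h2, h3, h4) =>
   (vec3 (exp (s + \<xi>) * (h1 + h2)) (exp (s - \<xi>) * (h1 - h2)) (exp (- 2 * s) * (- 2 * h1)),
   vec3 (exp (s + \<xi>) * (h3 + h4) + exp (s + \<xi>) * (h1 + h2) * (\<sigma> + \<omega>))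
    (exp (s - \<xi>) * (h3 - h4) + exp (s - \<xi>) * (h1 - h2) * (\<sigma> - \<omega>))
    (exp (- 2 * s) * (- 2 * h3) + exp (- 2 * s) * (- 2 * h1) * (- 2 * \<sigma>))))"

lemma inverse_squares:
 "1 / exp (s + \<xi>) * (1 / exp (s + \<xi>)) = exp (- 2 * s) * exp (- 2 * \<xi>)"
 "1 / exp (s - \<xi>) * (1 / exp (s - \<xi>)) = exp (- 2 * s) * exp (2 * \<xi>)"
 "1 / exp (- 2 * s) * (1 / exp (- 2 * s)) = exp (4 * s)" for s \<xi> :: complex
proof -
 have e: "1 / exp y * (1 / exp y) = exp (- 2 * y)" for y :: complex
 proof -
  have "exp (- 2 * y) = exp (- y) * exp (- y)" by (simp flip: exp_add)
  then show ?thesis by (simp add: exp_minus divide_inverse)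
 qed
 show "1 / exp (s + \<xi>) * (1 / exp (s + \<xi>)) = exp (- 2 * s) * exp (- 2 * \<xi>)"
  unfolding e exp_add[symmetric] by (simp add: algebra_simps)
 show "1 / exp (s - \<xi>) * (1 / exp (s - \<xi>)) = exp (- 2 * s) * exp (2 * \<xi>)"
  unfolding e exp_add[symmetric] by (simp add: algebra_simps)
 show "1 / exp (- 2 * s) * (1 / exp (- 2 * s)) = exp (4 * s)" unfolding e by simp
qed

lemma conormal_square: "cform (conormal (fst (chart (s, \<xi>, \<sigma>, \<omega>)))) (conormal (fst (chart (s, \<xi>, \<sigma>, \<omega>)))) = NN s \<xi>"
 unfolding cform3 conormal_def chart_def prod.case fst_conv vec3_nth inverse_squares NN_def by (simp add: algebra_simps)

lemma chart_in_PS: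
 assumes "a \<in> UU" shows "chart a \<in> PS"
proof -
 obtain s \<xi> \<sigma> \<omega> where a: "a = (s, \<xi>, \<sigma>, \<omega>)" by (cases a)
 have 1: "exp (s + \<xi>) * exp (s - \<xi>) * exp (- 2 * s) = 1" by (simp flip: exp_add)
 have "cform (conormal (fst (chart a))) (conormal (fst (chart a))) = NN s \<xi>" unfolding a by (rule conormal_square)
 moreover have "cform (conormal (fst (chart a))) (snd (chart a)) = 0"
  unfolding cform3 conormal_def chart_def a by simp
 moreover have "fst (chart a) \<in> surf" unfolding surf_def chart_def a using 1 by simp
 moreover have "NN s \<xi> ~= 0" using assms unfolding UU_def a by simp
 ultimately show ?thesis unfolding PS_def by (simp add: case_prod_unfold)
qed

lemma UU_if_chart: "chart a \<in> PS ==> a \<in> UU"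
proof -
 obtain s \<xi> \<sigma> \<omega> where a: "a = (s, \<xi>, \<sigma>, \<omega>)" by (cases a)
 have "cform (conormal (fst (chart a))) (conormal (fst (chart a))) = NN s \<xi>" unfolding a by (rule conormal_square)
 then show "chart a \<in> PS ==> a \<in> UU" unfolding PS_def UU_def a by (simp add: case_prod_unfold)
qed

text \<open>A local inverse of the chart, with logarithms near the prescribed values A and B.\<close>
definition unchart :: "complex => complex => phase => c4" where
 "unchart A B q = (case q of (r, v) =>
   ((A + Ln (r $ 1 * exp (- A)) + (B + Ln (r $ 2 * exp (- B)))) / 2, (A + Ln (r $ 1 * exp (- A)) - (B + Ln (r $ 2 * exp (- B)))) / 2,
   (v $ 1 / r $ 1 + v $ 2 / r $ 2) / 2, (v $ 1 / r $ 1 - v $ 2 / r $ 2) / 2))"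

lemma chart_unchart:
 assumes "q \<in> PS" shows "chart (unchart A B q) = q"
proof -
 obtain r v where q: "q = (r, v)" by (cases q)
 have r: "r \<in> surf" and v: "v $ 1 / r $ 1 + v $ 2 / r $ 2 + v $ 3 / r $ 3 = 0" using assms unfolding q PS_def cform3 conormal_def by auto
 note nz = surf_nz[OF r]
 define a b where "a = A + Ln (r $ 1 * exp (- A))" and "b = B + Ln (r $ 2 * exp (- B))"
 have ea: "exp a = r $ 1" "exp b = r $ 2" unfolding a_def b_def exp_add using nz by (simp_all add: exp_minus)
 have u: "unchart A B q = ((a + b) / 2, (a - b) / 2, (v $ 1 / r $ 1 + v $ 2 / r $ 2) / 2, (v $ 1 / r $ 1 - v $ 2 / r $ 2) / 2)"
  unfolding unchart_def q a_def b_def by simp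
 have h: "(a + b) / 2 + (a - b) / 2 = a" "(a + b) / 2 - (a - b) / 2 = b" "- 2 * ((a + b) / 2) = - (a + b)"
  "(x + y) / 2 + (x - y) / 2 = x" "(x + y) / 2 - (x - y) / 2 = y" "- 2 * ((x + y) / 2) = - (x + y)" for x y :: complex
  by (simp_all add: field_simps)
 have e3: "exp (- (a + b)) = r $ 3" unfolding exp_minus exp_add ea using r nz unfolding surf_def by (simp add: field_simps)
 have v3: "r $ 3 * - (v $ 1 / r $ 1 + v $ 2 / r $ 2) = v $ 3"
 proof -
  have "- (v $ 1 / r $ 1 + v $ 2 / r $ 2) = v $ 3 / r $ 3" using v unfolding add_eq_0_iff by simp
  then show ?thesis using nz by simp
 qed
 show ?thesis unfolding u chart_def prod.case h ea e3 v3 unfolding q using nz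
  by (simp only: prod.inject, intro conjI vec3_eqI) simp_all
qed

lemma unchart_chart: "unchart (s + \<xi>) (s - \<xi>) (chart (s, \<xi>, \<sigma>, \<omega>)) = (s, \<xi>, \<sigma>, \<omega>)"
proof -
 have e: "exp x * exp (- x) = 1" for x :: complex by (simp flip: exp_add)
 show ?thesis unfolding unchart_def chart_def by (simp only: prod.case vec3_nth e Ln_1) simp
qed

lemma unchart_cont: "isCont (unchart (s + \<xi>) (s - \<xi>)) (chart (s, \<xi>, \<sigma>, \<omega>))"
proof -
 have e: "exp x * exp (- x) = 1" for x :: complex by (simp flip: exp_add)
 have 1: "fst (chart (s, \<xi>, \<sigma>, \<omega>)) $ 1 * exp (- (s + \<xi>)) \<notin> \<real>\<^sub>\<le>\<^sub>0" "fst (chart (s, \<xi>, \<sigma>, \<omega>)) $ 2 * exp (- (s - \<xi>)) \<notin> \<real>\<^sub>\<le>\<^sub>0"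
  "fst (chart (s, \<xi>, \<sigma>, \<omega>)) $ 1 ~= 0" "fst (chart (s, \<xi>, \<sigma>, \<omega>)) $ 2 ~= 0"
  unfolding chart_def by (simp_all only: prod.case fst_conv vec3_nth e) simp_all
 have c: "isCont (\<lambda>q::phase. fst q $ i) x" "isCont (\<lambda>q::phase. snd q $ i) x" for i x
  by (intro isCont_vec_nth continuous_intros)+
 show ?thesis unfolding unchart_def case_prod_unfold
  by (intro continuous_intros isCont_Ln' c 1)
    (use 1 in simp_all)
qed

lemma chart_has_derivative: "(chart has_derivative dchart a) (at a)"
proof -
 have e: "((\<lambda>a. exp (f a)) has_derivative (\<lambda>h. exp (f a) * D h)) (at a)" if "(f has_derivative D) (at a)" for f :: "c4 => complex" and D
  using diff_chain_at[OF that, of exp "(*) (exp (f a))"] DERIV_exp[of "f a"] unfolding has_field_derivative_def by (simp add: o_def)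
 have d: "((\<lambda>a::c4. fst a + fst (snd a)) has_derivative (\<lambda>h. fst h + fst (snd h))) (at a)"
  "((\<lambda>a::c4. fst a - fst (snd a)) has_derivative (\<lambda>h. fst h - fst (snd h))) (at a)"
  "((\<lambda>a::c4. - 2 * fst a) has_derivative (\<lambda>h. - 2 * fst h)) (at a)"
  "((\<lambda>a::c4. fst (snd (snd a)) + snd (snd (snd a))) has_derivative (\<lambda>h. fst (snd (snd h)) + snd (snd (snd h)))) (at a)"
  "((\<lambda>a::c4. fst (snd (snd a)) - snd (snd (snd a))) has_derivative (\<lambda>h. fst (snd (snd h)) - snd (snd (snd h)))) (at a)"
  "((\<lambda>a::c4. - 2 * fst (snd (snd a))) has_derivative (\<lambda>h. - 2 * fst (snd (snd h)))) (at a)"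
  by (auto intro!: derivative_eq_intros)
 have "((\<lambda>a. (vec3 (exp (fst a + fst (snd a))) (exp (fst a - fst (snd a))) (exp (- 2 * fst a)),
   vec3 (exp (fst a + fst (snd a)) * (fst (snd (snd a)) + snd (snd (snd a)))) (exp (fst a - fst (snd a)) * (fst (snd (snd a)) - snd (snd (snd a)))) (exp (- 2 * fst a) * (- 2 * fst (snd (snd a)))))) has_derivative
  (\<lambda>h. (vec3 (exp (fst a + fst (snd a)) * (fst h + fst (snd h))) (exp (fst a - fst (snd a)) * (fst h - fst (snd h))) (exp (- 2 * fst a) * (- 2 * fst h)),
   vec3 (exp (fst a + fst (snd a)) * (fst (snd (snd h)) + snd (snd (snd h))) + exp (fst a + fst (snd a)) * (fst h + fst (snd h)) * (fst (snd (snd a)) + snd (snd (snd a))))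
    (exp (fst a - fst (snd a)) * (fst (snd (snd h)) - snd (snd (snd h))) + exp (fst a - fst (snd a)) * (fst h - fst (snd h)) * (fst (snd (snd a)) - snd (snd (snd a))))
    (exp (- 2 * fst a) * (- 2 * fst (snd (snd h))) + exp (- 2 * fst a) * (- 2 * fst h) * (- 2 * fst (snd (snd a))))))) (at a)"
  by (intro has_derivative_Pair has_derivative_vec3 e d has_derivative_mult)
 then show ?thesis unfolding chart_def[abs_def] dchart_def[abs_def] case_prod_unfold .
qed

lemma dchart_scale: "dchart a (sc4 c h) = cscale c (dchart a h)"
 unfolding dchart_def cscale_def case_prod_unfold sc4_def
 by (simp only: prod.inject fst_conv snd_conv, intro conjI vec3_eqI) (simp_all add: algebra_simps)

lemma open_UU: "open UU"
proof -
 have "continuous_on UNIV (\<lambda>a::c4. NN (fst a) (fst (snd a)))" unfolding NN_def by (intro continuous_intros)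
 from open_vimage[OF _ this, of "- {0}"] show ?thesis unfolding UU_def vimage_def by auto
qed

text \<open>The equations obtained by differentiating xyz = 1 and the tangency condition on v.\<close>
definition TT :: "phase => phase set" where
 "TT q = {(x, y). cform (conormal (fst q)) x = 0 \<and>
   cform (conormal (fst q)) y = cform (vec3 (snd q $ 1 / (fst q $ 1)\<^sup>2) (snd q $ 2 / (fst q $ 2)\<^sup>2) (snd q $ 3 / (fst q $ 3)\<^sup>2)) x}"

lemma TT_chart: assumes "\<xi> \<in> TT (chart a)" shows "\<exists>h. \<xi> = dchart a h"
proof -
 obtain s x \<sigma> \<omega> where a: "a = (s, x, \<sigma>, \<omega>)" by (cases a)
 obtain p q where \<xi>: "\<xi> = (p, q)" by (cases \<xi>)
 define r1 r2 r3 where "r1 = exp (s + x)" and "r2 = exp (s - x)" and "r3 = exp (- 2 * s)"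
 have nz: "r1 ~= 0" "r2 ~= 0" "r3 ~= 0" unfolding r1_def r2_def r3_def by simp_all
 have c: "p $ 1 / r1 + p $ 2 / r2 + p $ 3 / r3 = 0"
  "q $ 1 / r1 + q $ 2 / r2 + q $ 3 / r3 = (\<sigma> + \<omega>) * (p $ 1 / r1) + (\<sigma> - \<omega>) * (p $ 2 / r2) + (- 2 * \<sigma>) * (p $ 3 / r3)"
  using assms nz unfolding TT_def \<xi> a chart_def cform3 conormal_def prod.case fst_conv snd_conv vec3_nth r1_def[symmetric] r2_def[symmetric] r3_def[symmetric]
  by (simp_all add: power2_eq_square)
 define P1 P2 Q1 Q2 where "P1 = p $ 1 / r1" and "P2 = p $ 2 / r2" and "Q1 = q $ 1 / r1" and "Q2 = q $ 2 / r2"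
 have p3: "p $ 3 = r3 * - (P1 + P2)"
 proof -
  have "p $ 3 / r3 = - (P1 + P2)" using c(1) unfolding P1_def[symmetric] P2_def[symmetric] add_eq_0_iff by simp
  then show ?thesis using nz by (simp add: field_simps)
 qed
 have q3: "q $ 3 = r3 * ((\<sigma> + \<omega>) * P1 + (\<sigma> - \<omega>) * P2 + 2 * \<sigma> * (P1 + P2) - Q1 - Q2)"
 proof -
  have e: "p $ 3 / r3 = - (P1 + P2)" using p3 nz by simp
  have "q $ 3 / r3 = (\<sigma> + \<omega>) * P1 + (\<sigma> - \<omega>) * P2 + 2 * \<sigma> * (P1 + P2) - Q1 - Q2"
   using c(2) unfolding e P1_def[symmetric] P2_def[symmetric] Q1_def[symmetric] Q2_def[symmetric] by (simp add: algebra_simps)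
  then show ?thesis using nz by (simp add: field_simps)
 qed
 have p12: "p $ 1 = r1 * P1" "p $ 2 = r2 * P2" "q $ 1 = r1 * Q1" "q $ 2 = r2 * Q2" unfolding P1_def P2_def Q1_def Q2_def using nz by simp_all
 define R1 R2 where "R1 = Q1 - P1 * (\<sigma> + \<omega>)" and "R2 = Q2 - P2 * (\<sigma> - \<omega>)"
 have h: "(x + y) / 2 + (x - y) / 2 = x" "(x + y) / 2 - (x - y) / 2 = y" "- 2 * ((x + y) / 2) = - (x + y)" for x y :: complex
  by (simp_all add: field_simps)
 have "\<xi> = dchart a ((P1 + P2) / 2, (P1 - P2) / 2, (R1 + R2) / 2, (R1 - R2) / 2)"
  unfolding \<xi> dchart_def a prod.case r1_def[symmetric] r2_def[symmetric] r3_def[symmetric] h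
  by (simp only: prod.inject, intro conjI vec3_eqI) (simp_all add: p12 p3 q3 R1_def R2_def algebra_simps)
 then show ?thesis by blast
qed

lemma tangent_subset_TT: assumes q: "q \<in> PS" shows "tangent PS q \<subseteq> TT q"
proof
 fix \<xi> assume "\<xi> \<in> tangent PS q"
 then obtain \<gamma> e where \<gamma>: "e > 0" "\<gamma> 0 = q" "!!t. t \<in> ball 0 e ==> \<gamma> t \<in> PS" "(\<gamma> has_derivative (\<lambda>h. cscale h \<xi>)) (at 0)"
  unfolding tangent_def by blast
 obtain x y where \<xi>: "\<xi> = (x, y)" by (cases \<xi>)
 have r: "fst q \<in> surf" using q unfolding PS_def by auto
 note nz = surf_nz[OF r]
 have d1: "((\<lambda>t. fst (\<gamma> t) $ i) has_field_derivative x $ i) (at 0)" for i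
  using has_derivative_nth[OF has_derivative_fst[OF \<gamma>(4)], of i] unfolding has_field_derivative_def \<xi> cscale_def
  by (rule has_derivative_eq_rhs) (simp add: fun_eq_iff mult.commute)
 have d2: "((\<lambda>t. snd (\<gamma> t) $ i) has_field_derivative y $ i) (at 0)" for i
  using has_derivative_nth[OF has_derivative_snd[OF \<gamma>(4)], of i] unfolding has_field_derivative_def \<xi> cscale_def
  by (rule has_derivative_eq_rhs) (simp add: fun_eq_iff mult.commute)
 have z0: "(0::complex) \<in> ball 0 e" using \<gamma>(1) by simp
 have "((\<lambda>t. fst (\<gamma> t) $ 1 * fst (\<gamma> t) $ 2 * fst (\<gamma> t) $ 3) has_field_derivative
   (x $ 1 * fst q $ 2 + x $ 2 * fst q $ 1) * fst q $ 3 + x $ 3 * (fst q $ 1 * fst q $ 2)) (at 0)"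
  using DERIV_mult[OF DERIV_mult[OF d1[of 1] d1[of 2]] d1[of 3]] unfolding \<gamma>(2) .
 moreover have "((\<lambda>t. fst (\<gamma> t) $ 1 * fst (\<gamma> t) $ 2 * fst (\<gamma> t) $ 3) has_field_derivative 0) (at 0)"
  by (rule has_field_derivative_transform_within_open[OF DERIV_const[of 1] open_ball z0]) (use \<gamma>(3) in \<open>force simp: PS_def surf_def\<close>)
 ultimately have 1: "(x $ 1 * fst q $ 2 + x $ 2 * fst q $ 1) * fst q $ 3 + x $ 3 * (fst q $ 1 * fst q $ 2) = 0" by (rule DERIV_unique)
 have dv: "((\<lambda>t. snd (\<gamma> t) $ i / fst (\<gamma> t) $ i) has_field_derivative (y $ i * fst q $ i - snd q $ i * x $ i) / (fst q $ i * fst q $ i)) (at 0)" if "fst q $ i ~= 0" for i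
  using DERIV_divide[OF d2[of i] d1[of i]] that unfolding \<gamma>(2) by simp
 have "((\<lambda>t. snd (\<gamma> t) $ 1 / fst (\<gamma> t) $ 1 + snd (\<gamma> t) $ 2 / fst (\<gamma> t) $ 2 + snd (\<gamma> t) $ 3 / fst (\<gamma> t) $ 3) has_field_derivative
  (y $ 1 * fst q $ 1 - snd q $ 1 * x $ 1) / (fst q $ 1 * fst q $ 1) + (y $ 2 * fst q $ 2 - snd q $ 2 * x $ 2) / (fst q $ 2 * fst q $ 2) + (y $ 3 * fst q $ 3 - snd q $ 3 * x $ 3) / (fst q $ 3 * fst q $ 3)) (at 0)"
  by (intro DERIV_add dv nz)
 moreover have "((\<lambda>t. snd (\<gamma> t) $ 1 / fst (\<gamma> t) $ 1 + snd (\<gamma> t) $ 2 / fst (\<gamma> t) $ 2 + snd (\<gamma> t) $ 3 / fst (\<gamma> t) $ 3) has_field_derivative 0) (at 0)"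
  by (rule has_field_derivative_transform_within_open[OF DERIV_const[of 0] open_ball z0]) (use \<gamma>(3) in \<open>force simp: PS_def cform3 conormal_def\<close>)
 ultimately have 2: "(y $ 1 * fst q $ 1 - snd q $ 1 * x $ 1) / (fst q $ 1 * fst q $ 1) + (y $ 2 * fst q $ 2 - snd q $ 2 * x $ 2) / (fst q $ 2 * fst q $ 2) + (y $ 3 * fst q $ 3 - snd q $ 3 * x $ 3) / (fst q $ 3 * fst q $ 3) = 0"
  by (rule DERIV_unique)
 have "cform (conormal (fst q)) x * (fst q $ 1 * fst q $ 2 * fst q $ 3) = (x $ 1 * fst q $ 2 + x $ 2 * fst q $ 1) * fst q $ 3 + x $ 3 * (fst q $ 1 * fst q $ 2)"
  unfolding cform3 conormal_def using nz by (simp add: field_simps)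
 then have "cform (conormal (fst q)) x = 0" using 1 nz by simp
 moreover have "cform (conormal (fst q)) y - cform (vec3 (snd q $ 1 / (fst q $ 1)\<^sup>2) (snd q $ 2 / (fst q $ 2)\<^sup>2) (snd q $ 3 / (fst q $ 3)\<^sup>2)) x = 0"
  using 2 nz unfolding cform3 conormal_def
  by (simp add: diff_divide_distrib power2_eq_square) (simp add: algebra_simps)
 ultimately show "\<xi> \<in> TT q" unfolding TT_def \<xi> by simp
qed

lemma dchart_tangent: assumes a: "a \<in> UU" shows "dchart a h \<in> tangent PS (chart a)"
proof -
 have l: "((\<lambda>t. a + sc4 t h) has_derivative (\<lambda>\<mu>. sc4 \<mu> h)) (at t)" for t by (rule s4.line_derivative)
 have d: "((\<lambda>t. chart (a + sc4 t h)) has_derivative (\<lambda>\<mu>. cscale \<mu> (dchart (a + sc4 t h) h))) (at t)" for t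
  using diff_chain_at[OF l chart_has_derivative] by (simp add: o_def dchart_scale)
 have "open {t. a + sc4 t h \<in> UU}" by (rule s4.open_line[OF open_UU])
 moreover have "0 \<in> {t. a + sc4 t h \<in> UU}" using a by simp
 ultimately obtain e where e: "e > 0" "ball 0 e \<subseteq> {t. a + sc4 t h \<in> UU}" using openE by blast
 show ?thesis unfolding tangent_def
 proof (intro CollectI exI[of _ "\<lambda>t. chart (a + sc4 t h)"] exI[of _ e] conjI ballI)
  show "((\<lambda>t. chart (a + sc4 t h)) has_derivative (\<lambda>\<mu>. cscale \<mu> (dchart a h))) (at 0)" using d[of 0] by simp
  show "\<exists>\<eta>. ((\<lambda>t. chart (a + sc4 t h)) has_derivative (\<lambda>\<mu>. cscale \<mu> \<eta>)) (at t)" for t using d[of t] by blast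
  show "chart (a + sc4 t h) \<in> PS" if "t \<in> ball 0 e" for t using e(2) that chart_in_PS by blast
 qed (use e(1) in simp_all)
qed

text \<open>Curves in the phase space satisfy the differentiated equations; these describe the image of the derivative of the chart, whose vectors are velocities of curves.\<close>
lemma tangent_chart: assumes "a \<in> UU" shows "tangent PS (chart a) = TT (chart a)" "tangent PS (chart a) = range (dchart a)"
proof -
 have 1: "range (dchart a) \<subseteq> tangent PS (chart a)" using dchart_tangent[OF assms] by blast
 have 2: "tangent PS (chart a) \<subseteq> TT (chart a)" by (rule tangent_subset_TT[OF chart_in_PS[OF assms]])
 have 3: "TT (chart a) \<subseteq> range (dchart a)" using TT_chart by blast
 show "tangent PS (chart a) = TT (chart a)" "tangent PS (chart a) = range (dchart a)" using 1 2 3 by blast+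
qed

section \<open>Hamiltonian vectors\<close>

lemma bounded_linear_cform: "bounded_linear (\<lambda>x. cform x w)" "bounded_linear (\<lambda>x. cform w x)" for w :: "complex ^ 3"
proof -
 have "linear (\<lambda>x. cform x w)" "linear (\<lambda>x. cform w x)"
  by (rule linearI; simp add: cform3 algebra_simps)+
 then show "bounded_linear (\<lambda>x. cform x w)" "bounded_linear (\<lambda>x. cform w x)" by (simp_all add: linear_conv_bounded_linear)
qed

lemma symplectic_form_eq: "symplectic_form q \<xi> \<eta> = cform (fst \<xi>) (snd \<eta>) - cform (snd \<xi>) (fst \<eta>)"
proof -
 have "frechet_derivative (\<lambda>p. tautological_form p \<eta>) (at q) \<xi> = cform (snd \<xi>) (fst \<eta>)" for \<xi> \<eta>
 proof -
  have "((\<lambda>p::phase. cform (snd p) (fst \<eta>)) has_derivative (\<lambda>h. cform (snd h) (fst \<eta>))) (at q)"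
   by (rule bounded_linear.has_derivative[OF bounded_linear_cform(1) has_derivative_snd[OF has_derivative_ident]])
  from frechet_derivative_at[OF this] show ?thesis unfolding tautological_form_def by metis
 qed
 then show ?thesis unfolding symplectic_form_def exterior_derivative_def by (simp add: cform_commute)
qed

text \<open>The restriction of the symplectic form to the tangent space is nondegenerate. The solution is found by projecting along the conormal vector n, where N = n . n is not zero.\<close>
lemma hamiltonian_unique:
 assumes q: "q \<in> PS" and add: "!!x y. l (x + y) = l x + l y" and scale: "!!c x. l (cscale c x) = c * l x"
 shows "\<exists>!\<xi>. \<xi> \<in> TT q \<and> (\<forall>\<eta>\<in>TT q. symplectic_form q \<xi> \<eta> = l \<eta>)"
proof -
 define n where "n = conormal (fst q)"
 define N where "N = cform n n"
 define m where "m = vec3 (snd q $ 1 / (fst q $ 1)\<^sup>2) (snd q $ 2 / (fst q $ 2)\<^sup>2) (snd q $ 3 / (fst q $ 3)\<^sup>2)"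
 have r: "fst q \<in> surf" and N0: "N ~= 0" using q unfolding PS_def N_def n_def by auto
 have TT: "(x, y) \<in> TT q \<longleftrightarrow> cform n x = 0 \<and> cform n y = cform m x" for x y unfolding TT_def n_def m_def by simp
 define A where "A = vec3 (l (vec3 1 0 0, 0)) (l (vec3 0 1 0, 0)) (l (vec3 0 0 1, 0))"
 define B where "B = vec3 (l (0, vec3 1 0 0)) (l (0, vec3 0 1 0)) (l (0, vec3 0 0 1))"
 have l: "l (a, b) = cform A a + cform B b" for a b
 proof -
  have "(a, b) = cscale (a $ 1) (vec3 1 0 0, 0) + cscale (a $ 2) (vec3 0 1 0, 0) + cscale (a $ 3) (vec3 0 0 1, 0)
   + cscale (b $ 1) (0, vec3 1 0 0) + cscale (b $ 2) (0, vec3 0 1 0) + cscale (b $ 3) (0, vec3 0 0 1)"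
   unfolding cscale_def by (simp only: add_Pair prod.inject fst_conv snd_conv, intro conjI vec3_eqI) simp_all
  then have "l (a, b) = l (cscale (a $ 1) (vec3 1 0 0, 0) + cscale (a $ 2) (vec3 0 1 0, 0) + cscale (a $ 3) (vec3 0 0 1, 0)
   + cscale (b $ 1) (0, vec3 1 0 0) + cscale (b $ 2) (0, vec3 0 1 0) + cscale (b $ 3) (0, vec3 0 0 1))" by (rule arg_cong)
  then show ?thesis unfolding add scale A_def B_def cform3 by (simp add: mult.commute)
 qed
 define \<beta> where "\<beta> = cform n B / N"
 define x where "x = B - \<beta> *s n"
 define c where "c = (cform m x + cform n A + \<beta> * cform n m) / N"
 define y where "y = c *s n - A - \<beta> *s m"
 have "(x, y) \<in> TT q" unfolding TT
 proof
  show "cform n x = 0" unfolding x_def cform_add cform_scale N_def[symmetric] \<beta>_def using N0 by simp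
  have "cform n y = c * N - cform n A - \<beta> * cform n m" unfolding y_def cform_add cform_scale N_def[symmetric] ..
  then show "cform n y = cform m x" unfolding c_def using N0 by simp
 qed
 moreover have "symplectic_form q (x, y) \<eta> = l \<eta>" if "\<eta> \<in> TT q" for \<eta>
 proof -
  obtain a b where e: "\<eta> = (a, b)" by (cases \<eta>)
  have ab: "cform n a = 0" "cform n b = cform m a" using that unfolding e TT by auto
  show ?thesis unfolding symplectic_form_eq e fst_conv snd_conv l x_def y_def cform_add cform_scale ab by (simp add: algebra_simps)
 qed
 moreover have "\<xi> = (x, y)" if \<xi>: "\<xi> \<in> TT q" "\<forall>\<eta>\<in>TT q. symplectic_form q \<xi> \<eta> = l \<eta>" for \<xi>
 proof -
  obtain x' y' where e: "\<xi> = (x', y')" by (cases \<xi>)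
  define u w where "u = x' - x" and "w = y' - y"
  have uw: "cform n u = 0" "cform n w = cform m u"
   using \<xi>(1) \<open>(x, y) \<in> TT q\<close> unfolding e TT u_def w_def cform_add by auto
  have eq: "cform u b = cform w a" if "(a, b) \<in> TT q" for a b
  proof -
   have "symplectic_form q (x', y') (a, b) = symplectic_form q (x, y) (a, b)"
    using \<xi>(2) calculation(2) that unfolding e by simp
   then show ?thesis unfolding symplectic_form_eq u_def w_def cform_add by (simp add: algebra_simps)
  qed
  have normal: "z = 0" if z: "cform n z = 0" "!!b. cform n b = 0 ==> cform z b = 0" for z
  proof -
   obtain k where "z = k *s n" using tangent_plane_orthogonal[OF r] z(2) unfolding n_def by blast
   then show ?thesis using z(1) N0 unfolding N_def by (simp add: cform_scale)
  qed
  have u0: "u = 0"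
  proof (rule normal[OF uw(1)])
   fix b assume "cform n b = 0"
   then have "(0, b) \<in> TT q" unfolding TT by (simp add: cform_add)
   from eq[OF this] show "cform u b = 0" by (simp add: cform_add)
  qed
  have "w = 0"
  proof (rule normal)
   show "cform n w = 0" using uw(2) u0 by (simp add: cform_add)
   fix a assume "cform n a = 0"
   then have "(a, (cform m a / N) *s n) \<in> TT q" unfolding TT using N0 by (simp add: cform_scale N_def)
   from eq[OF this] show "cform w a = 0" unfolding u0 by (simp add: cform_add)
  qed
  then show ?thesis using u0 unfolding e u_def w_def by simp
 qed
 ultimately show ?thesis by blast
qed

text \<open>The derivative within the phase space is a choice, but along a curve in the phase space it must agree with the derivative of any holomorphic extension.\<close>
lemma differential_eq:
 assumes W: "open W" "q \<in> W" "chol cscale f W" "!!p. p \<in> W \<inter> PS ==> F p = f p" and q: "q \<in> PS" and \<eta>: "\<eta> \<in> tangent PS q"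
 shows "differential PS F q \<eta> = df f q \<eta>"
proof -
 have fq: "(f has_derivative df f q) (at q within PS)" by (rule has_derivative_at_withinI[OF chol_df(1)[OF W(3,2)]])
 obtain d where d: "d > 0" "ball q d \<subseteq> W" using openE[OF W(1,2)] by blast
 have "(F has_derivative df f q) (at q within PS)"
 proof (rule has_derivative_transform_within[OF fq d(1) q])
  fix x assume "x \<in> PS" "dist x q < d"
  then have "x \<in> W \<inter> PS" using d(2) by (auto simp: dist_commute)
  then show "f x = F x" using W(4) by simp
 qed
 then have dF: "(F has_derivative frechet_derivative F (at q within PS)) (at q within PS)"
  using differentiableI frechet_derivative_works by blast
 obtain \<gamma> e where \<gamma>: "e > 0" "\<gamma> 0 = q" "!!t. t \<in> ball 0 e ==> \<gamma> t \<in> PS" "(\<gamma> has_derivative (\<lambda>h. cscale h \<eta>)) (at 0)"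
  using \<eta> unfolding tangent_def by blast
 have z0: "(0::complex) \<in> ball 0 e" using \<gamma>(1) by simp
 have 1: "(f \<circ> \<gamma> has_derivative df f q \<circ> (\<lambda>h. cscale h \<eta>)) (at 0)"
  using diff_chain_at[OF \<gamma>(4)] chol_df(1)[OF W(3,2)] unfolding \<gamma>(2) by blast
 have "(\<gamma> has_derivative (\<lambda>h. cscale h \<eta>)) (at 0 within ball 0 e)" by (rule has_derivative_at_withinI[OF \<gamma>(4)])
 moreover have "(F has_derivative frechet_derivative F (at q within PS)) (at (\<gamma> 0) within \<gamma> ` ball 0 e)"
  unfolding \<gamma>(2) by (rule has_derivative_subset[OF dF]) (use \<gamma>(3) in blast)
 ultimately have "(F \<circ> \<gamma> has_derivative frechet_derivative F (at q within PS) \<circ> (\<lambda>h. cscale h \<eta>)) (at 0 within ball 0 e)"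
  by (rule diff_chain_within)
 then have 2: "(F \<circ> \<gamma> has_derivative frechet_derivative F (at q within PS) \<circ> (\<lambda>h. cscale h \<eta>)) (at 0)"
  using at_within_open[OF z0 open_ball] by simp
 have "isCont \<gamma> 0" using \<gamma>(4) has_derivative_continuous by blast
 then have "\<forall>\<^sub>F t in nhds 0. \<gamma> t \<in> W"
  using W(1,2) \<gamma>(2) unfolding continuous_at_open eventually_nhds by metis
 then obtain S where S: "open S" "0 \<in> S" "!!t. t \<in> S ==> \<gamma> t \<in> W" unfolding eventually_nhds by blast
 have oS: "open (S \<inter> ball 0 e)" using S(1) by blast
 have "(F \<circ> \<gamma> has_derivative df f q \<circ> (\<lambda>h. cscale h \<eta>)) (at 0)"
  by (rule has_derivative_transform_within_open[OF 1 oS]) (use S \<gamma>(1,3) W(4) in auto)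
 from fun_cong[OF has_derivative_unique[OF 2 this], of 1] have "frechet_derivative F (at q within PS) (cscale 1 \<eta>) = df f q (cscale 1 \<eta>)" by simp
 moreover have "cscale 1 \<eta> = \<eta>" unfolding cscale_def by simp
 ultimately show ?thesis unfolding differential_def by simp
qed

lemma kinetic_has_derivative: "(kinetic_energy has_derivative (\<lambda>h. cform (snd q) (snd h))) (at q)"
proof -
 have n: "((\<lambda>q::phase. snd q $ i) has_derivative (\<lambda>h. snd h $ i)) (at q)" for i
  by (rule has_derivative_nth[OF has_derivative_snd[OF has_derivative_ident]])
 have dk: "((\<lambda>q::phase. (snd q $ 1 * snd q $ 1 + snd q $ 2 * snd q $ 2 + snd q $ 3 * snd q $ 3) * (1/2)) has_derivative
  (\<lambda>h. (snd q $ 1 * snd h $ 1 + snd h $ 1 * snd q $ 1 + (snd q $ 2 * snd h $ 2 + snd h $ 2 * snd q $ 2) + (snd q $ 3 * snd h $ 3 + snd h $ 3 * snd q $ 3)) * (1/2))) (at q)"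
  by (intro has_derivative_mult_left has_derivative_add has_derivative_mult n)
 have ke: "kinetic_energy = (\<lambda>q::phase. (snd q $ 1 * snd q $ 1 + snd q $ 2 * snd q $ 2 + snd q $ 3 * snd q $ 3) * (1/2))"
  by (simp add: fun_eq_iff kinetic_energy_def cform3)
 show ?thesis unfolding ke
  by (rule has_derivative_eq_rhs[OF dk]) (simp add: fun_eq_iff cform3 add_divide_distrib mult.commute)
qed

lemma kinetic_chol: "chol cscale kinetic_energy UNIV"
 unfolding chol_def
 by (rule ballI, rule exI, rule conjI, rule kinetic_has_derivative) (simp add: cscale_def cform_scale)

text \<open>The Hamiltonian vector of the kinetic energy is (v, mu n): the acceleration of a geodesic is normal to the surface.\<close>
lemma flow_vector:
 assumes a: "a \<in> UU" shows "dchart a (X4 a) = (snd (chart a), mu a *s conormal (fst (chart a)))"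
proof -
 obtain s \<xi> \<sigma> \<omega> where aa: "a = (s, \<xi>, \<sigma>, \<omega>)" by (cases a)
 define \<mu> where "\<mu> = mu a"
 define x y S R where "x = exp (2 * \<xi>)" and "y = exp (- 2 * \<xi>)" and "S = exp (4 * s)" and "R = exp (- 2 * s)"
 define r1 r2 r3 where "r1 = exp (s + \<xi>)" and "r2 = exp (s - \<xi>)" and "r3 = exp (- 2 * s)"
 have nz: "r1 ~= 0" "r2 ~= 0" "r3 ~= 0" unfolding r1_def r2_def r3_def by simp_all
 have N0: "NN s \<xi> ~= 0" using a unfolding UU_def aa by simp
 have Ne: "R * (x + y) + S = NN s \<xi>" unfolding NN_def x_def y_def S_def R_def ..
 have mN: "\<mu> * (R * (x + y) + S) = 6 * \<sigma>\<^sup>2 + 2 * \<omega>\<^sup>2"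
  unfolding \<mu>_def mu_def aa Ne using N0 by simp
 have i: "1 / r1 = r1 * (R * y)" "1 / r2 = r2 * (R * x)" "1 / r3 = r3 * S"
  using inverse_squares(1)[of s \<xi>] inverse_squares(2)[of s \<xi>] inverse_squares(3)[of s] nz unfolding r1_def[symmetric] r2_def[symmetric] r3_def[symmetric] R_def[symmetric] S_def[symmetric] x_def[symmetric] y_def[symmetric]
  by (simp_all add: r3_def[folded R_def] divide_simps) (metis mult.commute mult.left_commute)+
 define h3 h4 where "h3 = 2 * \<sigma>\<^sup>2 - \<mu> * S / 2" and "h4 = - \<mu> * R * (x - y) / 2 - 2 * \<sigma> * \<omega>"
 have X: "X4 a = (\<sigma>, \<omega>, h3, h4)" unfolding X4_def aa h3_def h4_def \<mu>_def x_def y_def S_def R_def by simp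
 have half: "\<mu> * (R * (x + y) + S) / 2 = 3 * \<sigma>\<^sup>2 + \<omega>\<^sup>2" unfolding mN by simp
 have e1: "h3 + h4 + (\<sigma> + \<omega>)\<^sup>2 = \<mu> * (R * y)"
 proof -
  have "h3 + h4 + (\<sigma> + \<omega>)\<^sup>2 = (3 * \<sigma>\<^sup>2 + \<omega>\<^sup>2) - \<mu> * (R * (x + y) + S) / 2 + \<mu> * (R * y)"
   unfolding h3_def h4_def by (simp add: field_simps power2_eq_square)
  then show ?thesis unfolding half by simp
 qed
 have e2: "h3 - h4 + (\<sigma> - \<omega>)\<^sup>2 = \<mu> * (R * x)"
 proof -
  have "h3 - h4 + (\<sigma> - \<omega>)\<^sup>2 = (3 * \<sigma>\<^sup>2 + \<omega>\<^sup>2) - \<mu> * (R * (x + y) + S) / 2 + \<mu> * (R * x)"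
   unfolding h3_def h4_def by (simp add: field_simps power2_eq_square)
  then show ?thesis unfolding half by simp
 qed
 have e3: "- 2 * h3 + 4 * \<sigma>\<^sup>2 = \<mu> * S" unfolding h3_def by (simp add: field_simps)
 have c: "r1 * (h3 + h4) + r1 * (\<sigma> + \<omega>) * (\<sigma> + \<omega>) = \<mu> * (1 / r1)" "r2 * (h3 - h4) + r2 * (\<sigma> - \<omega>) * (\<sigma> - \<omega>) = \<mu> * (1 / r2)"
  "r3 * (- 2 * h3) + r3 * (- 2 * \<sigma>) * (- 2 * \<sigma>) = \<mu> * (1 / r3)"
 proof -
  have "r1 * (h3 + h4) + r1 * (\<sigma> + \<omega>) * (\<sigma> + \<omega>) = r1 * (h3 + h4 + (\<sigma> + \<omega>)\<^sup>2)" by (simp add: power2_eq_square algebra_simps)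
  then show "r1 * (h3 + h4) + r1 * (\<sigma> + \<omega>) * (\<sigma> + \<omega>) = \<mu> * (1 / r1)" unfolding e1 i by (simp add: mult_ac)
  have "r2 * (h3 - h4) + r2 * (\<sigma> - \<omega>) * (\<sigma> - \<omega>) = r2 * (h3 - h4 + (\<sigma> - \<omega>)\<^sup>2)" by (simp add: power2_eq_square algebra_simps)
  then show "r2 * (h3 - h4) + r2 * (\<sigma> - \<omega>) * (\<sigma> - \<omega>) = \<mu> * (1 / r2)" unfolding e2 i by (simp add: mult_ac)
  have "r3 * (- 2 * h3) + r3 * (- 2 * \<sigma>) * (- 2 * \<sigma>) = r3 * (- 2 * h3 + 4 * \<sigma>\<^sup>2)" by (simp add: power2_eq_square algebra_simps)
  then show "r3 * (- 2 * h3) + r3 * (- 2 * \<sigma>) * (- 2 * \<sigma>) = \<mu> * (1 / r3)" unfolding e3 i by (simp add: mult_ac)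
 qed
 show ?thesis unfolding X \<mu>_def[symmetric] unfolding aa dchart_def chart_def conormal_def prod.case fst_conv snd_conv r1_def[symmetric] r2_def[symmetric] r3_def[symmetric]
  by (simp only: prod.inject, intro conjI vec3_eqI) (simp_all only: vec3_nth c vector_smult_component)
qed

text \<open>The Hamiltonian vector of F represents the differential of F, which is then evaluated at the Hamiltonian vector of the energy.\<close>
lemma poisson_energy:
 assumes a: "a \<in> UU" and W: "open W" "chart a \<in> W" "chol cscale f W" "!!p. p \<in> W \<inter> PS ==> F p = f p"
 shows "poisson_bracket PS F kinetic_energy (chart a) = df f (chart a) (dchart a (X4 a))"
proof -
 define q where "q = chart a"
 have q: "q \<in> PS" unfolding q_def by (rule chart_in_PS[OF a])
 have T: "tangent PS q = TT q" unfolding q_def by (rule tangent_chart(1)[OF a])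
 have lin: "df g q (x + y) = df g q x + df g q y" "df g q (cscale c x) = c * df g q x" if "chol cscale g V" "q \<in> V" for g V x y c
  using linear_add[OF has_derivative_linear[OF chol_df(1)[OF that]]] chol_df(2)[OF that] by auto
 have qW: "q \<in> W" using W(2) unfolding q_def .
 have dF: "differential PS F q \<eta> = df f q \<eta>" if "\<eta> \<in> TT q" for \<eta>
  by (rule differential_eq[OF W(1) qW W(3,4) q]) (use that T in auto)
 have dH: "differential PS kinetic_energy q \<eta> = df kinetic_energy q \<eta>" if "\<eta> \<in> TT q" for \<eta>
  by (rule differential_eq[OF open_UNIV UNIV_I kinetic_chol _ q]) (use that T in auto)
 have hv: "hamiltonian_vector PS K q = (THE \<xi>. \<xi> \<in> TT q \<and> (\<forall>\<eta>\<in>TT q. symplectic_form q \<xi> \<eta> = df k q \<eta>))"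
  if "!!\<eta>. \<eta> \<in> TT q ==> differential PS K q \<eta> = df k q \<eta>" for K k
  unfolding hamiltonian_vector_def T using that by (intro arg_cong[where f = The] ext) auto
 have X: "hamiltonian_vector PS F q \<in> TT q \<and> (\<forall>\<eta>\<in>TT q. symplectic_form q (hamiltonian_vector PS F q) \<eta> = df f q \<eta>)"
 proof -
  have e: "hamiltonian_vector PS F q = (THE \<xi>. \<xi> \<in> TT q \<and> (\<forall>\<eta>\<in>TT q. symplectic_form q \<xi> \<eta> = df f q \<eta>))"
   by (rule hv) (rule dF)
  show ?thesis unfolding e
   by (rule theI'[OF hamiltonian_unique[where l = "df f q", OF q]]) (rule lin[OF W(3) qW])+
 qed
 define Y where "Y = dchart a (X4 a)"
 have Y: "Y = (snd q, mu a *s conormal (fst q))" unfolding Y_def q_def by (rule flow_vector[OF a])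
 have YT: "Y \<in> TT q" using tangent_chart[OF a] unfolding Y_def q_def by blast
 have "symplectic_form q Y \<eta> = df kinetic_energy q \<eta>" if "\<eta> \<in> TT q" for \<eta>
 proof -
  have "cform (conormal (fst q)) (fst \<eta>) = 0" using that unfolding TT_def by auto
  then show ?thesis unfolding symplectic_form_eq Y df_eqI[OF kinetic_has_derivative] by (simp add: cform_scale)
 qed
 then have YY: "Y \<in> TT q \<and> (\<forall>\<eta>\<in>TT q. symplectic_form q Y \<eta> = df kinetic_energy q \<eta>)" using YT by blast
 have e: "hamiltonian_vector PS kinetic_energy q = (THE \<xi>. \<xi> \<in> TT q \<and> (\<forall>\<eta>\<in>TT q. symplectic_form q \<xi> \<eta> = df kinetic_energy q \<eta>))"
  by (rule hv) (rule dH)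
 have ex1: "\<exists>!\<xi>. \<xi> \<in> TT q \<and> (\<forall>\<eta>\<in>TT q. symplectic_form q \<xi> \<eta> = df kinetic_energy q \<eta>)"
  by (rule hamiltonian_unique[OF q]) (rule lin[OF kinetic_chol UNIV_I])+
 have "hamiltonian_vector PS kinetic_energy q = Y"
  unfolding e by (rule the1_equality[OF ex1 YY])
 then show ?thesis unfolding poisson_bracket_def q_def[symmetric] Y_def[symmetric] using X YT by simp
qed

section \<open>Non-integrability\<close>

lemma chart_chol:
 assumes f: "chol cscale f W" shows "chol sc4 (\<lambda>a. f (chart a)) (chart -` W)"
  "a \<in> chart -` W ==> df (\<lambda>a. f (chart a)) a h = df f (chart a) (dchart a h)"
 using chol_compose[OF f, of "chart -` W" chart dchart sc4] chart_has_derivative dchart_scale by auto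

lemma chart_continuous: "continuous_on UNIV chart"
 by (intro continuous_at_imp_continuous_on ballI has_derivative_continuous[OF chart_has_derivative])

lemma quotient_chol:
 assumes f: "chol cscale f W" and g: "chol cscale g W" and q: "q \<in> W" "g q ~= 0"
 shows "\<exists>L. cder cscale (\<lambda>x. f x / g x) q L" "num_df f g q h = (g q)\<^sup>2 * df (\<lambda>x. f x / g x) q h"
proof -
 have cf: "cder cscale f q (df f q)" and cg: "cder cscale g q (df g q)" using chol_df[OF f q(1)] chol_df[OF g q(1)] unfolding cder_def by auto
 have "cder cscale (\<lambda>x. inverse (g x)) q (\<lambda>h. - (inverse (g q) * inverse (g q)) * df g q h)"
  by (rule cder_comp[OF cg]) (use q(2) in \<open>auto intro!: derivative_eq_intros simp: power2_eq_square\<close>)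
 from cder_mult[OF cf this] have c: "cder cscale (\<lambda>x. f x / g x) q (\<lambda>h. f q * (- (inverse (g q) * inverse (g q)) * df g q h) + df f q h * inverse (g q))"
  by (simp add: divide_inverse)
 then show "\<exists>L. cder cscale (\<lambda>x. f x / g x) q L" by blast
 show "num_df f g q h = (g q)\<^sup>2 * df (\<lambda>x. f x / g x) q h"
  unfolding cder_df[OF c] num_df_def using q(2) by (simp add: field_simps power2_eq_square)
qed

text \<open>Pull back the representations along the chart; density of the nonzero set of the denominator survives because the chart has continuous local inverses.\<close>
lemma representations:
 assumes mero: "meromorphic_fun_on F PS" and inv: "in_involution PS F kinetic_energy" and a: "a \<in> UU"
 shows "\<exists>W f g. a \<in> W \<and> rep4 (\<lambda>a. F (chart a)) W f g"
proof -
 obtain W0 f0 g0 where 0: "open W0" "chart a \<in> W0" "chol cscale f0 W0" "chol cscale g0 W0"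
  "W0 \<inter> PS \<subseteq> closure {q \<in> W0 \<inter> PS. g0 q ~= 0}" "\<forall>q \<in> W0 \<inter> PS. g0 q ~= 0 \<longrightarrow> F q = f0 q / g0 q"
  using bspec[OF mero[unfolded meromorphic_fun_on_def holomorphic_fun_on_def, folded chol_def] chart_in_PS[OF a]]
  by (elim exE conjE) (rule that)
 define W where "W = chart -` W0 \<inter> UU"
 define f g where "f = (\<lambda>a. f0 (chart a))" and "g = (\<lambda>a. g0 (chart a))"
 have oW: "open W" unfolding W_def using open_vimage[OF 0(1) chart_continuous] open_UU by blast
 have cf: "chol sc4 f W" and cg: "chol sc4 g W"
  unfolding f_def g_def W_def using chol_subset[OF chart_chol(1)[OF 0(3)]] chol_subset[OF chart_chol(1)[OF 0(4)]] by blast+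
 have dense: "b \<in> closure {a\<in>W. g a ~= 0}" if b: "b \<in> W" for b
 proof (rule ccontr)
  define T where "T = W - closure {a\<in>W. g a ~= 0}"
  assume "b \<notin> closure {a\<in>W. g a ~= 0}"
  then have bT: "b \<in> T" using b unfolding T_def by blast
  have oT: "open T" unfolding T_def using oW by (intro open_Diff) auto
  obtain s \<xi> \<sigma> \<omega> where bb: "b = (s, \<xi>, \<sigma>, \<omega>)" by (cases b)
  have "unchart (s + \<xi>) (s - \<xi>) (chart b) \<in> T" using bT unchart_chart unfolding bb by simp
  then obtain Q where Q: "open Q" "chart b \<in> Q" "\<forall>q\<in>Q. unchart (s + \<xi>) (s - \<xi>) q \<in> T"
   using unchart_cont[of s \<xi> \<sigma> \<omega>] oT unfolding bb continuous_at_open by blast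
  have "chart b \<in> W0 \<inter> PS" using b chart_in_PS unfolding W_def by blast
  then have "chart b \<in> closure {q \<in> W0 \<inter> PS. g0 q ~= 0}" using 0(5) by blast
  then have "Q \<inter> {q \<in> W0 \<inter> PS. g0 q ~= 0} ~= {}" using open_Int_closure_eq_empty[OF Q(1)] Q(2) by blast
  then obtain q where q: "q \<in> Q" "q \<in> PS" "g0 q ~= 0" by blast
  define c where "c = unchart (s + \<xi>) (s - \<xi>) q"
  have "c \<in> T" unfolding c_def using Q(3) q(1) by blast
  moreover have "chart c = q" unfolding c_def by (rule chart_unchart[OF q(2)])
  ultimately show False using q(3) closure_subset[of "{a\<in>W. g a ~= 0}"] unfolding T_def g_def by blast
 qed
 have val: "F (chart b) = f b / g b \<and> num_df f g b (X4 b) = 0" if b: "b \<in> W" "g b ~= 0" for b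
 proof -
  have bU: "b \<in> UU" and bW: "chart b \<in> W0" using b(1) unfolding W_def by auto
  have bP: "chart b \<in> PS" by (rule chart_in_PS[OF bU])
  have g0: "g0 (chart b) ~= 0" using b(2) unfolding g_def .
  define W1 where "W1 = {q\<in>W0. g0 q ~= 0}"
  have W1: "open W1" unfolding W1_def by (rule chol_open_nonzero[OF 0(4,1)])
  have b1: "chart b \<in> W1" using bW g0 unfolding W1_def by simp
  have ch: "chol cscale (\<lambda>q. f0 q / g0 q) W1" by (rule chol_cder) (use quotient_chol(1)[OF 0(3,4)] in \<open>auto simp: W1_def\<close>)
  have F1: "F p = f0 p / g0 p" if "p \<in> W1 \<inter> PS" for p using 0(6) that unfolding W1_def by auto
  have "holomorphic_near PS F (chart b)" unfolding holomorphic_near_def holomorphic_fun_on_def chol_def[symmetric]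
   by (intro exI[of _ W1] exI[of _ "\<lambda>q. f0 q / g0 q"] conjI ballI W1 b1 ch F1)
  moreover have "holomorphic_near PS kinetic_energy (chart b)" unfolding holomorphic_near_def holomorphic_fun_on_def chol_def[symmetric]
   by (intro exI[of _ UNIV] exI[of _ kinetic_energy] conjI ballI open_UNIV UNIV_I kinetic_chol refl)
  ultimately have "poisson_bracket PS F kinetic_energy (chart b) = 0" using inv bP unfolding in_involution_def by blast
  moreover have "poisson_bracket PS F kinetic_energy (chart b) = df (\<lambda>q. f0 q / g0 q) (chart b) (dchart b (X4 b))"
   by (rule poisson_energy[OF bU W1 b1 ch]) (rule F1)
  ultimately have "df (\<lambda>q. f0 q / g0 q) (chart b) (dchart b (X4 b)) = 0" by simp
  then have n: "num_df f0 g0 (chart b) (dchart b (X4 b)) = 0" unfolding quotient_chol(2)[OF 0(3,4) bW g0] by simp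
  have bv: "b \<in> chart -` W0" using bW by simp
  have "num_df f g b (X4 b) = num_df f0 g0 (chart b) (dchart b (X4 b))"
   unfolding num_df_def f_def g_def chart_chol(2)[OF 0(3) bv] chart_chol(2)[OF 0(4) bv] ..
  then show ?thesis using n bspec[OF 0(6), of "chart b"] bW bP g0 unfolding f_def g_def by simp
 qed
 have "rep4 (\<lambda>a. F (chart a)) W f g" unfolding rep4_def
 proof (intro conjI ballI impI subsetI)
  show "b \<in> UU" if "b \<in> W" for b using that unfolding W_def by simp
  show "F (chart b) = f b / g b" "num_df f g b (X4 b) = 0" if "b \<in> W" "g b ~= 0" for b
   using val[OF that] by (rule conjunct1, rule conjunct2)
 qed (rule oW cf cg dense; assumption?)+
 moreover have "a \<in> W" using a 0(2) unfolding W_def by simp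
 ultimately show ?thesis by blast
qed

lemma chart_periodic: "chart (s + 2 * of_real pi * \<i>, \<xi>, \<sigma>, \<omega>) = chart (s, \<xi>, \<sigma>, \<omega>)"
proof -
 define c :: complex where "c = 2 * of_real pi * \<i>"
 have c: "exp c = 1" unfolding c_def by simp
 have c2: "exp (- 2 * c) = 1"
 proof -
  have "exp (- 2 * c) = inverse (exp c * exp c)" by (simp flip: exp_add exp_minus)
  then show ?thesis unfolding c by simp
 qed
 have "s + c + \<xi> = (s + \<xi>) + c" "s + c - \<xi> = (s - \<xi>) + c" "- 2 * (s + c) = - 2 * s + - 2 * c" by (simp_all add: algebra_simps)
 then have "exp (s + c + \<xi>) = exp (s + \<xi>)" "exp (s + c - \<xi>) = exp (s - \<xi>)" "exp (- 2 * (s + c)) = exp (- 2 * s)"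
  by (simp_all only: exp_add c c2 mult_1_right)
 then show ?thesis unfolding chart_def c_def[symmetric] prod.case by (simp only:)
qed

text \<open>In the chart both integrals are functions of the energy, which contradicts their independence.\<close>
theorem not_integrable_on_PS: "\<not> meromorphically_integrable_on PS"
proof
 assume "meromorphically_integrable_on PS"
 then obtain F1 F2 where F: "meromorphic_fun_on F1 PS" "meromorphic_fun_on F2 PS" "in_involution PS F1 kinetic_energy"
  "in_involution PS F2 kinetic_energy" "functionally_independent PS F1 F2" unfolding meromorphically_integrable_on_def by blast
 obtain q \<xi> \<eta> where q: "q \<in> PS" "holomorphic_near PS F1 q" "holomorphic_near PS F2 q" "\<xi> \<in> tangent PS q" "\<eta> \<in> tangent PS q"
  "differential PS F1 q \<xi> * differential PS F2 q \<eta> - differential PS F1 q \<eta> * differential PS F2 q \<xi> ~= 0"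
  using F(5) unfolding functionally_independent_def by blast
 obtain W1 f1 where 1: "open W1" "q \<in> W1" "chol cscale f1 W1" "!!p. p \<in> W1 \<inter> PS ==> F1 p = f1 p"
  using q(2)[unfolded holomorphic_near_def holomorphic_fun_on_def, folded chol_def] by (elim exE conjE) (rule that, assumption+, rule bspec)
 obtain W2 f2 where 2: "open W2" "q \<in> W2" "chol cscale f2 W2" "!!p. p \<in> W2 \<inter> PS ==> F2 p = f2 p"
  using q(3)[unfolded holomorphic_near_def holomorphic_fun_on_def, folded chol_def] by (elim exE conjE) (rule that, assumption+, rule bspec)
 define a where "a = unchart 0 0 q"
 have ca: "chart a = q" unfolding a_def by (rule chart_unchart[OF q(1)])
 have aU: "a \<in> UU" by (rule UU_if_chart) (simp add: ca q(1))
 obtain h k where hk: "\<xi> = dchart a h" "\<eta> = dchart a k" using q(4,5) tangent_chart(2)[OF aU] unfolding ca by blast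
 define B where "B = chart -` W1 \<inter> chart -` W2 \<inter> UU"
 have oB: "open B" unfolding B_def using open_vimage[OF 1(1) chart_continuous] open_vimage[OF 2(1) chart_continuous] open_UU by blast
 have aB: "a \<in> B" unfolding B_def using ca 1(2) 2(2) aU by simp
 have av: "a \<in> chart -` W1" "a \<in> chart -` W2" using ca 1(2) 2(2) by auto
 have c1: "chol sc4 (\<lambda>a. f1 (chart a)) B" "chol sc4 (\<lambda>a. f2 (chart a)) B"
 proof -
  have BW: "B \<subseteq> chart -` W1" "B \<subseteq> chart -` W2" unfolding B_def by auto
  show "chol sc4 (\<lambda>a. f1 (chart a)) B" "chol sc4 (\<lambda>a. f2 (chart a)) B"
   by (rule chol_subset[OF chart_chol(1)[OF 1(3)] BW(1)], rule chol_subset[OF chart_chol(1)[OF 2(3)] BW(2)])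
 qed
 have "df (\<lambda>a. f1 (chart a)) a h * df (\<lambda>a. f2 (chart a)) a k = df (\<lambda>a. f1 (chart a)) a k * df (\<lambda>a. f2 (chart a)) a h"
 proof (rule first_integrals_dependent[where B = B and ?F1.0 = "\<lambda>a. F1 (chart a)" and ?F2.0 = "\<lambda>a. F2 (chart a)"])
  show "\<exists>W f g. b \<in> W \<and> rep4 (\<lambda>a. F1 (chart a)) W f g" "\<exists>W f g. b \<in> W \<and> rep4 (\<lambda>a. F2 (chart a)) W f g" if "b \<in> UU" for b
   by (rule representations[OF F(1,3) that], rule representations[OF F(2,4) that])
  show "F1 (chart x) = f1 (chart x)" "F2 (chart x) = f2 (chart x)" if "x \<in> B" for x
   using that 1(4) 2(4) chart_in_PS unfolding B_def by auto
  show "F1 (chart (s + 2 * of_real pi * \<i>, \<xi>, \<sigma>, \<omega>)) = F1 (chart (s, \<xi>, \<sigma>, \<omega>))"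
   "F2 (chart (s + 2 * of_real pi * \<i>, \<xi>, \<sigma>, \<omega>)) = F2 (chart (s, \<xi>, \<sigma>, \<omega>))" for s \<xi> \<sigma> \<omega>
   by (simp_all only: chart_periodic)
  show "open B" "a \<in> B" by (rule oB aB)+
  show "B \<subseteq> UU" unfolding B_def by blast
  show "chol sc4 (\<lambda>a. f1 (chart a)) B" "chol sc4 (\<lambda>a. f2 (chart a)) B" by (rule c1)+
 qed
 then have "df f1 q \<xi> * df f2 q \<eta> = df f1 q \<eta> * df f2 q \<xi>"
  unfolding chart_chol(2)[OF 1(3) av(1)] chart_chol(2)[OF 2(3) av(2)] ca hk .
 moreover have "differential PS F1 q v = df f1 q v" "differential PS F2 q v = df f2 q v" if "v \<in> tangent PS q" for v
  by (rule differential_eq[OF 1 q(1) that], assumption, rule differential_eq[OF 2 q(1) that], assumption)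
 ultimately show False using q(4,5,6) by simp
qed

theorem theorem1:
 shows "\<not> geodesic_flow_integrable {r :: real^3. r $ 1 * r $ 2 * r $ 3 = 1}"
proof
 let ?S = "{r :: real^3. r $ 1 * r $ 2 * r $ 3 = 1}"
 assume int: "geodesic_flow_integrable ?S"
 define S0 where "S0 = connected_component_set ?S (vec3 1 1 1)"
 have "vec3 1 1 1 \<in> ?S" by simp
 then have "S0 \<in> components ?S" unfolding S0_def by (rule componentsI)
 then have "meromorphically_integrable_on (phase_space (zariski_closure (complexify ` S0)))"
  using int unfolding geodesic_flow_integrable_def by blast
 moreover have "zariski_closure (complexify ` S0) = surf"
 proof (rule zariski_closure_surface)
  show "octant_point a b \<in> S0" for a b unfolding S0_def by (rule octant_in_component)
  show "S0 \<subseteq> ?S" unfolding S0_def by (rule connected_component_subset)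
 qed
 ultimately show False using not_integrable_on_PS phase_space_surf by simp
qed

end
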